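(* Let $u\in W^{k+4,\infty}(\Omega)$ be the solution of $u_t=u_{xx}$, $u(x,0)=u_0(x)$, let $q=u_x$, and let $u_h,q_h\in V_h$ be the solution of the LDG scheme with flux choice (I) or (II). Suppose the initial solution is $u_h(\cdot,0)=u_I^2(\cdot,0)$, with $u_I^2$ the interpolation function (with $l=2$) corresponding to the flux choice used. Let $$e_{ux,l}=\max_{j,m}\left|(u_x-u_{hx})(R^l_{j,m},t)\right|,\quad e_{ux,r}=\max_{j,m}\left|(u_x-u_{hx})(R^r_{j,m},t)\right|,$$ $$e_{qx,l}=\max_{j,m}\left|(q_x-q_{hx})(R^l_{j,m},t)\right|,\quad e_{qx,r}=\max_{j,m}\left|(q_x-q_{hx})(R^r_{j,m},t)\right|,$$ the maxima being over $1\le j\le N$, $1\le m\le k$. Then for both the periodic and mixed boundary conditions, $$e_{ux,l}\lesssim(1+t\sqrt h)h^{k+1}\|u\|_{k+4,\infty},\qquad e_{qx,r}\lesssim(1+\sqrt{th})h^{k+1}\|u\|_{k+4,\infty}$$ for flux choice (I), and $$e_{ux,r}\lesssim(1+t\sqrt h)h^{k+1}\|u\|_{k+4,\infty},\qquad e_{qx,l}\lesssim(1+\sqrt{th})h^{k+1}\|u\|_{k+4,\infty}$$ for flux choice (II).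
   Context: Equation: $u_t=u_{xx}$, $(x,t)\in[0,2\pi]\times(0,T]$, $u(x,0)=u_0(x)$, with $u_0$ sufficiently smooth; $\Omega=[0,2\pi]$. Boundary conditions: periodic, $u(0,t)=u(2\pi,t)$; or mixed, $u(0,t)=g_0(t),\,u_x(2\pi,t)=g_1(t)$, or $u_x(0,t)=g_0(t),\,u(2\pi,t)=g_1(t)$. Norms: $\|\cdot\|_{m,\infty}$ is the $W^{m,\infty}(\Omega)$ norm in $x$, with $\|u\|_{m,\infty}$ taken uniformly in time (supremum over $[0,T]$). $A\lesssim B$ means $A\le CB$ with $C$ independent of the mesh size $h$ (and of $t\in[0,T]$). Mesh: $0=x_{\frac12}<\cdots<x_{N+\frac12}=2\pi$, $\tau_j=(x_{j-\frac12},x_{j+\frac12})$, $x_j$ the midpoint, $h_j=x_{j+\frac12}-x_{j-\frac12}$, $\bar h_j=h_j/2$, $h=\max_jh_j$, quasi-uniform ($h\le ch_j$ for all $j$). $V_h=\{v: v|_{\tau_j}\in P_k(\tau_j),\ 1\le j\le N\}$, $P_k$ the polynomials in $x$ of degree at most $k$ with coefficients that may depend on $t$; here $k\ge2$ so that the interpolation function with $l=2\le k$ is defined. $(u,v)_j=\int_{\tau_j}uv\,dx$; $v^\mp|_{j+\frac12}$ are the left/right limits at $x_{j+\frac12}$; subscript $x$ denotes the (elementwise) $x$-derivative. LDG scheme: find $u_h,q_h\in V_h$ such that for all $v,w\in V_h$ and all $j$, $(u_{ht},v)_j=-(q_h,v_x)_j+\hat q_hv^-|_{j+\frac12}-\hat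 q_hv^+|_{j-\frac12}$, $\ (q_h,w)_j=-(u_h,w_x)_j+\hat u_hw^-|_{j+\frac12}-\hat u_hw^+|_{j-\frac12}$. Flux choice (I): $\hat u_h=u_h^-$, $\hat q_h=q_h^+$. Flux choice (II): $\hat u_h=u_h^+$, $\hat q_h=q_h^-$. Both are used for the periodic condition (with periodic identification of one-sided limits at $x_{\frac12}$ and $x_{N+\frac12}$); (I) is used for $u(0,t)=g_0,u_x(2\pi,t)=g_1$ (with $u_h^-|_{\frac12}=g_0$, $q_h^+|_{N+\frac12}=g_1$); (II) is used for $u_x(0,t)=g_0,u(2\pi,t)=g_1$ (with $q_h^-|_{\frac12}=g_0$, $u_h^+|_{N+\frac12}=g_1$). Legendre polynomials: $L_{j,m}(x)=L_m((x-x_j)/\bar h_j)$ on $\tau_j$, $L_m$ standard Legendre. Radau points: $R^l_{j,m}$, $m=1,\ldots,k$, are the $k$ zeros of $L_{j,k+1}+L_{j,k}$ other than $x_{j-\frac12}$ (interior left Radau points of $\tau_j$); $R^r_{j,m}$, $m=1,\ldots,k$, are the $k$ zeros of $L_{j,k+1}-L_{j,k}$ other than $x_{j+\frac12}$ (interior right Radau points). Gauss-Radau projections onto $V_h$: $(P_h^\mp v,w)_j=(v,w)_j$ for all $w\in P_{k-1}(\tau_j)$, with $P_h^-v(x_{j+\frac12}^-)=v(x_{j+\frac12}^-)$ and $P_h^+v(x_{j-\frac12}^+)=v(x_{j-\frac12}^+)$. $D_s^{-1}v(x)=\frac1{\bar h_j}\int_{x_{j-\frac12}}^xv(x')\,dx'$,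 $x\in\tau_j$. On each $\tau_j$: $F_{1,1}=P_h^+D_s^{-1}L_{j,k}$, $F_{2,1}=P_h^-D_s^{-1}L_{j,k}$, $\bar F_{1,1}=P_h^-D_s^{-1}F_{1,1}$, $\bar F_{2,1}=P_h^+D_s^{-1}F_{2,1}$. Coefficients: $\bar v_{j,k}(t)=-v(x^-_{j+\frac12},t)+\frac1{h_j}\int_{\tau_j}v\sum_{m=0}^k(2m+1)L_{j,m}\,dx$, $\ \tilde v_{j,k}(t)=(-1)^{k+1}v(x^+_{j-\frac12},t)+\frac1{h_j}\int_{\tau_j}v\sum_{m=0}^k(-1)^{k+m}(2m+1)L_{j,m}\,dx$. Interpolation function $u_I^2$ (case $l=2$). Choice (I): $u_I^2=P_h^-u-W_2^2$ with, on $\tau_j$, $W_2^2=\bar h_j^2\,\frac{d}{dt}\bar u_{j,k}\,\bar F_{1,1}+\bar h_j\,\tilde q_{j,k}\,F_{2,1}$. Choice (II): $u_I^2=P_h^+u-W_2^2$ with, on $\tau_j$, $W_2^2=\bar h_j\,\bar q_{j,k}\,F_{1,1}+\bar h_j^2\,\frac{d}{dt}\tilde u_{j,k}\,\bar F_{2,1}$.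
   Formalization: The periodic boundary condition is taken to include u_x(0,t)=u_x(2π,t) besides u(0,t)=u(2π,t); with the latter alone the solution is not determined by u_0 and the bounds fail. *)

theory Defs
  imports
    "HOL-Probability.Essential_Supremum"
    "HOL-Computational_Algebra.Polynomial"
begin

section \<open>Sobolev spaces of essentially bounded functions on the domain\<close>

abbreviation Omega :: "real set" where
  "Omega \<equiv> {0..2 * pi}"

definition test_function :: "(real \<Rightarrow> real) \<Rightarrow> bool" where
  "test_function \<phi> \<longleftrightarrow>
     (\<forall>n x. (deriv ^^ n) \<phi> differentiable (at x)) \<and>
     (\<exists>a b. 0 < a \<and> b < 2 * pi \<and> (\<forall>x. x \<notin> {a..b} \<longrightarrow> \<phi> x = 0))"

definition is_weak_deriv :: "nat \<Rightarrow> (real \<Rightarrow> real) \<Rightarrow> (real \<Rightarrow> real) \<Rightarrow> bool" where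
  "is_weak_deriv n f g \<longleftrightarrow>
     set_integrable lborel Omega f \<and> set_integrable lborel Omega g \<and>
     (\<forall>\<phi>. test_function \<phi> \<longrightarrow>
        (LINT x:Omega|lborel. f x * (deriv ^^ n) \<phi> x) =
        (-1) ^ n * (LINT x:Omega|lborel. g x * \<phi> x))"

definition Linf_norm :: "(real \<Rightarrow> real) \<Rightarrow> ereal" where
  "Linf_norm f = esssup (restrict_space lborel Omega) (\<lambda>x. ereal \<bar>f x\<bar>)"

definition in_W_inf :: "nat \<Rightarrow> (real \<Rightarrow> real) \<Rightarrow> bool" where
  "in_W_inf m f \<longleftrightarrow> (\<forall>i\<le>m. \<exists>g. is_weak_deriv i f g \<and> Linf_norm g < \<infinity>)"

text \<open>Weak derivatives are unique almost everywhere, so the choice does not affect the norm.\<close>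

definition W_inf_norm :: "nat \<Rightarrow> (real \<Rightarrow> real) \<Rightarrow> real" where
  "W_inf_norm m f =
     Max ((\<lambda>i. real_of_ereal (Linf_norm (SOME g. is_weak_deriv i f g))) ` {..m})"

text \<open>Functions of space and time take the arguments in the order \<open>u x t\<close>. Membership and norm
  are uniform in time.\<close>

definition in_W_inf_unif :: "nat \<Rightarrow> real \<Rightarrow> (real \<Rightarrow> real \<Rightarrow> real) \<Rightarrow> bool" where
  "in_W_inf_unif m T u \<longleftrightarrow>
     (\<forall>t\<in>{0..T}. in_W_inf m (\<lambda>x. u x t)) \<and>
     bdd_above ((\<lambda>t. W_inf_norm m (\<lambda>x. u x t)) ` {0..T})"

definition W_inf_norm_unif :: "nat \<Rightarrow> real \<Rightarrow> (real \<Rightarrow> real \<Rightarrow> real) \<Rightarrow> real" where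
  "W_inf_norm_unif m T u = (SUP t\<in>{0..T}. W_inf_norm m (\<lambda>x. u x t))"


section \<open>The heat equation and its boundary conditions\<close>

text \<open>Derivatives are one-sided at the ends of the space and time intervals.\<close>

definition x_deriv :: "(real \<Rightarrow> real \<Rightarrow> real) \<Rightarrow> real \<Rightarrow> real \<Rightarrow> real" where
  "x_deriv u x t = vector_derivative (\<lambda>y. u y t) (at x within Omega)"

definition t_deriv :: "real \<Rightarrow> (real \<Rightarrow> real) \<Rightarrow> real \<Rightarrow> real" where
  "t_deriv T f t = vector_derivative f (at t within {0..T})"

definition heat_solution ::
  "real \<Rightarrow> (real \<Rightarrow> real) \<Rightarrow> (real \<Rightarrow> real \<Rightarrow> real) \<Rightarrow> bool" where
  "heat_solution T u0 u \<longleftrightarrow>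
     continuous_on (Omega \<times> {0..T}) (\<lambda>(x, t). u x t) \<and>
     (\<forall>x\<in>Omega. u x 0 = u0 x) \<and>
     (\<forall>x\<in>Omega. \<forall>t\<in>{0<..T}.
        (\<lambda>y. u y t) differentiable (at x within Omega) \<and>
        (\<lambda>y. x_deriv u y t) differentiable (at x within Omega) \<and>
        u x differentiable (at t within {0..T}) \<and>
        t_deriv T (u x) t = x_deriv (x_deriv u) x t)"

datatype flux = FluxI | FluxII

datatype bc = Periodic | Mixed

text \<open>The periodic condition means that \<open>u(\<cdot>,t)\<close> is a \<open>2\<pi>\<close>-periodic solution, so the first
  derivative is matched as well; \<open>u(0,t) = u(2\<pi>,t)\<close> alone does not determine the solution of a
  second order equation. Which mixed condition applies is dictated by the flux, and the boundary
  data \<open>g0\<close>, \<open>g1\<close> are unused in the periodic case.\<close>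

fun boundary_condition ::
  "bc \<Rightarrow> flux \<Rightarrow> real \<Rightarrow> (real \<Rightarrow> real) \<Rightarrow> (real \<Rightarrow> real) \<Rightarrow> (real \<Rightarrow> real \<Rightarrow> real) \<Rightarrow> bool" where
  "boundary_condition Periodic fl T g0 g1 u \<longleftrightarrow>
     (\<forall>t\<in>{0..T}. u 0 t = u (2 * pi) t \<and> x_deriv u 0 t = x_deriv u (2 * pi) t)"
| "boundary_condition Mixed FluxI T g0 g1 u \<longleftrightarrow>
     (\<forall>t\<in>{0..T}. u 0 t = g0 t \<and> x_deriv u (2 * pi) t = g1 t)"
| "boundary_condition Mixed FluxII T g0 g1 u \<longleftrightarrow>
     (\<forall>t\<in>{0..T}. x_deriv u 0 t = g0 t \<and> u (2 * pi) t = g1 t)"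


section \<open>Meshes and piecewise polynomials\<close>

text \<open>The node \<open>x\<^bsub>j+1/2\<^esub>\<close> is \<open>X j\<close> for \<open>0 \<le> j \<le> N\<close>, so for \<open>1 \<le> j \<le> N\<close> the cell \<open>\<tau>\<^sub>j\<close> has
  end points \<open>X (j - 1)\<close> and \<open>X j\<close>.\<close>

definition mesh :: "nat \<Rightarrow> (nat \<Rightarrow> real) \<Rightarrow> bool" where
  "mesh N X \<longleftrightarrow> 1 \<le> N \<and> X 0 = 0 \<and> X N = 2 * pi \<and> (\<forall>j\<in>{1..N}. X (j - 1) < X j)"

definition cell :: "(nat \<Rightarrow> real) \<Rightarrow> nat \<Rightarrow> real set" where
  "cell X j = {X (j - 1)..X j}"

definition cell_mid :: "(nat \<Rightarrow> real) \<Rightarrow> nat \<Rightarrow> real" where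
  "cell_mid X j = (X (j - 1) + X j) / 2"

definition cell_len :: "(nat \<Rightarrow> real) \<Rightarrow> nat \<Rightarrow> real" where
  "cell_len X j = X j - X (j - 1)"

definition half_len :: "(nat \<Rightarrow> real) \<Rightarrow> nat \<Rightarrow> real" where
  "half_len X j = cell_len X j / 2"

definition mesh_size :: "nat \<Rightarrow> (nat \<Rightarrow> real) \<Rightarrow> real" where
  "mesh_size N X = Max (cell_len X ` {1..N})"

definition quasi_uniform :: "real \<Rightarrow> nat \<Rightarrow> (nat \<Rightarrow> real) \<Rightarrow> bool" where
  "quasi_uniform c N X \<longleftrightarrow> (\<forall>j\<in>{1..N}. mesh_size N X \<le> c * cell_len X j)"

text \<open>A piecewise polynomial is the family of its restrictions to the cells; it is two-valued at
  the nodes. The left limit at \<open>x\<^bsub>j+1/2\<^esub>\<close> comes from cell \<open>j\<close>, the right limit from cell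
  \<open>j + 1\<close>. The argument \<open>b\<close> supplies the limit from outside the domain.\<close>

definition Vh :: "nat \<Rightarrow> nat \<Rightarrow> (nat \<Rightarrow> real poly) set" where
  "Vh k N = {v. \<forall>j\<in>{1..N}. degree (v j) \<le> k}"

definition left_limit :: "(nat \<Rightarrow> real) \<Rightarrow> real \<Rightarrow> (nat \<Rightarrow> real poly) \<Rightarrow> nat \<Rightarrow> real" where
  "left_limit X b v j = (if j = 0 then b else poly (v j) (X j))"

definition right_limit ::
  "nat \<Rightarrow> (nat \<Rightarrow> real) \<Rightarrow> real \<Rightarrow> (nat \<Rightarrow> real poly) \<Rightarrow> nat \<Rightarrow> real" where
  "right_limit N X b v j = (if j = N then b else poly (v (Suc j)) (X j))"


section \<open>The LDG scheme\<close>

text \<open>Below, \<open>b0\<close> and \<open>b1\<close> are the values at time \<open>t\<close> of the boundary data.\<close>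

fun outer_left :: "bc \<Rightarrow> nat \<Rightarrow> (nat \<Rightarrow> real) \<Rightarrow> real \<Rightarrow> (nat \<Rightarrow> real poly) \<Rightarrow> real" where
  "outer_left Periodic N X b0 v = poly (v N) (X N)"
| "outer_left Mixed N X b0 v = b0"

fun outer_right :: "bc \<Rightarrow> (nat \<Rightarrow> real) \<Rightarrow> real \<Rightarrow> (nat \<Rightarrow> real poly) \<Rightarrow> real" where
  "outer_right Periodic X b1 v = poly (v 1) (X 0)"
| "outer_right Mixed X b1 v = b1"

fun u_hat ::
  "flux \<Rightarrow> bc \<Rightarrow> nat \<Rightarrow> (nat \<Rightarrow> real) \<Rightarrow> real \<Rightarrow> real \<Rightarrow> (nat \<Rightarrow> real poly) \<Rightarrow> nat \<Rightarrow> real" where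
  "u_hat FluxI B N X b0 b1 v j = left_limit X (outer_left B N X b0 v) v j"
| "u_hat FluxII B N X b0 b1 v j = right_limit N X (outer_right B X b1 v) v j"

fun q_hat ::
  "flux \<Rightarrow> bc \<Rightarrow> nat \<Rightarrow> (nat \<Rightarrow> real) \<Rightarrow> real \<Rightarrow> real \<Rightarrow> (nat \<Rightarrow> real poly) \<Rightarrow> nat \<Rightarrow> real" where
  "q_hat FluxI B N X b0 b1 v j = right_limit N X (outer_right B X b1 v) v j"
| "q_hat FluxII B N X b0 b1 v j = left_limit X (outer_left B N X b0 v) v j"

text \<open>The discrete solution is \<open>uh t j\<close>, \<open>qh t j\<close>: at time \<open>t\<close>, the polynomial on cell \<open>j\<close>.\<close>

definition ldg_solution ::
  "nat \<Rightarrow> real \<Rightarrow> flux \<Rightarrow> bc \<Rightarrow> (real \<Rightarrow> real) \<Rightarrow> (real \<Rightarrow> real) \<Rightarrow> nat \<Rightarrow> (nat \<Rightarrow> real) \<Rightarrow>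
   (real \<Rightarrow> nat \<Rightarrow> real poly) \<Rightarrow> (real \<Rightarrow> nat \<Rightarrow> real poly) \<Rightarrow> bool" where
  "ldg_solution k T fl B g0 g1 N X uh qh \<longleftrightarrow>
     (\<forall>t\<in>{0..T}. uh t \<in> Vh k N \<and> qh t \<in> Vh k N) \<and>
     (\<forall>j\<in>{1..N}. \<forall>i. (\<lambda>t. coeff (uh t j) i) differentiable_on {0..T}) \<and>
     (\<forall>t\<in>{0..T}. \<forall>v\<in>Vh k N. \<forall>w\<in>Vh k N. \<forall>j\<in>{1..N}.
        integral (cell X j) (\<lambda>x. t_deriv T (\<lambda>s. poly (uh s j) x) t * poly (v j) x) =
          - integral (cell X j) (\<lambda>x. poly (qh t j) x * poly (pderiv (v j)) x)
          + q_hat fl B N X (g0 t) (g1 t) (qh t) j * poly (v j) (X j)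
          - q_hat fl B N X (g0 t) (g1 t) (qh t) (j - 1) * poly (v j) (X (j - 1)) \<and>
        integral (cell X j) (\<lambda>x. poly (qh t j) x * poly (w j) x) =
          - integral (cell X j) (\<lambda>x. poly (uh t j) x * poly (pderiv (w j)) x)
          + u_hat fl B N X (g0 t) (g1 t) (uh t) j * poly (w j) (X j)
          - u_hat fl B N X (g0 t) (g1 t) (uh t) (j - 1) * poly (w j) (X (j - 1)))"


section \<open>Legendre polynomials and Radau points\<close>

text \<open>Rodrigues' formula.\<close>

definition legendre :: "nat \<Rightarrow> real poly" where
  "legendre m = smult (1 / (2 ^ m * fact m)) ((pderiv ^^ m) ([:-1, 0, 1:] ^ m))"

definition cell_legendre :: "(nat \<Rightarrow> real) \<Rightarrow> nat \<Rightarrow> nat \<Rightarrow> real poly" where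
  "cell_legendre X j m =
     pcompose (legendre m) [:- cell_mid X j / half_len X j, 1 / half_len X j:]"

definition left_radau_points :: "nat \<Rightarrow> (nat \<Rightarrow> real) \<Rightarrow> nat \<Rightarrow> real set" where
  "left_radau_points k X j =
     {x. poly (cell_legendre X j (k + 1) + cell_legendre X j k) x = 0 \<and> x \<noteq> X (j - 1)}"

definition right_radau_points :: "nat \<Rightarrow> (nat \<Rightarrow> real) \<Rightarrow> nat \<Rightarrow> real set" where
  "right_radau_points k X j =
     {x. poly (cell_legendre X j (k + 1) - cell_legendre X j k) x = 0 \<and> x \<noteq> X j}"

definition max_error_at ::
  "nat \<Rightarrow> (nat \<Rightarrow> real set) \<Rightarrow> (real \<Rightarrow> real) \<Rightarrow> (nat \<Rightarrow> real poly) \<Rightarrow> real" where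
  "max_error_at N R f v = Max {\<bar>f x - poly (v j) x\<bar> | j x. j \<in> {1..N} \<and> x \<in> R j}"


section \<open>The interpolation function\<close>

text \<open>The Gauss--Radau projections on cell \<open>j\<close>. They are only applied to functions continuous on
  the closed cell, so one-sided limits at the nodes are function values; the same holds for the
  coefficients further down.\<close>

definition proj_minus :: "nat \<Rightarrow> (nat \<Rightarrow> real) \<Rightarrow> nat \<Rightarrow> (real \<Rightarrow> real) \<Rightarrow> real poly" where
  "proj_minus k X j f = (THE p. degree p \<le> k \<and>
     (\<forall>w. degree w \<le> k - 1 \<longrightarrow>
        integral (cell X j) (\<lambda>x. poly p x * poly w x) =
        integral (cell X j) (\<lambda>x. f x * poly w x)) \<and>
     poly p (X j) = f (X j))"

definition proj_plus :: "nat \<Rightarrow> (nat \<Rightarrow> real) \<Rightarrow> nat \<Rightarrow> (real \<Rightarrow> real) \<Rightarrow> real poly" where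
  "proj_plus k X j f = (THE p. degree p \<le> k \<and>
     (\<forall>w. degree w \<le> k - 1 \<longrightarrow>
        integral (cell X j) (\<lambda>x. poly p x * poly w x) =
        integral (cell X j) (\<lambda>x. f x * poly w x)) \<and>
     poly p (X (j - 1)) = f (X (j - 1)))"

definition Ds_inv :: "(nat \<Rightarrow> real) \<Rightarrow> nat \<Rightarrow> real poly \<Rightarrow> real \<Rightarrow> real" where
  "Ds_inv X j p x = 1 / half_len X j * integral {X (j - 1)..x} (poly p)"

definition F11 :: "nat \<Rightarrow> (nat \<Rightarrow> real) \<Rightarrow> nat \<Rightarrow> real poly" where
  "F11 k X j = proj_plus k X j (Ds_inv X j (cell_legendre X j k))"

definition F21 :: "nat \<Rightarrow> (nat \<Rightarrow> real) \<Rightarrow> nat \<Rightarrow> real poly" where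
  "F21 k X j = proj_minus k X j (Ds_inv X j (cell_legendre X j k))"

definition F11_bar :: "nat \<Rightarrow> (nat \<Rightarrow> real) \<Rightarrow> nat \<Rightarrow> real poly" where
  "F11_bar k X j = proj_minus k X j (Ds_inv X j (F11 k X j))"

definition F21_bar :: "nat \<Rightarrow> (nat \<Rightarrow> real) \<Rightarrow> nat \<Rightarrow> real poly" where
  "F21_bar k X j = proj_plus k X j (Ds_inv X j (F21 k X j))"

definition coeff_bar :: "nat \<Rightarrow> (nat \<Rightarrow> real) \<Rightarrow> nat \<Rightarrow> (real \<Rightarrow> real) \<Rightarrow> real" where
  "coeff_bar k X j v = - v (X j) + 1 / cell_len X j *
     integral (cell X j)
       (\<lambda>x. v x * (\<Sum>m\<le>k. (2 * real m + 1) * poly (cell_legendre X j m) x))"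

definition coeff_tilde :: "nat \<Rightarrow> (nat \<Rightarrow> real) \<Rightarrow> nat \<Rightarrow> (real \<Rightarrow> real) \<Rightarrow> real" where
  "coeff_tilde k X j v = (-1) ^ (k + 1) * v (X (j - 1)) + 1 / cell_len X j *
     integral (cell X j)
       (\<lambda>x. v x * (\<Sum>m\<le>k. (-1) ^ (k + m) * (2 * real m + 1) * poly (cell_legendre X j m) x))"

fun W2 ::
  "flux \<Rightarrow> nat \<Rightarrow> real \<Rightarrow> (nat \<Rightarrow> real) \<Rightarrow> (real \<Rightarrow> real \<Rightarrow> real) \<Rightarrow> real \<Rightarrow> nat \<Rightarrow> real poly" where
  "W2 FluxI k T X u t j =
     smult ((half_len X j)\<^sup>2 * t_deriv T (\<lambda>s. coeff_bar k X j (\<lambda>x. u x s)) t) (F11_bar k X j)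
     + smult (half_len X j * coeff_tilde k X j (\<lambda>x. x_deriv u x t)) (F21 k X j)"
| "W2 FluxII k T X u t j =
     smult (half_len X j * coeff_bar k X j (\<lambda>x. x_deriv u x t)) (F11 k X j)
     + smult ((half_len X j)\<^sup>2 * t_deriv T (\<lambda>s. coeff_tilde k X j (\<lambda>x. u x s)) t) (F21_bar k X j)"

fun u_interp ::
  "flux \<Rightarrow> nat \<Rightarrow> real \<Rightarrow> (nat \<Rightarrow> real) \<Rightarrow> (real \<Rightarrow> real \<Rightarrow> real) \<Rightarrow> real \<Rightarrow> nat \<Rightarrow> real poly" where
  "u_interp FluxI k T X u t j = proj_minus k X j (\<lambda>x. u x t) - W2 FluxI k T X u t j"
| "u_interp FluxII k T X u t j = proj_plus k X j (\<lambda>x. u x t) - W2 FluxII k T X u t j"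

end

theory Submission
  imports Defs
begin

text \<open>The discrete solutions are compared with Gauss--Radau projections of \<open>u\<close> and \<open>q\<close> plus
  corrections of order \<open>h\<^bsup>k+2\<^esup>\<close> and \<open>h\<^bsup>k+3\<^esup>\<close>. On a cell of centred coordinate \<open>s\<close> the projection error
  of a smooth function is a multiple of \<open>L\<^sub>k\<^sub>+\<^sub>1 \<plusminus> L\<^sub>k\<close> up to order \<open>h\<^bsup>k+2\<^esup>\<close>, and the derivative of
  \<open>L\<^sub>k\<^sub>+\<^sub>1 - L\<^sub>k\<close> is a multiple of the quotient of \<open>L\<^sub>k\<^sub>+\<^sub>1 + L\<^sub>k\<close> by \<open>1 + s\<close>, which vanishes at the other
  family of Radau points; so the derivative of the projection superconverges there. The corrections
  cancel the leading consistency errors, and with respect to an orthonormal basis the remaining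
  errors solve \<open>y' = D\<^sup>T (z - D x)\<close>, \<open>y = x + r\<close>, \<open>x(0) = 0\<close>, where \<open>D\<close> is bounded by a power of \<open>1/h\<close>, \<open>z\<close> and
  \<open>r\<close> are of order \<open>h\<^bsup>k+3\<^esup>\<close> and \<open>r\<close> is \<open>1/2\<close>-Hoelder in time. Duality with the backward semigroup of
  \<open>D\<^sup>T D\<close> bounds \<open>x\<close> and \<open>D x\<close> well enough for an inverse estimate. Time regularity of the coefficients
  comes from bounded space derivatives alone, by interpolation.\<close>

section \<open>Legendre polynomials\<close>

text \<open>The powers of h leave no slack. Data of size h^(k+3) are turned into a pointwise
  derivative by an inverse estimate that costs h^(-3/2), so \<open>D x\<close> may lose at most
  h^(-1/2) against the target h^(k+1). Bounding \<open>D x\<close> by duality meets a kernel r^(-1)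
  in time, which is not integrable. Mixing it with the bound K r^(-1/2), in the proportion 3/4 to
  1/4, gives K^(1/4) r^(-7/8); with K of order h^(-2) this costs exactly the permitted h^(-1/2). The
  constants 7/8, 1/8 and 16 come from this kernel. The data cannot be differentiated once more in
  time: a time derivative costs two space derivatives, and k + 4 bounded weak derivatives give only
  k + 3 classical ones, the last of them Lipschitz. Therefore the second correction of u is never
  differentiated, and only its Hoelder continuity in time enters. The final constant depends on T, k
  and the mesh ratio; the growth factors in the theorem are at least 1.\<close>

lemma poly_integrable [simp]: "(\<lambda>x. poly p x) integrable_on {a..b::real}"
  by (intro integrable_continuous_real continuous_intros)

text \<open>Taking the polynomial itself as argument keeps linearity and integration by parts inside
  the polynomial ring, where \<open>simp\<close> can compute.\<close>

definition pint :: "real \<Rightarrow> real \<Rightarrow> real poly \<Rightarrow> real" where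
  "pint a b p = integral {a..b} (poly p)"

lemma pint_eq: "pint a b p = integral {a..b} (\<lambda>x. poly p x)"
  by (simp add: pint_def)

lemma pint_pderiv: "a \<le> b \<Longrightarrow> pint a b (pderiv p) = poly p b - poly p a"
  unfolding pint_def
  by (intro integral_unique fundamental_theorem_of_calculus)
     (auto simp: has_real_derivative_iff_has_vector_derivative[symmetric] intro: poly_DERIV has_field_derivative_at_within)

lemma pint_0 [simp]: "pint a b 0 = 0"
  by (simp add: pint_eq)

lemma pint_add: "pint a b (p + q) = pint a b p + pint a b q"
  unfolding pint_eq poly_add by (intro integral_add) auto

lemma pint_smult: "pint a b (smult c p) = c * pint a b p"
  unfolding pint_eq poly_smult by (rule integral_mult_right)

lemma pint_minus: "pint a b (- p) = - pint a b p"
  using pint_smult[of a b "-1" p] by simp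

lemma pint_diff: "pint a b (p - q) = pint a b p - pint a b q"
  using pint_add[of a b p "- q"] by (simp add: pint_minus)

lemma pint_sum: "pint a b (\<Sum>i\<in>S. f i) = (\<Sum>i\<in>S. pint a b (f i))"
  by (induction S rule: infinite_finite_induct) (auto simp: pint_add)

lemma pint_by_parts:
  "a \<le> b \<Longrightarrow> pint a b (pderiv p * q) = poly p b * poly q b - poly p a * poly q a - pint a b (p * pderiv q)"
  using pint_pderiv[of a b "p * q"]
  by (simp add: pderiv_mult pint_add mult.commute)

section \<open>Legendre polynomials from Rodrigues' formula\<close>

lemma poly_funpow_pderiv_linear_factor:
  fixes q :: "real poly"
  shows "poly ((pderiv ^^ n) ([:-a, 1:] ^ n * q)) a = fact n * poly q a"
proof (induction n arbitrary: q)
  case (Suc n)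
  have "pderiv ([:-a, 1:] ^ Suc n * q) =
      [:-a, 1:] ^ n * (smult (of_nat (Suc n)) q + [:-a, 1:] * pderiv q)"
    unfolding pderiv_mult pderiv_power_Suc by (simp add: pderiv_pCons algebra_simps)
  then have "poly ((pderiv ^^ Suc n) ([:-a, 1:] ^ Suc n * q)) a =
      fact n * poly (smult (of_nat (Suc n)) q + [:-a, 1:] * pderiv q) a"
    using Suc.IH by (simp add: funpow_swap1)
  then show ?case by simp
qed simp

lemma poly_funpow_pderiv_linear_factor_zero:
  fixes q :: "real poly"
  assumes "n < m"
  shows "poly ((pderiv ^^ n) ([:-a, 1:] ^ m * q)) a = 0"
proof -
  have "[:-a, 1:] ^ m * q = [:-a, 1:] ^ n * ([:-a, 1:] ^ (m - n) * q)"
    using assms by (metis (no_types) le_add_diff_inverse less_imp_le mult.assoc power_add)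
  moreover have "poly ([:-a, 1:] ^ (m - n) * q) a = 0" using assms by simp
  ultimately show ?thesis by (simp only: poly_funpow_pderiv_linear_factor mult_zero_right)
qed

lemma rodrigues_factor: "[:-1, 0, 1:] ^ m = [:-1, 1:] ^ m * [:1, 1::real:] ^ m"
  by (simp add: power_mult_distrib[symmetric])

lemma degree_funpow_pderiv: "degree ((pderiv ^^ n) p) = degree p - n" for p :: "real poly"
  by (induction n) (auto simp: degree_pderiv)

lemma degree_legendre [simp]: "degree (legendre m) = m"
  unfolding legendre_def by (simp add: degree_funpow_pderiv degree_power_eq)

lemma legendre_1 [simp]: "poly (legendre m) 1 = 1"
  unfolding legendre_def rodrigues_factor
  using poly_funpow_pderiv_linear_factor[of m 1 "[:1, 1:] ^ m"] by (simp add: poly_power)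

lemma legendre_minus_1 [simp]: "poly (legendre m) (-1) = (-1) ^ m"
  unfolding legendre_def rodrigues_factor
  using poly_funpow_pderiv_linear_factor[of m "-1" "[:-1, 1:] ^ m"]
  by (simp add: poly_power mult.commute power_minus[of "2::real"])

lemma legendre_nonzero [simp]: "legendre m \<noteq> 0"
  using legendre_1[of m] by (metis poly_0 zero_neq_one)

lemma pint_funpow_pderiv:
  fixes a b :: real
  assumes "a \<le> b" "\<And>n. n < m \<Longrightarrow> poly ((pderiv ^^ n) W) a = 0" "\<And>n. n < m \<Longrightarrow> poly ((pderiv ^^ n) W) b = 0"
  shows "pint a b (((pderiv ^^ m) W * p)) = (-1) ^ m * pint a b ((W * (pderiv ^^ m) p))"
  using assms(2,3)
proof (induction m arbitrary: p)
  case (Suc m)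
  have "pint a b (((pderiv ^^ Suc m) W * p)) =
      - pint a b (((pderiv ^^ m) W * pderiv p))"
    using Suc.prems[of m] pint_by_parts[OF assms(1), of "(pderiv ^^ m) W" p] by simp
  then show ?case using Suc by (simp add: funpow_swap1)
qed simp

text \<open>By Rodrigues' formula and \<open>m\<close> integrations by parts all derivatives land on
  \<open>p\<close>, whose degree is too small to survive them. The boundary terms vanish because s^2
  - 1 is raised to the power \<open>m\<close>.\<close>

lemma legendre_orthogonal:
  assumes "degree p < m"
  shows "pint (-1) 1 ((legendre m * p)) = 0"
proof -
  have "(pderiv ^^ m) p = 0"
  proof -
    obtain n where n: "m = Suc n" using assms by (cases m) auto
    have "degree ((pderiv ^^ n) p) = 0" using assms n by (simp add: degree_funpow_pderiv)
    then show ?thesis using n by (simp add: pderiv_eq_0_iff)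
  qed
  moreover have "pint (-1) 1 (((pderiv ^^ m) ([:-1, 0, 1:] ^ m) * p)) =
      (-1) ^ m * pint (-1) 1 (([:-1, 0, 1:] ^ m * (pderiv ^^ m) p))"
  proof (rule pint_funpow_pderiv)
    show "poly ((pderiv ^^ n) ([:- 1, 0, 1:] ^ m)) (-1) = (0::real)" if "n < m" for n :: nat
    proof -
      have "[:-1, 0, 1:] ^ m = [:- (-1), 1:] ^ m * [:-1, 1::real:] ^ m"
        by (simp add: rodrigues_factor mult.commute)
      then show ?thesis using poly_funpow_pderiv_linear_factor_zero[OF that, of "-1" "[:-1, 1:] ^ m"] by metis
    qed
    show "poly ((pderiv ^^ n) ([:- 1, 0, 1:] ^ m)) 1 = (0::real)" if "n < m" for n :: nat
      using poly_funpow_pderiv_linear_factor_zero[OF that, of 1 "[:1, 1:] ^ m"]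
      unfolding rodrigues_factor by simp
  qed simp
  ultimately show ?thesis
    unfolding legendre_def by (simp add: pint_smult)
qed

text \<open>Integrate \<open>s L\<^sub>m L\<^sub>m'\<close> by parts and note \<open>s L\<^sub>m' = m L\<^sub>m\<close> up to lower order.\<close>

lemma legendre_norm: "pint (-1) 1 ((legendre m * legendre m)) = 2 / (2 * real m + 1)"
proof -
  let ?L = "legendre m"
  let ?N = "pint (-1) 1 ((?L * ?L))"
  have "pint (-1) 1 ((pderiv (?L * ?L) * [:0, 1:])) = 2 - ?N"
    using pint_by_parts[of "-1" 1 "?L * ?L" "[:0, 1:]"]
    by (simp add: pderiv_pCons power_mult_distrib[symmetric])
  moreover have "pint (-1) 1 ((pderiv (?L * ?L) * [:0, 1:])) = 2 * real m * ?N"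
  proof -
    let ?r = "[:0, 1:] * pderiv ?L - smult (real m) ?L"
    have "degree ?r \<le> m" by (intro degree_diff_le)
        (cases m, auto simp: degree_pderiv pderiv_eq_0_iff)
    moreover have "coeff ?r m = 0"
      by (cases m) (auto simp: coeff_pderiv coeff_pCons)
    ultimately have "m = 0 \<or> degree ?r < m"
      by (metis eq_zero_or_degree_less leading_coeff_0_iff degree_0 le_neq_implies_less bot_nat_0.not_eq_extremum)
    then have r: "pint (-1) 1 ((?L * ?r)) = 0"
    proof
      assume "m = 0"
      then have "?r = 0" by (simp add: legendre_def pderiv_1)
      then show ?thesis by simp
    qed (rule legendre_orthogonal)
    have "pderiv (?L * ?L) * [:0, 1:] = smult 2 (?L * ?r) + smult (2 * real m) (?L * ?L)"
      by (simp add: pderiv_mult algebra_simps smult_diff_right numeral_poly)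
    then show ?thesis using r by (simp add: pint_add pint_smult)
  qed
  ultimately have "?N * (2 * real m + 1) = 2" by (simp add: algebra_simps)
  then show ?thesis by (simp add: eq_divide_eq)
qed

section \<open>Expansion in Legendre polynomials\<close>

lemma eq_smult_legendre_plus_lower:
  assumes "degree p \<le> n"
  obtains c r where "p = smult c (legendre n) + r" "n = 0 \<Longrightarrow> r = 0" "n > 0 \<Longrightarrow> degree r < n"
proof -
  define c where "c = coeff p n / lead_coeff (legendre n)"
  define r where "r = p - smult c (legendre n)"
  have "degree r \<le> n" unfolding r_def using assms by (intro degree_diff_le) (auto intro: order_trans[OF degree_smult_le])
  moreover have "coeff r n = 0"
    using leading_coeff_0_iff[of "legendre n"] unfolding r_def c_def by simp
  ultimately have "r = 0 \<or> degree r < n"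
    by (metis leading_coeff_0_iff le_neq_implies_less)
  then show ?thesis using that[of c r] unfolding r_def by (cases "n = 0") auto
qed

text \<open>Pairing with the top Legendre polynomial isolates the leading coefficient, which must
  vanish; induction on the degree removes the rest.\<close>

lemma orthogonal_legendre_imp_zero:
  assumes "degree p \<le> n" "\<And>m. m \<le> n \<Longrightarrow> pint (-1) 1 (legendre m * p) = 0"
  shows "p = 0"
  using assms
proof (induction n arbitrary: p)
  case 0
  obtain c r where p: "p = smult c (legendre 0) + r" "r = 0"
    using eq_smult_legendre_plus_lower[OF 0(1)] by metis
  then have "c = 0" using 0(2)[of 0] by (simp add: pint_smult legendre_norm)
  then show ?case using p by simp
next
  case (Suc n)
  obtain c r where p: "p = smult c (legendre (Suc n)) + r" "degree r < Suc n"
    using eq_smult_legendre_plus_lower[OF Suc.prems(1)] by (metis zero_less_Suc)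
  have "pint (-1) 1 (legendre (Suc n) * p) = c * (2 / (2 * real (Suc n) + 1))"
    using legendre_orthogonal[OF p(2)] unfolding p(1)
    by (simp add: algebra_simps pint_add pint_smult legendre_norm)
  moreover have "2 * real (Suc n) + 1 > 0" by simp
  ultimately have "c = 0" using Suc.prems(2)[of "Suc n"] by auto
  then show ?case using Suc.IH[of p] Suc.prems(2) p by simp
qed

text \<open>The difference of the two sides is orthogonal to every Legendre polynomial up to degree
  \<open>n\<close>.\<close>

lemma legendre_expansion_ref:
  assumes "degree p \<le> n"
  shows "p = (\<Sum>m\<le>n. smult ((2 * real m + 1) / 2 * pint (-1) 1 (p * legendre m)) (legendre m))"
proof -
  let ?S = "\<Sum>m\<le>n. smult ((2 * real m + 1) / 2 * pint (-1) 1 (p * legendre m)) (legendre m)"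
  have orth: "pint (-1) 1 (legendre m * legendre i) = (if m = i then 2 / (2 * real m + 1) else 0)" for m i
    using legendre_orthogonal[of "legendre i" m] legendre_orthogonal[of "legendre m" i]
    by (cases m i rule: linorder_cases) (auto simp: legendre_norm mult.commute)
  have "p - ?S = 0"
  proof (rule orthogonal_legendre_imp_zero)
    show "degree (p - ?S) \<le> n" using assms
      by (intro degree_diff_le degree_sum_le) (auto intro: order_trans[OF degree_smult_le])
    fix i assume i: "i \<le> n"
    have "pint (-1) 1 (legendre i * ?S) =
        (\<Sum>m\<le>n. (2 * real m + 1) / 2 * pint (-1) 1 (p * legendre m) * pint (-1) 1 (legendre i * legendre m))"
      by (simp add: sum_distrib_left pint_sum pint_smult)
    also have "\<dots> = (\<Sum>m\<le>n. if i = m then pint (-1) 1 (p * legendre m) else 0)"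
    proof (intro sum.cong refl)
      fix m
      have "2 * real m + 1 \<noteq> 0" by linarith
      then have "(2 * real m + 1) / 2 * x * (2 / (2 * real m + 1)) = x" for x by simp
      then show "(2 * real m + 1) / 2 * pint (-1) 1 (p * legendre m) * pint (-1) 1 (legendre i * legendre m) =
          (if i = m then pint (-1) 1 (p * legendre m) else 0)"
        unfolding orth by auto
    qed
    also have "\<dots> = pint (-1) 1 (p * legendre i)" using i by simp
    finally show "pint (-1) 1 (legendre i * (p - ?S)) = 0"
      by (simp add: right_diff_distrib pint_diff mult.commute)
  qed
  then show ?thesis by simp
qed

section \<open>The Radau identities and the location of their zeros\<close>

lemma orthogonal_eq_combination:
  assumes "degree p \<le> k + 1" "\<And>w. degree w < k \<Longrightarrow> pint (-1) 1 (p * w) = 0"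
  obtains \<alpha> \<beta> where "p = smult \<alpha> (legendre (k + 1)) + smult \<beta> (legendre k)"
proof -
  let ?f = "\<lambda>m. smult ((2 * real m + 1) / 2 * pint (-1) 1 (p * legendre m)) (legendre m)"
  have "p = (\<Sum>m\<le>k + 1. ?f m)" by (rule legendre_expansion_ref[OF assms(1)])
  also have "\<dots> = (\<Sum>m\<in>{k, k + 1}. ?f m)" using assms(2)
    by (intro sum.mono_neutral_right) auto
  also have "\<dots> = ?f (k + 1) + ?f k" by simp
  finally show ?thesis using that by blast
qed

text \<open>Integration by parts shows that the left side is orthogonal to all degrees below
  \<open>k\<close>: the difference vanishes at 1 and the factor 1 + s at -1. So it is a combination
  of the two top Legendre polynomials. Its zero at -1 makes the two coefficients equal, and the
  leading coefficient fixes them as \<open>k + 1\<close>.\<close>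

lemma radau_identity:
  "[:1, 1:] * pderiv (legendre (k + 1) - legendre k) = smult (real (k + 1)) (legendre (k + 1) + legendre k)"
proof -
  let ?d = "legendre (k + 1) - legendre k" and ?p = "[:1, 1:] * pderiv (legendre (k + 1) - legendre k)"
  have degd: "degree ?d = k + 1" using degree_add_eq_left[of "- legendre k" "legendre (k + 1)"] by simp
  have deg: "degree ?p \<le> k + 1"
    using degree_mult_le[of "[:1, 1:]" "pderiv ?d"] by (simp add: degree_pderiv degd[simplified] del: mult_pCons_left)
  have "pint (-1) 1 (?p * w) = 0" if w: "degree w < k" for w
  proof -
    have "degree (pderiv ([:1, 1:] * w)) < k"
      using degree_mult_le[of "[:1, 1:]" w] w by (simp add: degree_pderiv)
    then have "pint (-1) 1 (?d * pderiv ([:1, 1:] * w)) = 0"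
      using legendre_orthogonal[of "pderiv ([:1, 1:] * w)"]
      by (simp only: left_diff_distrib pint_diff)
    moreover have "pint (-1) 1 (pderiv ?d * ([:1, 1:] * w)) = - pint (-1) 1 (?d * pderiv ([:1, 1:] * w))"
      using pint_by_parts[of "-1" 1 ?d "[:1, 1:] * w"] by (simp only: poly_mult) simp
    moreover have "?p * w = pderiv ?d * ([:1, 1:] * w)" by (simp only: mult.assoc mult.left_commute)
    ultimately show ?thesis by (simp only: minus_zero)
  qed
  from orthogonal_eq_combination[OF deg this] obtain \<alpha> \<beta>
    where p: "?p = smult \<alpha> (legendre (k + 1)) + smult \<beta> (legendre k)" by blast
  have "poly ?p (-1) = 0" by simp
  then have "\<alpha> * (-1) ^ (k + 1) + \<beta> * (-1) ^ k = 0" unfolding p by simp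
  then have "(-1) ^ k * (\<beta> - \<alpha>) = 0" by (simp add: right_diff_distrib mult.commute)
  then have "\<alpha> = \<beta>" by simp
  have lc: "coeff (legendre (k + 1)) (k + 1) \<noteq> 0"
    using leading_coeff_0_iff[of "legendre (k + 1)"] by simp
  have "?p = pderiv ?d + pCons 0 (pderiv ?d)" by simp
  then have "coeff ?p (k + 1) = coeff (pderiv ?d) (k + 1) + coeff (pderiv ?d) k"
    by (simp only: coeff_add coeff_pCons_Suc flip: Suc_eq_plus1)
  also have "\<dots> = real (k + 1) * coeff (legendre (k + 1)) (k + 1)"
    by (simp add: coeff_pderiv coeff_eq_0)
  finally have "coeff ?p (k + 1) = real (k + 1) * coeff (legendre (k + 1)) (k + 1)" .
  moreover have "coeff ?p (k + 1) = \<alpha> * coeff (legendre (k + 1)) (k + 1)"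
    unfolding p by (simp add: coeff_eq_0)
  ultimately have "\<alpha> = real (k + 1)" using lc by simp
  with \<open>\<alpha> = \<beta>\<close> p show ?thesis by (simp only: smult_add_right)
qed

lemma funpow_pderiv_reflect:
  "(pderiv ^^ n) (pcompose p [:0, -1:]) = smult ((-1) ^ n) (pcompose ((pderiv ^^ n) p) [:0, -1::real:])"
  by (induction n) (auto simp: pderiv_smult pderiv_pcompose pderiv_pCons)

text \<open>s^2 - 1 is even and each of the \<open>m\<close> derivatives contributes a sign.\<close>

lemma legendre_reflect: "pcompose (legendre m) [:0, -1:] = smult ((-1) ^ m) (legendre m)"
proof -
  have "pcompose ([:-1, 0, 1:] ^ m) [:0, -1::real:] = [:-1, 0, 1:] ^ m"
  proof (induction m)
    case (Suc m)
    have "pcompose [:-1, 0, 1:] [:0, -1::real:] = [:-1, 0, 1:]" by (simp add: pcompose_pCons)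
    then show ?case by (simp only: power_Suc pcompose_mult Suc)
  qed (simp add: pcompose_1)
  then have *: "(pderiv ^^ m) ([:-1, 0, 1:] ^ m) =
      smult ((-1) ^ m) (pcompose ((pderiv ^^ m) ([:-1, 0, 1:] ^ m)) [:0, -1::real:])" (is "?X = smult _ ?Y")
    using funpow_pderiv_reflect[of m "[:-1, 0, 1:] ^ m"] by simp
  have "smult ((-1) ^ m) ?X = ?Y"
    by (subst *) (simp add: power_mult_distrib[symmetric])
  moreover have "smult ((-1) ^ m) (smult c ?X) = smult c (smult ((-1) ^ m) ?X)" for c
    by (simp only: smult_smult mult.commute)
  ultimately show ?thesis
    unfolding legendre_def pcompose_smult by (simp only:)
qed

lemma legendre_neg: "poly (legendre m) (- s) = (-1) ^ m * poly (legendre m) s"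
  using arg_cong[OF legendre_reflect[of m], of "\<lambda>p. poly p s"] by (simp add: poly_pcompose)

text \<open>The mirror image of \<open>radau_identity\<close> under the reflection of s, where
  parity turns the difference into a sum.\<close>

lemma radau_identity':
  "[:1, -1:] * pderiv (legendre (k + 1) + legendre k) = smult (real (k + 1)) (legendre k - legendre (k + 1))"
proof (rule poly_eq_poly_eq_iff[THEN iffD1], rule ext)
  fix s :: real
  have d: "poly (pderiv (legendre m)) (- s) = (-1) ^ (m + 1) * poly (pderiv (legendre m)) s" for m
    using arg_cong[OF arg_cong[OF legendre_reflect[of m], of pderiv], of "\<lambda>p. poly p s"]
    by (simp add: pderiv_pcompose pderiv_smult pderiv_pCons poly_pcompose)
  have "poly ([:1, 1:] * pderiv (legendre (k + 1) - legendre k)) (- s) =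
      poly (smult (real (k + 1)) (legendre (k + 1) + legendre k)) (- s)" by (simp only: radau_identity)
  then have "(-1) ^ k * ((1 - s) * (poly (pderiv (legendre (k + 1))) s + poly (pderiv (legendre k)) s))
     = (-1) ^ k * (real (k + 1) * (poly (legendre k) s - poly (legendre (k + 1)) s))"
    unfolding poly_mult poly_smult poly_add poly_diff pderiv_diff d legendre_neg
    by (simp add: algebra_simps)
  then have "(1 - s) * (poly (pderiv (legendre (k + 1))) s + poly (pderiv (legendre k)) s)
     = real (k + 1) * (poly (legendre k) s - poly (legendre (k + 1)) s)"
    by (simp only: mult_cancel_left) simp
  then show "poly ([:1, -1:] * pderiv (legendre (k + 1) + legendre k)) s =
      poly (smult (real (k + 1)) (legendre k - legendre (k + 1))) s"
    by (simp add: pderiv_add algebra_simps)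
qed

text \<open>With \<open>d = L\<^sub>k\<^sub>+\<^sub>1 - L\<^sub>k\<close>, the Radau identity says \<open>(d / (1 + s)^(k+1))' = 2 (k + 1) L\<^sub>k / (1 + s)^(k+2)\<close>.\<close>

lemma legendre_increasing:
  assumes "1 < s"
  shows "0 < poly (legendre k) s \<and> poly (legendre k) s < poly (legendre (k + 1)) s"
proof -
  have step: "poly (legendre k) s < poly (legendre (k + 1)) s"
    if pos: "\<And>s. s > 1 \<Longrightarrow> 0 < poly (legendre k) s" and s: "s > 1" for k s
  proof -
    let ?d = "legendre (k + 1) - legendre k"
    let ?g = "\<lambda>s. poly ?d s / (1 + s) ^ (k + 1)"
    have "?g 1 < ?g s"
    proof (rule DERIV_pos_imp_increasing_open[OF s])
      fix r :: real assume r: "1 < r" "r < s"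
      have id: "(1 + r) * poly (pderiv ?d) r = real (k + 1) * (poly ?d r + 2 * poly (legendre k) r)"
        using arg_cong[OF radau_identity[of k], of "\<lambda>p. poly p r"] by (simp add: algebra_simps)
      have "(?g has_real_derivative
          (poly (pderiv ?d) r * (1 + r) ^ (k + 1) - poly ?d r * (real (k + 1) * (1 + r) ^ k)) / ((1 + r) ^ (k + 1))\<^sup>2) (at r)"
      proof -
        have "((\<lambda>s. (1 + s) ^ (k + 1)) has_real_derivative real (k + 1) * (1 + r) ^ k) (at r)"
          using DERIV_power[OF DERIV_add[OF DERIV_const DERIV_ident], where n = "k + 1" and s = UNIV] by simp
        from DERIV_divide[OF poly_DERIV[of ?d] this] show ?thesis using r by (simp add: power2_eq_square)
      qed
      moreover have "poly (pderiv ?d) r * (1 + r) ^ (k + 1) - poly ?d r * (real (k + 1) * (1 + r) ^ k)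
          = (1 + r) ^ k * (real (k + 1) * (2 * poly (legendre k) r))"
      proof -
        have "poly (pderiv ?d) r * (1 + r) ^ (k + 1) - poly ?d r * (real (k + 1) * (1 + r) ^ k)
            = (1 + r) ^ k * ((1 + r) * poly (pderiv ?d) r - real (k + 1) * poly ?d r)"
          by (simp only: power_add power_one_right) (simp only: algebra_simps)
        then show ?thesis unfolding id by (simp only: distrib_left add_diff_cancel_left')
      qed
      moreover have "\<dots> > 0" using r pos[of r] by simp
      ultimately show "\<exists>y. (?g has_real_derivative y) (at r) \<and> 0 < y"
        using r by (intro exI conjI) (assumption, simp)
    next
      show "continuous_on {1..s} ?g" by (intro continuous_intros) auto
    qed
    then have "0 < poly ?d s / (1 + s) ^ (k + 1)" by simp
    moreover have "0 < (1 + s) ^ (k + 1)" using s by (intro zero_less_power) simp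
    ultimately have "0 < poly ?d s" by (simp only: zero_less_divide_iff) linarith
    then show ?thesis by simp
  qed
  have "0 < poly (legendre k) s" if "1 < s" for s
    using that
  proof (induction k arbitrary: s)
    case 0
    then show ?case by (simp add: legendre_def)
  next
    case (Suc k)
    then show ?case using step[of k s] by force
  qed
  then show ?thesis using step assms by blast
qed

text \<open>Beyond the interval two consecutive Legendre polynomials have strictly different
  absolute values. Since Radau points are defined as real zeros anywhere, this is what places them
  in their cell.\<close>

lemma legendre_sum_zero_in_interval:
  assumes "poly (legendre (k + 1) + legendre k) s = 0 \<or> poly (legendre (k + 1) - legendre k) s = 0"
  shows "-1 \<le> s" "s \<le> 1"
proof -
  have *: "\<bar>poly (legendre (k + 1)) s\<bar> = \<bar>poly (legendre k) s\<bar>" using assms by (auto simp: algebra_simps)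
  show "s \<le> 1" using * legendre_increasing[of s k] by force
  have "\<bar>poly (legendre (k + 1)) (- s)\<bar> = \<bar>poly (legendre k) (- s)\<bar>"
    using * by (simp add: legendre_neg abs_mult power_abs)
  then show "-1 \<le> s" using legendre_increasing[of "- s" k] by force
qed

text \<open>Rolle's theorem for the primitive. Applied to the Radau polynomial it shows that Radau
  points exist.\<close>

lemma pint_zero_imp_root:
  assumes "a < b" "pint a b p = 0"
  obtains x where "a < x" "x < b" "poly p x = 0"
proof -
  let ?P = "\<lambda>x. integral {a..x} (\<lambda>x. poly p x)"
  have cont: "continuous_on {a..b} (\<lambda>x. poly p x)" by (intro continuous_intros)
  have d: "(?P has_real_derivative poly p x) (at x within {a..b})" if "x \<in> {a..b}" for x
    using integral_has_real_derivative[OF cont that] .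
  have "\<exists>z>a. z < b \<and> (\<lambda>h. poly p z * h) = (\<lambda>v. 0)"
  proof (rule Rolle_deriv[OF assms(1)])
    show "?P a = ?P b" using assms by (simp add: pint_eq)
    show "continuous_on {a..b} ?P" by (rule DERIV_continuous_on[OF d])
    show "(?P has_derivative (\<lambda>h. poly p x * h)) (at x)" if "a < x" "x < b" for x
      using d[of x] that at_within_interior[of x "{a..b}"] by (auto simp: has_field_derivative_def)
  qed
  then obtain z where z: "a < z" "z < b" "(\<lambda>h. poly p z * h) = (\<lambda>v. 0)" by blast
  have "poly p z = 0" using fun_cong[OF z(3), of 1] by simp
  with z that show ?thesis by blast
qed

lemma legendre_bounded:
  obtains L where "L \<ge> 1"
    "\<And>m s. m \<le> n \<Longrightarrow> -1 \<le> s \<Longrightarrow> s \<le> 1 \<Longrightarrow> \<bar>poly (legendre m) s\<bar> \<le> L \<and> \<bar>poly (pderiv (legendre m)) s\<bar> \<le> L"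
proof -
  have "\<exists>B. \<forall>s\<in>{-1..1}. \<bar>poly p s\<bar> \<le> B" for p :: "real poly"
  proof -
    have "compact ((\<lambda>s. poly p s) ` {-1..1})" by (intro compact_continuous_image continuous_intros) auto
    then show ?thesis using compact_imp_bounded[THEN bounded_iff[THEN iffD1]] by (metis image_eqI real_norm_def)
  qed
  then have "\<forall>p::real poly. \<exists>B. \<forall>s\<in>{-1..1}. \<bar>poly p s\<bar> \<le> B" by blast
  from choice[OF this] obtain B where B: "\<And>(p::real poly) s. s \<in> {-1..1} \<Longrightarrow> \<bar>poly p s\<bar> \<le> B p" by blast
  define L where "L = 1 + (\<Sum>m\<le>n. \<bar>B (legendre m)\<bar> + \<bar>B (pderiv (legendre m))\<bar>)"
  have "\<bar>B (legendre m)\<bar> + \<bar>B (pderiv (legendre m))\<bar> \<le> L" if "m \<le> n" for m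
    unfolding L_def using member_le_sum[of m "{..n}" "\<lambda>m. \<bar>B (legendre m)\<bar> + \<bar>B (pderiv (legendre m))\<bar>"] that by simp
  moreover have "L \<ge> 1" unfolding L_def by (simp add: sum_nonneg)
  ultimately show ?thesis
  proof (intro that[of L] conjI)
    fix m s assume "m \<le> n" "-1 \<le> s" "s \<le> (1::real)"
    moreover have "s \<in> {-1..1}" using calculation by simp
    note B[OF this, of "legendre m"] B[OF this, of "pderiv (legendre m)"]
    moreover note \<open>m \<le> n \<Longrightarrow> \<bar>B (legendre m)\<bar> + \<bar>B (pderiv (legendre m))\<bar> \<le> L\<close>
    ultimately show "\<bar>poly (legendre m) s\<bar> \<le> L" "\<bar>poly (pderiv (legendre m)) s\<bar> \<le> L" by linarith+
  qed
qed

section \<open>Legendre expansions and Gauss--Radau projections on an interval\<close>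

text \<open>\<open>cell_legendre\<close> with the cell given by its end points, so that the local
  theory needs no mesh.\<close>

definition leg :: "real \<Rightarrow> real \<Rightarrow> nat \<Rightarrow> real poly" where
  "leg a b m = pcompose (legendre m) [:- (a + b) / (b - a), 2 / (b - a):]"

lemma cell_legendre_eq_leg: "cell_legendre X j m = leg (X (j - 1)) (X j) m"
proof -
  have "- ((a + b) / 2) / ((b - a) / 2) = - (a + b) / (b - a)" "1 / ((b - a) / 2) = 2 / (b - a)" for a b :: real
  proof -
    have "- (x / 2) / (y / 2) = - x / y" "1 / (y / 2) = 2 / y" for x y :: real by simp_all
    then show "- ((a + b) / 2) / ((b - a) / 2) = - (a + b) / (b - a)" "1 / ((b - a) / 2) = 2 / (b - a)" by blast+
  qed
  then show ?thesis
    unfolding cell_legendre_def leg_def cell_mid_def half_len_def cell_len_def by (simp only:)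
qed

lemma poly_leg: "poly (leg a b m) x = poly (legendre m) ((2 * x - (a + b)) / (b - a))"
  by (simp add: leg_def poly_pcompose diff_divide_distrib add_divide_distrib algebra_simps)

lemma poly_pderiv_leg:
  "poly (pderiv (leg a b m)) x = poly (pderiv (legendre m)) ((2 * x - (a + b)) / (b - a)) * (2 / (b - a))"
  by (simp add: leg_def pderiv_pcompose pderiv_pCons poly_pcompose diff_divide_distrib add_divide_distrib algebra_simps)

lemma degree_leg [simp]: "a < b \<Longrightarrow> degree (leg a b m) = m"
  by (simp add: leg_def degree_pcompose)

lemma leg_right [simp]: "a < b \<Longrightarrow> poly (leg a b m) b = 1"
proof -
  assume "a < b"
  then have "(2 * b - (a + b)) / (b - a) = 1" by (simp add: field_simps)
  then show ?thesis unfolding poly_leg by simp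
qed

lemma leg_left [simp]: "a < b \<Longrightarrow> poly (leg a b m) a = (-1) ^ m"
proof -
  assume "a < b"
  then have "(2 * a - (a + b)) / (b - a) = -1" by (simp add: field_simps)
  then show ?thesis unfolding poly_leg by simp
qed

lemma pint_affine:
  assumes "a < b"
  shows "pint a b (pcompose p [:- (a + b) / (b - a), 2 / (b - a):]) = (b - a) / 2 * pint (-1) 1 p"
proof -
  let ?m = "2 / (b - a)" and ?c = "- (a + b) / (b - a)"
  have m: "?m > 0" using assms by simp
  have "((\<lambda>x. poly p x) has_integral pint (-1) 1 p) (cbox (-1) 1)"
    unfolding pint_eq by (simp add: integrable_integral)
  from has_integral_affinity'[OF this m, of ?c]
  have "((\<lambda>x. poly p (?m * x + ?c)) has_integral pint (-1) 1 p /\<^sub>R ?m) {(-1 - ?c) /\<^sub>R ?m..(1 - ?c) /\<^sub>R ?m}"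
    by (simp only: real_scaleR_def DIM_real power_one_right cbox_interval)
  then have "((\<lambda>x. poly p (?m * x + ?c)) has_integral pint (-1) 1 p / ?m) {(-1 - ?c) / ?m..(1 - ?c) / ?m}"
    by (simp only: real_scaleR_def divide_inverse_commute)
  moreover have "(-1 - ?c) / ?m = a" "(1 - ?c) / ?m = b" using assms by (simp_all add: field_simps)
  moreover have "poly (pcompose p [:- (a + b) / (b - a), 2 / (b - a):]) x = poly p (?m * x + ?c)" for x
    by (simp add: poly_pcompose add.commute mult.commute)
  ultimately have "((\<lambda>x. poly (pcompose p [:- (a + b) / (b - a), 2 / (b - a):]) x) has_integral
      pint (-1) 1 p / ?m) {a..b}" by (simp only:)
  from integral_unique[OF this] show ?thesis unfolding pint_eq[of a b] by simp
qed

text \<open>Lets any polynomial on the interval be written as a pullback from the reference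
  interval, which carries orthogonality and expansions over.\<close>

lemma affine_inverse:
  fixes a b :: real
  assumes "a < b"
  shows "pcompose (pcompose p [:(a + b) / 2, (b - a) / 2:]) [:- (a + b) / (b - a), 2 / (b - a):] = p"
proof -
  have "pcompose [:(a + b) / 2, (b - a) / 2:] [:- (a + b) / (b - a), 2 / (b - a):] = [:0, 1:]"
  proof -
    have "d \<noteq> 0 \<Longrightarrow> d / 2 * (x / d) = x / 2" for d x :: real by simp
    then have "(b - a) / 2 * (x / (b - a)) = x / 2" for x using assms by (metis less_numeral_extra(3) diff_gt_0_iff_gt)
    note e = this[of "- (a + b)"] this[of 2]
    have "pcompose [:c, d:] [:u, v:] = [:c + d * u, d * v:]" for c d u v :: real
      by (simp add: pcompose_pCons)
    then have "pcompose [:(a + b) / 2, (b - a) / 2:] [:- (a + b) / (b - a), 2 / (b - a):]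
        = [:(a + b) / 2 + - (a + b) / 2, 2 / 2:]"
      by (simp only: e)
    moreover have "(a + b) / 2 + - (a + b) / 2 = 0" by (simp add: field_simps)
    ultimately show ?thesis by (simp only: divide_self_if) simp
  qed
  then show ?thesis by (simp only: pcompose_assoc[symmetric] pcompose_idR)
qed

lemma leg_orthogonal:
  assumes "a < b" "degree p < m"
  shows "pint a b (leg a b m * p) = 0"
proof -
  let ?p = "pcompose p [:(a + b) / 2, (b - a) / 2:]"
  have "leg a b m * p = pcompose (legendre m * ?p) [:- (a + b) / (b - a), 2 / (b - a):]"
    by (simp only: pcompose_mult affine_inverse[OF assms(1)] leg_def)
  moreover have "degree ?p < m" using assms by (simp add: degree_pcompose)
  ultimately show ?thesis using pint_affine[OF assms(1)] legendre_orthogonal by (simp only: mult_zero_right)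
qed

lemma leg_norm:
  assumes "a < b"
  shows "pint a b (leg a b m * leg a b m) = (b - a) / (2 * real m + 1)"
proof -
  have "x / 2 * (2 / y) = x / y" for x y :: real by simp
  with pint_affine[OF assms, of "legendre m * legendre m"] show ?thesis
    by (simp only: pcompose_mult leg_def[symmetric] legendre_norm)
qed

lemma leg_orthonormal:
  assumes "a < b"
  shows "pint a b (leg a b m * leg a b n) = (if m = n then (b - a) / (2 * real m + 1) else 0)"
  using leg_orthogonal[OF assms, of "leg a b n" m] leg_orthogonal[OF assms, of "leg a b m" n] assms
  by (cases m n rule: linorder_cases) (auto simp: leg_norm mult.commute)

lemma leg_expansion:
  assumes "a < b" "degree p \<le> n"
  shows "p = (\<Sum>m\<le>n. smult ((2 * real m + 1) / (b - a) * pint a b (p * leg a b m)) (leg a b m))"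
proof -
  let ?A = "[:- (a + b) / (b - a), 2 / (b - a):]"
  let ?p = "pcompose p [:(a + b) / 2, (b - a) / 2:]"
  have "degree ?p \<le> n" using assms by (simp add: degree_pcompose)
  note exp = legendre_expansion_ref[OF this]
  have coeffs: "(2 * real m + 1) / 2 * pint (-1) 1 (?p * legendre m) = (2 * real m + 1) / (b - a) * pint a b (p * leg a b m)" for m
  proof -
    have "p * leg a b m = pcompose (?p * legendre m) ?A"
      by (simp only: pcompose_mult affine_inverse[OF assms(1)] leg_def)
    then have e: "pint a b (p * leg a b m) = (b - a) / 2 * pint (-1) 1 (?p * legendre m)"
      using pint_affine[OF assms(1)] by (simp only:)
    have "x / 2 * y = x / (b - a) * ((b - a) / 2 * y)" for x y using assms(1) by simp
    then show ?thesis unfolding e by blast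
  qed
  have "p = pcompose ?p ?A" by (simp only: affine_inverse[OF assms(1)])
  also have "\<dots> = pcompose (\<Sum>m\<le>n. smult ((2 * real m + 1) / 2 * pint (-1) 1 (?p * legendre m)) (legendre m)) ?A"
    by (rule arg_cong[OF exp])
  also have "\<dots> = (\<Sum>m\<le>n. smult ((2 * real m + 1) / (b - a) * pint a b (p * leg a b m)) (leg a b m))"
    by (simp only: pcompose_sum pcompose_smult coeffs leg_def)
  finally show ?thesis .
qed

lemma leg_bounded:
  obtains L where "L \<ge> 1"
    "\<And>a b m x. a < b \<Longrightarrow> m \<le> n \<Longrightarrow> x \<in> {a..b} \<Longrightarrow> \<bar>poly (leg a b m) x\<bar> \<le> L"
    "\<And>a b m x. a < b \<Longrightarrow> m \<le> n \<Longrightarrow> x \<in> {a..b} \<Longrightarrow> \<bar>poly (pderiv (leg a b m)) x\<bar> \<le> 2 * L / (b - a)"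
proof -
  obtain L where L: "L \<ge> 1"
    "\<And>m s. m \<le> n \<Longrightarrow> -1 \<le> s \<Longrightarrow> s \<le> 1 \<Longrightarrow> \<bar>poly (legendre m) s\<bar> \<le> L \<and> \<bar>poly (pderiv (legendre m)) s\<bar> \<le> L"
    using legendre_bounded by metis
  show ?thesis
  proof (rule that[OF L(1)])
    fix a b x :: real and m :: nat
    assume ab: "a < b" and m: "m \<le> n" and x: "x \<in> {a..b}"
    define s where "s = (2 * x - (a + b)) / (b - a)"
    have "-1 \<le> s" "s \<le> 1" using ab x by (auto simp: s_def field_simps)
    note s = L(2)[OF m this]
    show "\<bar>poly (leg a b m) x\<bar> \<le> L" using s ab by (simp add: poly_leg s_def)
    have "\<bar>poly (pderiv (leg a b m)) x\<bar> = \<bar>poly (pderiv (legendre m)) s\<bar> * (2 / (b - a))"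
      using ab by (simp only: poly_pderiv_leg abs_mult s_def) simp
    also have "\<dots> \<le> L * (2 / (b - a))" using s ab by (intro mult_right_mono) auto
    finally show "\<bar>poly (pderiv (leg a b m)) x\<bar> \<le> 2 * L / (b - a)" by (simp add: mult.commute)
  qed
qed

section \<open>Gauss-Radau projections for both fluxes at once, collocating at
  \<open>end_pt\<close>\<close>

fun opp :: "flux \<Rightarrow> flux" where
  "opp FluxI = FluxII"
| "opp FluxII = FluxI"

text \<open>The value of the Legendre polynomial of degree 1 at \<open>end_pt\<close>; its powers
  are the end values of the higher degrees.\<close>

fun end_sign :: "flux \<Rightarrow> real" where
  "end_sign FluxI = 1"
| "end_sign FluxII = -1"

fun end_pt :: "flux \<Rightarrow> real \<Rightarrow> real \<Rightarrow> real" where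
  "end_pt FluxI a b = b"
| "end_pt FluxII a b = a"

lemma leg_end_pt: "a < b \<Longrightarrow> poly (leg a b m) (end_pt fl a b) = end_sign fl ^ m"
  by (cases fl) auto

lemma end_sign_sq [simp]: "end_sign fl ^ n * end_sign fl ^ n = 1"
  by (cases fl) (auto simp: power_mult_distrib[symmetric])

lemma end_pt_in [simp]: "a < b \<Longrightarrow> end_pt fl a b \<in> {a..b}"
  by (cases fl) auto

definition moment :: "real \<Rightarrow> real \<Rightarrow> (real \<Rightarrow> real) \<Rightarrow> nat \<Rightarrow> real" where
  "moment a b v m = (2 * real m + 1) / (b - a) * integral {a..b} (\<lambda>x. v x * poly (leg a b m) x)"

text \<open>\<open>radau_coef\<close> is \<open>coeff_bar\<close> for \<open>FluxI\<close> and \<open>coeff_tilde\<close> for \<open>FluxII\<close>.\<close>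

definition radau_coef :: "nat \<Rightarrow> flux \<Rightarrow> real \<Rightarrow> real \<Rightarrow> (real \<Rightarrow> real) \<Rightarrow> real" where
  "radau_coef k fl a b v = (\<Sum>m\<le>k. end_sign fl ^ (k + m) * moment a b v m) - end_sign fl ^ k * v (end_pt fl a b)"

text \<open>A truncated Legendre series whose top coefficient is altered so that the end value is
  matched. Orthogonality of the error to degrees below \<open>k\<close> is untouched; uniqueness
  then identifies it with \<open>proj_minus\<close> and \<open>proj_plus\<close>.\<close>

definition radau_proj :: "nat \<Rightarrow> flux \<Rightarrow> real \<Rightarrow> real \<Rightarrow> (real \<Rightarrow> real) \<Rightarrow> real poly" where
  "radau_proj k fl a b v = (\<Sum>m\<le>k. smult (moment a b v m) (leg a b m)) - smult (radau_coef k fl a b v) (leg a b k)"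

lemma integrable_mult_poly:
  "continuous_on {a..b} v \<Longrightarrow> (\<lambda>x. v x * poly w x) integrable_on {a..b::real}"
  by (intro integrable_continuous_real continuous_intros)

lemma moment_cong: "(\<And>x. x \<in> {a..b} \<Longrightarrow> v x = v' x) \<Longrightarrow> moment a b v m = moment a b v' m"
  unfolding moment_def by (intro arg_cong2[where f = "(*)"] refl integral_cong) auto

lemma radau_coef_cong:
  "a < b \<Longrightarrow> (\<And>x. x \<in> {a..b} \<Longrightarrow> v x = v' x) \<Longrightarrow> radau_coef k fl a b v = radau_coef k fl a b v'"
  unfolding radau_coef_def using moment_cong[of a b v v'] end_pt_in[of a b fl] by simp

lemma radau_proj_cong:
  "a < b \<Longrightarrow> (\<And>x. x \<in> {a..b} \<Longrightarrow> v x = v' x) \<Longrightarrow> radau_proj k fl a b v = radau_proj k fl a b v'"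
  unfolding radau_proj_def using moment_cong[of a b v v'] radau_coef_cong[of a b v v'] by simp

lemma moment_diff:
  "continuous_on {a..b} v \<Longrightarrow> continuous_on {a..b} w \<Longrightarrow>
    moment a b (\<lambda>x. v x - w x) m = moment a b v m - moment a b w m"
  unfolding moment_def by (simp add: left_diff_distrib integral_diff integrable_mult_poly right_diff_distrib)

lemma radau_coef_diff:
  "continuous_on {a..b} v \<Longrightarrow> continuous_on {a..b} w \<Longrightarrow>
    radau_coef k fl a b (\<lambda>x. v x - w x) = radau_coef k fl a b v - radau_coef k fl a b w"
  unfolding radau_coef_def by (simp add: moment_diff right_diff_distrib sum_subtractf)

lemma radau_proj_diff:
  assumes "continuous_on {a..b} v" "continuous_on {a..b} w"
  shows "radau_proj k fl a b (\<lambda>x. v x - w x) = radau_proj k fl a b v - radau_proj k fl a b w"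
  unfolding radau_proj_def radau_coef_diff[OF assms] moment_diff[OF assms]
  by (simp add: smult_diff_left sum_subtractf)

lemma sum_smult: "smult c (\<Sum>i\<in>S. f i) = (\<Sum>i\<in>S. smult c (f i))"
  by (induction S rule: infinite_finite_induct) (auto simp: smult_add_right)

lemma radau_proj_scale: "radau_proj k fl a b (\<lambda>x. c * v x) = smult c (radau_proj k fl a b v)"
proof -
  have m: "moment a b (\<lambda>x. c * v x) m = c * moment a b v m" for m
    by (simp add: moment_def mult.assoc)
  have "radau_coef k fl a b (\<lambda>x. c * v x) = c * radau_coef k fl a b v"
    unfolding radau_coef_def m by (simp add: right_diff_distrib sum_distrib_left mult_ac)
  then show ?thesis
    unfolding radau_proj_def m by (simp add: smult_diff_right sum_smult)
qed

lemma moment_poly: "moment a b (poly p) m = (2 * real m + 1) / (b - a) * pint a b (p * leg a b m)"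
  by (simp add: moment_def pint_eq)

lemma moment_expansion:
  assumes "a < b" "degree p \<le> n"
  shows "p = (\<Sum>m\<le>n. smult (moment a b (poly p) m) (leg a b m))"
  using leg_expansion[OF assms] by (simp add: moment_def pint_eq)

text \<open>A polynomial of degree at most \<open>k\<close> is its own truncated series, so nothing
  is missing at the end point.\<close>

lemma radau_coef_poly:
  assumes "a < b" "degree p \<le> k"
  shows "radau_coef k fl a b (poly p) = 0"
proof -
  have "poly p (end_pt fl a b) = (\<Sum>m\<le>k. moment a b (poly p) m * end_sign fl ^ m)"
    by (subst moment_expansion[OF assms]) (simp add: poly_sum leg_end_pt assms(1))
  then show ?thesis unfolding radau_coef_def
    by (simp add: power_add sum_distrib_left mult_ac)
qed

lemma radau_proj_poly:
  assumes "a < b" "degree p \<le> k"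
  shows "radau_proj k fl a b (poly p) = p"
  unfolding radau_proj_def radau_coef_poly[OF assms] using moment_expansion[OF assms] by simp

lemma degree_radau_proj: "a < b \<Longrightarrow> degree (radau_proj k fl a b v) \<le> k"
  unfolding radau_proj_def
  by (intro degree_diff_le degree_sum_le) (auto intro: order_trans[OF degree_smult_le])

lemma radau_proj_end_pt:
  assumes "a < b"
  shows "poly (radau_proj k fl a b v) (end_pt fl a b) = v (end_pt fl a b)"
proof -
  let ?s = "end_sign fl" and ?e = "end_pt fl a b"
  have "?s ^ (k + m) * x * ?s ^ k = x * ?s ^ m" for m x
    using end_sign_sq[of fl k] by (simp add: power_add mult_ac)
  moreover have "?s ^ k * v ?e * ?s ^ k = v ?e" using end_sign_sq[of fl k] by (simp add: mult_ac)
  ultimately have "radau_coef k fl a b v * ?s ^ k = (\<Sum>m\<le>k. moment a b v m * ?s ^ m) - v ?e"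
    unfolding radau_coef_def left_diff_distrib sum_distrib_right by (simp only:)
  then show ?thesis
    unfolding radau_proj_def by (simp add: poly_sum leg_end_pt assms)
qed

text \<open>Against test functions of full degree \<open>k\<close> the projection misses a multiple
  of \<open>leg a b k\<close>. This residual is what the corrections of the interpolants cancel; for
  degrees below \<open>k\<close> it vanishes.\<close>

lemma integral_radau_proj:
  assumes "a < b" and v: "continuous_on {a..b} v" and w: "degree w \<le> k"
  shows "integral {a..b} (\<lambda>x. v x * poly w x) =
    pint a b (radau_proj k fl a b v * w) + radau_coef k fl a b v * pint a b (leg a b k * w)"
proof -
  let ?S = "\<Sum>m\<le>k. smult (moment a b v m) (leg a b m)"
  have "integral {a..b} (\<lambda>x. v x * poly w x) = pint a b (?S * w)"
  proof -
    define c where "c m = (2 * real m + 1) / (b - a) * pint a b (w * leg a b m)" for m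
    have w_exp: "w = (\<Sum>m\<le>k. smult (c m) (leg a b m))" unfolding c_def by (rule leg_expansion[OF assms(1) w])
    have "integral {a..b} (\<lambda>x. v x * poly w x) = integral {a..b} (\<lambda>x. \<Sum>m\<le>k. c m * (v x * poly (leg a b m) x))"
      by (subst w_exp) (simp add: poly_sum sum_distrib_left mult_ac)
    also have "\<dots> = (\<Sum>m\<le>k. c m * integral {a..b} (\<lambda>x. v x * poly (leg a b m) x))"
      by (subst integral_sum) (auto intro!: integrable_on_mult_right integrable_mult_poly v)
    also have "\<dots> = (\<Sum>m\<le>k. moment a b v m * pint a b (leg a b m * w))"
    proof (intro sum.cong refl)
      fix m
      show "c m * integral {a..b} (\<lambda>x. v x * poly (leg a b m) x) = moment a b v m * pint a b (leg a b m * w)"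
        unfolding c_def moment_def by (simp add: mult.commute)
    qed
    also have "\<dots> = pint a b (?S * w)" by (simp add: sum_distrib_right pint_sum pint_smult)
    finally show ?thesis .
  qed
  then show ?thesis unfolding radau_proj_def by (simp add: left_diff_distrib pint_diff pint_smult)
qed

lemma orthogonal_imp_multiple:
  assumes "a < b" "degree p \<le> k" "\<And>w. degree w < k \<Longrightarrow> pint a b (p * w) = 0"
  obtains c where "p = smult c (leg a b k)"
proof -
  have "p = (\<Sum>m\<le>k. smult ((2 * real m + 1) / (b - a) * pint a b (p * leg a b m)) (leg a b m))" (is "p = (\<Sum>m\<le>k. ?f m)")
    by (rule leg_expansion[OF assms(1,2)])
  also have "\<dots> = (\<Sum>m\<in>{k}. ?f m)" using assms
    by (intro sum.mono_neutral_right) auto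
  finally show ?thesis using that by simp
qed

text \<open>Two candidates differ by a multiple of \<open>leg a b k\<close>, whose value at the end
  point is 1 or -1.\<close>

lemma radau_proj_unique:
  assumes "a < b" "1 \<le> k" and v: "continuous_on {a..b} v"
  shows "(THE p. degree p \<le> k \<and>
     (\<forall>w. degree w \<le> k - 1 \<longrightarrow> integral {a..b} (\<lambda>x. poly p x * poly w x) = integral {a..b} (\<lambda>x. v x * poly w x)) \<and>
     poly p (end_pt fl a b) = v (end_pt fl a b)) = radau_proj k fl a b v"
proof (rule the_equality)
  let ?P = "radau_proj k fl a b v"
  have P: "integral {a..b} (\<lambda>x. v x * poly w x) = pint a b (?P * w)" if "degree w \<le> k - 1" for w
    using integral_radau_proj[OF assms(1) v, of w k fl] leg_orthogonal[OF assms(1), of w k] that assms(2) by simp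
  then show "degree ?P \<le> k \<and>
     (\<forall>w. degree w \<le> k - 1 \<longrightarrow> integral {a..b} (\<lambda>x. poly ?P x * poly w x) = integral {a..b} (\<lambda>x. v x * poly w x)) \<and>
     poly ?P (end_pt fl a b) = v (end_pt fl a b)"
    using assms by (auto simp: degree_radau_proj radau_proj_end_pt pint_eq)
  fix p assume p: "degree p \<le> k \<and>
     (\<forall>w. degree w \<le> k - 1 \<longrightarrow> integral {a..b} (\<lambda>x. poly p x * poly w x) = integral {a..b} (\<lambda>x. v x * poly w x)) \<and>
     poly p (end_pt fl a b) = v (end_pt fl a b)"
  have deg: "degree (p - ?P) \<le> k" using p degree_radau_proj[OF assms(1)] by (intro degree_diff_le) auto
  have "pint a b ((p - ?P) * w) = 0" if "degree w < k" for w
  proof -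
    have "degree w \<le> k - 1" using that by simp
    then show ?thesis using p P[of w] by (simp add: left_diff_distrib pint_diff) (simp add: pint_eq)
  qed
  from orthogonal_imp_multiple[OF assms(1) deg this] obtain c where c: "p - ?P = smult c (leg a b k)" by blast
  have "poly (p - ?P) (end_pt fl a b) = 0" using p radau_proj_end_pt[OF assms(1)] by simp
  then have "c * end_sign fl ^ k = 0" unfolding c by (simp add: leg_end_pt assms(1))
  then have "c = 0" by (cases fl) auto
  with c show "p = ?P" by simp
qed

lemma proj_minus_eq:
  "X (j - 1) < X j \<Longrightarrow> 1 \<le> k \<Longrightarrow> continuous_on {X (j - 1)..X j} v \<Longrightarrow>
    proj_minus k X j v = radau_proj k FluxI (X (j - 1)) (X j) v"
  unfolding proj_minus_def cell_def using radau_proj_unique[of "X (j - 1)" "X j" k v FluxI] by simp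

lemma proj_plus_eq:
  "X (j - 1) < X j \<Longrightarrow> 1 \<le> k \<Longrightarrow> continuous_on {X (j - 1)..X j} v \<Longrightarrow>
    proj_plus k X j v = radau_proj k FluxII (X (j - 1)) (X j) v"
  unfolding proj_plus_def cell_def using radau_proj_unique[of "X (j - 1)" "X j" k v FluxII] by simp

lemma coeff_sum_eq:
  assumes "a < b" "continuous_on {a..b} v"
  shows "1 / (b - a) * integral {a..b} (\<lambda>x. v x * (\<Sum>m\<le>k. c m * (2 * real m + 1) * poly (leg a b m) x)) =
    (\<Sum>m\<le>k. c m * moment a b v m)"
proof -
  have "integral {a..b} (\<lambda>x. v x * (\<Sum>m\<le>k. c m * (2 * real m + 1) * poly (leg a b m) x)) =
      integral {a..b} (\<lambda>x. \<Sum>m\<le>k. (c m * (2 * real m + 1)) * (v x * poly (leg a b m) x))"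
    by (simp add: sum_distrib_left mult_ac)
  also have "\<dots> = (\<Sum>m\<le>k. (c m * (2 * real m + 1)) * integral {a..b} (\<lambda>x. v x * poly (leg a b m) x))"
    by (subst integral_sum) (auto intro!: integrable_on_mult_right integrable_mult_poly assms)
  finally show ?thesis by (simp add: moment_def sum_distrib_left mult_ac)
qed

lemma coeff_bar_eq:
  assumes "X (j - 1) < X j" "continuous_on {X (j - 1)..X j} v"
  shows "coeff_bar k X j v = radau_coef k FluxI (X (j - 1)) (X j) v"
  using coeff_sum_eq[OF assms, where k = k and c = "\<lambda>_. 1"]
  by (simp add: coeff_bar_def radau_coef_def cell_len_def cell_def cell_legendre_eq_leg)

lemma coeff_tilde_eq:
  assumes "X (j - 1) < X j" "continuous_on {X (j - 1)..X j} v"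
  shows "coeff_tilde k X j v = radau_coef k FluxII (X (j - 1)) (X j) v"
  using coeff_sum_eq[OF assms, where k = k and c = "\<lambda>m. (-1) ^ (k + m)"]
  by (simp add: coeff_tilde_def radau_coef_def cell_len_def cell_def cell_legendre_eq_leg)

section \<open>Primitives and the correction functions built from them\<close>

definition antiderivative :: "real poly \<Rightarrow> real poly" where
  "antiderivative p = (\<Sum>i\<le>degree p. monom (coeff p i / real (Suc i)) (Suc i))"

lemma pderiv_sum: "pderiv (\<Sum>i\<in>S. f i) = (\<Sum>i\<in>S. pderiv (f i))"
  by (induction S rule: infinite_finite_induct) (auto simp: pderiv_add)

lemma pderiv_antiderivative: "pderiv (antiderivative p) = p"
proof -
  have "pderiv (antiderivative p) = (\<Sum>i\<le>degree p. monom (coeff p i) i)"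
    unfolding antiderivative_def pderiv_sum by (intro sum.cong refl) (simp add: pderiv_monom del: of_nat_Suc)
  then show ?thesis by (simp add: poly_as_sum_of_monoms)
qed

text \<open>On its cell \<open>Ds_inv\<close> of a polynomial is a polynomial again; this is that
  polynomial.\<close>

definition scaled_primitive :: "real \<Rightarrow> real \<Rightarrow> real poly \<Rightarrow> real poly" where
  "scaled_primitive a b p = smult (2 / (b - a)) (antiderivative p - [:poly (antiderivative p) a:])"

lemma poly_scaled_primitive:
  assumes "a \<le> x"
  shows "poly (scaled_primitive a b p) x = 2 / (b - a) * pint a x p"
  using pint_pderiv[OF assms, of "antiderivative p"]
  by (simp add: scaled_primitive_def pderiv_antiderivative)

lemma Ds_inv_eq:
  "x \<in> {X (j - 1)..X j} \<Longrightarrow> Ds_inv X j p x = poly (scaled_primitive (X (j - 1)) (X j) p) x"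
  by (simp add: Ds_inv_def poly_scaled_primitive half_len_def cell_len_def pint_def)

text \<open>Mean zero makes the primitive vanish at \<open>b\<close> as well as at \<open>a\<close>,
  so no boundary terms appear. Thus \<open>Ds_inv\<close> trades one derivative of the test function
  for the factor 2 / (b - a).\<close>

lemma scaled_primitive_by_parts:
  assumes "a < b" "pint a b p = 0"
  shows "pint a b (scaled_primitive a b p * pderiv w) = - (2 / (b - a)) * pint a b (p * w)"
proof -
  have "pderiv (scaled_primitive a b p) = smult (2 / (b - a)) p"
    by (simp add: scaled_primitive_def pderiv_smult pderiv_diff pderiv_antiderivative pderiv_pCons)
  moreover have "poly (scaled_primitive a b p) b = 0" "poly (scaled_primitive a b p) a = 0"
    using assms by (simp_all add: poly_scaled_primitive pint_def)
  ultimately show ?thesis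
    using pint_by_parts[of a b "scaled_primitive a b p" w] assms(1) by (simp add: pint_smult)
qed

lemma scaled_primitive_bound:
  assumes "a < b" "x \<in> {a..b}" "\<And>y. y \<in> {a..b} \<Longrightarrow> \<bar>poly p y\<bar> \<le> A"
  shows "\<bar>poly (scaled_primitive a b p) x\<bar> \<le> 2 * A"
proof -
  have A: "0 \<le> A" using assms(1) assms(3)[of a] by simp
  have "norm (integral {a..x} (poly p)) \<le> A * (x - a)"
    using assms A by (intro integral_bound) (auto intro: continuous_on_poly continuous_on_id)
  then have "\<bar>pint a x p\<bar> \<le> A * (x - a)" using assms by (simp add: pint_def)
  also have "\<dots> \<le> A * (b - a)" using assms A by (intro mult_left_mono) auto
  finally have "2 / (b - a) * \<bar>pint a x p\<bar> \<le> 2 / (b - a) * (A * (b - a))" using assms(1)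
    by (intro mult_left_mono) auto
  then show ?thesis using assms by (simp add: poly_scaled_primitive abs_mult)
qed

definition radau_F :: "nat \<Rightarrow> flux \<Rightarrow> real \<Rightarrow> real \<Rightarrow> real poly" where
  "radau_F k fl a b = radau_proj k fl a b (poly (scaled_primitive a b (leg a b k)))"

definition radau_Fbar :: "nat \<Rightarrow> flux \<Rightarrow> real \<Rightarrow> real \<Rightarrow> real poly" where
  "radau_Fbar k fl a b = radau_proj k fl a b (poly (scaled_primitive a b (radau_F k (opp fl) a b)))"

text \<open>\<open>pderiv w\<close> has degree below \<open>k\<close>, so projecting leaves its
  pairing with the primitive unchanged, and the primitive is zero at both ends. Corrections built
  this way do not change the numerical traces.\<close>

lemma proj_scaled_primitive:
  fixes fl :: flux
  assumes "a < b" "1 \<le> k" "pint a b p = 0"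
  defines "F \<equiv> radau_proj k fl a b (poly (scaled_primitive a b p))"
  shows "degree F \<le> k" "poly F (end_pt fl a b) = 0"
    and "degree w \<le> k \<Longrightarrow> pint a b (F * pderiv w) = - (2 / (b - a)) * pint a b (p * w)"
proof -
  let ?V = "scaled_primitive a b p"
  show "degree F \<le> k" unfolding F_def by (rule degree_radau_proj[OF assms(1)])
  have "poly ?V b = 0" "poly ?V a = 0" using assms by (simp_all add: poly_scaled_primitive pint_def)
  then show "poly F (end_pt fl a b) = 0" unfolding F_def radau_proj_end_pt[OF assms(1)] by (cases fl) auto
  assume w: "degree w \<le> k"
  then have dw: "degree (pderiv w) < k" using assms(2) by (simp add: degree_pderiv)
  have "pint a b (F * pderiv w) = integral {a..b} (\<lambda>x. poly ?V x * poly (pderiv w) x)"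
    using integral_radau_proj[OF assms(1), of "poly ?V" "pderiv w" k fl] leg_orthogonal[OF assms(1) dw] dw
    unfolding F_def by (simp add: continuous_on_poly)
  also have "\<dots> = pint a b (?V * pderiv w)" by (simp add: pint_eq)
  finally show "pint a b (F * pderiv w) = - (2 / (b - a)) * pint a b (p * w)"
    using scaled_primitive_by_parts[OF assms(1,3)] by simp
qed

text \<open>Here \<open>2 \<le> k\<close> enters: tested with w = x, the mean of
  \<open>radau_F\<close> is a multiple of the pairing of \<open>leg a b k\<close> with a linear
  function. Mean zero is what allows a second primitive.\<close>

lemma radau_F_mean_zero:
  assumes "a < b" "2 \<le> k"
  shows "pint a b (leg a b k) = 0" "pint a b (radau_F k fl a b) = 0"
proof -
  show 0: "pint a b (leg a b k) = 0" using leg_orthogonal[OF assms(1), of 1 k] assms(2) by simp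
  have "pint a b (radau_F k fl a b * pderiv [:0, 1:]) = - (2 / (b - a)) * pint a b (leg a b k * [:0, 1:])"
    unfolding radau_F_def by (rule proj_scaled_primitive(3)) (use assms 0 in auto)
  also have "\<dots> = 0" using leg_orthogonal[OF assms(1), of "[:0, 1:]" k] assms(2) by (simp del: mult_pCons_right)
  finally show "pint a b (radau_F k fl a b) = 0" by (simp add: pderiv_pCons)
qed

lemma radau_F_props:
  assumes "a < b" "2 \<le> k"
  shows "degree (radau_F k fl a b) \<le> k" "poly (radau_F k fl a b) (end_pt fl a b) = 0"
    and "degree w \<le> k \<Longrightarrow> pint a b (radau_F k fl a b * pderiv w) = - (2 / (b - a)) * pint a b (leg a b k * w)"
  using proj_scaled_primitive(1,2)[where a = a and b = b and k = k and p = "leg a b k" and fl = fl]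
    proj_scaled_primitive(3)[where a = a and b = b and k = k and p = "leg a b k" and fl = fl and w = w]
    radau_F_mean_zero[OF assms] assms
  unfolding radau_F_def by auto

lemma radau_Fbar_props:
  assumes "a < b" "2 \<le> k"
  shows "degree (radau_Fbar k fl a b) \<le> k" "poly (radau_Fbar k fl a b) (end_pt fl a b) = 0"
    and "degree w \<le> k \<Longrightarrow>
      pint a b (radau_Fbar k fl a b * pderiv w) = - (2 / (b - a)) * pint a b (radau_F k (opp fl) a b * w)"
  using proj_scaled_primitive(1,2)[where a = a and b = b and k = k and p = "radau_F k (opp fl) a b" and fl = fl]
    proj_scaled_primitive(3)[where a = a and b = b and k = k and p = "radau_F k (opp fl) a b" and fl = fl and w = w]
    radau_F_mean_zero[OF assms] assms
  unfolding radau_Fbar_def by auto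

text \<open>The flux names the side of the outermost projection, hence the crossed indices:
  \<open>F11\<close> projects with \<open>proj_plus\<close>, but \<open>F11_bar\<close> with
  \<open>proj_minus\<close>.\<close>

lemma F_defs_eq:
  assumes "X (j - 1) < X j" "2 \<le> k"
  shows "F11 k X j = radau_F k FluxII (X (j - 1)) (X j)"
    and "F21 k X j = radau_F k FluxI (X (j - 1)) (X j)"
    and "F11_bar k X j = radau_Fbar k FluxI (X (j - 1)) (X j)"
    and "F21_bar k X j = radau_Fbar k FluxII (X (j - 1)) (X j)"
proof -
  let ?a = "X (j - 1)" and ?b = "X j"
  have cong: "radau_proj k fl ?a ?b (Ds_inv X j p) = radau_proj k fl ?a ?b (poly (scaled_primitive ?a ?b p))" for fl p
    by (rule radau_proj_cong[OF assms(1)]) (rule Ds_inv_eq)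
  have cont: "continuous_on {?a..?b} (Ds_inv X j p)" for p
    using continuous_on_cong[of "{?a..?b}" "{?a..?b}" "Ds_inv X j p" "poly (scaled_primitive ?a ?b p)"]
    by (simp add: Ds_inv_eq continuous_on_poly)
  have k: "1 \<le> k" using assms(2) by simp
  show 1: "F11 k X j = radau_F k FluxII ?a ?b"
    unfolding F11_def proj_plus_eq[OF assms(1) k cont] cong cell_legendre_eq_leg radau_F_def ..
  show 2: "F21 k X j = radau_F k FluxI ?a ?b"
    unfolding F21_def proj_minus_eq[OF assms(1) k cont] cong cell_legendre_eq_leg radau_F_def ..
  show "F11_bar k X j = radau_Fbar k FluxI ?a ?b"
    unfolding F11_bar_def proj_minus_eq[OF assms(1) k cont] cong 1 radau_Fbar_def by simp
  show "F21_bar k X j = radau_Fbar k FluxII ?a ?b"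
    unfolding F21_bar_def proj_plus_eq[OF assms(1) k cont] cong 2 radau_Fbar_def by simp
qed

section \<open>Bounds uniform in the interval\<close>

lemma moment_bound:
  assumes "a < b" "continuous_on {a..b} v" "\<And>x. x \<in> {a..b} \<Longrightarrow> \<bar>v x\<bar> \<le> A"
    and "\<And>x. x \<in> {a..b} \<Longrightarrow> \<bar>poly (leg a b m) x\<bar> \<le> L"
  shows "\<bar>moment a b v m\<bar> \<le> (2 * real m + 1) * (A * L)"
proof -
  have A: "0 \<le> A" "0 \<le> L" using assms(1) assms(3,4)[of a] by auto
  have "norm (integral {a..b} (\<lambda>x. v x * poly (leg a b m) x)) \<le> (A * L) * (b - a)"
    using assms A by (intro integral_bound) (auto simp: abs_mult intro!: mult_mono continuous_intros)
  then have "\<bar>integral {a..b} (\<lambda>x. v x * poly (leg a b m) x)\<bar> \<le> (A * L) * (b - a)" by simp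
  then have "(2 * real m + 1) / (b - a) * \<bar>integral {a..b} (\<lambda>x. v x * poly (leg a b m) x)\<bar>
      \<le> (2 * real m + 1) / (b - a) * ((A * L) * (b - a))"
    using assms(1) by (intro mult_left_mono) auto
  then show ?thesis using assms(1) by (simp add: moment_def abs_mult)
qed

text \<open>The mean in \<open>moment\<close> cancels the length of the interval, so values are
  controlled by a constant of \<open>k\<close> only; a derivative costs one factor 1 / (b -
  a).\<close>

lemma radau_stability:
  obtains C where "C \<ge> 1"
    "\<And>a b v A fl. a < b \<Longrightarrow> continuous_on {a..b} v \<Longrightarrow> (\<And>x. x \<in> {a..b} \<Longrightarrow> \<bar>v x\<bar> \<le> A) \<Longrightarrow>
      \<bar>radau_coef k fl a b v\<bar> \<le> C * A"
    "\<And>a b v A fl x. a < b \<Longrightarrow> continuous_on {a..b} v \<Longrightarrow> (\<And>x. x \<in> {a..b} \<Longrightarrow> \<bar>v x\<bar> \<le> A) \<Longrightarrow>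
      x \<in> {a..b} \<Longrightarrow> \<bar>poly (radau_proj k fl a b v) x\<bar> \<le> C * A"
    "\<And>a b v A fl x. a < b \<Longrightarrow> continuous_on {a..b} v \<Longrightarrow> (\<And>x. x \<in> {a..b} \<Longrightarrow> \<bar>v x\<bar> \<le> A) \<Longrightarrow>
      x \<in> {a..b} \<Longrightarrow> \<bar>poly (pderiv (radau_proj k fl a b v)) x\<bar> \<le> C * A / (b - a)"
proof -
  obtain L where L: "L \<ge> 1"
    "\<And>a b m x. a < b \<Longrightarrow> m \<le> k \<Longrightarrow> x \<in> {a..b} \<Longrightarrow> \<bar>poly (leg a b m) x\<bar> \<le> L"
    "\<And>a b m x. a < b \<Longrightarrow> m \<le> k \<Longrightarrow> x \<in> {a..b} \<Longrightarrow> \<bar>poly (pderiv (leg a b m)) x\<bar> \<le> 2 * L / (b - a)"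
    using leg_bounded[of k] by metis
  define S where "S = (\<Sum>m\<le>k. (2 * real m + 1) * L)"
  have S0: "S \<ge> 0" unfolding S_def using L(1) by (intro sum_nonneg) auto
  \<comment> \<open>\<open>S + 1\<close> bounds the coefficient, \<open>(2 * S + 1) * L\<close> the
    projection, and the extra 2 comes from the derivative of \<open>leg\<close>.\<close>
  define C where "C = 2 * ((2 * S + 1) * L)"
  have CS: "S + 1 \<le> C" "(2 * S + 1) * L \<le> C" "1 \<le> C"
  proof -
    have "(2 * S + 1) * 1 \<le> (2 * S + 1) * L" using S0 L(1) by (intro mult_left_mono) auto
    then have X: "2 * S + 1 \<le> (2 * S + 1) * L" by simp
    then show "S + 1 \<le> C" unfolding C_def using S0 by linarith
    show "(2 * S + 1) * L \<le> C" unfolding C_def using X S0 by linarith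
    show "1 \<le> C" unfolding C_def using X S0 by linarith
  qed
  show ?thesis
  proof (rule that[of C])
    show "C \<ge> 1" by (rule CS)
    fix a b A :: real and v :: "real \<Rightarrow> real" and fl
    assume ab: "a < b" and v: "continuous_on {a..b} v" and bnd: "\<And>x. x \<in> {a..b} \<Longrightarrow> \<bar>v x\<bar> \<le> A"
    have A: "0 \<le> A" using ab bnd[of a] by auto
    have mom: "\<bar>moment a b v m\<bar> \<le> (2 * real m + 1) * (A * L)" if "m \<le> k" for m
      using moment_bound[OF ab v bnd] L(2)[OF ab that] by blast
    have abs_sign: "\<bar>end_sign fl ^ n\<bar> = 1" for n by (cases fl) auto
    have sum_mom: "(\<Sum>m\<le>k. \<bar>moment a b v m\<bar>) \<le> S * A"
    proof -
      have "(\<Sum>m\<le>k. \<bar>moment a b v m\<bar>) \<le> (\<Sum>m\<le>k. (2 * real m + 1) * (A * L))" by (intro sum_mono mom) auto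
      also have "\<dots> = S * A" unfolding S_def sum_distrib_right by (intro sum.cong refl) simp
      finally show ?thesis .
    qed
    have coef: "\<bar>radau_coef k fl a b v\<bar> \<le> (S + 1) * A"
    proof -
      have "\<bar>radau_coef k fl a b v\<bar> \<le> \<bar>\<Sum>m\<le>k. end_sign fl ^ (k + m) * moment a b v m\<bar> + \<bar>end_sign fl ^ k * v (end_pt fl a b)\<bar>"
        unfolding radau_coef_def by (rule abs_triangle_ineq4)
      also have "\<bar>\<Sum>m\<le>k. end_sign fl ^ (k + m) * moment a b v m\<bar> \<le> (\<Sum>m\<le>k. \<bar>moment a b v m\<bar>)"
        by (rule order_trans[OF sum_abs]) (simp add: abs_mult abs_sign)
      also have "\<dots> \<le> S * A" by (rule sum_mom)
      also have "\<bar>end_sign fl ^ k * v (end_pt fl a b)\<bar> \<le> A" using bnd[OF end_pt_in[OF ab]] by (simp add: abs_mult abs_sign)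
      finally show ?thesis by (simp add: algebra_simps)
    qed
    also have "\<dots> \<le> C * A" using CS A by (intro mult_right_mono) auto
    finally show "\<bar>radau_coef k fl a b v\<bar> \<le> C * A" .
    have combine: "\<bar>(\<Sum>m\<le>k. moment a b v m * f m) - radau_coef k fl a b v * f k\<bar> \<le> (2 * S + 1) * A * B"
      if f: "\<And>m. m \<le> k \<Longrightarrow> \<bar>f m\<bar> \<le> B" for f B
    proof -
      have B: "0 \<le> B" using f[of 0] by auto
      have "\<bar>(\<Sum>m\<le>k. moment a b v m * f m) - radau_coef k fl a b v * f k\<bar>
          \<le> \<bar>\<Sum>m\<le>k. moment a b v m * f m\<bar> + \<bar>radau_coef k fl a b v * f k\<bar>" by (rule abs_triangle_ineq4)
      also have "\<bar>\<Sum>m\<le>k. moment a b v m * f m\<bar> \<le> (\<Sum>m\<le>k. \<bar>moment a b v m\<bar> * B)"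
        by (rule order_trans[OF sum_abs]) (auto simp: abs_mult intro!: sum_mono mult_left_mono f)
      also have "\<dots> \<le> S * A * B" unfolding sum_distrib_right[symmetric] using sum_mom B by (intro mult_right_mono)
      also have "\<bar>radau_coef k fl a b v * f k\<bar> \<le> (S + 1) * A * B"
        unfolding abs_mult using coef f[of k] A S0 by (intro mult_mono) auto
      finally show ?thesis by (simp add: algebra_simps)
    qed
    fix x assume x: "x \<in> {a..b}"
    have "\<bar>poly (radau_proj k fl a b v) x\<bar> \<le> (2 * S + 1) * A * L"
      using combine[of "\<lambda>m. poly (leg a b m) x" L] L(2)[OF ab _ x] by (simp add: radau_proj_def poly_sum)
    also have "\<dots> \<le> C * A" using mult_right_mono[OF CS(2) A] by (simp add: mult_ac)
    finally show "\<bar>poly (radau_proj k fl a b v) x\<bar> \<le> C * A" .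
    have "\<bar>poly (pderiv (radau_proj k fl a b v)) x\<bar> \<le> (2 * S + 1) * A * (2 * L / (b - a))"
      using combine[of "\<lambda>m. poly (pderiv (leg a b m)) x" "2 * L / (b - a)"] L(3)[OF ab _ x]
      by (simp add: radau_proj_def poly_sum pderiv_sum pderiv_smult pderiv_diff)
    also have "\<dots> = C * A / (b - a)" by (simp add: C_def)
    finally show "\<bar>poly (pderiv (radau_proj k fl a b v)) x\<bar> \<le> C * A / (b - a)" .
  qed
qed

lemma radau_F_bounded:
  obtains C where "C \<ge> 1"
    "\<And>a b fl x. a < b \<Longrightarrow> x \<in> {a..b} \<Longrightarrow> \<bar>poly (radau_F k fl a b) x\<bar> \<le> C \<and> \<bar>poly (radau_Fbar k fl a b) x\<bar> \<le> C"
    "\<And>a b fl x. a < b \<Longrightarrow> x \<in> {a..b} \<Longrightarrow>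
      \<bar>poly (pderiv (radau_F k fl a b)) x\<bar> \<le> C / (b - a) \<and> \<bar>poly (pderiv (radau_Fbar k fl a b)) x\<bar> \<le> C / (b - a)"
proof -
  obtain C where C: "C \<ge> 1"
    "\<And>a b v A fl x. a < b \<Longrightarrow> continuous_on {a..b} v \<Longrightarrow> (\<And>x. x \<in> {a..b} \<Longrightarrow> \<bar>v x\<bar> \<le> A) \<Longrightarrow>
      x \<in> {a..b} \<Longrightarrow> \<bar>poly (radau_proj k fl a b v) x\<bar> \<le> C * A"
    "\<And>a b v A fl x. a < b \<Longrightarrow> continuous_on {a..b} v \<Longrightarrow> (\<And>x. x \<in> {a..b} \<Longrightarrow> \<bar>v x\<bar> \<le> A) \<Longrightarrow>
      x \<in> {a..b} \<Longrightarrow> \<bar>poly (pderiv (radau_proj k fl a b v)) x\<bar> \<le> C * A / (b - a)"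
    using radau_stability[of k] by metis
  obtain L where L: "L \<ge> 1"
    "\<And>a b m x. a < b \<Longrightarrow> m \<le> k \<Longrightarrow> x \<in> {a..b} \<Longrightarrow> \<bar>poly (leg a b m) x\<bar> \<le> L"
    using leg_bounded[of k] by metis
  \<comment> \<open>Each primitive contributes a factor 2 and each projection a factor
    \<open>C\<close>, starting from the bound \<open>L\<close> of \<open>leg\<close>.\<close>
  define K where "K = C * (2 * (C * (2 * L)))"
  have CL: "1 * (2 * 1) \<le> C * (2 * L)" using C(1) L(1) by (intro mult_mono) auto
  have "1 * (2 * L) \<le> C * (2 * L)" using C(1) L(1) by (intro mult_right_mono) auto
  then have "2 * L \<le> 2 * (C * (2 * L))" using L(1) by linarith
  then have K1: "C * (2 * L) \<le> K" unfolding K_def using C(1) by (intro mult_left_mono) auto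
  show ?thesis
  proof (rule that[of K])
    show "K \<ge> 1" using CL K1 by linarith
    fix a b x :: real and fl assume ab: "a < b" and x: "x \<in> {a..b}"
    have V: "\<bar>poly (scaled_primitive a b (leg a b k)) y\<bar> \<le> 2 * L" if "y \<in> {a..b}" for y
      using scaled_primitive_bound[OF ab that] L(2)[OF ab] by blast
    have F: "\<bar>poly (radau_F k fl a b) y\<bar> \<le> C * (2 * L)" if "y \<in> {a..b}" for y fl
      unfolding radau_F_def using C(2)[OF ab _ V that] by (simp add: continuous_on_poly)
    have V2: "\<bar>poly (scaled_primitive a b (radau_F k (opp fl) a b)) y\<bar> \<le> 2 * (C * (2 * L))" if "y \<in> {a..b}" for y
      using scaled_primitive_bound[OF ab that] F by blast
    have "\<bar>poly (radau_Fbar k fl a b) x\<bar> \<le> K"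
      unfolding radau_Fbar_def K_def using C(2)[OF ab _ V2 x] by (simp add: continuous_on_poly)
    then show "\<bar>poly (radau_F k fl a b) x\<bar> \<le> K \<and> \<bar>poly (radau_Fbar k fl a b) x\<bar> \<le> K"
      using F[OF x, of fl] K1 by linarith
    have "\<bar>poly (pderiv (radau_F k fl a b)) x\<bar> \<le> C * (2 * L) / (b - a)"
      unfolding radau_F_def using C(3)[OF ab _ V x] by (simp add: continuous_on_poly)
    also have "\<dots> \<le> K / (b - a)" using K1 ab by (intro divide_right_mono) auto
    finally have "\<bar>poly (pderiv (radau_F k fl a b)) x\<bar> \<le> K / (b - a)" .
    moreover have "\<bar>poly (pderiv (radau_Fbar k fl a b)) x\<bar> \<le> K / (b - a)"
      unfolding radau_Fbar_def K_def using C(3)[OF ab _ V2 x] by (simp add: continuous_on_poly)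
    ultimately show "\<bar>poly (pderiv (radau_F k fl a b)) x\<bar> \<le> K / (b - a) \<and>
        \<bar>poly (pderiv (radau_Fbar k fl a b)) x\<bar> \<le> K / (b - a)" by blast
  qed
qed

text \<open>Indexed by the flux of the projection whose derivative superconverges there:
  \<open>FluxI\<close> gives the left Radau points, \<open>FluxII\<close> the right ones. The
  excluded end is the one opposite to the collocation point.\<close>

definition radau_zero :: "nat \<Rightarrow> flux \<Rightarrow> real \<Rightarrow> real \<Rightarrow> real \<Rightarrow> bool" where
  "radau_zero k fl a b x \<longleftrightarrow>
    poly (leg a b (k + 1) + smult (end_sign fl) (leg a b k)) x = 0 \<and> x \<noteq> end_pt (opp fl) a b"

lemma radau_zero_in_interval:
  assumes "a < b" "radau_zero k fl a b x"
  shows "x \<in> {a..b}"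
proof -
  define s where "s = (2 * x - (a + b)) / (b - a)"
  have "poly (legendre (k + 1)) s + end_sign fl * poly (legendre k) s = 0"
    using assms(2) unfolding radau_zero_def by (simp add: poly_leg s_def)
  then have "poly (legendre (k + 1) + legendre k) s = 0 \<or> poly (legendre (k + 1) - legendre k) s = 0"
    by (cases fl) auto
  from legendre_sum_zero_in_interval[OF this] show ?thesis
    using assms(1) by (auto simp: s_def field_simps)
qed

text \<open>The Radau identity on the reference interval; its factor 1 + s or 1 - s is nonzero
  because the opposite end is excluded.\<close>

lemma radau_zero_pderiv:
  assumes "a < b" "radau_zero k fl a b x"
  shows "poly (pderiv (leg a b (k + 1) - smult (end_sign fl) (leg a b k))) x = 0"
proof -
  define s where "s = (2 * x - (a + b)) / (b - a)"
  have z: "poly (legendre (k + 1)) s + end_sign fl * poly (legendre k) s = 0"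
    using assms(2) unfolding radau_zero_def by (simp add: poly_leg s_def)
  have "poly (pderiv (legendre (k + 1))) s - end_sign fl * poly (pderiv (legendre k)) s = 0"
  proof (cases fl)
    case FluxI
    have "s \<noteq> -1" using assms FluxI unfolding radau_zero_def s_def by (auto simp: field_simps)
    moreover have "(1 + s) * poly (pderiv (legendre (k + 1) - legendre k)) s =
        real (k + 1) * (poly (legendre (k + 1)) s + poly (legendre k) s)"
      using arg_cong[OF radau_identity[of k], of "\<lambda>p. poly p s"] by (simp add: algebra_simps)
    then have "(1 + s) * poly (pderiv (legendre (k + 1) - legendre k)) s = 0" using z FluxI by simp
    ultimately show ?thesis using FluxI by (simp add: pderiv_diff)
  next
    case FluxII
    have "s \<noteq> 1" using assms FluxII unfolding radau_zero_def s_def by (auto simp: field_simps)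
    moreover have "(1 - s) * poly (pderiv (legendre (k + 1) + legendre k)) s =
        real (k + 1) * (poly (legendre k) s - poly (legendre (k + 1)) s)"
      using arg_cong[OF radau_identity'[of k], of "\<lambda>p. poly p s"] by (simp add: algebra_simps)
    then have "(1 - s) * poly (pderiv (legendre (k + 1) + legendre k)) s = 0" using z FluxII by simp
    ultimately show ?thesis using FluxII by (simp add: pderiv_add)
  qed
  then show ?thesis
    by (simp add: pderiv_diff pderiv_smult poly_pderiv_leg s_def[symmetric] flip: left_diff_distrib mult.assoc)
qed

text \<open>The Radau polynomial has mean zero, hence an interior root. This makes the maxima in the
  theorem range over a nonempty set.\<close>

lemma radau_zero_exists:
  assumes "a < b" "1 \<le> k"
  obtains x where "radau_zero k fl a b x"
proof -
  have "pint a b (leg a b (k + 1) + smult (end_sign fl) (leg a b k)) = 0"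
    using leg_orthogonal[OF assms(1), of 1] assms(2) by (simp add: pint_add pint_smult)
  from pint_zero_imp_root[OF assms(1) this] obtain x
    where "a < x" "x < b" "poly (leg a b (k + 1) + smult (end_sign fl) (leg a b k)) x = 0" by blast
  then show ?thesis using that[of x] unfolding radau_zero_def by (cases fl) auto
qed

lemma radau_points_eq:
  "left_radau_points k X j = {x. radau_zero k FluxI (X (j - 1)) (X j) x}"
  "right_radau_points k X j = {x. radau_zero k FluxII (X (j - 1)) (X j) x}"
  unfolding left_radau_points_def right_radau_points_def radau_zero_def cell_legendre_eq_leg by simp_all

lemma finite_radau_zeros:
  assumes "a < b"
  shows "finite {x. radau_zero k fl a b x}"
proof (rule finite_subset)
  let ?p = "leg a b (k + 1) + smult (end_sign fl) (leg a b k)"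
  have "degree ?p = k + 1" using assms
    by (subst degree_add_eq_left) (auto intro: le_less_trans[OF degree_smult_le])
  then have "?p \<noteq> 0" by (metis degree_0 add_is_0 zero_neq_one)
  then show "finite {x. poly ?p x = 0}" by (rule poly_roots_finite)
qed (auto simp: radau_zero_def)

text \<open>The polynomial \<open>leg a b (k + 1) - smult (end_sign fl) (leg a b k)\<close> is
  projected to zero. So the projection error of a polynomial of degree \<open>k + 1\<close> is
  exactly a multiple of it, and its derivative vanishes at these points.\<close>

lemma radau_proj_superconvergence:
  assumes "a < b" "1 \<le> k" "degree p \<le> k + 1" "radau_zero k fl a b x"
  shows "poly (pderiv (radau_proj k fl a b (poly p))) x = poly (pderiv p) x"
proof -
  obtain c r where p: "p = smult c (leg a b (k + 1)) + r" "degree r \<le> k"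
  proof -
    define c where "c = coeff p (k + 1) / lead_coeff (leg a b (k + 1))"
    define r where "r = p - smult c (leg a b (k + 1))"
    have lc: "coeff (leg a b (k + 1)) (k + 1) \<noteq> 0"
      using degree_leg[OF assms(1), of "k + 1"] by (metis leading_coeff_0_iff degree_0 add_is_0 zero_neq_one)
    have "degree r \<le> k + 1" unfolding r_def using assms
      by (intro degree_diff_le) (auto intro: order_trans[OF degree_smult_le])
    moreover have "coeff r (k + 1) = 0" unfolding r_def c_def using lc assms(1) by simp
    ultimately have "degree r \<le> k"
      by (metis Suc_eq_plus1 leading_coeff_0_iff degree_0 le_SucE zero_le)
    then show ?thesis using that[of c r] unfolding r_def by simp
  qed
  let ?G = "leg a b (k + 1) - smult (end_sign fl) (leg a b k)"
  let ?q = "p - smult c ?G"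
  have "radau_proj k fl a b (poly ?G) = 0"
  proof -
    have m: "moment a b (poly ?G) m = (if m = k then - end_sign fl else 0)" if "m \<le> k" for m
    proof -
      have "moment a b (poly ?G) m = (2 * real m + 1) / (b - a) *
          (pint a b (leg a b (k + 1) * leg a b m) - end_sign fl * pint a b (leg a b k * leg a b m))"
        unfolding moment_poly by (simp add: left_diff_distrib pint_diff pint_smult)
      also have "\<dots> = (if m = k then - end_sign fl else 0)"
        unfolding leg_orthonormal[OF assms(1)] using that assms(1) by (auto simp: divide_simps)
      finally show ?thesis .
    qed
    have sum_k: "(\<Sum>m\<le>k. f m (if m = k then - end_sign fl else 0)) = f k (- end_sign fl)"
      if "\<And>m. f m 0 = 0" for f :: "nat \<Rightarrow> real \<Rightarrow> 'a::comm_monoid_add"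
      using that by (subst sum.remove[of _ k]) (auto intro!: sum.neutral)
    have "radau_coef k fl a b (poly ?G) = - end_sign fl"
    proof -
      have "poly ?G (end_pt fl a b) = 0" using assms(1) by (simp add: leg_end_pt)
      moreover have "(\<Sum>m\<le>k. end_sign fl ^ (k + m) * moment a b (poly ?G) m) = - end_sign fl"
        using sum_k[of "\<lambda>m y. end_sign fl ^ (k + m) * y"] m end_sign_sq[of fl k] by (simp add: power_add)
      ultimately show ?thesis unfolding radau_coef_def by simp
    qed
    moreover have "(\<Sum>m\<le>k. smult (moment a b (poly ?G) m) (leg a b m)) = smult (- end_sign fl) (leg a b k)"
      using sum_k[of "\<lambda>m y. smult y (leg a b m)"] m by simp
    ultimately show ?thesis unfolding radau_proj_def by simp
  qed
  moreover have "poly (smult c ?G) = (\<lambda>x. c * poly ?G x)" by auto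
  ultimately have G: "radau_proj k fl a b (poly (smult c ?G)) = 0"
    by (simp only: radau_proj_scale) simp
  have deg: "degree ?q \<le> k"
  proof -
    have "?q = r + smult (c * end_sign fl) (leg a b k)" unfolding p by (simp add: smult_diff_right)
    then show ?thesis using p(2) assms(1)
      by (simp only:) (intro degree_add_le order_trans[OF degree_smult_le], auto)
  qed
  have "poly ?q = (\<lambda>x. poly p x - poly (smult c ?G) x)" by auto
  then have "?q = radau_proj k fl a b (poly p) - radau_proj k fl a b (poly (smult c ?G))"
    using radau_proj_poly[OF assms(1) deg, of fl]
      radau_proj_diff[of a b "poly p" "poly (smult c ?G)" k fl] by (simp only: continuous_on_poly continuous_on_id)
  then have "radau_proj k fl a b (poly p) = p - smult c ?G" using G by simp
  then show ?thesis using radau_zero_pderiv[OF assms(1,4)] by (simp only: pderiv_diff[of p] pderiv_smult poly_diff[of "pderiv p"] poly_smult)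
qed

section \<open>Test functions\<close>

lemma power_le_fact_mult_exp: "0 \<le> y \<Longrightarrow> y ^ n \<le> fact n * exp (y::real)"
proof (induction n arbitrary: y)
  case (Suc n)
  let ?f = "\<lambda>y::real. fact (Suc n) * exp y - y ^ Suc n"
  have "?f 0 \<le> ?f y"
  proof (rule DERIV_nonneg_imp_nondecreasing[OF Suc.prems])
    fix x :: real assume x: "0 \<le> x" "x \<le> y"
    have "(?f has_real_derivative fact (Suc n) * exp x - real (Suc n) * x ^ n) (at x)"
      by (rule derivative_eq_intros refl | simp)+
    moreover have "real (Suc n) * x ^ n \<le> real (Suc n) * (fact n * exp x)"
      using Suc.IH[OF x(1)] by (intro mult_left_mono) auto
    ultimately show "\<exists>d. (?f has_real_derivative d) (at x) \<and> 0 \<le> d"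
      by (intro exI conjI) (assumption, simp add: algebra_simps)
  qed
  moreover have "0 \<le> ?f 0" by (simp del: fact_Suc)
  ultimately have "0 \<le> ?f y" by (rule order_trans[rotated])
  then show ?case by simp
qed simp

text \<open>A family closed under differentiation up to a change of \<open>m\<close> and
  \<open>P\<close>, so that one flatness estimate serves all derivatives.
  \<open>bump a b 0 1\<close> is the usual nonnegative bump.\<close>

definition bump :: "real \<Rightarrow> real \<Rightarrow> nat \<Rightarrow> real poly \<Rightarrow> real \<Rightarrow> real" where
  "bump a b m P x = (if a < x \<and> x < b then
     poly P x * inverse ((x - a) * (b - x)) ^ m * exp (- inverse ((x - a) * (b - x))) else 0)"

text \<open>The flatness estimate behind smoothness at the end points.\<close>

lemma bump_flat:
  assumes "a < b"
  obtains K where "\<And>x. \<bar>bump a b m P x\<bar> \<le> K * (x - a)\<^sup>2" "\<And>x. \<bar>bump a b m P x\<bar> \<le> K * (x - b)\<^sup>2"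
proof -
  have "compact ((\<lambda>s. poly P s) ` {a..b})" by (intro compact_continuous_image continuous_intros) auto
  then obtain B where B: "\<And>s. s \<in> {a..b} \<Longrightarrow> \<bar>poly P s\<bar> \<le> B"
    using compact_imp_bounded[THEN bounded_iff[THEN iffD1]] by (metis image_eqI real_norm_def)
  have B0: "0 \<le> B" using B[of a] assms by auto
  have key: "\<bar>bump a b m P x\<bar> \<le> B * fact (m + 2) * ((x - a) * (b - x))\<^sup>2" if x: "a < x" "x < b" for x
  proof -
    let ?r = "(x - a) * (b - x)"
    let ?R = "inverse ?r"
    have r: "?r > 0" using x by simp
    have "?R ^ (m + 2) * exp (- ?R) \<le> fact (m + 2) * exp ?R * exp (- ?R)"
      using r by (intro mult_right_mono power_le_fact_mult_exp less_imp_le[OF positive_imp_inverse_positive]) auto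
    also have "\<dots> = fact (m + 2)" by (simp add: mult.assoc exp_add[symmetric])
    finally have "?R ^ (m + 2) * exp (- ?R) * ?r\<^sup>2 \<le> fact (m + 2) * ?r\<^sup>2"
      by (rule mult_right_mono) simp
    then have "?R ^ m * exp (- ?R) * (?R\<^sup>2 * ?r\<^sup>2) \<le> fact (m + 2) * ?r\<^sup>2"
      by (simp only: power_add mult_ac)
    moreover have "?r \<noteq> 0" using r by (metis less_irrefl)
    then have "?R * ?r = 1" by (rule left_inverse)
    then have "?R\<^sup>2 * ?r\<^sup>2 = 1" by (simp only: power_mult_distrib[symmetric] power_one)
    ultimately have e: "?R ^ m * exp (- ?R) \<le> fact (m + 2) * ?r\<^sup>2" by simp
    have "\<bar>bump a b m P x\<bar> = \<bar>poly P x\<bar> * (?R ^ m * exp (- ?R))"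
      using x r by (simp add: bump_def abs_mult power_abs)
    also have "\<dots> \<le> B * (fact (m + 2) * ?r\<^sup>2)" using B[of x] x r B0 by (intro mult_mono e) auto
    finally show ?thesis by simp
  qed
  define K where "K = B * fact (m + 2) * (b - a)\<^sup>2"
  show ?thesis
  proof (rule that)
    fix x
    show "\<bar>bump a b m P x\<bar> \<le> K * (x - a)\<^sup>2"
    proof (cases "a < x \<and> x < b")
      case True
      then have "(b - x)\<^sup>2 \<le> (b - a)\<^sup>2" by (intro power_mono) auto
      then have "B * fact (m + 2) * ((x - a) * (b - x))\<^sup>2 \<le> K * (x - a)\<^sup>2"
        using mult_left_mono[of "(b - x)\<^sup>2" "(b - a)\<^sup>2" "B * fact (m + 2) * (x - a)\<^sup>2"] B0
        by (simp add: K_def power_mult_distrib mult_ac del: fact_Suc)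
      then show ?thesis using key[of x] True by linarith
    qed (auto simp: bump_def K_def B0)
    show "\<bar>bump a b m P x\<bar> \<le> K * (x - b)\<^sup>2"
    proof (cases "a < x \<and> x < b")
      case True
      then have "(x - a)\<^sup>2 \<le> (b - a)\<^sup>2" by (intro power_mono) auto
      then have "B * fact (m + 2) * ((x - a) * (b - x))\<^sup>2 \<le> K * (x - b)\<^sup>2"
        using mult_left_mono[of "(x - a)\<^sup>2" "(b - a)\<^sup>2" "B * fact (m + 2) * (b - x)\<^sup>2"] B0
        by (simp add: K_def power_mult_distrib mult_ac power2_commute[of x b] del: fact_Suc)
      then show ?thesis using key[of x] True by linarith
    qed (auto simp: bump_def K_def B0)
  qed
qed

lemma has_real_derivative_0_if_flat:
  assumes "\<And>x. \<bar>f x\<bar> \<le> K * (x - c)\<^sup>2"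
  shows "(f has_real_derivative 0) (at c)"
proof -
  have fc: "f c = 0" using assms[of c] by simp
  have "((\<lambda>x. (f x - f c) / (x - c)) \<longlongrightarrow> 0) (at c)"
  proof (rule Lim_null_comparison)
    show "\<forall>\<^sub>F x in at c. norm ((f x - f c) / (x - c)) \<le> K * \<bar>x - c\<bar>"
    proof (rule eventually_at_topological[THEN iffD2], intro exI[of _ UNIV] conjI ballI impI)
      fix x assume "x \<noteq> c"
      then show "norm ((f x - f c) / (x - c)) \<le> K * \<bar>x - c\<bar>"
        using assms[of x] fc by (simp add: abs_divide divide_le_eq power2_eq_square abs_mult[symmetric] mult.assoc)
    qed auto
    show "((\<lambda>x. K * \<bar>x - c\<bar>) \<longlongrightarrow> 0) (at c)"
      by (rule tendsto_eq_intros refl | simp)+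
  qed
  then show ?thesis by (simp add: has_field_derivative_iff)
qed

lemma bump_deriv:
  assumes ab: "a < b"
  obtains Q where "\<And>x. (bump a b m P has_real_derivative bump a b (m + 2) Q x) (at x)"
proof -
  let ?r = "[:-a, 1:] * [:b, -1:]"
  \<comment> \<open>Product and chain rule with R^(m + 2) taken out as a common factor,
    \<open>?r\<close> being 1 / R.\<close>
  define Q where "Q = pderiv P * ?r\<^sup>2 - smult (real m) (P * pderiv ?r * ?r) + P * pderiv ?r"
  have "(bump a b m P has_real_derivative bump a b (m + 2) Q x) (at x)" for x
  proof -
    consider "x < a" | "b < x" | "a < x" "x < b" | "x = a \<or> x = b" by linarith
    then show ?thesis
    proof cases
      case 1
      have "((\<lambda>x. 0) has_real_derivative 0) (at x)" by simp
      then have "(bump a b m P has_real_derivative 0) (at x)"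
        by (rule has_field_derivative_transform_within_open[of _ _ _ "{..<a}"]) (use 1 in \<open>auto simp: bump_def\<close>)
      then show ?thesis using 1 by (simp add: bump_def)
    next
      case 2
      have "((\<lambda>x. 0) has_real_derivative 0) (at x)" by simp
      then have "(bump a b m P has_real_derivative 0) (at x)"
        by (rule has_field_derivative_transform_within_open[of _ _ _ "{b<..}"]) (use 2 in \<open>auto simp: bump_def\<close>)
      then show ?thesis using 2 by (simp add: bump_def)
    next
      case 3
      define R where "R = inverse (poly ?r x)"
      have r: "poly ?r x = (x - a) * (b - x)" by (simp add: algebra_simps)
      then have r0: "poly ?r x \<noteq> 0" using 3 by simp
      have dR: "((\<lambda>x. inverse (poly ?r x)) has_real_derivative - (R * poly (pderiv ?r) x * R)) (at x)"
        unfolding R_def by (rule DERIV_inverse_fun[OF poly_DERIV r0, unfolded power2_eq_square, THEN DERIV_cong]) simp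
      have "((\<lambda>x. poly P x * inverse (poly ?r x) ^ m * exp (- inverse (poly ?r x))) has_real_derivative
          (poly (pderiv P) x * R ^ m + (real m * (- (R * poly (pderiv ?r) x * R) * R ^ (m - 1))) * poly P x) * exp (- R)
          + exp (- R) * (R * poly (pderiv ?r) x * R) * (poly P x * R ^ m)) (at x)"
        unfolding R_def
        by (rule DERIV_mult[OF DERIV_mult[OF poly_DERIV DERIV_power[OF dR[unfolded R_def]]]
              DERIV_fun_exp[OF DERIV_minus[OF dR[unfolded R_def]]], THEN DERIV_cong]) (simp add: R_def)
      moreover have "(poly (pderiv P) x * R ^ m + (real m * (- (R * poly (pderiv ?r) x * R) * R ^ (m - 1))) * poly P x) * exp (- R)
          + exp (- R) * (R * poly (pderiv ?r) x * R) * (poly P x * R ^ m) = poly Q x * R ^ (m + 2) * exp (- R)"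
      proof -
        have Rr: "poly ?r x * R = 1" using r0 unfolding R_def by simp
        \<comment> \<open>The factor \<open>real m\<close> absorbs the truncated exponent at
          \<open>m = 0\<close>.\<close>
        have R1: "real m * (R * R ^ (m - 1)) = real m * R ^ m" by (cases m) auto
        have "poly Q x * R ^ (m + 2) = poly (pderiv P) x * R ^ m * (poly ?r x * R)\<^sup>2
            - real m * R ^ m * R * (poly ?r x * R) * poly P x * poly (pderiv ?r) x
            + poly P x * poly (pderiv ?r) x * R ^ m * R * R"
          unfolding Q_def by (simp only: poly_add poly_diff poly_mult poly_smult poly_power power_add power2_eq_square) (simp only: algebra_simps)
        also have "\<dots> = poly (pderiv P) x * R ^ m - real m * R ^ m * R * poly P x * poly (pderiv ?r) x
            + poly P x * poly (pderiv ?r) x * R ^ m * R * R" unfolding Rr by simp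
        also have "real m * R ^ m * R * poly P x * poly (pderiv ?r) x =
            real m * (R * R ^ (m - 1)) * R * poly P x * poly (pderiv ?r) x" unfolding R1 ..
        finally have *: "poly Q x * R ^ (m + 2) = poly (pderiv P) x * R ^ m
            - real m * (R * R ^ (m - 1)) * R * poly P x * poly (pderiv ?r) x
            + poly P x * poly (pderiv ?r) x * R ^ m * R * R" .
        have "(poly (pderiv P) x * R ^ m + (real m * (- (R * poly (pderiv ?r) x * R) * R ^ (m - 1))) * poly P x) * exp (- R)
          + exp (- R) * (R * poly (pderiv ?r) x * R) * (poly P x * R ^ m)
          = (poly (pderiv P) x * R ^ m - real m * (R * R ^ (m - 1)) * R * poly P x * poly (pderiv ?r) x
            + poly P x * poly (pderiv ?r) x * R ^ m * R * R) * exp (- R)"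
          by (simp only: algebra_simps mult_minus_left mult_minus_right add_uminus_conv_diff minus_mult_minus)
        then show ?thesis unfolding * .
      qed
      ultimately have "((\<lambda>x. poly P x * inverse (poly ?r x) ^ m * exp (- inverse (poly ?r x))) has_real_derivative
          poly Q x * R ^ (m + 2) * exp (- R)) (at x)" by simp
      then have "(bump a b m P has_real_derivative poly Q x * R ^ (m + 2) * exp (- R)) (at x)"
        by (rule has_field_derivative_transform_within_open[of _ _ _ "{a<..<b}"])
           (use 3 in \<open>auto simp: bump_def algebra_simps\<close>)
      then show ?thesis using 3 unfolding R_def r by (simp add: bump_def)
    next
      case 4
      obtain K where K: "\<And>x. \<bar>bump a b m P x\<bar> \<le> K * (x - a)\<^sup>2" "\<And>x. \<bar>bump a b m P x\<bar> \<le> K * (x - b)\<^sup>2"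
        using bump_flat[OF ab] by blast
      have "(bump a b m P has_real_derivative 0) (at x)"
        using 4 has_real_derivative_0_if_flat[OF K(1)] has_real_derivative_0_if_flat[OF K(2)] by auto
      then show ?thesis using 4 by (auto simp: bump_def)
    qed
  qed
  then show ?thesis using that by blast
qed

lemma funpow_deriv_bump:
  assumes "a < b"
  shows "\<exists>m' Q. (deriv ^^ n) (bump a b m P) = bump a b m' Q"
proof (induction n)
  case (Suc n)
  then obtain m' Q where "(deriv ^^ n) (bump a b m P) = bump a b m' Q" by blast
  moreover obtain Q' where "\<And>x. (bump a b m' Q has_real_derivative bump a b (m' + 2) Q' x) (at x)"
    using bump_deriv[OF assms] by blast
  then have "deriv (bump a b m' Q) = bump a b (m' + 2) Q'" by (intro ext DERIV_imp_deriv)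
  ultimately show ?case by auto
qed auto

lemma test_functionI:
  assumes "\<And>n x. (deriv ^^ n) \<phi> differentiable (at x)" "0 < a" "b < 2 * pi"
    "\<And>x. x \<notin> {a..b} \<Longrightarrow> \<phi> x = 0"
  shows "test_function \<phi>"
  unfolding test_function_def using assms by blast

lemma test_function_bump:
  assumes "0 < a" "a < b" "b < 2 * pi"
  shows "test_function (bump a b m P)"
proof (rule test_functionI[of _ a b])
  fix n x
  obtain m' Q where Q: "(deriv ^^ n) (bump a b m P) = bump a b m' Q" using funpow_deriv_bump[OF assms(2)] by blast
  obtain Q' where "\<And>x. (bump a b m' Q has_real_derivative bump a b (m' + 2) Q' x) (at x)"
    using bump_deriv[OF assms(2)] by blast
  then show "(deriv ^^ n) (bump a b m P) differentiable (at x)"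
    unfolding Q by (meson real_differentiable_def)
qed (use assms in \<open>auto simp: bump_def\<close>)

lemma bump_nonneg: "0 \<le> bump a b 0 1 x" and bump_pos: "a < x \<Longrightarrow> x < b \<Longrightarrow> 0 < bump a b 0 1 x"
  by (auto simp: bump_def)

lemma test_function_deriv_chain:
  assumes "test_function \<phi>"
  shows "((deriv ^^ n) \<phi> has_real_derivative (deriv ^^ Suc n) \<phi> x) (at x)"
  using assms unfolding test_function_def by (simp add: DERIV_deriv_iff_real_differentiable)

lemma test_function_deriv_eq_0:
  assumes "x \<notin> {a..b}" "\<And>x. x \<notin> {a..b::real} \<Longrightarrow> \<phi> x = (0::real)"
  shows "(deriv ^^ n) \<phi> x = 0"
  using assms(1)
proof (induction n arbitrary: x)
  case (Suc n)
  have "((\<lambda>x. 0) has_real_derivative 0) (at x)" by simp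
  then have "((deriv ^^ n) \<phi> has_real_derivative 0) (at x)"
    by (rule has_field_derivative_transform_within_open[of _ _ _ "- {a..b}"]) (use Suc in auto)
  then show ?case by (simp add: DERIV_imp_deriv)
qed (use assms in auto)

lemma test_function_ends:
  assumes "test_function \<phi>"
  shows "x \<le> 0 \<or> 2 * pi \<le> x \<Longrightarrow> (deriv ^^ n) \<phi> x = 0"
proof -
  obtain a b where ab: "0 < a" "b < 2 * pi" "\<And>x. x \<notin> {a..b} \<Longrightarrow> \<phi> x = 0"
    using assms unfolding test_function_def by auto
  assume "x \<le> 0 \<or> 2 * pi \<le> x"
  then show ?thesis using ab by (intro test_function_deriv_eq_0[of x a b]) auto
qed

lemma test_function_continuous: "test_function \<phi> \<Longrightarrow> continuous_on S ((deriv ^^ n) \<phi>)"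
  using test_function_deriv_chain by (meson DERIV_continuous_on has_field_derivative_at_within)

lemma funpow_deriv_diff:
  assumes "test_function \<phi>" "test_function \<psi>"
  shows "(deriv ^^ n) (\<lambda>x. \<phi> x - c * \<psi> x) = (\<lambda>x. (deriv ^^ n) \<phi> x - c * (deriv ^^ n) \<psi> x)"
proof (induction n)
  case (Suc n)
  have "((\<lambda>x. (deriv ^^ n) \<phi> x - c * (deriv ^^ n) \<psi> x) has_real_derivative
      (deriv ^^ Suc n) \<phi> x - c * (deriv ^^ Suc n) \<psi> x) (at x)" for x
    by (intro DERIV_diff DERIV_cmult test_function_deriv_chain assms)
  then have "deriv (\<lambda>x. (deriv ^^ n) \<phi> x - c * (deriv ^^ n) \<psi> x) =
      (\<lambda>x. (deriv ^^ Suc n) \<phi> x - c * (deriv ^^ Suc n) \<psi> x)" by (intro ext DERIV_imp_deriv)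
  then show ?case using Suc by simp
qed simp

lemma test_function_diff:
  assumes "test_function \<phi>" "test_function \<psi>"
  shows "test_function (\<lambda>x. \<phi> x - c * \<psi> x)"
proof -
  obtain a b where ab: "0 < a" "b < 2 * pi" "\<And>x. x \<notin> {a..b} \<Longrightarrow> \<phi> x = 0"
    using assms(1) unfolding test_function_def by auto
  obtain a' b' where ab': "0 < a'" "b' < 2 * pi" "\<And>x. x \<notin> {a'..b'} \<Longrightarrow> \<psi> x = 0"
    using assms(2) unfolding test_function_def by auto
  show ?thesis
  proof (rule test_functionI[of _ "min a a'" "max b b'"])
    fix n x
    show "(deriv ^^ n) (\<lambda>x. \<phi> x - c * \<psi> x) differentiable (at x)"
      unfolding funpow_deriv_diff[OF assms]
      using DERIV_diff[OF test_function_deriv_chain[OF assms(1)] DERIV_cmult[OF test_function_deriv_chain[OF assms(2)]]]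
      by (meson real_differentiable_def)
  next
    fix x assume "x \<notin> {min a a'..max b b'}"
    then have "x \<notin> {a..b}" "x \<notin> {a'..b'}" by auto
    then show "\<phi> x - c * \<psi> x = 0" using ab ab' by simp
  qed (use ab ab' in auto)
qed

text \<open>The primitive from 0 is zero to the left of the support, and to the right of it because
  the whole integral vanishes.\<close>

lemma test_function_primitive:
  assumes "test_function \<phi>" "integral Omega \<phi> = 0"
  obtains \<theta> where "test_function \<theta>" "deriv \<theta> = \<phi>"
proof -
  obtain a b where ab: "0 < a" "b < 2 * pi" "\<And>x. x \<notin> {a..b} \<Longrightarrow> \<phi> x = 0"
    using assms unfolding test_function_def by auto
  define \<theta> where "\<theta> x = integral {0..x} \<phi>" for x
  have cont: "continuous_on S \<phi>" for S using test_function_continuous[OF assms(1), of S 0] by simp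
  have left: "\<theta> x = 0" if "x < a" for x
    unfolding \<theta>_def using that ab by (intro integral_unique has_integral_is_0) auto
  have d: "(\<theta> has_real_derivative \<phi> x) (at x)" for x
  proof (cases "x < a")
    case True
    have "((\<lambda>x. 0) has_real_derivative 0) (at x)" by simp
    then have "(\<theta> has_real_derivative 0) (at x)"
      by (rule has_field_derivative_transform_within_open[of _ _ _ "{..<a}"]) (use True left in auto)
    then show ?thesis using True ab by simp
  next
    case False
    then have x: "0 < x" using ab by auto
    have "(\<theta> has_real_derivative \<phi> x) (at x within {0..x + 1})"
      unfolding \<theta>_def using x by (intro integral_has_real_derivative cont) auto
    then show ?thesis using x at_within_interior[of x "{0..x + 1}"] by auto
  qed
  then have deriv: "deriv \<theta> = \<phi>" by (intro ext DERIV_imp_deriv)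
  have right: "\<theta> x = 0" if x: "b < x" "0 < x" for x
  proof -
    \<comment> \<open>\<open>x\<close> may lie on either side of 2 pi, while the hypothesis concerns
      the integral up to 2 pi.\<close>
    let ?m = "max x (2 * pi)"
    have "integral {0..x} \<phi> + integral {x..?m} \<phi> = integral {0..?m} \<phi>"
      using x by (intro Henstock_Kurzweil_Integration.integral_combine integrable_continuous_real cont) auto
    moreover have "integral {0..2 * pi} \<phi> + integral {2 * pi..?m} \<phi> = integral {0..?m} \<phi>"
      by (intro Henstock_Kurzweil_Integration.integral_combine integrable_continuous_real cont) auto
    moreover have "integral {x..?m} \<phi> = 0" "integral {2 * pi..?m} \<phi> = 0"
      using x ab by (auto intro!: integral_unique has_integral_is_0)
    ultimately show ?thesis unfolding \<theta>_def using assms(2) by simp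
  qed
  have "test_function \<theta>"
  \<comment> \<open>\<open>test_function\<close> does not force \<open>a \<le> b\<close>; clamping
    with \<open>pi\<close> keeps the upper end positive and below 2 pi.\<close>
  proof (rule test_functionI[of _ "min a pi" "max b (min a pi)"])
    fix n x
    show "(deriv ^^ n) \<theta> differentiable (at x)"
    proof (cases n)
      case 0
      then show ?thesis using d by (simp add: real_differentiable_def) blast
    next
      case (Suc m)
      then have "(deriv ^^ n) \<theta> = (deriv ^^ m) \<phi>" by (simp add: funpow_swap1 deriv)
      then show ?thesis using assms(1) unfolding test_function_def by auto
    qed
  next
    fix x assume "x \<notin> {min a pi..max b (min a pi)}"
    then have "x < a \<or> (b < x \<and> 0 < x)" using ab pi_gt_zero by auto
    then show "\<theta> x = 0" using left right by auto
  qed (use ab pi_gt_zero in \<open>auto simp: min_less_iff_disj\<close>)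
  then show ?thesis using deriv that by blast
qed

section \<open>Weak derivatives of continuous functions\<close>

definition zero_ext :: "(real \<Rightarrow> real) \<Rightarrow> real \<Rightarrow> real" where
  "zero_ext h x = indicator Omega x * h x"

lemma integrable_zero_ext: "continuous_on Omega h \<Longrightarrow> integrable lborel (zero_ext h)"
  using borel_integrable_atLeastAtMost'[of 0 "2 * pi" h]
  by (simp add: set_integrable_def zero_ext_def[abs_def])

lemma integral_zero_ext:
  "continuous_on Omega h \<Longrightarrow> (LINT x|lborel. zero_ext h x) = integral Omega h"
  using set_borel_integral_eq_integral(2)[OF borel_integrable_atLeastAtMost'[of 0 "2 * pi" h]]
  by (simp add: set_lebesgue_integral_def zero_ext_def)

lemma integral_zero_ext_test:
  assumes "continuous_on Omega h" "test_function \<phi>"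
  shows "(LINT x|lborel. zero_ext h x * (deriv ^^ n) \<phi> x) = integral Omega (\<lambda>x. h x * (deriv ^^ n) \<phi> x)"
  using integral_zero_ext[of "\<lambda>x. h x * (deriv ^^ n) \<phi> x"] assms test_function_continuous[OF assms(2)]
  by (simp add: zero_ext_def mult.assoc continuous_on_mult)

lemma test_function_bounded:
  assumes "test_function \<phi>"
  obtains B where "\<And>x. \<bar>(deriv ^^ n) \<phi> x\<bar> \<le> B"
proof -
  have "compact ((deriv ^^ n) \<phi> ` Omega)"
    by (intro compact_continuous_image test_function_continuous assms) auto
  then obtain B where B: "\<And>s. s \<in> Omega \<Longrightarrow> \<bar>(deriv ^^ n) \<phi> s\<bar> \<le> B"
    using compact_imp_bounded[THEN bounded_iff[THEN iffD1]] by (metis image_eqI real_norm_def)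
  have "0 \<le> B" using B[of 0] by auto
  then have "\<bar>(deriv ^^ n) \<phi> x\<bar> \<le> B" for x
    using B[of x] test_function_ends[OF assms, of x n] by (cases "x \<in> Omega") auto
  then show ?thesis using that by blast
qed

lemma test_function_measurable: "test_function \<phi> \<Longrightarrow> (deriv ^^ n) \<phi> \<in> borel_measurable borel"
  by (intro borel_measurable_continuous_onI test_function_continuous)

lemma integrable_mult_test:
  assumes w: "integrable lborel w" and "test_function \<phi>"
  shows "integrable lborel (\<lambda>x. w x * (deriv ^^ n) \<phi> x)"
proof -
  obtain B where B: "\<And>x. \<bar>(deriv ^^ n) \<phi> x\<bar> \<le> B" using test_function_bounded[OF assms(2)] by blast
  have m: "(deriv ^^ n) \<phi> \<in> borel_measurable lborel" using test_function_measurable[OF assms(2)] by simp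
  show ?thesis
  proof (rule Bochner_Integration.integrable_bound)
    show "integrable lborel (\<lambda>x. B * w x)" using w by simp
    show "(\<lambda>x. w x * (deriv ^^ n) \<phi> x) \<in> borel_measurable lborel" using w m by measurable
    have "\<bar>w x\<bar> * \<bar>(deriv ^^ n) \<phi> x\<bar> \<le> B * \<bar>w x\<bar>" for x
      using mult_left_mono[OF B abs_ge_zero, of "w x" x] by (simp add: mult.commute)
    moreover have "B * \<bar>w x\<bar> \<le> \<bar>B * w x\<bar>" for x by (simp add: abs_mult mult_right_mono)
    ultimately have "\<bar>w x\<bar> * \<bar>(deriv ^^ n) \<phi> x\<bar> \<le> \<bar>B * w x\<bar>" for x by (rule order_trans)
    then show "AE x in lborel. norm (w x * (deriv ^^ n) \<phi> x) \<le> norm (B * w x)"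
      by (intro AE_I2) (simp add: abs_mult)
  qed
qed

text \<open>Were \<open>g\<close> above \<open>M\<close> at an interior point, a bump supported
  where \<open>g\<close> exceeds \<open>M\<close> would make the pairing of \<open>g - M\<close>
  positive, while the bound on \<open>v\<close> makes it nonpositive. End points follow by
  continuity.\<close>

lemma upper_bound_by_testing:
  assumes g: "continuous_on Omega g" and v: "integrable lborel v"
    and eq: "\<And>\<phi>. test_function \<phi> \<Longrightarrow> integral Omega (\<lambda>x. g x * \<phi> x) = (LINT x|lborel. v x * \<phi> x)"
    and bnd: "AE x in lborel. x \<in> Omega \<longrightarrow> v x \<le> M" and x: "x \<in> Omega"
  shows "g x \<le> M"
proof -
  have int: "g y \<le> M" if y: "y \<in> {0<..<2 * pi}" for y
  proof (rule ccontr)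
    assume "\<not> g y \<le> M"
    then have "0 < g y - M" by simp
    moreover have "y \<in> Omega" using y by simp
    ultimately obtain d where d: "d > 0" "\<And>z. z \<in> Omega \<Longrightarrow> dist z y < d \<Longrightarrow> dist (g z) (g y) < g y - M"
      using g unfolding continuous_on_iff by metis
    \<comment> \<open>Keeps the bump inside the neighbourhood of \<open>y\<close> and strictly
      inside the domain.\<close>
    define e where "e = min (d / 2) (min (y / 2) ((2 * pi - y) / 2))"
    have "e \<le> d / 2" "e \<le> y / 2" "e \<le> (2 * pi - y) / 2"
      unfolding e_def by (meson min.cobounded1 min.cobounded2 order_trans)+
    moreover have "0 < e" unfolding e_def using d(1) y by auto
    ultimately have e: "0 < e" "e < d" "0 < y - e" "y + e < 2 * pi" using d(1) y by (auto simp: field_simps)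
    define \<phi> where "\<phi> = bump (y - e) (y + e) 0 1"
    have test: "test_function \<phi>" unfolding \<phi>_def using e by (intro test_function_bump) auto
    have c\<phi>: "continuous_on Omega \<phi>" using test_function_continuous[OF test, of _ 0] by simp
    have nn: "0 \<le> (g z - M) * \<phi> z" if "z \<in> Omega" for z
    proof (cases "y - e < z \<and> z < y + e")
      case True
      then have "dist (g z) (g y) < g y - M" using e that by (intro d(2)) (auto simp: dist_real_def)
      then have "g z > M" by (auto simp: dist_real_def)
      then show ?thesis using bump_nonneg by (simp add: \<phi>_def)
    qed (auto simp: \<phi>_def bump_def)
    have "integral Omega (\<lambda>z. (g z - M) * \<phi> z) = integral Omega (\<lambda>z. g z * \<phi> z) - integral Omega (\<lambda>z. M * \<phi> z)"
      unfolding left_diff_distrib by (intro integral_diff integrable_continuous_real continuous_intros g c\<phi>)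
    also have "integral Omega (\<lambda>z. M * \<phi> z) = (LINT z|lborel. zero_ext (\<lambda>_. M) z * \<phi> z)"
      using integral_zero_ext_test[OF _ test, of "\<lambda>_. M" 0] by simp
    also have "integral Omega (\<lambda>z. g z * \<phi> z) - \<dots> = (LINT z|lborel. v z * \<phi> z - zero_ext (\<lambda>_. M) z * \<phi> z)"
      unfolding eq[OF test]
      using integrable_mult_test[OF v test, of 0] integrable_mult_test[OF integrable_zero_ext test, of "\<lambda>_. M" 0]
      by (simp add: continuous_on_const)
    also have "\<dots> \<le> 0"
    proof -
      have "AE z in lborel. 0 \<le> - (v z * \<phi> z - zero_ext (\<lambda>_. M) z * \<phi> z)"
        using bnd
      proof eventually_elim
        case (elim z)
        show ?case
        proof (cases "z \<in> Omega")
          case True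
          then have "v z * \<phi> z \<le> M * \<phi> z" using elim bump_nonneg by (intro mult_right_mono) (auto simp: \<phi>_def)
          then show ?thesis using True by (simp add: zero_ext_def)
        next
          case False
          then have "\<phi> z = 0" using test_function_ends[OF test, of z 0] by auto
          then show ?thesis by simp
        qed
      qed
      from integral_nonneg_AE[OF this, unfolded Bochner_Integration.integral_minus] show ?thesis by linarith
    qed
    finally have le: "integral Omega (\<lambda>z. (g z - M) * \<phi> z) \<le> 0" .
    have cont: "continuous_on Omega (\<lambda>z. (g z - M) * \<phi> z)" by (intro continuous_intros g c\<phi>)
    have "0 \<le> integral Omega (\<lambda>z. (g z - M) * \<phi> z)"
      by (intro integral_nonneg integrable_continuous_real cont nn)
    with le have "integral Omega (\<lambda>z. (g z - M) * \<phi> z) = 0" by simp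
    then have "(g y - M) * \<phi> y = 0" using integral_eq_0_iff[OF cont _ nn] y by auto
    moreover have "\<phi> y > 0" unfolding \<phi>_def using e by (intro bump_pos) auto
    ultimately show False using \<open>0 < g y - M\<close> by simp
  qed
  have "closure {0<..<2 * pi} = Omega" using pi_gt_zero by (intro closure_greaterThanLessThan) auto
  then show ?thesis using continuous_le_on_closure[of "{0<..<2 * pi}" g x M] g x int by simp
qed

lemma abs_bound_by_testing:
  assumes g: "continuous_on Omega g" and v: "integrable lborel v"
    and eq: "\<And>\<phi>. test_function \<phi> \<Longrightarrow> integral Omega (\<lambda>x. g x * \<phi> x) = (LINT x|lborel. v x * \<phi> x)"
    and bnd: "AE x in lborel. x \<in> Omega \<longrightarrow> \<bar>v x\<bar> \<le> M" and x: "x \<in> Omega"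
  shows "\<bar>g x\<bar> \<le> M"
proof -
  have "g x \<le> M" by (rule upper_bound_by_testing[OF g v eq _ x]) (use bnd in \<open>auto elim!: eventually_mono\<close>)
  moreover have "- g x \<le> M"
    by (rule upper_bound_by_testing[OF _ _ _ _ x, of "\<lambda>x. - g x" "\<lambda>x. - v x"])
       (use bnd g v eq in \<open>auto elim!: eventually_mono intro: continuous_on_minus\<close>)
  ultimately show ?thesis by simp
qed

lemma zero_by_testing:
  assumes "continuous_on Omega h" "\<And>\<phi>. test_function \<phi> \<Longrightarrow> integral Omega (\<lambda>x. h x * \<phi> x) = 0" "x \<in> Omega"
  shows "h x = 0"
  using abs_bound_by_testing[OF assms(1), of "\<lambda>_. 0" 0 x] assms(2,3) by simp

lemma test_by_parts:
  assumes h: "\<And>x. x \<in> Omega \<Longrightarrow> (h has_real_derivative h' x) (at x within Omega)"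
    and h': "continuous_on Omega h'" and "test_function \<phi>"
  shows "integral Omega (\<lambda>x. h x * (deriv ^^ Suc n) \<phi> x) = - integral Omega (\<lambda>x. h' x * (deriv ^^ n) \<phi> x)"
proof -
  have ch: "continuous_on Omega h" by (rule DERIV_continuous_on[OF h])
  have "((\<lambda>x. h x * (deriv ^^ Suc n) \<phi> x + h' x * (deriv ^^ n) \<phi> x) has_integral
      h (2 * pi) * (deriv ^^ n) \<phi> (2 * pi) - h 0 * (deriv ^^ n) \<phi> 0) Omega"
  proof (rule fundamental_theorem_of_calculus)
    fix x assume "x \<in> Omega"
    then have "((\<lambda>x. h x * (deriv ^^ n) \<phi> x) has_real_derivative
        h' x * (deriv ^^ n) \<phi> x + (deriv ^^ Suc n) \<phi> x * h x) (at x within Omega)"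
      by (intro DERIV_mult h has_field_derivative_at_within[OF test_function_deriv_chain] assms)
    then show "((\<lambda>x. h x * (deriv ^^ n) \<phi> x) has_vector_derivative
        h x * (deriv ^^ Suc n) \<phi> x + h' x * (deriv ^^ n) \<phi> x) (at x within Omega)"
      by (simp add: has_real_derivative_iff_has_vector_derivative add.commute mult.commute)
  qed simp
  then have "integral Omega (\<lambda>x. h x * (deriv ^^ Suc n) \<phi> x + h' x * (deriv ^^ n) \<phi> x) = 0"
    using test_function_ends[OF assms(3)] by (simp add: integral_unique)
  moreover have "integral Omega (\<lambda>x. h x * (deriv ^^ Suc n) \<phi> x + h' x * (deriv ^^ n) \<phi> x) =
      integral Omega (\<lambda>x. h x * (deriv ^^ Suc n) \<phi> x) + integral Omega (\<lambda>x. h' x * (deriv ^^ n) \<phi> x)"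
    by (intro integral_add integrable_continuous_real continuous_on_mult ch h' test_function_continuous assms)
  ultimately show ?thesis by simp
qed

lemma test_by_parts_iterated:
  assumes "\<And>i x. i < n \<Longrightarrow> x \<in> Omega \<Longrightarrow> (g i has_real_derivative g (Suc i) x) (at x within Omega)"
    and "continuous_on Omega (g n)" "test_function \<phi>"
  shows "integral Omega (\<lambda>x. g 0 x * (deriv ^^ (n + m)) \<phi> x) = (-1) ^ n * integral Omega (\<lambda>x. g n x * (deriv ^^ m) \<phi> x)"
  using assms(1,2)
proof (induction n arbitrary: m)
  case (Suc n)
  have c: "continuous_on Omega (g n)" using Suc.prems(1)[of n] by (intro DERIV_continuous_on[of _ "g n" "g (Suc n)"]) blast
  have "integral Omega (\<lambda>x. g 0 x * (deriv ^^ (n + Suc m)) \<phi> x) =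
      (-1) ^ n * integral Omega (\<lambda>x. g n x * (deriv ^^ Suc m) \<phi> x)"
  proof (rule Suc.IH[OF _ c])
    show "(g i has_real_derivative g (Suc i) x) (at x within Omega)" if "i < n" "x \<in> Omega" for i x
      using Suc.prems(1)[of i x] that by simp
  qed
  also have "integral Omega (\<lambda>x. g n x * (deriv ^^ Suc m) \<phi> x) = - integral Omega (\<lambda>x. g (Suc n) x * (deriv ^^ m) \<phi> x)"
    using Suc.prems by (intro test_by_parts assms(3)) auto
  finally show ?case by simp
qed simp

lemma test_by_parts_poly:
  assumes "test_function \<phi>"
  shows "integral Omega (\<lambda>x. poly p x * (deriv ^^ (n + m)) \<phi> x) =
    (-1) ^ n * integral Omega (\<lambda>x. poly ((pderiv ^^ n) p) x * (deriv ^^ m) \<phi> x)"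
  using test_by_parts_iterated[of n "\<lambda>i. poly ((pderiv ^^ i) p)" \<phi> m] assms
  by (simp add: poly_DERIV has_field_derivative_at_within continuous_on_poly)

text \<open>A test function with vanishing integral is the derivative of a test function.\<close>

lemma du_bois_reymond:
  assumes "continuous_on Omega h"
    and "\<And>\<phi>. test_function \<phi> \<Longrightarrow> integral Omega (\<lambda>x. h x * (deriv ^^ n) \<phi> x) = 0"
  obtains p where "\<And>x. x \<in> Omega \<Longrightarrow> h x = poly p x" "\<And>x. x \<in> Omega \<Longrightarrow> poly ((pderiv ^^ n) p) x = 0"
proof -
  have "\<exists>p. \<forall>x\<in>Omega. h x = poly p x"
    using assms
  proof (induction n arbitrary: h)
    case 0
    have "h x = poly 0 x" if "x \<in> Omega" for x
      using zero_by_testing[OF 0(1) _ that] 0(2) by simp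
    then show ?case by blast
  next
    case (Suc n)
    \<comment> \<open>A fixed test function of nonzero mean: subtracting a suitable multiple of it
      from any test function leaves mean zero.\<close>
    define \<beta> where "\<beta> = bump 1 2 0 1"
    have "2 < 2 * pi" using pi_gt3 by simp
    then have \<beta>: "test_function \<beta>" unfolding \<beta>_def by (intro test_function_bump) auto
    have c\<beta>: "continuous_on S \<beta>" for S using test_function_continuous[OF \<beta>, of S 0] by simp
    define b where "b = integral Omega \<beta>"
    have b: "b \<noteq> 0"
    proof
      assume "b = 0"
      then have "\<forall>x\<in>Omega. \<beta> x = 0" using integral_eq_0_iff[of 0 "2 * pi" \<beta>, OF c\<beta>] bump_nonneg
        unfolding b_def \<beta>_def by simp
      moreover have "3 / 2 \<in> Omega" using pi_gt3 by simp
      ultimately have "\<beta> (3/2) = 0" by blast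
      then show False using bump_pos[of 1 "3/2" 2] unfolding \<beta>_def by simp
    qed
    \<comment> \<open>On derivatives of order \<open>n\<close>, \<open>h\<close> acts through the
      mean of the test function only, with factor \<open>c\<close>. The monomial \<open>p\<close>
      reproduces this factor up to the sign of \<open>n\<close> integrations by parts.\<close>
    define c where "c = integral Omega (\<lambda>x. h x * (deriv ^^ n) \<beta> x) / b"
    define p where "p = monom ((-1) ^ n * c / fact n) n"
    have pn: "(pderiv ^^ n) p = [:(-1) ^ n * c:]"
    proof -
      have "(pderiv ^^ n) (monom a n) = [:fact n * a:]" for a :: real
      proof (induction n arbitrary: a)
        case (Suc n)
        have "(pderiv ^^ Suc n) (monom a (Suc n)) = (pderiv ^^ n) (monom (real (Suc n) * a) n)"
          by (simp add: funpow_swap1 pderiv_monom)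
        then show ?case using Suc by (simp add: mult_ac)
      qed (simp add: monom_0)
      then show ?thesis unfolding p_def by simp
    qed
    have "integral Omega (\<lambda>x. (h x - poly p x) * (deriv ^^ n) \<phi> x) = 0" if \<phi>: "test_function \<phi>" for \<phi>
    proof -
      define a where "a = integral Omega \<phi> / b"
      have c\<phi>: "continuous_on S \<phi>" for S using test_function_continuous[OF \<phi>, of S 0] by simp
      have "integral Omega (\<lambda>x. \<phi> x - a * \<beta> x) = integral Omega \<phi> - a * b"
        unfolding b_def by (subst integral_diff) (auto intro!: integrable_continuous_real continuous_intros c\<phi> c\<beta>)
      then have "integral Omega (\<lambda>x. \<phi> x - a * \<beta> x) = 0" using b by (simp add: a_def)
      from test_function_primitive[OF test_function_diff[OF \<phi> \<beta>] this] obtain \<theta>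
        where \<theta>: "test_function \<theta>" "deriv \<theta> = (\<lambda>x. \<phi> x - a * \<beta> x)" by blast
      have "0 = integral Omega (\<lambda>x. h x * (deriv ^^ Suc n) \<theta> x)" using Suc.prems(2)[OF \<theta>(1)] by simp
      also have "(deriv ^^ Suc n) \<theta> = (\<lambda>x. (deriv ^^ n) \<phi> x - a * (deriv ^^ n) \<beta> x)"
        unfolding funpow_Suc_right o_apply \<theta>(2) by (rule funpow_deriv_diff[OF \<phi> \<beta>])
      also have "integral Omega (\<lambda>x. h x * ((deriv ^^ n) \<phi> x - a * (deriv ^^ n) \<beta> x)) =
          integral Omega (\<lambda>x. h x * (deriv ^^ n) \<phi> x) - a * integral Omega (\<lambda>x. h x * (deriv ^^ n) \<beta> x)"
        by (simp add: right_diff_distrib mult.left_commute[of _ a], subst integral_diff)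
           (auto intro!: integrable_continuous_real continuous_intros test_function_continuous Suc.prems(1) \<phi> \<beta>)
      finally have 1: "integral Omega (\<lambda>x. h x * (deriv ^^ n) \<phi> x) = c * integral Omega \<phi>"
        unfolding a_def c_def by simp
      have "integral Omega (\<lambda>x. poly p x * (deriv ^^ n) \<phi> x) = c * integral Omega \<phi>"
        using test_by_parts_poly[OF \<phi>, of p n 0] unfolding pn
        by (simp add: power_mult_distrib[symmetric] mult.assoc[symmetric])
      with 1 have "integral Omega (\<lambda>x. h x * (deriv ^^ n) \<phi> x) - integral Omega (\<lambda>x. poly p x * (deriv ^^ n) \<phi> x) = 0"
        by simp
      moreover have "integral Omega (\<lambda>x. (h x - poly p x) * (deriv ^^ n) \<phi> x) =
          integral Omega (\<lambda>x. h x * (deriv ^^ n) \<phi> x) - integral Omega (\<lambda>x. poly p x * (deriv ^^ n) \<phi> x)"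
        unfolding left_diff_distrib
        by (intro integral_diff integrable_continuous_real continuous_intros test_function_continuous Suc.prems(1) \<phi>)
      ultimately show ?thesis by simp
    qed
    moreover have "continuous_on Omega (\<lambda>x. h x - poly p x)" by (intro continuous_intros Suc.prems(1))
    ultimately obtain p' where "\<forall>x\<in>Omega. h x - poly p x = poly p' x"
      using Suc.IH[of "\<lambda>x. h x - poly p x"] by blast
    then show ?case by (intro exI[of _ "p + p'"]) (auto simp: algebra_simps)
  qed
  then obtain p where p: "\<And>x. x \<in> Omega \<Longrightarrow> h x = poly p x" by blast
  have "poly ((pderiv ^^ n) p) x = 0" if "x \<in> Omega" for x
  proof (rule zero_by_testing[OF _ _ that])
    fix \<phi> assume \<phi>: "test_function \<phi>"
    have "integral Omega (\<lambda>x. poly p x * (deriv ^^ n) \<phi> x) = integral Omega (\<lambda>x. h x * (deriv ^^ n) \<phi> x)"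
      using p by (intro integral_cong) auto
    then have "(-1) ^ n * integral Omega (\<lambda>x. poly ((pderiv ^^ n) p) x * \<phi> x) = 0"
      using assms(2)[OF \<phi>] test_by_parts_poly[OF \<phi>, of p n 0] by simp
    then show "integral Omega (\<lambda>x. poly ((pderiv ^^ n) p) x * \<phi> x) = 0" by simp
  qed (auto intro: continuous_on_poly)
  with p that show ?thesis by blast
qed

section \<open>Classical representatives of Sobolev functions\<close>

text \<open>Integrating over a half line makes the sets \<open>{..x}\<close> available as generators
  of the Borel sets.\<close>

definition primitive :: "(real \<Rightarrow> real) \<Rightarrow> real \<Rightarrow> real" where
  "primitive w x = (LINT y|lborel. indicator {..x} y * w y)"

lemma integrable_indicator_mult:
  "integrable lborel w \<Longrightarrow> A \<in> sets borel \<Longrightarrow> integrable lborel (\<lambda>y. indicator A y * (w y :: real))"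
  using integrable_mult_indicator[of A lborel w] by simp

lemma primitive_eq_integral:
  assumes w: "integrable lborel w" "\<And>x. x \<notin> Omega \<Longrightarrow> w x = 0" and x: "x \<in> Omega"
  shows "primitive w x = integral {0..x} w"
proof -
  have "indicator {..x} y * w y = indicator {0..x} y * w y" for y
    using w(2)[of y] x by (auto simp: indicator_def)
  then have "primitive w x = (LINT y:{0..x}|lborel. w y)"
    by (simp only: primitive_def set_lebesgue_integral_def real_scaleR_def)
  also have "\<dots> = integral {0..x} w"
    using integrable_indicator_mult[OF w(1), of "{0..x}"]
    by (intro set_borel_integral_eq_integral) (simp add: set_integrable_def)
  finally show ?thesis .
qed

lemma continuous_on_primitive:
  assumes w: "integrable lborel w" "\<And>x. x \<notin> Omega \<Longrightarrow> w x = 0"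
  shows "continuous_on Omega (primitive w)"
proof -
  have "set_integrable lborel Omega w"
    using integrable_indicator_mult[OF w(1), of Omega] by (simp add: set_integrable_def)
  then have "w integrable_on Omega" by (rule set_borel_integral_eq_integral)
  then have "continuous_on Omega (\<lambda>x. integral {0..x} w)" by (rule indefinite_integral_continuous_1)
  then show ?thesis using primitive_eq_integral[OF w]
    by (subst continuous_on_cong[of Omega Omega "primitive w" "\<lambda>x. integral {0..x} w"]) auto
qed

text \<open>Fubini on the region where y is at most x; the inner integral of the derivative of the
  test function, from \<open>y\<close> to the end of the domain, is
  \<open>- \<phi> y\<close>.\<close>

lemma primitive_by_parts:
  assumes w: "integrable lborel w" "\<And>x. x \<notin> Omega \<Longrightarrow> w x = 0" and \<phi>: "test_function \<phi>"
  shows "integral Omega (\<lambda>x. primitive w x * (deriv ^^ Suc 0) \<phi> x) = - (LINT x|lborel. w x * \<phi> x)"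
proof -
  define \<psi> where "\<psi> = (deriv ^^ Suc 0) \<phi>"
  have \<psi>0: "\<psi> x = 0" if "x \<notin> Omega" for x
    unfolding \<psi>_def using test_function_ends[OF \<phi>, of x "Suc 0"] that by auto
  have c\<psi>: "continuous_on S \<psi>" for S unfolding \<psi>_def by (rule test_function_continuous[OF \<phi>])
  have m\<psi>[measurable]: "\<psi> \<in> borel_measurable borel" unfolding \<psi>_def by (rule test_function_measurable[OF \<phi>])
  have mw[measurable]: "w \<in> borel_measurable borel" using w(1) by simp
  have i\<psi>: "integrable lborel \<psi>"
  proof -
    have "zero_ext \<psi> x = \<psi> x" for x using \<psi>0[of x] by (cases "x \<in> Omega") (auto simp: zero_ext_def)
    then have "zero_ext \<psi> = \<psi>" by (rule ext)
    then show ?thesis using integrable_zero_ext[OF c\<psi>] by simp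
  qed
  let ?f = "\<lambda>x y. \<psi> x * (indicator {..x} y * w y)"
  have mf: "(\<lambda>(x, y). ?f x y) \<in> borel_measurable (lborel \<Otimes>\<^sub>M lborel)"
  proof -
    have "(\<lambda>(x, y). ?f x y) = (\<lambda>z. \<psi> (fst z) * ((if snd z \<le> fst z then 1 else 0) * w (snd z)))"
      by (auto simp: fun_eq_iff indicator_def)
    then show ?thesis by simp
  qed
  have "integrable (lborel \<Otimes>\<^sub>M lborel) (\<lambda>(x, y). ?f x y)"
  proof (rule lborel_pair.Fubini_integrable[OF mf])
    show "AE x in lborel. integrable lborel (\<lambda>y. case (x, y) of (x, y) \<Rightarrow> ?f x y)"
      using integrable_indicator_mult[OF w(1)] by simp
    have "integrable lborel (\<lambda>x. \<bar>\<psi> x\<bar> * (LINT y|lborel. \<bar>w y\<bar>))" using i\<psi> by simp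
    then show "integrable lborel (\<lambda>x. LINT y|lborel. norm (case (x, y) of (x, y) \<Rightarrow> ?f x y))"
    proof (rule Bochner_Integration.integrable_bound)
      show "(\<lambda>x. LINT y|lborel. norm (case (x, y) of (x, y) \<Rightarrow> ?f x y)) \<in> borel_measurable lborel"
        using mf by (intro lborel.borel_measurable_lebesgue_integral) simp
      show "AE x in lborel. norm (LINT y|lborel. norm (case (x, y) of (x, y) \<Rightarrow> ?f x y))
          \<le> norm (\<bar>\<psi> x\<bar> * (LINT y|lborel. \<bar>w y\<bar>))"
      proof (rule AE_I2)
        fix x
        have "(LINT y|lborel. \<bar>?f x y\<bar>) \<le> (LINT y|lborel. \<bar>\<psi> x\<bar> * \<bar>w y\<bar>)"
          using w(1) integrable_indicator_mult[OF integrable_abs[OF w(1)], of "{..x}"]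
          by (intro integral_mono) (auto simp: abs_mult indicator_def)
        then show "norm (LINT y|lborel. norm (case (x, y) of (x, y) \<Rightarrow> ?f x y))
          \<le> norm (\<bar>\<psi> x\<bar> * (LINT y|lborel. \<bar>w y\<bar>))"
          by (simp add: abs_mult)
      qed
    qed
  qed
  from lborel_pair.Fubini_integral[OF this]
  have fub: "(LINT y|lborel. LINT x|lborel. ?f x y) = (LINT x|lborel. LINT y|lborel. ?f x y)" .
  have "(LINT x|lborel. LINT y|lborel. ?f x y) = (LINT x|lborel. zero_ext (primitive w) x * \<psi> x)"
    unfolding primitive_def[symmetric] using \<psi>0
    by (intro Bochner_Integration.integral_cong refl) (auto simp: zero_ext_def primitive_def indicator_def mult.commute)
  also have "\<dots> = integral Omega (\<lambda>x. primitive w x * \<psi> x)"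
    unfolding \<psi>_def by (rule integral_zero_ext_test[OF continuous_on_primitive[OF w] \<phi>])
  finally have 1: "(LINT x|lborel. LINT y|lborel. ?f x y) = integral Omega (\<lambda>x. primitive w x * \<psi> x)" .
  have inner: "(LINT x|lborel. ?f x y) = - (w y * \<phi> y)" for y
  proof (cases "y \<in> Omega")
    case True
    have "(LINT x|lborel. \<psi> x * indicator {..x} y) = (LINT x:{y..2 * pi}|lborel. \<psi> x)"
      unfolding set_lebesgue_integral_def using \<psi>0
      by (intro Bochner_Integration.integral_cong refl) (auto simp: indicator_def)
    also have "\<dots> = integral {y..2 * pi} \<psi>"
      by (intro set_borel_integral_eq_integral borel_integrable_atLeastAtMost' c\<psi>)
    also have "\<dots> = \<phi> (2 * pi) - \<phi> y"
    proof (rule integral_unique)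
      have "(\<phi> has_vector_derivative \<psi> x) (at x within {y..2 * pi})" for x
        unfolding has_real_derivative_iff_has_vector_derivative[symmetric] \<psi>_def
        by (rule has_field_derivative_at_within) (rule test_function_deriv_chain[OF \<phi>, of 0, unfolded funpow_0])
      then show "(\<psi> has_integral \<phi> (2 * pi) - \<phi> y) {y..2 * pi}"
        using True fundamental_theorem_of_calculus[of y "2 * pi" \<phi> \<psi>] by simp
    qed
    also have "\<phi> (2 * pi) = 0" using test_function_ends[OF \<phi>, of "2 * pi" 0] by simp
    finally have "(LINT x|lborel. \<psi> x * indicator {..x} y) = - \<phi> y" by simp
    moreover have "(LINT x|lborel. ?f x y) = (LINT x|lborel. \<psi> x * indicator {..x} y) * w y"
      by (subst Bochner_Integration.integral_mult_left_zero[symmetric]) (simp add: mult.assoc)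
    ultimately show ?thesis by simp
  qed (simp add: w(2))
  show ?thesis using fub[unfolded 1 inner Bochner_Integration.integral_minus] by (simp only: \<psi>_def)
qed

text \<open>The half lines form an intersection stable generator, so the integral over every Borel
  set vanishes. The sets where \<open>w\<close> is positive or negative are then null.\<close>

lemma AE_zero_if_primitive_zero:
  assumes w: "integrable lborel w" and "\<And>x. primitive w x = 0"
  shows "AE x in lborel. w x = 0"
proof -
  have zero: "(LINT y|lborel. indicator A y * w y) = 0" if "A \<in> sets borel" for A :: "real set"
  proof -
    have "Int_stable (range (\<lambda>a. {..a::real}))"
      by (auto simp: Int_stable_def intro!: image_eqI[of _ _ "min _ _"])
    moreover have "range (\<lambda>a. {..a::real}) \<subseteq> Pow UNIV" by simp
    moreover have "A \<in> sigma_sets UNIV (range (\<lambda>a. {..a::real}))" using that by (simp add: borel_eq_atMost)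
    ultimately show ?thesis
    proof (induction rule: sigma_sets_induct_disjoint)
      case (basic A)
      then show ?case using assms(2) by (auto simp: primitive_def)
    next
      case (compl A)
      then have A: "A \<in> sets borel" by (simp add: borel_eq_atMost)
      \<comment> \<open>Complements need the integral over the whole line, which is a limit of half
        lines.\<close>
      have total: "(LINT y|lborel. w y) = 0"
      proof -
        have "(\<lambda>n. LINT y|lborel. indicator {..real n} y * w y) \<longlonglongrightarrow> (LINT y|lborel. w y)"
        proof (rule integral_dominated_convergence[where w = "\<lambda>y. \<bar>w y\<bar>"])
          show "AE y in lborel. (\<lambda>n. indicator {..real n} y * w y) \<longlonglongrightarrow> w y"
          proof (intro AE_I2 tendsto_eventually)
            fix y
            obtain N where "y \<le> real N" using real_arch_simple by blast
            then show "\<forall>\<^sub>F n in sequentially. indicator {..real n} y * w y = w y"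
              by (intro eventually_sequentiallyI[of N]) (auto simp: indicator_def intro: order_trans)
          qed
        qed (use w in \<open>auto simp: indicator_def\<close>)
        then show ?thesis using assms(2) LIMSEQ_unique[OF _ tendsto_const] unfolding primitive_def by fastforce
      qed
      have "(LINT y|lborel. indicator (UNIV - A) y * w y) = (LINT y|lborel. w y - indicator A y * w y)"
        by (intro Bochner_Integration.integral_cong refl) (auto simp: indicator_def)
      also have "\<dots> = 0" using w integrable_indicator_mult[OF w A] total compl by simp
      finally show ?case .
    next
      case (union A)
      then have A: "A i \<in> sets borel" for i by (auto simp: borel_eq_atMost)
      have "(LINT y:(\<Union>i. A i)|lborel. w y) = (\<Sum>i. (LINT y:(A i)|lborel. w y))"
        using union(1) A integrable_indicator_mult[OF w, of "\<Union>i. A i"]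
        by (intro lebesgue_integral_countable_add) (auto simp: disjoint_family_on_def set_integrable_def)
      then show ?case using union by (simp add: set_lebesgue_integral_def)
    qed auto
  qed
  have mw[measurable]: "w \<in> borel_measurable borel" using w by simp
  have pos: "AE x in lborel. v x \<le> 0"
    if v: "integrable lborel v" "\<And>A. A \<in> sets borel \<Longrightarrow> (LINT y|lborel. indicator A y * v y) = 0" for v :: "real \<Rightarrow> real"
  proof -
    have [measurable]: "v \<in> borel_measurable borel" using v by simp
    have A: "{x. 0 < v x} \<in> sets borel" by measurable
    have "AE x in lborel. indicator {x. 0 < v x} x * v x = 0"
      using v(2)[OF A] integrable_indicator_mult[OF v(1) A]
      by (subst (asm) integral_nonneg_eq_0_iff_AE) (auto simp: indicator_def)
    then show ?thesis by eventually_elim (auto simp: indicator_def split: if_splits)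
  qed
  have "AE x in lborel. w x \<le> 0" using pos[OF w zero] .
  moreover have "AE x in lborel. - w x \<le> 0" using w zero by (intro pos) auto
  ultimately show ?thesis by eventually_elim auto
qed

text \<open>The primitive of \<open>w\<close> has vanishing weak derivative, hence is constant on
  the domain, and it is 0 at the left end.\<close>

lemma eq_AE_by_testing:
  assumes w: "integrable lborel w" "\<And>x. x \<notin> Omega \<Longrightarrow> w x = 0"
    and test: "\<And>\<phi>. test_function \<phi> \<Longrightarrow> (LINT x|lborel. w x * \<phi> x) = 0"
  shows "AE x in lborel. w x = 0"
proof (rule AE_zero_if_primitive_zero[OF w(1)])
  obtain p where p: "\<And>x. x \<in> Omega \<Longrightarrow> primitive w x = poly p x"
    "\<And>x. x \<in> Omega \<Longrightarrow> poly ((pderiv ^^ Suc 0) p) x = 0"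
    using du_bois_reymond[OF continuous_on_primitive[OF w], of "Suc 0"] primitive_by_parts[OF w] test by auto
  have inf: "infinite Omega" using pi_gt_zero by simp
  have "pderiv p = 0"
  proof (rule ccontr)
    assume "pderiv p \<noteq> 0"
    then have "finite {x. poly (pderiv p) x = 0}" by (rule poly_roots_finite)
    moreover have "Omega \<subseteq> {x. poly (pderiv p) x = 0}" using p(2) by auto
    ultimately show False using inf finite_subset by blast
  qed
  then obtain c where c: "p = [:c:]" using pderiv_iszero by blast
  have "primitive w 0 = 0" using primitive_eq_integral[OF w, of 0] by simp
  then have "c = 0" using p(1)[of 0] c by simp
  fix x
  consider "x < 0" | "x \<in> Omega" | "2 * pi < x" by fastforce
  then show "primitive w x = 0"
  proof cases
    case 1
    then have "indicator {..x} y * w y = 0" for y using w(2)[of y] by (auto simp: indicator_def)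
    then show ?thesis by (simp only: primitive_def Bochner_Integration.integral_zero)
  next
    case 2
    then show ?thesis using p(1) c \<open>c = 0\<close> by simp
  next
    case 3
    then have "indicator {..x} y * w y = indicator {..2 * pi} y * w y" for y using w(2)[of y] by (auto simp: indicator_def)
    then have "primitive w x = primitive w (2 * pi)" by (simp only: primitive_def)
    then show ?thesis using p(1)[of "2 * pi"] c \<open>c = 0\<close> by simp
  qed
qed

lemma weak_deriv_zero_ext:
  assumes "is_weak_deriv i f v" "continuous_on Omega f"
  shows "integrable lborel (zero_ext v)" "x \<notin> Omega \<Longrightarrow> zero_ext v x = 0"
    and "test_function \<phi> \<Longrightarrow> (LINT x|lborel. zero_ext v x * \<phi> x) = (-1) ^ i * integral Omega (\<lambda>x. f x * (deriv ^^ i) \<phi> x)"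
proof -
  show "integrable lborel (zero_ext v)"
    using assms unfolding is_weak_deriv_def set_integrable_def zero_ext_def[abs_def] by simp
  show "x \<notin> Omega \<Longrightarrow> zero_ext v x = 0" by (simp add: zero_ext_def)
  assume \<phi>: "test_function \<phi>"
  then have "(LINT x:Omega|lborel. f x * (deriv ^^ i) \<phi> x) = (-1) ^ i * (LINT x:Omega|lborel. v x * \<phi> x)"
    using assms(1) unfolding is_weak_deriv_def by blast
  then have "integral Omega (\<lambda>x. f x * (deriv ^^ i) \<phi> x) = (-1) ^ i * (LINT x|lborel. zero_ext v x * \<phi> x)"
    unfolding integral_zero_ext_test[OF assms(2) \<phi>, symmetric]
    by (simp add: set_lebesgue_integral_def zero_ext_def mult.assoc)
  then show "(LINT x|lborel. zero_ext v x * \<phi> x) = (-1) ^ i * integral Omega (\<lambda>x. f x * (deriv ^^ i) \<phi> x)"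
    by (simp add: power_mult_distrib[symmetric] mult.assoc[symmetric])
qed

text \<open>Makes the norm independent of the representative picked by \<open>SOME\<close> in
  \<open>W_inf_norm\<close>.\<close>

lemma weak_deriv_unique:
  assumes "is_weak_deriv i f v" "is_weak_deriv i f v'" "continuous_on Omega f"
  shows "AE x in restrict_space lborel Omega. v x = v' x"
proof -
  note v = weak_deriv_zero_ext[OF assms(1,3)] and v' = weak_deriv_zero_ext[OF assms(2,3)]
  have "AE x in lborel. zero_ext v x - zero_ext v' x = 0"
  proof (rule eq_AE_by_testing)
    fix \<phi> assume \<phi>: "test_function \<phi>"
    show "(LINT x|lborel. (zero_ext v x - zero_ext v' x) * \<phi> x) = 0"
      using integrable_mult_test[OF v(1) \<phi>, of 0] integrable_mult_test[OF v'(1) \<phi>, of 0] v(3)[OF \<phi>] v'(3)[OF \<phi>]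
      by (simp add: left_diff_distrib)
  qed (use v v' in auto)
  then show ?thesis
    by (subst AE_restrict_space_iff) (auto elim!: eventually_mono simp: zero_ext_def)
qed

text \<open>The weak derivative chosen in \<open>W_inf_norm\<close> inherits finiteness of its norm
  from a bounded one by uniqueness. Finiteness comes first because \<open>real_of_ereal\<close>
  sends infinity to 0.\<close>

lemma weak_deriv_bounded_by_norm:
  assumes W: "in_W_inf n f" and f: "continuous_on Omega f" and i: "i \<le> n"
  obtains v where "is_weak_deriv i f v" "AE x in lborel. x \<in> Omega \<longrightarrow> \<bar>v x\<bar> \<le> W_inf_norm n f"
proof -
  define v where "v = (SOME g. is_weak_deriv i f g)"
  obtain g where g: "is_weak_deriv i f g" "Linf_norm g < \<infinity>" using W i unfolding in_W_inf_def by blast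
  have v: "is_weak_deriv i f v" unfolding v_def by (rule someI[of _ g]) (rule g)
  let ?R = "restrict_space lborel Omega"
  have meas: "h \<in> borel_measurable ?R" if "is_weak_deriv i f h" for h
    using that set_integrable_eq[of Omega lborel h] unfolding is_weak_deriv_def by auto
  have "Linf_norm v = Linf_norm g"
    unfolding Linf_norm_def
  proof (rule esssup_AE_cong)
    show "AE x in ?R. ereal \<bar>v x\<bar> = ereal \<bar>g x\<bar>"
      using weak_deriv_unique[OF v g(1) f] by eventually_elim simp
  qed (use meas[OF v] meas[OF g(1)] in measurable)
  then have fin: "Linf_norm v < \<infinity>" using g by simp
  have AE: "AE x in ?R. ereal \<bar>v x\<bar> \<le> Linf_norm v" unfolding Linf_norm_def by (rule esssup_AE)
  have "AE x in ?R. \<bar>v x\<bar> \<le> real_of_ereal (Linf_norm v)"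
    using AE
  proof eventually_elim
    case (elim x)
    then show ?case using fin by (cases "Linf_norm v") auto
  qed
  moreover have "real_of_ereal (Linf_norm v) \<le> W_inf_norm n f"
    unfolding W_inf_norm_def v_def using i by (intro Max_ge) auto
  ultimately have "AE x in ?R. \<bar>v x\<bar> \<le> W_inf_norm n f" by (auto elim!: eventually_mono)
  then have "AE x in lborel. x \<in> Omega \<longrightarrow> \<bar>v x\<bar> \<le> W_inf_norm n f"
    by (subst (asm) AE_restrict_space_iff) auto
  with v that show ?thesis by blast
qed

lemma primitive_lipschitz:
  assumes w: "integrable lborel w" and bnd: "AE x in lborel. \<bar>w x\<bar> \<le> M"
  shows "\<bar>primitive w x - primitive w y\<bar> \<le> M * \<bar>x - y\<bar>"
proof -
  have *: "\<bar>primitive w x - primitive w y\<bar> \<le> M * (x - y)" if "y \<le> x" for x y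
  proof -
    have "primitive w x - primitive w y = (LINT z|lborel. indicator {..x} z * w z - indicator {..y} z * w z)"
      unfolding primitive_def using integrable_indicator_mult[OF w] by simp
    also have "\<bar>\<dots>\<bar> \<le> (LINT z|lborel. norm (indicator {..x} z * w z - indicator {..y} z * w z))"
      using integral_norm_bound[of lborel "\<lambda>z. indicator {..x} z * w z - indicator {..y} z * w z"] by simp
    also have "\<dots> \<le> (LINT z|lborel. M * indicator {y..x} z)"
    proof (rule integral_mono_AE)
      show "integrable lborel (\<lambda>z. norm (indicator {..x} z * w z - indicator {..y} z * w z))"
        using integrable_indicator_mult[OF w] by simp
      show "AE z in lborel. norm (indicator {..x} z * w z - indicator {..y} z * w z) \<le> M * indicator {y..x} z"
        using bnd by eventually_elim (use that in \<open>auto simp: indicator_def\<close>)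
    qed (intro integrable_mult_right integrable_real_indicator, auto simp: emeasure_lborel_Icc_eq)
    also have "\<dots> = M * (x - y)" using that by simp
    finally show ?thesis .
  qed
  show ?thesis using *[of y x] *[of x y] by (cases "y \<le> x") (auto simp: abs_minus_commute)
qed

text \<open>Subtract from \<open>f\<close> an iterated primitive of its top weak derivative; what remains is a
  polynomial by the du Bois-Reymond lemma.\<close>

theorem sobolev_classical:
  assumes W: "in_W_inf (Suc n) f" and f: "continuous_on Omega f"
  defines "M \<equiv> W_inf_norm (Suc n) f"
  obtains g where "\<And>x. x \<in> Omega \<Longrightarrow> g 0 x = f x"
    "\<And>i x. i < n \<Longrightarrow> x \<in> Omega \<Longrightarrow> (g i has_real_derivative g (Suc i) x) (at x within Omega)"
    "\<And>i x. i \<le> n \<Longrightarrow> x \<in> Omega \<Longrightarrow> \<bar>g i x\<bar> \<le> M"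
    "\<And>x y. x \<in> Omega \<Longrightarrow> y \<in> Omega \<Longrightarrow> \<bar>g n x - g n y\<bar> \<le> M * \<bar>x - y\<bar>"
proof -
  obtain v where v: "is_weak_deriv (Suc n) f v" "AE x in lborel. x \<in> Omega \<longrightarrow> \<bar>v x\<bar> \<le> M"
    using weak_deriv_bounded_by_norm[OF W f, of "Suc n"] unfolding M_def by auto
  define w where "w = zero_ext v"
  note w = weak_deriv_zero_ext[OF v(1) f, folded w_def]
  \<comment> \<open>\<open>M\<close> bounds an absolute value at some point, because the domain is
    not a null set.\<close>
  have M0: "0 \<le> M"
  proof -
    have "\<not> (AE x in lborel. x \<notin> Omega)"
    proof
      assume "AE x in lborel. x \<notin> Omega"
      then have "emeasure lborel Omega = 0" by (subst (asm) AE_iff_measurable[of Omega]) auto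
      then show False by simp
    qed
    then obtain x where "x \<in> Omega" "\<bar>v x\<bar> \<le> M" using v(2) by (metis (mono_tags, lifting) eventually_mono)
    then show ?thesis by linarith
  qed
  have "AE x in lborel. \<bar>w x\<bar> \<le> M"
    using v(2) by eventually_elim (auto simp: w_def zero_ext_def indicator_def M0)
  note lip = primitive_lipschitz[OF w(1) this]
  define G where "G = rec_nat (primitive w) (\<lambda>i h x. integral {0..x} h)"
  have G0: "G 0 = primitive w" and GS: "G (Suc i) x = integral {0..x} (G i)" for i x by (simp_all add: G_def)
  have contG: "continuous_on Omega (G i)" for i
  proof (induction i)
    case 0
    show ?case unfolding G0 by (rule continuous_on_primitive[OF w(1,2)])
  next
    case (Suc i)
    have "G (Suc i) = (\<lambda>x. integral {0..x} (G i))" by (simp add: GS fun_eq_iff)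
    then show ?case using indefinite_integral_continuous_1[OF integrable_continuous_real[OF Suc]] by simp
  qed
  have dG: "(G (Suc i) has_real_derivative G i x) (at x within Omega)" if "x \<in> Omega" for i x
  proof -
    have "G (Suc i) = (\<lambda>x. integral {0..x} (G i))" by (simp add: GS fun_eq_iff)
    then show ?thesis using integral_has_real_derivative[OF contG that] by simp
  qed
  \<comment> \<open>\<open>g0 i\<close> is the derivative of order \<open>i\<close> of
    \<open>g0 0\<close>, the n-fold primitive of \<open>primitive w\<close>.\<close>
  define g0 where "g0 i = G (n - i)" for i
  have dg0: "(g0 i has_real_derivative g0 (Suc i) x) (at x within Omega)" if "i < n" "x \<in> Omega" for i x
  proof -
    have "n - i = Suc (n - Suc i)" using that by simp
    then show ?thesis using dG[OF that(2), of "n - Suc i"] by (simp add: g0_def)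
  qed
  have "integral Omega (\<lambda>x. (f x - g0 0 x) * (deriv ^^ Suc n) \<phi> x) = 0" if \<phi>: "test_function \<phi>" for \<phi>
  proof -
    have "integral Omega (\<lambda>x. g0 0 x * (deriv ^^ (n + Suc 0)) \<phi> x) =
        (-1) ^ n * integral Omega (\<lambda>x. g0 n x * (deriv ^^ Suc 0) \<phi> x)"
      using dg0 contG \<phi> by (intro test_by_parts_iterated) (auto simp: g0_def)
    also have "\<dots> = (-1) ^ Suc n * (LINT x|lborel. w x * \<phi> x)"
      using primitive_by_parts[OF w(1,2) \<phi>] by (simp add: g0_def G0)
    also have "\<dots> = integral Omega (\<lambda>x. f x * (deriv ^^ Suc n) \<phi> x)"
      unfolding w(3)[OF \<phi>] by (simp add: power_mult_distrib[symmetric] mult.assoc[symmetric])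
    finally have "integral Omega (\<lambda>x. g0 0 x * (deriv ^^ Suc n) \<phi> x) = integral Omega (\<lambda>x. f x * (deriv ^^ Suc n) \<phi> x)"
      by (simp del: funpow.simps)
    moreover have "integral Omega (\<lambda>x. (f x - g0 0 x) * (deriv ^^ Suc n) \<phi> x) =
        integral Omega (\<lambda>x. f x * (deriv ^^ Suc n) \<phi> x) - integral Omega (\<lambda>x. g0 0 x * (deriv ^^ Suc n) \<phi> x)"
      unfolding left_diff_distrib g0_def
      by (intro integral_diff integrable_continuous_real continuous_on_mult contG f test_function_continuous \<phi>)
    ultimately show ?thesis by simp
  qed
  then obtain p where p: "\<And>x. x \<in> Omega \<Longrightarrow> f x - g0 0 x = poly p x"
    "\<And>x. x \<in> Omega \<Longrightarrow> poly ((pderiv ^^ Suc n) p) x = 0"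
    using du_bois_reymond[of "\<lambda>x. f x - g0 0 x" "Suc n"] continuous_on_diff[OF f contG[of "n - 0"]]
    unfolding g0_def by blast
  define g where "g i x = g0 i x + poly ((pderiv ^^ i) p) x" for i x
  have gf: "g 0 x = f x" if "x \<in> Omega" for x using p(1)[OF that] by (simp add: g_def)
  have dg: "(g i has_real_derivative g (Suc i) x) (at x within Omega)" if "i < n" "x \<in> Omega" for i x
    using DERIV_add[OF dg0[OF that] has_field_derivative_at_within[OF poly_DERIV[of "(pderiv ^^ i) p" x]]]
    by (simp add: g_def[abs_def])
  have cg: "continuous_on Omega (g i)" for i
    unfolding g_def[abs_def] g0_def by (intro continuous_intros contG)
  show ?thesis
  proof (rule that)
    fix i x assume i: "i \<le> n" and x: "x \<in> Omega"
    obtain s where s: "is_weak_deriv i f s" "AE x in lborel. x \<in> Omega \<longrightarrow> \<bar>s x\<bar> \<le> M"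
      using weak_deriv_bounded_by_norm[OF W f, of i] i unfolding M_def by auto
    note zs = weak_deriv_zero_ext[OF s(1) f]
    show "\<bar>g i x\<bar> \<le> M"
    \<comment> \<open>Each order is bounded through its own weak derivative rather than by
      integrating the top one, so the length of the domain does not enter.\<close>
    proof (rule abs_bound_by_testing[OF cg zs(1) _ _ x])
      show "AE x in lborel. x \<in> Omega \<longrightarrow> \<bar>zero_ext s x\<bar> \<le> M"
        using s(2) by eventually_elim (auto simp: zero_ext_def)
      fix \<phi> assume \<phi>: "test_function \<phi>"
      have "integral Omega (\<lambda>x. g 0 x * (deriv ^^ (i + 0)) \<phi> x) = (-1) ^ i * integral Omega (\<lambda>x. g i x * (deriv ^^ 0) \<phi> x)"
        using dg i cg \<phi> by (intro test_by_parts_iterated) auto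
      moreover have "integral Omega (\<lambda>x. g 0 x * (deriv ^^ (i + 0)) \<phi> x) = integral Omega (\<lambda>x. f x * (deriv ^^ i) \<phi> x)"
        using gf by (intro integral_cong) auto
      ultimately have e: "integral Omega (\<lambda>x. f x * (deriv ^^ i) \<phi> x) = (-1) ^ i * integral Omega (\<lambda>x. g i x * \<phi> x)"
        by simp
      show "integral Omega (\<lambda>x. g i x * \<phi> x) = (LINT x|lborel. zero_ext s x * \<phi> x)"
        unfolding zs(3)[OF \<phi>] e by (simp add: power_mult_distrib[symmetric] mult.assoc[symmetric])
    qed
  next
    fix x y assume xy: "x \<in> Omega" "y \<in> Omega"
    let ?r = "(pderiv ^^ n) p"
    have inf: "infinite Omega" using pi_gt_zero by simp
    \<comment> \<open>So \<open>g n\<close> differs from the Lipschitz function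
      \<open>primitive w\<close> by a constant.\<close>
    have "pderiv ?r = 0"
    proof (rule ccontr)
      assume "pderiv ?r \<noteq> 0"
      then have "finite {x. poly (pderiv ?r) x = 0}" by (rule poly_roots_finite)
      moreover have "Omega \<subseteq> {x. poly (pderiv ?r) x = 0}" using p(2) by auto
      ultimately show False using inf finite_subset by blast
    qed
    then obtain c where "?r = [:c:]" using pderiv_iszero by blast
    then show "\<bar>g n x - g n y\<bar> \<le> M * \<bar>x - y\<bar>" using lip[of x y] by (simp add: g_def g0_def G0)
  qed (use gf dg in auto)
qed

section \<open>Regularity in time\<close>

lemma mvt_two_points:
  fixes f :: "real \<Rightarrow> real"
  assumes d: "\<And>z. z \<in> {a..b} \<Longrightarrow> (f has_real_derivative f' z) (at z within {a..b})"
    and xy: "x \<in> {a..b}" "y \<in> {a..b}" "x \<noteq> y"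
  obtains \<xi> where "\<xi> \<in> {a..b}" "\<bar>\<xi> - x\<bar> \<le> \<bar>y - x\<bar>" "f y - f x = (y - x) * f' \<xi>"
proof -
  have *: "\<exists>\<xi>\<in>{u<..<v}. f v - f u = f' \<xi> * (v - u)" if uv: "u < v" "u \<in> {a..b}" "v \<in> {a..b}" for u v
  proof (rule mvt_simple[OF uv(1)])
    fix z assume "u \<le> z" "z \<le> v"
    then have "(f has_real_derivative f' z) (at z within {u..v})"
      using uv by (intro has_field_derivative_subset[OF d]) auto
    then show "(f has_derivative (*) (f' z)) (at z within {u..v})" by (simp add: has_field_derivative_def)
  qed
  show ?thesis
  proof (cases "x < y")
    case True
    then obtain \<xi> where "\<xi> \<in> {x<..<y}" "f y - f x = f' \<xi> * (y - x)" using *[of x y] xy by blast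
    then show ?thesis using that[of \<xi>] xy by (auto simp: mult.commute)
  next
    case False
    then obtain \<xi> where "\<xi> \<in> {y<..<x}" "f x - f y = f' \<xi> * (x - y)" using *[of y x] xy by force
    then show ?thesis using that[of \<xi>] xy by (auto simp: algebra_simps)
  qed
qed

lemma continuous_on_uniform_approx:
  fixes f :: "real \<Rightarrow> real"
  assumes "\<And>e. e > 0 \<Longrightarrow> \<exists>g. continuous_on S g \<and> (\<forall>t\<in>S. \<bar>f t - g t\<bar> \<le> e)"
  shows "continuous_on S f"
  unfolding continuous_on_iff
proof (intro ballI allI impI)
  fix t e :: real assume t: "t \<in> S" and e: "e > 0"
  obtain g where g: "continuous_on S g" "\<And>t. t \<in> S \<Longrightarrow> \<bar>f t - g t\<bar> \<le> e / 4" using assms[of "e / 4"] e by auto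
  obtain d where d: "d > 0" "\<And>s. s \<in> S \<Longrightarrow> dist s t < d \<Longrightarrow> dist (g s) (g t) < e / 4"
    using g(1) t e unfolding continuous_on_iff by (metis zero_less_divide_iff zero_less_numeral)
  show "\<exists>d>0. \<forall>s\<in>S. dist s t < d \<longrightarrow> dist (f s) (f t) < e"
  proof (intro exI[of _ d] conjI ballI impI d(1))
    fix s assume "s \<in> S" "dist s t < d"
    then have "\<bar>g s - g t\<bar> < e / 4" "\<bar>f s - g s\<bar> \<le> e / 4" using d(2) g(2) by (auto simp: dist_real_def)
    then show "dist (f s) (f t) < e" using g(2)[OF t] e unfolding dist_real_def by linarith
  qed
qed

text \<open>Passage to the limit d = 0; the restriction to \<open>d \<le> 1\<close> matches the
  steps for which a neighbour in the domain exists.\<close>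

lemma le_if_all_approx:
  fixes A B K :: real
  assumes "\<And>d. 0 < d \<Longrightarrow> d \<le> 1 \<Longrightarrow> A \<le> B + K * d"
  shows "A \<le> B"
proof (rule field_le_epsilon)
  fix e :: real assume e: "0 < e"
  define d where "d = min 1 (e / (\<bar>K\<bar> + 1))"
  have d: "0 < d" "d \<le> 1" "d \<le> e / (\<bar>K\<bar> + 1)" using e by (auto simp: d_def)
  have "K * d \<le> \<bar>K\<bar> * d" using d(1) by (intro mult_right_mono) auto
  also have "\<dots> \<le> (\<bar>K\<bar> + 1) * d" using d(1) by (intro mult_right_mono) auto
  also have "\<dots> \<le> e" using d(3) by (simp add: field_simps)
  finally show "A \<le> B + e" using assms[OF d(1,2)] by linarith
qed

lemma neighbour_in_Omega:
  assumes "x \<in> Omega" "0 < d" "d \<le> 1"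
  obtains y where "y \<in> Omega" "y \<noteq> x" "\<bar>y - x\<bar> = d"
proof (cases "x \<le> pi")
  case True
  then show ?thesis using that[of "x + d"] assms pi_gt3 by auto
next
  case False
  then show ?thesis using that[of "x - d"] assms pi_gt3 by auto
qed

text \<open>In time, only \<open>U 0\<close> is known to be continuous and to satisfy the equation
  at positive times. All other time regularity is derived from the space bounds.\<close>

locale smooth_heat =
  fixes U :: "nat \<Rightarrow> real \<Rightarrow> real \<Rightarrow> real" and n :: nat and M T :: real
  assumes T: "0 < T" and n: "2 \<le> n"
    and dx: "\<And>i x t. i < n \<Longrightarrow> x \<in> Omega \<Longrightarrow> t \<in> {0..T} \<Longrightarrow>
      ((\<lambda>y. U i y t) has_real_derivative U (Suc i) x t) (at x within Omega)"
    and bound: "\<And>i x t. i \<le> n \<Longrightarrow> x \<in> Omega \<Longrightarrow> t \<in> {0..T} \<Longrightarrow> \<bar>U i x t\<bar> \<le> M"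
    and lip_top: "\<And>x y t. x \<in> Omega \<Longrightarrow> y \<in> Omega \<Longrightarrow> t \<in> {0..T} \<Longrightarrow> \<bar>U n x t - U n y t\<bar> \<le> M * \<bar>x - y\<bar>"
    and cont0: "\<And>x. x \<in> Omega \<Longrightarrow> continuous_on {0..T} (U 0 x)"
    and dt0: "\<And>x t. x \<in> Omega \<Longrightarrow> t \<in> {0<..T} \<Longrightarrow> (U 0 x has_real_derivative U 2 x t) (at t within {0..T})"
begin

lemma M_nonneg: "0 \<le> M"
  using bound[of 0 0 0] T by auto

lemma mvt_x:
  assumes "i < n" "x \<in> Omega" "y \<in> Omega" "x \<noteq> y" "t \<in> {0..T}"
  obtains \<xi> where "\<xi> \<in> Omega" "\<bar>\<xi> - x\<bar> \<le> \<bar>y - x\<bar>" "U i y t - U i x t = (y - x) * U (Suc i) \<xi> t"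
  by (rule mvt_two_points[of 0 "2 * pi" "\<lambda>y. U i y t" "\<lambda>y. U (Suc i) y t" x y]) (use assms dx in auto)

lemma lip_x:
  assumes "i \<le> n" "x \<in> Omega" "y \<in> Omega" "t \<in> {0..T}"
  shows "\<bar>U i x t - U i y t\<bar> \<le> M * \<bar>x - y\<bar>"
proof (cases "i = n \<or> x = y")
  case True
  then show ?thesis using lip_top assms by auto
next
  case False
  then obtain \<xi> where \<xi>: "\<xi> \<in> Omega" "U i y t - U i x t = (y - x) * U (Suc i) \<xi> t"
    using mvt_x[of i x y t] assms by (metis le_neq_implies_less)
  have "\<bar>U i y t - U i x t\<bar> \<le> \<bar>y - x\<bar> * M"
    unfolding \<xi>(2) abs_mult using bound[of "Suc i" \<xi> t] \<xi>(1) assms False by (intro mult_left_mono) auto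
  then show ?thesis by (simp add: abs_minus_commute mult.commute)
qed

lemma quotient_approx:
  assumes "i < n" "x \<in> Omega" "y \<in> Omega" "x \<noteq> y" "t \<in> {0..T}"
  shows "\<bar>(U i y t - U i x t) / (y - x) - U (Suc i) x t\<bar> \<le> M * \<bar>y - x\<bar>"
proof -
  obtain \<xi> where \<xi>: "\<xi> \<in> Omega" "\<bar>\<xi> - x\<bar> \<le> \<bar>y - x\<bar>" "U i y t - U i x t = (y - x) * U (Suc i) \<xi> t"
    using mvt_x[OF assms] by blast
  have "\<bar>U (Suc i) \<xi> t - U (Suc i) x t\<bar> \<le> M * \<bar>\<xi> - x\<bar>" using assms \<xi> by (intro lip_x) auto
  also have "\<dots> \<le> M * \<bar>y - x\<bar>" using \<xi> M_nonneg by (intro mult_left_mono) auto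
  finally show ?thesis using \<xi>(3) assms(4) by simp
qed

text \<open>A uniform limit of difference quotients in \<open>x\<close>: they approach the next
  derivative with an error independent of \<open>t\<close>.\<close>

lemma cont_t: "i \<le> n \<Longrightarrow> x \<in> Omega \<Longrightarrow> continuous_on {0..T} (U i x)"
proof (induction i arbitrary: x)
  case (Suc i)
  show ?case
  proof (rule continuous_on_uniform_approx)
    fix e :: real assume e: "e > 0"
    define d where "d = min 1 (e / (M + 1))"
    have d: "0 < d" "d \<le> 1" "d \<le> e / (M + 1)" unfolding d_def using e M_nonneg by auto
    obtain y where y: "y \<in> Omega" "y \<noteq> x" "\<bar>y - x\<bar> = d" using neighbour_in_Omega[OF Suc.prems(2) d(1,2)] by blast
    have "M * d \<le> (M + 1) * d" using d by (intro mult_right_mono) auto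
    also have "\<dots> \<le> e" using d(3) M_nonneg by (simp add: field_simps)
    finally have Md: "M * d \<le> e" .
    show "\<exists>g. continuous_on {0..T} g \<and> (\<forall>t\<in>{0..T}. \<bar>U (Suc i) x t - g t\<bar> \<le> e)"
    proof (intro exI conjI ballI)
      show "continuous_on {0..T} (\<lambda>t. (U i y t - U i x t) / (y - x))"
        using Suc y by (intro continuous_intros) auto
      fix t assume "t \<in> {0..T}"
      then show "\<bar>U (Suc i) x t - (U i y t - U i x t) / (y - x)\<bar> \<le> e"
        using quotient_approx[of i x y t] Suc.prems y Md by (simp add: abs_minus_commute)
    qed
  qed
qed (rule cont0)

lemma integrable_t: "i \<le> n \<Longrightarrow> x \<in> Omega \<Longrightarrow> 0 \<le> s \<Longrightarrow> t \<le> T \<Longrightarrow> U i x integrable_on {s..t}"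
  by (intro integrable_continuous_real continuous_on_subset[OF cont_t]) auto

text \<open>The difference quotients in \<open>x\<close> of the identity for \<open>i\<close> converge to the one for \<open>i + 1\<close>.\<close>

lemma ftc_t:
  assumes "i + 2 \<le> n" "x \<in> Omega" "0 \<le> s" "s \<le> t" "t \<le> T"
  shows "U i x t - U i x s = integral {s..t} (U (i + 2) x)"
  using assms(1,2)
proof (induction i arbitrary: x)
  case 0
  have "(U 2 x has_integral U 0 x t - U 0 x s) {s..t}"
  proof (rule fundamental_theorem_of_calculus_interior[OF assms(4)])
    show "continuous_on {s..t} (U 0 x)" by (rule continuous_on_subset[OF cont0[OF 0(2)]]) (use assms in auto)
    fix r assume r: "r \<in> {s<..<t}"
    then have "at r within {0..T} = at r" using assms by (intro at_within_interior) auto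
    then show "(U 0 x has_vector_derivative U 2 x r) (at r)"
      using dt0[of x r] r 0 assms by (auto simp: has_real_derivative_iff_has_vector_derivative)
  qed
  then show ?case by (simp only: add_0 integral_unique)
next
  case (Suc i)
  let ?D = "U (Suc i) x t - U (Suc i) x s - integral {s..t} (U (Suc i + 2) x)"
  have "\<bar>?D\<bar> \<le> 0"
  proof (rule le_if_all_approx[of _ _ "2 * M + M * (t - s)"])
    fix d :: real assume d: "0 < d" "d \<le> 1"
    obtain y where y: "y \<in> Omega" "y \<noteq> x" "\<bar>y - x\<bar> = d" using neighbour_in_Omega[OF Suc.prems(2) d] by blast
    let ?Q = "\<lambda>i r. (U i y r - U i x r) / (y - x)"
    have Q: "\<bar>?Q i r - U (Suc i) x r\<bar> \<le> M * d" if "i < n" "r \<in> {0..T}" for i r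
      using quotient_approx[of i x y r] that y Suc.prems by auto
    have IH: "U i z t - U i z s = integral {s..t} (U (i + 2) z)" if "z \<in> Omega" for z
      using Suc.IH[OF _ that] Suc.prems by simp
    have "?Q i t - ?Q i s = ((U i y t - U i y s) - (U i x t - U i x s)) / (y - x)"
      by (simp add: diff_divide_distrib)
    also have "\<dots> = integral {s..t} (?Q (i + 2))"
      unfolding IH[OF y(1)] IH[OF Suc.prems(2)] using y Suc.prems assms
      by (subst integral_diff[symmetric]) (auto intro!: integrable_t)
    finally have "?Q i t - ?Q i s = integral {s..t} (?Q (i + 2))" .
    moreover have "norm (integral {s..t} (\<lambda>r. ?Q (i + 2) r - U (Suc i + 2) x r)) \<le> M * d * (t - s)"
    proof (rule integral_bound[OF assms(4)])
      show "continuous_on {s..t} (\<lambda>r. ?Q (i + 2) r - U (Suc i + 2) x r)"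
        using y Suc.prems assms by (intro continuous_intros continuous_on_subset[OF cont_t]) auto
      show "norm (?Q (i + 2) r - U (Suc i + 2) x r) \<le> M * d" if "r \<in> {s..t}" for r
        using Q[of "i + 2" r] that assms Suc.prems by simp
    qed
    moreover have "integral {s..t} (\<lambda>r. ?Q (i + 2) r - U (Suc i + 2) x r) =
        integral {s..t} (?Q (i + 2)) - integral {s..t} (U (Suc i + 2) x)"
      using y Suc.prems assms
      by (intro integral_diff integrable_continuous_real continuous_intros continuous_on_subset[OF cont_t]) auto
    moreover have "\<bar>?Q i t - U (Suc i) x t\<bar> \<le> M * d" "\<bar>?Q i s - U (Suc i) x s\<bar> \<le> M * d"
      using assms Suc.prems by (auto intro!: Q)
    ultimately have "\<bar>?D\<bar> \<le> M * d + M * d + M * d * (t - s)"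
      unfolding real_norm_def by linarith
    then show "\<bar>?D\<bar> \<le> 0 + (2 * M + M * (t - s)) * d" by (simp add: algebra_simps)
  qed
  then show ?case by simp
qed

lemma lip_t_pre:
  assumes "i + 2 \<le> n" "x \<in> Omega" "0 \<le> s" "s \<le> t" "t \<le> T"
  shows "\<bar>U i x t - U i x s\<bar> \<le> M * (t - s)"
proof -
  have "norm (integral {s..t} (U (i + 2) x)) \<le> M * (t - s)"
    using assms bound[of "i + 2" x] by (intro integral_bound continuous_on_subset[OF cont_t]) auto
  then show ?thesis using ftc_t[OF assms] by simp
qed

text \<open>Reaches order n - 1, one beyond \<open>lip_t_pre\<close>. For a difference quotient with
  step d the increment in time integrates a difference of \<open>U (j + 2)\<close>, which is of size
  M d, so the division by d costs nothing.\<close>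

lemma lip_t:
  assumes "i < n" "x \<in> Omega" "0 \<le> s" "s \<le> t" "t \<le> T"
  shows "\<bar>U i x t - U i x s\<bar> \<le> M * (t - s)"
proof (cases i)
  case 0
  then show ?thesis using lip_t_pre[of 0] assms n by simp
next
  case (Suc j)
  then have j: "j + 2 \<le> n" using assms by simp
  show ?thesis
  proof (rule le_if_all_approx[of _ _ "2 * M"])
    fix d :: real assume d: "0 < d" "d \<le> 1"
    obtain y where y: "y \<in> Omega" "y \<noteq> x" "\<bar>y - x\<bar> = d" using neighbour_in_Omega[OF assms(2) d] by blast
    let ?Q = "\<lambda>r. (U j y r - U j x r) / (y - x)"
    have Q: "\<bar>?Q r - U i x r\<bar> \<le> M * d" if "r \<in> {0..T}" for r
      using quotient_approx[of j x y r] that y assms Suc j by auto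
    have "norm (integral {s..t} (\<lambda>r. U (j + 2) y r - U (j + 2) x r)) \<le> M * d * (t - s)"
    proof (rule integral_bound[OF assms(4)])
      show "continuous_on {s..t} (\<lambda>r. U (j + 2) y r - U (j + 2) x r)"
        using y assms j by (intro continuous_intros continuous_on_subset[OF cont_t]) auto
      show "norm (U (j + 2) y r - U (j + 2) x r) \<le> M * d" if "r \<in> {s..t}" for r
        using lip_x[of "j + 2" y x r] that assms y j by simp
    qed
    moreover have "integral {s..t} (\<lambda>r. U (j + 2) y r - U (j + 2) x r) = (U j y t - U j y s) - (U j x t - U j x s)"
      using ftc_t[OF j y(1) assms(3-5)] ftc_t[OF j assms(2-5)] y assms j
      by (subst integral_diff) (auto intro!: integrable_t)
    ultimately have "\<bar>(U j y t - U j y s) - (U j x t - U j x s)\<bar> \<le> d * (M * (t - s))" by (simp add: mult_ac)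
    moreover have "?Q t - ?Q s = ((U j y t - U j y s) - (U j x t - U j x s)) / (y - x)"
      by (simp add: diff_divide_distrib)
    ultimately have "\<bar>?Q t - ?Q s\<bar> \<le> M * (t - s)" using y d by (simp add: abs_divide divide_le_eq mult.commute)
    moreover have "\<bar>?Q t - U i x t\<bar> \<le> M * d" "\<bar>?Q s - U i x s\<bar> \<le> M * d" using Q assms by auto
    ultimately show "\<bar>U i x t - U i x s\<bar> \<le> M * (t - s) + 2 * M * d" by linarith
  qed
qed

text \<open>Interpolate between the Lipschitz bound in \<open>t\<close> of the derivative of order \<open>n - 1\<close> and that in
  \<open>x\<close> of the derivative of order \<open>n\<close>.\<close>

lemma holder_t:
  assumes "x \<in> Omega" "s \<in> {0..T}" "t \<in> {0..T}"
  shows "\<bar>U n x t - U n x s\<bar> \<le> (4 + 2 * sqrt T) * M * sqrt \<bar>t - s\<bar>"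
proof -
  have *: "\<bar>U n x t - U n x s\<bar> \<le> (4 + 2 * sqrt T) * M * sqrt (t - s)" if st: "0 \<le> s" "s < t" "t \<le> T" for s t
  proof -
    define r where "r = sqrt (t - s)"
    \<comment> \<open>A step of order sqrt (t - s) balances (t - s) / d against d; the divisor keeps
      it at most 1.\<close>
    define d where "d = r / (1 + sqrt T)"
    have r: "0 < r" "r \<le> sqrt T" "r * r = t - s" using st by (auto simp: r_def)
    have sT: "0 < 1 + sqrt T" using T by (simp add: add_pos_nonneg)
    have d: "0 < d" "d \<le> 1" using r sT by (auto simp: d_def)
    obtain y where y: "y \<in> Omega" "y \<noteq> x" "\<bar>y - x\<bar> = d" using neighbour_in_Omega[OF assms(1) d] by blast
    obtain j where j: "n = Suc j" using n by (cases n) auto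
    let ?Q = "\<lambda>r. (U j y r - U j x r) / (y - x)"
    have Q: "\<bar>?Q r - U n x r\<bar> \<le> M * d" if "r \<in> {0..T}" for r
      using quotient_approx[of j x y r] that y assms(1) j by auto
    have "\<bar>(U j y t - U j y s) - (U j x t - U j x s)\<bar> \<le> 2 * M * (t - s)"
      using lip_t[of j y s t] lip_t[of j x s t] assms(1) y st j by linarith
    moreover have "?Q t - ?Q s = ((U j y t - U j y s) - (U j x t - U j x s)) / (y - x)"
      by (simp add: diff_divide_distrib)
    ultimately have "\<bar>?Q t - ?Q s\<bar> \<le> 2 * M * (t - s) / d"
      using y d by (simp add: abs_divide divide_right_mono)
    also have "\<dots> = 2 * M * r * (1 + sqrt T)"
      using r sT by (simp add: d_def r(3)[symmetric])
    finally have "\<bar>?Q t - ?Q s\<bar> \<le> 2 * M * r * (1 + sqrt T)" .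
    moreover have "\<bar>?Q t - U n x t\<bar> \<le> M * d" "\<bar>?Q s - U n x s\<bar> \<le> M * d" using Q st by auto
    moreover have "M * d \<le> M * r"
      using M_nonneg r sT T divide_left_mono[of 1 "1 + sqrt T" r] unfolding d_def by (intro mult_left_mono) auto
    ultimately have "\<bar>U n x t - U n x s\<bar> \<le> 2 * M * r * (1 + sqrt T) + 2 * (M * r)" by linarith
    then show ?thesis unfolding r_def[symmetric] by (simp add: algebra_simps)
  qed
  show ?thesis
    using *[of s t] *[of t s] assms by (cases s t rule: linorder_cases) (auto simp: abs_minus_commute)
qed

text \<open>The integral identity yields a derivative on the closed time interval, including t = 0,
  which the equation itself does not cover.\<close>

lemma dt:
  assumes "i + 2 \<le> n" "x \<in> Omega" "t \<in> {0..T}"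
  shows "(U i x has_real_derivative U (i + 2) x t) (at t within {0..T})"
proof -
  let ?F = "\<lambda>t. U i x 0 + integral {0..t} (U (i + 2) x)"
  have "(?F has_real_derivative 0 + U (i + 2) x t) (at t within {0..T})"
    using assms by (intro DERIV_add DERIV_const integral_has_real_derivative cont_t)
  then have F: "(?F has_derivative (*) (U (i + 2) x t)) (at t within {0..T})"
    by (simp only: has_field_derivative_def add_0)
  have "U i x s = ?F s" if "s \<in> {0..T}" for s
    using ftc_t[OF assms(1,2), of 0 s] that by simp
  from has_derivative_transform[where f = ?F and g = "U i x", OF assms(3) this F] show ?thesis
    by (simp only: has_field_derivative_def)
qed

lemma continuous_x:
  assumes "i \<le> n" "t \<in> {0..T}" "S \<subseteq> Omega"
  shows "continuous_on S (\<lambda>x. U i x t)"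
proof (rule continuous_on_subset[OF _ assms(3)])
  show "continuous_on Omega (\<lambda>x. U i x t)"
  proof (rule lipschitz_on_continuous_on[of M], rule lipschitz_onI[OF _ M_nonneg])
    show "dist (U i x t) (U i y t) \<le> M * dist x y" if "x \<in> Omega" "y \<in> Omega" for x y
      using lip_x[of i x y t] assms that by (simp add: dist_real_def)
  qed
qed

lemma continuous_joint:
  assumes "i \<le> n"
  shows "continuous_on ({0..T} \<times> Omega) (\<lambda>(t, x). U i x t)"
  unfolding continuous_on_iff
proof (intro ballI allI impI)
  fix p :: "real \<times> real" and e :: real assume p: "p \<in> {0..T} \<times> Omega" and e: "0 < e"
  obtain t x where tx: "p = (t, x)" "t \<in> {0..T}" "x \<in> Omega" using p by auto
  obtain d where d: "0 < d" "\<And>s. s \<in> {0..T} \<Longrightarrow> dist s t < d \<Longrightarrow> dist (U i x s) (U i x t) < e / 2"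
    using cont_t[OF assms tx(3)] tx(2) e unfolding continuous_on_iff by (metis half_gt_zero)
  define d' where "d' = min d (e / (2 * (M + 1)))"
  have d': "0 < d'" "d' \<le> d" "d' \<le> e / (2 * (M + 1))" unfolding d'_def using d(1) e M_nonneg by auto
  show "\<exists>d>0. \<forall>q\<in>{0..T} \<times> Omega. dist q p < d \<longrightarrow> dist (case q of (t, x) \<Rightarrow> U i x t) (case p of (t, x) \<Rightarrow> U i x t) < e"
  proof (intro exI[of _ d'] conjI ballI impI d'(1))
    fix q :: "real \<times> real" assume q: "q \<in> {0..T} \<times> Omega" "dist q p < d'"
    obtain s y where sy: "q = (s, y)" "s \<in> {0..T}" "y \<in> Omega" using q by auto
    have "dist s t < d'" "dist y x < d'"
      using q(2) dist_fst_le[of q p] dist_snd_le[of q p] unfolding sy(1) tx(1) by auto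
    then have 1: "\<bar>U i x s - U i x t\<bar> < e / 2" and yx: "\<bar>y - x\<bar> < d'"
      using d(2)[OF sy(2)] d' by (auto simp: dist_real_def)
    have "\<bar>U i y s - U i x s\<bar> \<le> M * \<bar>y - x\<bar>" by (rule lip_x[OF assms sy(3) tx(3) sy(2)])
    also have "\<dots> \<le> M * d'" using yx M_nonneg by (intro mult_left_mono) auto
    also have "\<dots> \<le> (M + 1) * d'" using d'(1) by (intro mult_right_mono) auto
    also have "\<dots> \<le> e / 2" using d'(3) M_nonneg by (simp add: field_simps)
    finally show "dist (case q of (t, x) \<Rightarrow> U i x t) (case p of (t, x) \<Rightarrow> U i x t) < e"
      using 1 unfolding sy(1) tx(1) dist_real_def prod.case by linarith
  qed
qed

lemma dt_integral:
  assumes i: "i + 2 \<le> n" and ab: "{a..b} \<subseteq> Omega" and t: "t \<in> {0..T}"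
  shows "((\<lambda>t. integral {a..b} (\<lambda>x. U i x t * poly p x)) has_real_derivative
    integral {a..b} (\<lambda>x. U (i + 2) x t * poly p x)) (at t within {0..T})"
proof -
  have "((\<lambda>t. integral (cbox a b) (\<lambda>x. U i x t * poly p x)) has_real_derivative
    integral (cbox a b) (\<lambda>x. U (i + 2) x t * poly p x)) (at t within {0..T})"
  proof (rule leibniz_rule_field_derivative[where fx = "\<lambda>t x. U (i + 2) x t * poly p x"])
    show "((\<lambda>t. U i x t * poly p x) has_real_derivative U (i + 2) x s * poly p x) (at s within {0..T})"
      if "s \<in> {0..T}" "x \<in> cbox a b" for s x
      using that ab i by (intro DERIV_cmult_right dt) auto
    show "(\<lambda>x. U i x s * poly p x) integrable_on cbox a b" if "s \<in> {0..T}" for s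
      using that ab i by (auto intro!: integrable_continuous_real continuous_intros continuous_x)
    have "{0..T} \<times> cbox a b \<subseteq> {0..T} \<times> Omega" using ab by auto
    then have "continuous_on ({0..T} \<times> cbox a b) (\<lambda>z. (case z of (t, x) \<Rightarrow> U (i + 2) x t) * poly p (snd z))"
      by (intro continuous_on_mult continuous_on_subset[OF continuous_joint[OF i]] continuous_intros)
    then show "continuous_on ({0..T} \<times> cbox a b) (\<lambda>(t, x). U (i + 2) x t * poly p x)"
      by (simp add: case_prod_unfold)
  qed (use t in auto)
  then show ?thesis by simp
qed

lemma dt_moment:
  assumes "i + 2 \<le> n" "{a..b} \<subseteq> Omega" "t \<in> {0..T}"
  shows "((\<lambda>t. moment a b (\<lambda>x. U i x t) m) has_real_derivative moment a b (\<lambda>x. U (i + 2) x t) m) (at t within {0..T})"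
  unfolding moment_def by (intro DERIV_cmult dt_integral assms)

lemma dt_radau_coef:
  assumes "i + 2 \<le> n" "a < b" "{a..b} \<subseteq> Omega" "t \<in> {0..T}"
  shows "((\<lambda>t. radau_coef k fl a b (\<lambda>x. U i x t)) has_real_derivative
    radau_coef k fl a b (\<lambda>x. U (i + 2) x t)) (at t within {0..T})"
  unfolding radau_coef_def
  using assms end_pt_in[OF assms(2), of fl]
  by (intro DERIV_diff DERIV_sum DERIV_cmult dt_moment dt) auto

end

section \<open>Approximation on a cell\<close>

text \<open>Integrate the approximation of the derivative. Starting from a constant at order
  \<open>m\<close> uses only the oscillation of \<open>f m\<close>, which a Lipschitz top derivative
  supplies.\<close>

lemma taylor_approx:
  fixes f :: "nat \<Rightarrow> real \<Rightarrow> real"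
  assumes ab: "a < b"
    and d: "\<And>i x. i < m \<Longrightarrow> x \<in> {a..b} \<Longrightarrow> (f i has_real_derivative f (Suc i) x) (at x within {a..b})"
    and L: "\<And>x. x \<in> {a..b} \<Longrightarrow> \<bar>f m x - f m a\<bar> \<le> L"
  shows "\<exists>p. degree p \<le> m \<and> (\<forall>x\<in>{a..b}. \<bar>f 0 x - poly p x\<bar> \<le> L * (b - a) ^ m) \<and>
    (0 < m \<longrightarrow> (\<forall>x\<in>{a..b}. \<bar>f 1 x - poly (pderiv p) x\<bar> \<le> L * (b - a) ^ (m - 1)))"
  using d L
proof (induction m arbitrary: f)
  case 0
  then show ?case by (intro exI[of _ "[:f 0 a:]"]) auto
next
  case (Suc m)
  obtain q where q: "degree q \<le> m" "\<And>x. x \<in> {a..b} \<Longrightarrow> \<bar>f 1 x - poly q x\<bar> \<le> L * (b - a) ^ m"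
    using Suc.IH[of "\<lambda>i. f (Suc i)"] Suc.prems by auto
  define p where "p = antiderivative q - [:poly (antiderivative q) a - f 0 a:]"
  have pq: "pderiv p = q" unfolding p_def by (simp add: pderiv_diff pderiv_antiderivative pderiv_pCons)
  have pa: "poly p a = f 0 a" by (simp add: p_def)
  have "degree p \<le> Suc m"
    using q(1) degree_pderiv[of p] unfolding pq by simp
  moreover have "\<bar>f 0 x - poly p x\<bar> \<le> L * (b - a) ^ Suc m" if x: "x \<in> {a..b}" for x
  proof (cases "x = a")
    case True
    have "0 \<le> L" using Suc.prems(2)[of a] ab by auto
    then show ?thesis using True pa ab by simp
  next
    case False
    have dd: "((\<lambda>z. f 0 z - poly p z) has_real_derivative f 1 z - poly q z) (at z within {a..b})"
      if "z \<in> {a..b}" for z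
    proof (rule DERIV_diff)
      show "(f 0 has_real_derivative f 1 z) (at z within {a..b})" using Suc.prems(1)[of 0 z] that by simp
      show "((\<lambda>z. poly p z) has_real_derivative poly q z) (at z within {a..b})"
        using poly_DERIV[of p z] unfolding pq by (rule has_field_derivative_at_within)
    qed
    obtain \<xi> where \<xi>: "\<xi> \<in> {a..b}" "\<bar>\<xi> - a\<bar> \<le> \<bar>x - a\<bar>"
      "(f 0 x - poly p x) - (f 0 a - poly p a) = (x - a) * (f 1 \<xi> - poly q \<xi>)"
      by (rule mvt_two_points[of a b "\<lambda>z. f 0 z - poly p z" "\<lambda>z. f 1 z - poly q z" a x, OF dd])
         (use x ab False in auto)
    have "\<bar>f 0 x - poly p x\<bar> = \<bar>x - a\<bar> * \<bar>f 1 \<xi> - poly q \<xi>\<bar>" using \<xi>(3) pa by (simp add: abs_mult)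
    also have "\<dots> \<le> (b - a) * (L * (b - a) ^ m)" using q(2)[OF \<xi>(1)] x by (intro mult_mono) auto
    finally show ?thesis by (simp add: mult_ac)
  qed
  moreover have "\<bar>f 1 x - poly (pderiv p) x\<bar> \<le> L * (b - a) ^ (Suc m - 1)" if "x \<in> {a..b}" for x
    using q(2)[OF that] unfolding pq by simp
  ultimately show ?case by (intro exI[of _ p] conjI ballI impI)
qed

text \<open>The Taylor polynomial is treated exactly, by invariance for degree \<open>k\<close> and
  by superconvergence for degree \<open>k + 1\<close>. Stability applies to the remainder, whose
  projected derivative loses one power of the length.\<close>

lemma radau_approximation:
  assumes k: "1 \<le> k"
  obtains C where "C \<ge> 1"
    "\<And>a b f L fl. a < b \<Longrightarrow>
      (\<And>i x. i < k \<Longrightarrow> x \<in> {a..b} \<Longrightarrow> (f i has_real_derivative f (Suc i) x) (at x within {a..b})) \<Longrightarrow>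
      (\<And>x. x \<in> {a..b} \<Longrightarrow> \<bar>f k x - f k a\<bar> \<le> L) \<Longrightarrow>
      \<bar>radau_coef k fl a b (f 0)\<bar> \<le> C * (L * (b - a) ^ k)"
    "\<And>a b f L fl x. a < b \<Longrightarrow>
      (\<And>i x. i < k + 1 \<Longrightarrow> x \<in> {a..b} \<Longrightarrow> (f i has_real_derivative f (Suc i) x) (at x within {a..b})) \<Longrightarrow>
      (\<And>x. x \<in> {a..b} \<Longrightarrow> \<bar>f (k + 1) x - f (k + 1) a\<bar> \<le> L) \<Longrightarrow> radau_zero k fl a b x \<Longrightarrow>
      \<bar>f 1 x - poly (pderiv (radau_proj k fl a b (f 0))) x\<bar> \<le> C * (L * (b - a) ^ k)"
proof -
  obtain C where C: "C \<ge> 1"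
    "\<And>a b v A fl. a < b \<Longrightarrow> continuous_on {a..b} v \<Longrightarrow> (\<And>x. x \<in> {a..b} \<Longrightarrow> \<bar>v x\<bar> \<le> A) \<Longrightarrow>
      \<bar>radau_coef k fl a b v\<bar> \<le> C * A"
    "\<And>a b v A fl x. a < b \<Longrightarrow> continuous_on {a..b} v \<Longrightarrow> (\<And>x. x \<in> {a..b} \<Longrightarrow> \<bar>v x\<bar> \<le> A) \<Longrightarrow>
      x \<in> {a..b} \<Longrightarrow> \<bar>poly (pderiv (radau_proj k fl a b v)) x\<bar> \<le> C * A / (b - a)"
    using radau_stability[of k] by metis
  show ?thesis
  proof (rule that[of "1 + C"])
    show "1 + C \<ge> 1" using C by simp
    fix a b L :: real and f :: "nat \<Rightarrow> real \<Rightarrow> real" and fl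
    assume ab: "a < b"
    {
      assume d: "\<And>i x. i < k \<Longrightarrow> x \<in> {a..b} \<Longrightarrow> (f i has_real_derivative f (Suc i) x) (at x within {a..b})"
        and L: "\<And>x. x \<in> {a..b} \<Longrightarrow> \<bar>f k x - f k a\<bar> \<le> L"
      have L0: "0 \<le> L" using L[of a] ab by auto
      have "\<exists>p. degree p \<le> k \<and> (\<forall>x\<in>{a..b}. \<bar>f 0 x - poly p x\<bar> \<le> L * (b - a) ^ k) \<and>
        (0 < k \<longrightarrow> (\<forall>x\<in>{a..b}. \<bar>f 1 x - poly (pderiv p) x\<bar> \<le> L * (b - a) ^ (k - 1)))"
        by (rule taylor_approx[OF ab]) (assumption | rule d L)+
      then obtain p where p: "degree p \<le> k" "\<And>x. x \<in> {a..b} \<Longrightarrow> \<bar>f 0 x - poly p x\<bar> \<le> L * (b - a) ^ k"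
        by auto
      have cf: "continuous_on {a..b} (f 0)" using k by (intro DERIV_continuous_on[OF d]) auto
      have cp: "continuous_on {a..b} (poly p)" by (intro continuous_on_poly continuous_on_id)
      have "radau_coef k fl a b (f 0) = radau_coef k fl a b (\<lambda>x. f 0 x - poly p x)"
        using radau_coef_diff[OF cf cp] radau_coef_poly[OF ab p(1)] by simp
      also have "\<bar>\<dots>\<bar> \<le> C * (L * (b - a) ^ k)" by (intro C(2) ab p(2) continuous_on_diff cf cp)
      also have "\<dots> \<le> (1 + C) * (L * (b - a) ^ k)" using L0 ab by (intro mult_right_mono) auto
      finally show "\<bar>radau_coef k fl a b (f 0)\<bar> \<le> (1 + C) * (L * (b - a) ^ k)" .
    }
    fix x
    assume d: "\<And>i x. i < k + 1 \<Longrightarrow> x \<in> {a..b} \<Longrightarrow> (f i has_real_derivative f (Suc i) x) (at x within {a..b})"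
      and L: "\<And>x. x \<in> {a..b} \<Longrightarrow> \<bar>f (k + 1) x - f (k + 1) a\<bar> \<le> L" and z: "radau_zero k fl a b x"
    have x: "x \<in> {a..b}" by (rule radau_zero_in_interval[OF ab z])
    have "\<exists>p. degree p \<le> k + 1 \<and> (\<forall>x\<in>{a..b}. \<bar>f 0 x - poly p x\<bar> \<le> L * (b - a) ^ (k + 1)) \<and>
      (0 < k + 1 \<longrightarrow> (\<forall>x\<in>{a..b}. \<bar>f 1 x - poly (pderiv p) x\<bar> \<le> L * (b - a) ^ (k + 1 - 1)))"
      by (rule taylor_approx[OF ab]) (assumption | rule d L)+
    then obtain p where p': "degree p \<le> k + 1" "\<forall>x\<in>{a..b}. \<bar>f 0 x - poly p x\<bar> \<le> L * (b - a) ^ (k + 1)"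
      "0 < k + 1 \<longrightarrow> (\<forall>x\<in>{a..b}. \<bar>f 1 x - poly (pderiv p) x\<bar> \<le> L * (b - a) ^ (k + 1 - 1))"
      by (elim exE conjE)
    have p: "degree p \<le> k + 1" "\<And>x. x \<in> {a..b} \<Longrightarrow> \<bar>f 0 x - poly p x\<bar> \<le> L * (b - a) ^ (k + 1)"
      "\<And>x. x \<in> {a..b} \<Longrightarrow> \<bar>f 1 x - poly (pderiv p) x\<bar> \<le> L * (b - a) ^ k"
      using p' by simp_all
    have cf: "continuous_on {a..b} (f 0)" using k by (intro DERIV_continuous_on[OF d]) auto
    have cp: "continuous_on {a..b} (poly p)" by (intro continuous_on_poly continuous_on_id)
    have "radau_proj k fl a b (\<lambda>x. f 0 x - poly p x) = radau_proj k fl a b (f 0) - radau_proj k fl a b (poly p)"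
      by (rule radau_proj_diff[OF cf cp])
    then have e: "poly (pderiv (radau_proj k fl a b (\<lambda>x. f 0 x - poly p x))) x =
        poly (pderiv (radau_proj k fl a b (f 0))) x - poly (pderiv p) x"
      using radau_proj_superconvergence[OF ab k p(1) z] by (simp add: pderiv_diff)
    have "\<bar>poly (pderiv (radau_proj k fl a b (\<lambda>x. f 0 x - poly p x))) x\<bar> \<le> C * (L * (b - a) ^ (k + 1)) / (b - a)"
      by (intro C(3) ab p(2) continuous_on_diff cf cp x)
    also have "\<dots> = C * (L * (b - a) ^ k)" using ab by simp
    finally have "\<bar>poly (pderiv (radau_proj k fl a b (f 0))) x - poly (pderiv p) x\<bar> \<le> C * (L * (b - a) ^ k)"
      unfolding e .
    moreover have "\<bar>f 1 x - poly (pderiv p) x\<bar> \<le> L * (b - a) ^ k" by (rule p(3)[OF x])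
    ultimately have "\<bar>f 1 x - poly (pderiv (radau_proj k fl a b (f 0))) x\<bar> \<le> L * (b - a) ^ k + C * (L * (b - a) ^ k)"
      by linarith
    then show "\<bar>f 1 x - poly (pderiv (radau_proj k fl a b (f 0))) x\<bar> \<le> (1 + C) * (L * (b - a) ^ k)"
      by (simp add: algebra_simps)
  qed
qed

section \<open>Duality for perturbed gradient flows\<close>

definition mat_app :: "'i set \<Rightarrow> ('i \<Rightarrow> 'i \<Rightarrow> real) \<Rightarrow> ('i \<Rightarrow> real) \<Rightarrow> 'i \<Rightarrow> real" where
  "mat_app I A v = (\<lambda>a. \<Sum>b\<in>I. A a b * v b)"

abbreviation (input) transp_mat :: "('i \<Rightarrow> 'i \<Rightarrow> real) \<Rightarrow> 'i \<Rightarrow> 'i \<Rightarrow> real" where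
  "transp_mat A \<equiv> (\<lambda>a b. A b a)"

lemma mat_app_adjoint:
  "(\<Sum>a\<in>I. u a * mat_app I A v a) = (\<Sum>b\<in>I. mat_app I (transp_mat A) u b * v b)"
proof -
  have "(\<Sum>a\<in>I. u a * mat_app I A v a) = (\<Sum>a\<in>I. \<Sum>b\<in>I. A a b * u a * v b)"
    by (simp add: mat_app_def sum_distrib_left mult_ac)
  also have "\<dots> = (\<Sum>b\<in>I. \<Sum>a\<in>I. A a b * u a * v b)" by (rule sum.swap)
  also have "\<dots> = (\<Sum>b\<in>I. mat_app I (transp_mat A) u b * v b)"
    by (simp add: mat_app_def sum_distrib_right)
  finally show ?thesis .
qed

text \<open>The exponential series of \<open>S\<close> applied to \<open>v\<close>, coefficient by
  coefficient.\<close>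

lemma linear_ode_exists:
  fixes S :: "'i \<Rightarrow> 'i \<Rightarrow> real"
  assumes fin: "finite I"
  obtains \<psi> where "\<psi> 0 = v"
    "\<And>t a. a \<in> I \<Longrightarrow> ((\<lambda>t. \<psi> t a) has_real_derivative mat_app I S (\<psi> t) a) (at t)"
proof -
  define c where "c = rec_nat v (\<lambda>n f a. mat_app I S f a / real (Suc n))"
  have c0: "c 0 = v" and cS: "c (Suc n) a = mat_app I S (c n) a / real (Suc n)" for n a
    by (simp_all add: c_def)
  \<comment> \<open>The sum of all absolute entries dominates every row sum, which is enough for
    convergence at all times.\<close>
  define Q where "Q = (\<Sum>a\<in>I. \<Sum>b\<in>I. \<bar>S a b\<bar>)"
  define R where "R = (\<Sum>a\<in>I. \<bar>v a\<bar>)"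
  have Q0: "Q \<ge> 0" and R0: "R \<ge> 0" unfolding Q_def R_def by (auto intro!: sum_nonneg)
  have row: "(\<Sum>b\<in>I. \<bar>S a b\<bar>) \<le> Q" if "a \<in> I" for a
    unfolding Q_def using fin that by (intro member_le_sum) (auto intro!: sum_nonneg)
  have bound: "\<bar>c n a\<bar> \<le> R * Q ^ n / fact n" if "a \<in> I" for n a
    using that
  proof (induction n arbitrary: a)
    case 0
    then show ?case unfolding c0 R_def using fin by (auto intro!: member_le_sum)
  next
    case (Suc n)
    have "\<bar>mat_app I S (c n) a\<bar> \<le> (\<Sum>b\<in>I. \<bar>S a b\<bar> * (R * Q ^ n / fact n))"
      unfolding mat_app_def
      by (rule order_trans[OF sum_abs], rule sum_mono) (simp only: abs_mult, intro mult_left_mono Suc.IH, auto)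
    also have "\<dots> = (\<Sum>b\<in>I. \<bar>S a b\<bar>) * (R * Q ^ n / fact n)" by (rule sum_distrib_right[symmetric])
    also have "\<dots> \<le> Q * (R * Q ^ n / fact n)"
      using Q0 R0 by (intro mult_right_mono row Suc.prems) auto
    finally have "\<bar>mat_app I S (c n) a\<bar> / real (Suc n) \<le> Q * (R * Q ^ n / fact n) / real (Suc n)"
      by (intro divide_right_mono) auto
    also have "\<dots> = R * Q ^ Suc n / fact (Suc n)" by (simp add: mult_ac)
    finally show ?case unfolding cS by simp
  qed
  have summ: "summable (\<lambda>n. c n a * t ^ n)" if "a \<in> I" for a t
  proof (rule summable_comparison_test')
    show "summable (\<lambda>n. R * (inverse (fact n) * (Q * \<bar>t\<bar>) ^ n))"
      by (intro summable_mult summable_exp)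
    show "norm (c n a * t ^ n) \<le> R * (inverse (fact n) * (Q * \<bar>t\<bar>) ^ n)" for n
    proof -
      have "norm (c n a * t ^ n) = \<bar>c n a\<bar> * \<bar>t\<bar> ^ n" by (simp add: abs_mult power_abs)
      also have "\<dots> \<le> (R * Q ^ n / fact n) * \<bar>t\<bar> ^ n" by (intro mult_right_mono bound that) auto
      finally show ?thesis by (simp add: power_mult_distrib field_simps)
    qed
  qed
  define \<psi> where "\<psi> t a = (\<Sum>n. c n a * t ^ n)" for t a
  have "((\<lambda>t. \<psi> t a) has_real_derivative mat_app I S (\<psi> t) a) (at t)" if a: "a \<in> I" for t a
  proof -
    have "diffs (\<lambda>n. c n a) n * t ^ n = (\<Sum>b\<in>I. S a b * (c n b * t ^ n))" for n
    proof -
      have "diffs (\<lambda>n. c n a) n = mat_app I S (c n) a" by (simp add: diffs_def cS)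
      then show ?thesis by (simp add: mat_app_def sum_distrib_right mult.assoc)
    qed
    then have "(\<Sum>n. diffs (\<lambda>n. c n a) n * t ^ n) = (\<Sum>n. \<Sum>b\<in>I. S a b * (c n b * t ^ n))"
      by simp
    also have "\<dots> = (\<Sum>b\<in>I. \<Sum>n. S a b * (c n b * t ^ n))"
      by (rule suminf_sum) (intro summable_mult summ)
    also have "\<dots> = mat_app I S (\<psi> t) a"
      unfolding mat_app_def \<psi>_def by (intro sum.cong refl suminf_mult summ)
    finally show ?thesis
      using termdiffs_strong_converges_everywhere[OF summ[OF a], of t] unfolding \<psi>_def by simp
  qed
  moreover have "\<psi> 0 a = v a" for a
    unfolding \<psi>_def c0[symmetric] by (subst powser_zero) simp
  then have "\<psi> 0 = v" by auto
  ultimately show ?thesis using that by blast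
qed

section \<open>Smoothing estimates for the matrix heat flow\<close>

definition heat_flow :: "'i set \<Rightarrow> ('i \<Rightarrow> 'i \<Rightarrow> real) \<Rightarrow> (real \<Rightarrow> 'i \<Rightarrow> real) \<Rightarrow> bool" where
  "heat_flow I G \<psi> \<longleftrightarrow> (\<forall>t. \<forall>a\<in>I. ((\<lambda>t. \<psi> t a) has_real_derivative
     - mat_app I (transp_mat G) (mat_app I G (\<psi> t)) a) (at t))"

lemma heat_flow_exists:
  assumes "finite I"
  obtains \<psi> where "\<psi> 0 = v" "heat_flow I G \<psi>"
proof -
  define S where "S = (\<lambda>a b. - (\<Sum>c\<in>I. G c a * G c b))"
  obtain \<psi> where 0: "\<psi> 0 = v"
    "\<And>t a. a \<in> I \<Longrightarrow> ((\<lambda>t. \<psi> t a) has_real_derivative mat_app I S (\<psi> t) a) (at t)"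
    using linear_ode_exists[OF assms] by metis
  have "mat_app I S w a = - mat_app I (transp_mat G) (mat_app I G w) a" for w a
  proof -
    have "(\<Sum>b\<in>I. \<Sum>c\<in>I. G c a * G c b * w b) = (\<Sum>c\<in>I. \<Sum>b\<in>I. G c a * G c b * w b)"
      by (rule sum.swap)
    then show ?thesis
      unfolding S_def mat_app_def
      by (simp add: sum_distrib_left sum_distrib_right sum_negf mult_ac)
  qed
  with 0 have "heat_flow I G \<psi>" unfolding heat_flow_def by simp
  with 0 that show ?thesis by blast
qed

text \<open>The image under \<open>G\<close> solves the flow with the two factors exchanged, so
  every estimate can be iterated.\<close>

lemma heat_flow_mat_app:
  assumes "heat_flow I G \<psi>"
  shows "heat_flow I (transp_mat G) (\<lambda>t. mat_app I G (\<psi> t))"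
  unfolding heat_flow_def
proof (intro allI ballI)
  fix t a
  have "((\<lambda>t. \<Sum>b\<in>I. G a b * \<psi> t b) has_real_derivative
      (\<Sum>b\<in>I. G a b * (- mat_app I (transp_mat G) (mat_app I G (\<psi> t)) b))) (at t)"
    using assms unfolding heat_flow_def by (intro DERIV_sum DERIV_cmult) auto
  then show "((\<lambda>t. mat_app I G (\<psi> t) a) has_real_derivative
      - mat_app I G (mat_app I (transp_mat G) (mat_app I G (\<psi> t))) a) (at t)"
    by (simp add: mat_app_def sum_negf)
qed

lemma heat_flow_energy:
  assumes "heat_flow I G \<psi>"
  shows "((\<lambda>t. \<Sum>a\<in>I. (\<psi> t a)\<^sup>2) has_real_derivative - 2 * (\<Sum>a\<in>I. (mat_app I G (\<psi> t) a)\<^sup>2)) (at t)"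
proof -
  let ?d = "\<lambda>a. - mat_app I (transp_mat G) (mat_app I G (\<psi> t)) a"
  have "((\<lambda>t. \<Sum>a\<in>I. (\<psi> t a)\<^sup>2) has_real_derivative (\<Sum>a\<in>I. 2 * \<psi> t a * ?d a)) (at t)"
    using assms unfolding heat_flow_def
    by (intro DERIV_sum) (auto intro!: derivative_eq_intros simp: algebra_simps)
  moreover have "(\<Sum>a\<in>I. 2 * \<psi> t a * ?d a) =
      - 2 * (\<Sum>a\<in>I. \<psi> t a * mat_app I (transp_mat G) (mat_app I G (\<psi> t)) a)"
    by (simp add: sum_distrib_left sum_negf mult_ac)
  ultimately show ?thesis by (subst (asm) mat_app_adjoint) (simp add: power2_eq_square)
qed

lemma heat_flow_antimono:
  assumes "heat_flow I G \<psi>" "s \<le> t"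
  shows "(\<Sum>a\<in>I. (\<psi> t a)\<^sup>2) \<le> (\<Sum>a\<in>I. (\<psi> s a)\<^sup>2)"
proof (rule DERIV_nonpos_imp_nonincreasing[OF assms(2)])
  fix r
  show "\<exists>y. ((\<lambda>t. \<Sum>a\<in>I. (\<psi> t a)\<^sup>2) has_real_derivative y) (at r) \<and> y \<le> 0"
    using heat_flow_energy[OF assms(1), of r]
    by (intro exI[of _ "- 2 * (\<Sum>a\<in>I. (mat_app I G (\<psi> r) a)\<^sup>2)"]) (simp add: sum_nonneg)
qed

text \<open>The energy lost over the time interval is twice its length times an intermediate value
  of the squared norm of the image under \<open>G\<close>, and that norm itself decreases in
  time.\<close>

lemma heat_flow_decay:
  assumes flow: "heat_flow I G \<psi>" and "s < t"
  shows "(\<Sum>a\<in>I. (mat_app I G (\<psi> t) a)\<^sup>2) \<le> (\<Sum>a\<in>I. (\<psi> s a)\<^sup>2) / (2 * (t - s))"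
proof -
  let ?y0 = "\<lambda>t. \<Sum>a\<in>I. (\<psi> t a)\<^sup>2" and ?y1 = "\<lambda>t. \<Sum>a\<in>I. (mat_app I G (\<psi> t) a)\<^sup>2"
  obtain r where r: "s < r" "r < t" "?y0 t - ?y0 s = (t - s) * (- 2 * ?y1 r)"
    using MVT2[OF \<open>s < t\<close>, of ?y0 "\<lambda>r. - 2 * ?y1 r"] heat_flow_energy[OF flow] by blast
  have "?y1 t \<le> ?y1 r"
    using heat_flow_antimono[OF heat_flow_mat_app[OF flow]] r by simp
  then have "(t - s) * ?y1 t \<le> (t - s) * ?y1 r" using assms by (intro mult_left_mono) auto
  moreover have "0 \<le> ?y0 t" by (intro sum_nonneg) auto
  ultimately have "2 * (t - s) * ?y1 t \<le> ?y0 s" using r(3) by (simp add: algebra_simps)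
  with \<open>s < t\<close> show ?thesis by (simp add: field_simps)
qed

lemma mat_app_frobenius:
  assumes "(\<Sum>a\<in>I. \<Sum>b\<in>I. (G a b)\<^sup>2) \<le> K\<^sup>2"
  shows "(\<Sum>a\<in>I. (mat_app I G v a)\<^sup>2) \<le> K\<^sup>2 * (\<Sum>a\<in>I. (v a)\<^sup>2)"
proof -
  have "(mat_app I G v a)\<^sup>2 \<le> (\<Sum>b\<in>I. (G a b)\<^sup>2) * (\<Sum>b\<in>I. (v b)\<^sup>2)" for a
    unfolding mat_app_def by (rule Cauchy_Schwarz_ineq_sum)
  then have "(\<Sum>a\<in>I. (mat_app I G v a)\<^sup>2) \<le> (\<Sum>a\<in>I. \<Sum>b\<in>I. (G a b)\<^sup>2) * (\<Sum>b\<in>I. (v b)\<^sup>2)"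
    unfolding sum_distrib_right by (intro sum_mono) (simp add: sum_distrib_right)
  also have "\<dots> \<le> K\<^sup>2 * (\<Sum>b\<in>I. (v b)\<^sup>2)" by (intro mult_right_mono assms sum_nonneg) auto
  finally show ?thesis .
qed

text \<open>The bounds by powers of \<open>K\<close> trade singularity at \<open>t = 0\<close> against the size of the matrix.\<close>

lemma heat_flow_bounds:
  assumes flow: "heat_flow I G \<psi>" and t: "0 < t" and n: "(\<Sum>a\<in>I. (\<psi> 0 a)\<^sup>2) = n"
    and K: "(\<Sum>a\<in>I. \<Sum>b\<in>I. (G a b)\<^sup>2) \<le> K\<^sup>2"
  shows "(\<Sum>a\<in>I. (mat_app I G (\<psi> t) a)\<^sup>2) \<le> n / t"
    and "(\<Sum>a\<in>I. (mat_app I (transp_mat G) (mat_app I G (\<psi> t)) a)\<^sup>2) \<le> 2 * n / t\<^sup>2"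
    and "(\<Sum>a\<in>I. (mat_app I G (mat_app I (transp_mat G) (mat_app I G (\<psi> t))) a)\<^sup>2) \<le> 8 * n / t ^ 3"
    and "(\<Sum>a\<in>I. (mat_app I (transp_mat G) (mat_app I G (\<psi> t)) a)\<^sup>2) \<le> K\<^sup>2 * n / t"
    and "(\<Sum>a\<in>I. (mat_app I G (mat_app I (transp_mat G) (mat_app I G (\<psi> t))) a)\<^sup>2) \<le> 2 * K\<^sup>2 * n / t\<^sup>2"
proof -
  let ?y1 = "\<lambda>t. \<Sum>a\<in>I. (mat_app I G (\<psi> t) a)\<^sup>2"
  let ?y2 = "\<lambda>t. \<Sum>a\<in>I. (mat_app I (transp_mat G) (mat_app I G (\<psi> t)) a)\<^sup>2"
  let ?y3 = "\<lambda>t. \<Sum>a\<in>I. (mat_app I G (mat_app I (transp_mat G) (mat_app I G (\<psi> t))) a)\<^sup>2"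
  note flow1 = heat_flow_mat_app[OF flow]
  note flow2 = heat_flow_mat_app[OF flow1]
  have n0: "n \<ge> 0" unfolding n[symmetric] by (intro sum_nonneg) auto
  have K': "(\<Sum>a\<in>I. \<Sum>b\<in>I. (G b a)\<^sup>2) \<le> K\<^sup>2" using K by (subst sum.swap)
  have y1: "?y1 s \<le> n / s" if "s > 0" for s
  proof -
    have "?y1 s \<le> n / (2 * s)" using heat_flow_decay[OF flow, of 0 s] that n by simp
    also have "\<dots> \<le> n / s" using that n0 by (intro divide_left_mono) auto
    finally show ?thesis .
  qed
  then show "?y1 t \<le> n / t" using t by simp
  \<comment> \<open>Each further factor is paid for on the second half of the time interval.\<close>
  have y2: "?y2 s \<le> 2 * n / s\<^sup>2" if "s > 0" for s
  proof -
    have "?y2 s \<le> ?y1 (s / 2) / (2 * (s - s / 2))" using heat_flow_decay[OF flow1, of "s/2" s] that by simp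
    also have "\<dots> = ?y1 (s / 2) / s" by simp
    also have "\<dots> \<le> (n / (s / 2)) / s" using y1[of "s/2"] that by (intro divide_right_mono) auto
    also have "\<dots> = 2 * n / s\<^sup>2" by (simp add: power2_eq_square)
    finally show ?thesis .
  qed
  then show "?y2 t \<le> 2 * n / t\<^sup>2" using t by simp
  have "?y3 t \<le> ?y2 (t / 2) / (2 * (t - t / 2))" using heat_flow_decay[OF flow2, of "t/2" t] t by simp
  also have "\<dots> = ?y2 (t / 2) / t" by simp
  also have "\<dots> \<le> (2 * n / (t / 2)\<^sup>2) / t" using y2[of "t/2"] t by (intro divide_right_mono) auto
  also have "\<dots> = 8 * n / t ^ 3" by (simp add: power2_eq_square power3_eq_cube)
  finally show "?y3 t \<le> 8 * n / t ^ 3" .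
  have "?y2 t \<le> K\<^sup>2 * ?y1 t" by (rule mat_app_frobenius[OF K'])
  also have "\<dots> \<le> K\<^sup>2 * (n / t)" by (intro mult_left_mono y1 t) auto
  finally show "?y2 t \<le> K\<^sup>2 * n / t" by simp
  have "?y3 t \<le> K\<^sup>2 * ?y2 t" by (rule mat_app_frobenius[OF K])
  also have "\<dots> \<le> K\<^sup>2 * (2 * n / t\<^sup>2)" by (intro mult_left_mono y2 t) auto
  finally show "?y3 t \<le> 2 * K\<^sup>2 * n / t\<^sup>2" by (simp add: mult_ac)
qed

lemma Cauchy_Schwarz_sum_abs:
  fixes u v :: "'i \<Rightarrow> real"
  shows "\<bar>\<Sum>a\<in>I. u a * v a\<bar> \<le> L2_set u I * L2_set v I"
proof -
  have "\<bar>\<Sum>a\<in>I. u a * v a\<bar> \<le> (\<Sum>a\<in>I. \<bar>u a\<bar> * \<bar>v a\<bar>)"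
    using sum_abs[of "\<lambda>a. u a * v a" I] by (simp add: abs_mult)
  also have "\<dots> \<le> L2_set u I * L2_set v I" by (rule L2_set_mult_ineq)
  finally show ?thesis .
qed

text \<open>Time derivatives are available for the sum \<open>y\<close> alone; \<open>x\<close> is
  the unknown and \<open>w\<close> the perturbation called r in the overview. The same
  \<open>E\<close> measures both data.\<close>

locale perturbed_flow =
  fixes I :: "'i set" and D :: "'i \<Rightarrow> 'i \<Rightarrow> real" and x y w z :: "real \<Rightarrow> 'i \<Rightarrow> real"
    and T E K :: real
  assumes fin: "finite I" and T: "0 < T" and E: "0 \<le> E" and K: "1 \<le> K"
    and frobenius: "(\<Sum>a\<in>I. \<Sum>b\<in>I. (D a b)\<^sup>2) \<le> K\<^sup>2"
    and deriv: "\<And>s a. s \<in> {0..T} \<Longrightarrow> a \<in> I \<Longrightarrow> ((\<lambda>s. y s a) has_real_derivative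
        mat_app I (transp_mat D) (\<lambda>b. z s b - mat_app I D (x s) b) a) (at s within {0..T})"
    and split: "\<And>s a. s \<in> {0..T} \<Longrightarrow> a \<in> I \<Longrightarrow> y s a = x s a + w s a"
    and init: "\<And>a. a \<in> I \<Longrightarrow> x 0 a = 0"
    and z_bound: "\<And>s. s \<in> {0..T} \<Longrightarrow> L2_set (z s) I \<le> E"
    and w_holder: "\<And>s s'. s \<in> {0..T} \<Longrightarrow> s' \<in> {0..T} \<Longrightarrow>
        L2_set (\<lambda>a. w s a - w s' a) I \<le> E * sqrt \<bar>s - s'\<bar>"
begin

text \<open>Testing with the backward flow \<open>s \<mapsto> \<phi> (t - s)\<close> moves all matrices to \<open>\<phi>\<close>. Subtracting the
  value of \<open>w\<close> at the final time makes the singularity at \<open>s = t\<close> integrable, and no time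
  derivative of \<open>w\<close> is needed.\<close>

lemma duality_bound:
  assumes t: "0 < t" "t \<le> T" and flow: "heat_flow I D \<phi>" and A: "0 \<le> A"
    and b0: "sqrt t * L2_set (\<phi> t) I \<le> A"
    and b1: "\<And>r. 0 < r \<Longrightarrow> r \<le> T \<Longrightarrow> L2_set (mat_app I D (\<phi> r)) I \<le> A * r powr (-7/8)"
    and b2: "\<And>r. 0 < r \<Longrightarrow> r \<le> T \<Longrightarrow>
        sqrt r * L2_set (mat_app I (transp_mat D) (mat_app I D (\<phi> r))) I \<le> A * r powr (-7/8)"
  shows "\<bar>\<Sum>a\<in>I. x t a * \<phi> 0 a\<bar> \<le> E * A * (1 + 16 * t powr (1/8))"
proof -
  define F where "F s = (\<Sum>a\<in>I. (y s a - w t a) * \<phi> (t - s) a)" for s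
  define F' where "F' s = (\<Sum>a\<in>I. z s a * mat_app I D (\<phi> (t - s)) a)
     + (\<Sum>a\<in>I. (w s a - w t a) * mat_app I (transp_mat D) (mat_app I D (\<phi> (t - s))) a)" for s
  have dphi: "((\<lambda>s. \<phi> (t - s) a) has_real_derivative
      mat_app I (transp_mat D) (mat_app I D (\<phi> (t - s))) a) (at s within S)" if "a \<in> I" for a s S
  proof -
    have "((\<lambda>s. \<phi> s a) has_real_derivative - mat_app I (transp_mat D) (mat_app I D (\<phi> (t - s))) a) (at (t - s))"
      using flow that unfolding heat_flow_def by blast
    moreover have "((\<lambda>s. t - s) has_real_derivative -1) (at s within S)"
      by (auto intro!: derivative_eq_intros)
    ultimately show ?thesis using DERIV_chain2[where f = "\<lambda>s. \<phi> s a" and g = "\<lambda>s. t - s"] by fastforce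
  qed
  have dF: "(F has_real_derivative F' s) (at s within {0..T})" if s: "s \<in> {0..T}" for s
  proof -
    let ?\<phi> = "\<phi> (t - s)"
    let ?Y = "\<lambda>a. mat_app I (transp_mat D) (\<lambda>b. z s b - mat_app I D (x s) b) a"
    let ?L = "mat_app I (transp_mat D) (mat_app I D ?\<phi>)"
    have "(F has_real_derivative (\<Sum>a\<in>I. ?Y a * ?\<phi> a + (y s a - w t a) * ?L a)) (at s within {0..T})"
      unfolding F_def
      by (intro DERIV_sum) (auto intro!: derivative_eq_intros deriv dphi s simp: algebra_simps)
    moreover have "(\<Sum>a\<in>I. ?Y a * ?\<phi> a + (y s a - w t a) * ?L a) = F' s"
    proof -
      have 1: "(\<Sum>a\<in>I. ?Y a * ?\<phi> a) = (\<Sum>a\<in>I. (z s a - mat_app I D (x s) a) * mat_app I D ?\<phi> a)"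
        using mat_app_adjoint[of "\<lambda>b. z s b - mat_app I D (x s) b" I D ?\<phi>] by simp
      \<comment> \<open>This is the term that cancels the contribution of \<open>D x\<close> in the
        derivative of \<open>y\<close>.\<close>
      have 2: "(\<Sum>a\<in>I. x s a * ?L a) = (\<Sum>a\<in>I. mat_app I D (x s) a * mat_app I D ?\<phi> a)"
        using mat_app_adjoint[of "x s" I "transp_mat D" "mat_app I D ?\<phi>"] by simp
      have "(\<Sum>a\<in>I. (y s a - w t a) * ?L a) = (\<Sum>a\<in>I. x s a * ?L a) + (\<Sum>a\<in>I. (w s a - w t a) * ?L a)"
        unfolding sum.distrib[symmetric] using split s by (intro sum.cong) (auto simp: algebra_simps)
      then show ?thesis unfolding F'_def sum.distrib 1 2
        by (simp add: algebra_simps sum_subtractf)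
    qed
    ultimately show ?thesis by simp
  qed
  have F_end: "F t = (\<Sum>a\<in>I. x t a * \<phi> 0 a)" unfolding F_def using split[of t] t
    by (intro sum.cong) auto
  have "\<bar>F 0\<bar> \<le> E * A"
  proof -
    have "F 0 = (\<Sum>a\<in>I. (w 0 a - w t a) * \<phi> t a)" unfolding F_def using split[of 0] init T
      by (intro sum.cong) auto
    also have "\<bar>\<dots>\<bar> \<le> L2_set (\<lambda>a. w 0 a - w t a) I * L2_set (\<phi> t) I"
      by (rule Cauchy_Schwarz_sum_abs)
    also have "\<dots> \<le> (E * sqrt t) * L2_set (\<phi> t) I"
      using w_holder[of 0 t] t by (intro mult_right_mono) (auto simp: L2_set_nonneg)
    also have "\<dots> = E * (sqrt t * L2_set (\<phi> t) I)" by simp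
    also have "\<dots> \<le> E * A" using E b0 by (intro mult_left_mono) auto
    finally show ?thesis .
  qed
  \<comment> \<open>Comparison with a primitive of the singular bound: -16 (t - s)^(1/8) has
    derivative 2 (t - s)^(-7/8), and it is continuous up to s = t.\<close>
  moreover have "norm (F t - F 0) \<le> (-16 * E * A * (t - t) powr (1/8)) - (-16 * E * A * (t - 0) powr (1/8))"
  proof (rule differentiable_bound_general[where f' = F' and \<phi>' = "\<lambda>s. 2 * E * A * (t - s) powr (-7/8)"])
    show "0 < t" by fact
    show "continuous_on {0..t} F"
      using continuous_on_subset[OF DERIV_continuous_on[of "{0..T}" F F']] dF t by auto
    show "continuous_on {0..t} (\<lambda>s. -16 * E * A * (t - s) powr (1/8))"
      by (intro continuous_intros continuous_on_powr') auto
    show "(F has_vector_derivative F' s) (at s)" if "0 < s" "s < t" for s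
    proof -
      have "at s within {0..T} = at s" using that t by (intro at_within_interior) auto
      then show ?thesis using dF[of s] that t
        by (simp add: has_real_derivative_iff_has_vector_derivative)
    qed
    show "((\<lambda>s. -16 * E * A * (t - s) powr (1/8)) has_vector_derivative
        2 * E * A * (t - s) powr (-7/8)) (at s)" if "0 < s" "s < t" for s
      unfolding has_real_derivative_iff_has_vector_derivative[symmetric]
      by (rule derivative_eq_intros refl | use that in simp)+
    show "norm (F' s) \<le> 2 * E * A * (t - s) powr (-7/8)" if s: "0 < s" "s < t" for s
    proof -
      let ?r = "t - s"
      have r: "0 < ?r" "?r \<le> T" using s t by auto
      have "\<bar>\<Sum>a\<in>I. z s a * mat_app I D (\<phi> ?r) a\<bar> \<le> L2_set (z s) I * L2_set (mat_app I D (\<phi> ?r)) I"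
        by (rule Cauchy_Schwarz_sum_abs)
      also have "\<dots> \<le> E * (A * ?r powr (-7/8))"
        using z_bound[of s] s t E by (intro mult_mono b1 r) (auto simp: L2_set_nonneg)
      finally have 1: "\<bar>\<Sum>a\<in>I. z s a * mat_app I D (\<phi> ?r) a\<bar> \<le> E * (A * ?r powr (-7/8))" .
      let ?L = "mat_app I (transp_mat D) (mat_app I D (\<phi> ?r))"
      have "\<bar>\<Sum>a\<in>I. (w s a - w t a) * ?L a\<bar> \<le> L2_set (\<lambda>a. w s a - w t a) I * L2_set ?L I"
        by (rule Cauchy_Schwarz_sum_abs)
      also have "\<dots> \<le> (E * sqrt ?r) * L2_set ?L I"
        using w_holder[of s t] s t by (intro mult_right_mono) (auto simp: L2_set_nonneg)
      also have "\<dots> = E * (sqrt ?r * L2_set ?L I)" by simp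
      also have "\<dots> \<le> E * (A * ?r powr (-7/8))" using E by (intro mult_left_mono b2 r) auto
      finally show ?thesis unfolding F'_def real_norm_def using 1 by linarith
    qed
  qed
  ultimately show ?thesis unfolding F_end by (simp add: algebra_simps)
qed

lemma L2_set_sq: "(L2_set f I)\<^sup>2 = (\<Sum>a\<in>I. (f a)\<^sup>2)"
  by (simp add: L2_set_def sum_nonneg)

lemma L2_set_leI: "(\<Sum>a\<in>I. (f a)\<^sup>2) \<le> b\<^sup>2 \<Longrightarrow> 0 \<le> b \<Longrightarrow> L2_set f I \<le> b"
  unfolding L2_set_def by (rule real_le_lsqrt) (auto intro: sum_nonneg)

text \<open>Dominates the constants of the two bounds below: 2 T^(3/8) + sqrt T for
  \<open>x\<close>, and 3 for \<open>D x\<close>.\<close>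

definition growth :: real where
  "growth = (3 + 2 * T powr (3/8) + sqrt T) * (1 + 16 * T powr (1/8))"

text \<open>Weakens the kernel so that the case without loss in \<open>K\<close> fits the exponent
  of \<open>duality_bound\<close>.\<close>

lemma powr_mult_le: "0 < r \<Longrightarrow> r \<le> T \<Longrightarrow> r powr (-1/2) \<le> T powr (3/8) * r powr (-7/8)"
proof -
  assume r: "0 < r" "r \<le> T"
  have "r powr (-1/2) = r powr (3/8) * r powr (-7/8)" by (simp add: powr_add[symmetric])
  also have "\<dots> \<le> T powr (3/8) * r powr (-7/8)" using r by (intro mult_right_mono powr_mono2) auto
  finally show ?thesis .
qed

text \<open>Starting the backward flow at \<open>x t\<close> itself makes the pairing its squared
  norm. The kernel r^(-1/2) is integrable as it stands.\<close>

lemma x_bound: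
  assumes "0 \<le> t" "t \<le> T"
  shows "L2_set (x t) I \<le> growth * E"
proof (cases "t = 0 \<or> L2_set (x t) I = 0")
  case True
  have "growth \<ge> 0" unfolding growth_def using T by (intro mult_nonneg_nonneg add_nonneg_nonneg) auto
  moreover have "L2_set (x 0) I = 0" using init by (simp add: L2_set_eq_0_iff fin)
  ultimately show ?thesis using True E by auto
next
  case False
  define n where "n = L2_set (x t) I"
  have n: "n > 0" using False L2_set_nonneg[of "x t" I] unfolding n_def by linarith
  obtain \<phi> where \<phi>: "\<phi> 0 = x t" "heat_flow I D \<phi>" using heat_flow_exists[OF fin] by blast
  define A where "A = n * (2 * T powr (3/8) + sqrt T)"
  have n2: "(\<Sum>a\<in>I. (\<phi> 0 a)\<^sup>2) = n\<^sup>2" unfolding \<phi> n_def L2_set_sq by simp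
  note bnd = heat_flow_bounds[OF \<phi>(2) _ n2 frobenius]
  have "\<bar>\<Sum>a\<in>I. x t a * \<phi> 0 a\<bar> \<le> E * A * (1 + 16 * t powr (1/8))"
  proof (rule duality_bound[OF _ _ \<phi>(2)])
    show "0 < t" "t \<le> T" using assms False by auto
    show "0 \<le> A" unfolding A_def using n T by (intro mult_nonneg_nonneg add_nonneg_nonneg) auto
    have "L2_set (\<phi> t) I \<le> n" using heat_flow_antimono[OF \<phi>(2) \<open>0 \<le> t\<close>] n n2 by (intro L2_set_leI) auto
    then have "sqrt t * L2_set (\<phi> t) I \<le> sqrt T * n"
      using assms by (intro mult_mono) (auto simp: L2_set_nonneg)
    also have "\<dots> \<le> A" unfolding A_def using n by (simp add: algebra_simps)
    finally show "sqrt t * L2_set (\<phi> t) I \<le> A" .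
  next
    fix r :: real assume r: "0 < r" "r \<le> T"
    have sq: "r powr (-1/2) * r powr (-1/2) = 1 / r"
      using r by (simp add: powr_add[symmetric] powr_minus field_simps)
    have A: "n * (2 * (T powr (3/8) * r powr (-7/8))) \<le> A * r powr (-7/8)"
      unfolding A_def using n T by (simp add: algebra_simps)
    have "L2_set (mat_app I D (\<phi> r)) I \<le> n * r powr (-1/2)"
      using bnd(1)[OF r(1)] n sq by (intro L2_set_leI) (auto simp: power2_eq_square mult_ac)
    also have "\<dots> \<le> n * (2 * (T powr (3/8) * r powr (-7/8)))"
      using powr_mult_le[OF r] n by (intro mult_left_mono) (auto intro: order_trans[OF _ mult_right_mono[of 1 2, simplified]])
    finally show "L2_set (mat_app I D (\<phi> r)) I \<le> A * r powr (-7/8)" using A by linarith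
    have "2 * n\<^sup>2 / r\<^sup>2 \<le> 4 * n\<^sup>2 / r\<^sup>2" by (intro divide_right_mono) auto
    then have "2 * n\<^sup>2 / r\<^sup>2 \<le> (2 * n / r)\<^sup>2" by (simp add: power_divide power_mult_distrib)
    then have "L2_set (mat_app I (transp_mat D) (mat_app I D (\<phi> r))) I \<le> 2 * n / r"
      using bnd(2)[OF r(1)] n r by (intro L2_set_leI order_trans[OF bnd(2)]) auto
    then have "sqrt r * L2_set (mat_app I (transp_mat D) (mat_app I D (\<phi> r))) I \<le> sqrt r * (2 * n / r)"
      using r by (intro mult_left_mono) auto
    also have "sqrt r * (2 * n / r) = n * (2 * r powr (-1/2))"
      using r by (simp add: powr_minus powr_half_sqrt real_div_sqrt field_simps)
    also have "\<dots> \<le> n * (2 * (T powr (3/8) * r powr (-7/8)))"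
      using powr_mult_le[OF r] n by (intro mult_left_mono) auto
    finally show "sqrt r * L2_set (mat_app I (transp_mat D) (mat_app I D (\<phi> r))) I \<le> A * r powr (-7/8)"
      using A by linarith
  qed
  also have "(\<Sum>a\<in>I. x t a * \<phi> 0 a) = n * n"
    using n2 unfolding \<phi> by (simp add: power2_eq_square)
  finally have "n * n \<le> n * ((2 * T powr (3/8) + sqrt T) * E * (1 + 16 * t powr (1/8)))"
    unfolding A_def by (simp add: algebra_simps)
  then have "n \<le> (2 * T powr (3/8) + sqrt T) * E * (1 + 16 * t powr (1/8))"
    using n by (simp add: mult_le_cancel_left)
  also have "\<dots> \<le> (3 + 2 * T powr (3/8) + sqrt T) * E * (1 + 16 * T powr (1/8))"
    using assms T E by (intro mult_mono add_mono powr_mono2) (auto intro!: mult_nonneg_nonneg add_nonneg_nonneg)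
  finally show ?thesis unfolding n_def growth_def by (simp add: mult_ac)
qed

lemma interpolate_powr:
  fixes a p q :: real
  assumes "0 \<le> a" "a \<le> p" "a \<le> q"
  shows "a \<le> p powr (3/4) * q powr (1/4)"
proof (cases "a = 0")
  case False
  then have "a = a powr (3/4) * a powr (1/4)" using assms by (simp add: powr_add[symmetric])
  also have "\<dots> \<le> p powr (3/4) * q powr (1/4)" using assms by (intro mult_mono powr_mono2) auto
  finally show ?thesis .
qed auto

text \<open>The backward flow is the image under \<open>transp_mat D\<close> of the flow
  \<open>\<psi>\<close> started at \<open>D x\<close>, so that the pairing is the squared norm of
  \<open>D x\<close>. The additional matrix factor worsens the kernel to r^(-1), which is therefore
  interpolated with the bound that uses \<open>K\<close>.\<close>

lemma Dx_bound:
  assumes "0 \<le> t" "t \<le> T"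
  shows "L2_set (mat_app I D (x t)) I \<le> growth * E * K powr (1/4)"
proof (cases "t = 0 \<or> L2_set (mat_app I D (x t)) I = 0")
  case True
  have "growth \<ge> 0" unfolding growth_def using T by (intro mult_nonneg_nonneg add_nonneg_nonneg) auto
  moreover have "L2_set (mat_app I D (x 0)) I = 0" using init by (simp add: L2_set_eq_0_iff fin mat_app_def)
  ultimately show ?thesis using True E by auto
next
  case False
  define n where "n = L2_set (mat_app I D (x t)) I"
  have n: "n > 0" using False L2_set_nonneg[of "mat_app I D (x t)" I] unfolding n_def by linarith
  obtain \<psi> where \<psi>: "\<psi> 0 = mat_app I D (x t)" "heat_flow I (transp_mat D) \<psi>"
    using heat_flow_exists[OF fin, of "mat_app I D (x t)" "transp_mat D"] by metis
  define \<phi> where "\<phi> r = mat_app I (transp_mat D) (\<psi> r)" for r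
  have flow: "heat_flow I D \<phi>" using heat_flow_mat_app[OF \<psi>(2)] unfolding \<phi>_def by simp
  define A where "A = n * (3 * K powr (1/4))"
  have K1: "1 \<le> K powr (1/4)" using K by (simp add: ge_one_powr_ge_zero)
  have n2: "(\<Sum>a\<in>I. (\<psi> 0 a)\<^sup>2) = n\<^sup>2" unfolding \<psi> n_def L2_set_sq by simp
  have frob': "(\<Sum>a\<in>I. \<Sum>b\<in>I. (D b a)\<^sup>2) \<le> K\<^sup>2" using frobenius by (subst sum.swap)
  note bnd = heat_flow_bounds[OF \<psi>(2) _ n2 frob']
  have "\<bar>\<Sum>a\<in>I. x t a * \<phi> 0 a\<bar> \<le> E * A * (1 + 16 * t powr (1/8))"
  proof (rule duality_bound[OF _ _ flow])
    show t: "0 < t" "t \<le> T" using assms False by auto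
    show "0 \<le> A" unfolding A_def using n by simp
    have "L2_set (\<phi> t) I \<le> n / sqrt t" unfolding \<phi>_def
      using bnd(1)[OF t(1)] n t by (intro L2_set_leI) (auto simp: power_divide)
    then have "sqrt t * L2_set (\<phi> t) I \<le> sqrt t * (n / sqrt t)"
      using t by (intro mult_left_mono) auto
    also have "\<dots> = n" using t by simp
    also have "\<dots> \<le> A" unfolding A_def using n K1 by simp
    finally show "sqrt t * L2_set (\<phi> t) I \<le> A" .
  next
    fix r :: real assume r: "0 < r" "r \<le> T"
    let ?a = "L2_set (mat_app I D (\<phi> r)) I"
    have "2 * n\<^sup>2 / r\<^sup>2 \<le> 4 * n\<^sup>2 / r\<^sup>2" by (intro divide_right_mono) auto
    then have "2 * n\<^sup>2 / r\<^sup>2 \<le> (n * (2 / r))\<^sup>2" by (simp add: power_divide power_mult_distrib)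
    then have "?a \<le> n * (2 / r)" unfolding \<phi>_def
      using n r by (intro L2_set_leI order_trans[OF bnd(2)]) auto
    moreover have "?a \<le> n * (K / sqrt r)" unfolding \<phi>_def
      using bnd(4)[OF r(1)] n r K by (intro L2_set_leI) (auto simp: power_divide power_mult_distrib mult_ac)
    \<comment> \<open>The weights give -3/4 - 1/8 = -7/8 as exponent of \<open>r\<close>, at the
      cost of K^(1/4).\<close>
    ultimately have "?a / n \<le> (2 / r) powr (3/4) * (K / sqrt r) powr (1/4)"
      using n by (intro interpolate_powr) (auto simp: L2_set_nonneg field_simps)
    also have "\<dots> = 2 powr (3/4) * (K powr (1/4) * r powr (-7/8))"
      using r K by (simp add: powr_divide powr_half_sqrt[symmetric] powr_powr powr_minus field_simps powr_add[symmetric])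
    also have "\<dots> \<le> 3 * (K powr (1/4) * r powr (-7/8))"
    proof (rule mult_right_mono)
      have "(2::real) powr (3/4) \<le> 2 powr 1" by (rule powr_mono) auto
      then show "(2::real) powr (3/4) \<le> 3" by simp
    qed auto
    finally show "?a \<le> A * r powr (-7/8)" unfolding A_def using n by (simp add: field_simps)
    let ?b = "L2_set (mat_app I (transp_mat D) (mat_app I D (\<phi> r))) I"
    have "?b \<le> n * (3 / (r * sqrt r))" unfolding \<phi>_def
    proof (rule L2_set_leI)
      have "(n * (3 / (r * sqrt r)))\<^sup>2 = 9 * n\<^sup>2 / r ^ 3"
        using r by (simp add: power_mult_distrib power_divide power2_eq_square power3_eq_cube)
      moreover have "8 * n\<^sup>2 / r ^ 3 \<le> 9 * n\<^sup>2 / r ^ 3" using r by (intro divide_right_mono) auto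
      ultimately show "(\<Sum>a\<in>I. (mat_app I (transp_mat D) (mat_app I D (mat_app I (transp_mat D) (\<psi> r))) a)\<^sup>2)
          \<le> (n * (3 / (r * sqrt r)))\<^sup>2"
        using bnd(3)[OF r(1)] by linarith
    qed (use n r in auto)
    moreover have "?b \<le> n * (2 * K / r)" unfolding \<phi>_def
    proof (rule L2_set_leI)
      have "2 * K\<^sup>2 * n\<^sup>2 / r\<^sup>2 \<le> 4 * K\<^sup>2 * n\<^sup>2 / r\<^sup>2" using r
        by (intro divide_right_mono mult_right_mono) auto
      moreover have "(n * (2 * K / r))\<^sup>2 = 4 * K\<^sup>2 * n\<^sup>2 / r\<^sup>2"
        by (simp add: power_mult_distrib power_divide)
      ultimately show "(\<Sum>a\<in>I. (mat_app I (transp_mat D) (mat_app I D (mat_app I (transp_mat D) (\<psi> r))) a)\<^sup>2)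
          \<le> (n * (2 * K / r))\<^sup>2"
        using bnd(5)[OF r(1)] by linarith
    qed (use n r K in auto)
    \<comment> \<open>Here the exponent is -9/8 - 1/4 = -11/8, and the Hoelder factor sqrt r
      restores -7/8.\<close>
    ultimately have "?b / n \<le> (3 / (r * sqrt r)) powr (3/4) * (2 * K / r) powr (1/4)"
      using n by (intro interpolate_powr) (auto simp: L2_set_nonneg field_simps)
    also have "\<dots> = (3 powr (3/4) * 2 powr (1/4)) * (K powr (1/4) * r powr (-11/8))"
    proof -
      have rr: "r * sqrt r = r powr (3/2)" using r
        using powr_mult_base[of r "1/2"] by (simp add: powr_half_sqrt)
      show ?thesis unfolding rr using r K
        by (simp add: powr_divide powr_mult powr_powr powr_minus field_simps powr_add[symmetric])
    qed
    also have "\<dots> \<le> 3 * (K powr (1/4) * r powr (-11/8))"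
    proof (rule mult_right_mono)
      have "(3::real) powr (3/4) * 2 powr (1/4) \<le> 3 powr (3/4) * 3 powr (1/4)"
        by (intro mult_left_mono powr_mono2) auto
      also have "\<dots> = 3" by (simp add: powr_add[symmetric])
      finally show "(3::real) powr (3/4) * 2 powr (1/4) \<le> 3" .
    qed auto
    finally have "?b \<le> A * r powr (-11/8)" unfolding A_def using n by (simp add: field_simps)
    then have "sqrt r * ?b \<le> sqrt r * (A * r powr (-11/8))" using r by (intro mult_left_mono) auto
    also have "\<dots> = A * (r powr (1/2) * r powr (-11/8))" using r by (simp add: powr_half_sqrt)
    also have "\<dots> = A * r powr (-7/8)" by (simp add: powr_add[symmetric])
    finally show "sqrt r * ?b \<le> A * r powr (-7/8)" .
  qed
  also have "(\<Sum>a\<in>I. x t a * \<phi> 0 a) = n * n"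
    using mat_app_adjoint[of "x t" I "transp_mat D" "\<psi> 0"] n2 unfolding \<phi>_def \<psi>(1)
    by (simp add: power2_eq_square)
  finally have "n * n \<le> n * (3 * K powr (1/4) * E * (1 + 16 * t powr (1/8)))"
    unfolding A_def by (simp add: algebra_simps)
  then have "n \<le> 3 * K powr (1/4) * E * (1 + 16 * t powr (1/8))"
    using n by (simp add: mult_le_cancel_left)
  also have "\<dots> \<le> (3 + 2 * T powr (3/8) + sqrt T) * K powr (1/4) * E * (1 + 16 * T powr (1/8))"
    using assms T E K by (intro mult_mono add_mono powr_mono2) (auto intro!: mult_nonneg_nonneg add_nonneg_nonneg)
  finally show ?thesis unfolding n_def growth_def by (simp add: mult_ac)
qed

end

section \<open>The bilinear form of the scheme\<close>

lemma opp_opp [simp]: "opp (opp fl) = fl"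
  by (cases fl) auto

lemma q_hat_eq: "q_hat fl = u_hat (opp fl)"
  by (intro ext) (cases fl; simp)

text \<open>The boundary data are zero because the form is applied to errors: the exact solution and
  the scheme share their data.\<close>

definition flux_form ::
  "bc \<Rightarrow> nat \<Rightarrow> (nat \<Rightarrow> real) \<Rightarrow> flux \<Rightarrow> (nat \<Rightarrow> real poly) \<Rightarrow> nat \<Rightarrow> real poly \<Rightarrow> real" where
  "flux_form B N X fl v j w = - pint (X (j - 1)) (X j) (v j * pderiv w)
     + u_hat fl B N X 0 0 v j * poly w (X j) - u_hat fl B N X 0 0 v (j - 1) * poly w (X (j - 1))"

text \<open>Normalised in the L2 norm of the cell, so that \<open>L2_set\<close> of the coordinates
  is the L2 norm of a piecewise polynomial.\<close>

definition cell_basis :: "(nat \<Rightarrow> real) \<Rightarrow> nat \<times> nat \<Rightarrow> real poly" where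
  "cell_basis X a = smult (sqrt ((2 * real (snd a) + 1) / (X (fst a) - X (fst a - 1))))
     (leg (X (fst a - 1)) (X (fst a)) (snd a))"

definition basis_fun :: "(nat \<Rightarrow> real) \<Rightarrow> nat \<times> nat \<Rightarrow> nat \<Rightarrow> real poly" where
  "basis_fun X a j = (if j = fst a then cell_basis X a else 0)"

definition coord :: "(nat \<Rightarrow> real) \<Rightarrow> (nat \<Rightarrow> real poly) \<Rightarrow> nat \<times> nat \<Rightarrow> real" where
  "coord X v a = pint (X (fst a - 1)) (X (fst a)) (v (fst a) * cell_basis X a)"

lemma u_hat_diff:
  "u_hat fl B N X (b0 - b0') (b1 - b1') (\<lambda>j. v j - w j) i = u_hat fl B N X b0 b1 v i - u_hat fl B N X b0' b1' w i"
  by (cases fl; cases B) (auto simp: left_limit_def right_limit_def)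

lemma u_hat_sum:
  "u_hat fl B N X 0 0 (\<lambda>j. \<Sum>b\<in>S. smult (c b) (f b j)) i = (\<Sum>b\<in>S. c b * u_hat fl B N X 0 0 (f b) i)"
  by (cases fl; cases B) (auto simp: left_limit_def right_limit_def poly_sum)

lemma flux_form_sum_left:
  "flux_form B N X fl (\<lambda>j. \<Sum>b\<in>S. smult (c b) (f b j)) j w = (\<Sum>b\<in>S. c b * flux_form B N X fl (f b) j w)"
  unfolding flux_form_def u_hat_sum
  by (simp add: sum_distrib_right pint_sum pint_smult right_diff_distrib distrib_left sum.distrib
      sum_subtractf sum_negf mult.assoc)

lemma flux_form_sum_right:
  "flux_form B N X fl v j (\<Sum>b\<in>S. smult (c b) (w b)) = (\<Sum>b\<in>S. c b * flux_form B N X fl v j (w b))"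
  unfolding flux_form_def
  by (simp add: poly_sum pderiv_sum pderiv_smult sum_distrib_left pint_sum pint_smult right_diff_distrib
      distrib_left sum.distrib sum_subtractf sum_negf mult.left_commute)

lemma flux_form_0 [simp]: "flux_form B N X fl v j 0 = 0"
  by (simp add: flux_form_def)

lemma flux_form_diff:
  "flux_form B N X fl (\<lambda>j. v j - w j) j p = flux_form B N X fl v j p - flux_form B N X fl w j p"
  using u_hat_diff[of fl B N X 0 0 0 0 v w] unfolding flux_form_def
  by (simp add: left_diff_distrib pint_diff)

section \<open>Traces, adjointness and the matrix of the scheme\<close>

locale mesh_space =
  fixes N :: nat and X :: "nat \<Rightarrow> real" and k :: nat and B :: bc
  assumes mesh: "mesh N X" and k: "2 \<le> k"
begin

abbreviation "idx \<equiv> {1..N} \<times> {..k}"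

lemma N: "1 \<le> N" and X0: "X 0 = 0" and XN: "X N = 2 * pi"
  using mesh unfolding mesh_def by auto

lemma cell_less: "j \<in> {1..N} \<Longrightarrow> X (j - 1) < X j"
  using mesh unfolding mesh_def by auto

lemma X_mono: "i \<le> j \<Longrightarrow> j \<le> N \<Longrightarrow> X i \<le> X j"
proof (induction j)
  case (Suc j)
  then show ?case using cell_less[of "Suc j"] by (cases "i = Suc j") auto
qed simp

lemma X_in: "i \<le> N \<Longrightarrow> X i \<in> Omega"
  using X_mono[of 0 i] X_mono[of i N] X0 XN by auto

lemma cell_in: "j \<in> {1..N} \<Longrightarrow> {X (j - 1)..X j} \<subseteq> Omega"
  using X_in[of "j - 1"] X_in[of j] by auto

lemma sum_cells: "(\<Sum>j\<in>{1..N}. X j - X (j - 1)) = 2 * pi"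
proof -
  have "(\<Sum>j\<in>{1..n}. X j - X (j - 1)) = X n - X 0" for n by (induction n) auto
  then show ?thesis using X0 XN by simp
qed

text \<open>Every node is seen by the flux from one side only, where \<open>v\<close> takes the
  values of \<open>f\<close>. At the ends of the domain periodicity or the boundary data supply the
  value.\<close>

lemma u_hat_exact:
  assumes v: "\<And>j. j \<in> {1..N} \<Longrightarrow>
      poly (v j) (end_pt fl (X (j - 1)) (X j)) = f (end_pt fl (X (j - 1)) (X j))"
    and per: "B = Periodic \<Longrightarrow> f 0 = f (2 * pi)"
    and mix: "B = Mixed \<Longrightarrow> fl = FluxI \<Longrightarrow> b0 = f 0" "B = Mixed \<Longrightarrow> fl = FluxII \<Longrightarrow> b1 = f (2 * pi)"
    and i: "i \<le> N"
  shows "u_hat fl B N X b0 b1 v i = f (X i)"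
proof (cases fl)
  case FluxI
  then have v': "\<And>j. j \<in> {1..N} \<Longrightarrow> poly (v j) (X j) = f (X j)" using v by simp
  show ?thesis
    using FluxI v'[of i] v'[of N] i N X0 XN per mix by (cases B) (auto simp: left_limit_def)
next
  case FluxII
  then have v': "\<And>j. j \<in> {1..N} \<Longrightarrow> poly (v j) (X (j - 1)) = f (X (j - 1))" using v by simp
  show ?thesis
    using FluxII v'[of "Suc i"] v'[of 1] i N X0 XN per mix by (cases B) (auto simp: right_limit_def)
qed

lemma u_hat_bound:
  assumes "\<And>j x. j \<in> {1..N} \<Longrightarrow> x \<in> {X (j - 1)..X j} \<Longrightarrow> \<bar>poly (v j) x\<bar> \<le> R" "i \<le> N"
  shows "\<bar>u_hat fl B N X 0 0 v i\<bar> \<le> R"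
proof -
  have R: "0 \<le> R" using assms(1)[of 1 "X 1"] N cell_less[of 1] by force
  have 1: "\<bar>poly (v j) (X j)\<bar> \<le> R" "\<bar>poly (v j) (X (j - 1))\<bar> \<le> R" if "j \<in> {1..N}" for j
    using assms(1)[OF that] cell_less[OF that] by auto
  show ?thesis
    using 1[of i] 1[of N] 1[of "Suc i"] 1[of 1] N R assms(2) X0
    by (cases fl; cases B) (auto simp: left_limit_def right_limit_def)
qed

text \<open>Integration by parts on each cell leaves the increment of a product of the two traces.
  The sum telescopes to the ends of the domain, where the products agree by periodicity or contain a
  zero boundary value.\<close>

lemma flux_form_adjoint_I:
  "(\<Sum>j\<in>{1..N}. flux_form B N X FluxI v j (w j)) = - (\<Sum>j\<in>{1..N}. flux_form B N X FluxII w j (v j))"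
proof -
  let ?V = "\<lambda>i. u_hat FluxI B N X 0 0 v i" and ?W = "\<lambda>i. u_hat FluxII B N X 0 0 w i"
  have "flux_form B N X FluxI v j (w j) + flux_form B N X FluxII w j (v j) = ?W j * ?V j - ?W (j - 1) * ?V (j - 1)"
    if j: "j \<in> {1..N}" for j
  proof -
    have 1: "?V j = poly (v j) (X j)" using j by (simp add: left_limit_def)
    have 2: "?W (j - 1) = poly (w j) (X (j - 1))" using j by (auto simp: right_limit_def)
    have 3: "pint (X (j - 1)) (X j) (w j * pderiv (v j)) = poly (v j) (X j) * poly (w j) (X j)
        - poly (v j) (X (j - 1)) * poly (w j) (X (j - 1)) - pint (X (j - 1)) (X j) (v j * pderiv (w j))"
      using pint_by_parts[of "X (j - 1)" "X j" "v j" "w j"] cell_less[OF j] by (simp add: mult.commute)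
    show ?thesis unfolding flux_form_def 3 1 2 by (simp add: algebra_simps)
  qed
  then have "(\<Sum>j\<in>{1..N}. flux_form B N X FluxI v j (w j) + flux_form B N X FluxII w j (v j)) =
      (\<Sum>j\<in>{1..N}. ?W j * ?V j - ?W (j - 1) * ?V (j - 1))" by (intro sum.cong refl)
  also have "\<dots> = ?W N * ?V N - ?W 0 * ?V 0"
  proof -
    have tel: "(\<Sum>j\<in>{1..n}. f j - f (j - 1)) = f n - f 0" for n and f :: "nat \<Rightarrow> real" by (induction n) auto
    show ?thesis by (rule tel[where f = "\<lambda>j. ?W j * ?V j"])
  qed
  also have "\<dots> = 0" using N X0 by (cases B) (auto simp: left_limit_def right_limit_def)
  finally show ?thesis by (simp add: sum.distrib)
qed

lemma flux_form_adjoint: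
  "(\<Sum>j\<in>{1..N}. flux_form B N X fl v j (w j)) = - (\<Sum>j\<in>{1..N}. flux_form B N X (opp fl) w j (v j))"
  using flux_form_adjoint_I[of v w] flux_form_adjoint_I[of w v] by (cases fl) auto

lemma degree_cell_basis: "a \<in> idx \<Longrightarrow> degree (cell_basis X a) \<le> k"
  using cell_less[of "fst a"] unfolding cell_basis_def
  by (auto intro!: order_trans[OF degree_smult_le])

lemma coord_expansion:
  assumes "degree (v j) \<le> k" and j: "j \<in> {1..N}"
  shows "v j = (\<Sum>m\<le>k. smult (coord X v (j, m)) (cell_basis X (j, m)))"
proof -
  let ?h = "X j - X (j - 1)"
  have h: "?h > 0" using cell_less[OF j] by simp
  have "smult (coord X v (j, m)) (cell_basis X (j, m)) =
      smult ((2 * real m + 1) / ?h * pint (X (j - 1)) (X j) (v j * leg (X (j - 1)) (X j) m)) (leg (X (j - 1)) (X j) m)" for m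
  proof -
    let ?s = "sqrt ((2 * real m + 1) / ?h)"
    have ss: "?s * ?s = (2 * real m + 1) / ?h" using h by simp
    have e: "smult (s * P) (smult s q) = smult ((s * s) * P) q" for s P :: real and q by (simp add: mult_ac)
    show ?thesis
      unfolding coord_def cell_basis_def fst_conv snd_conv mult_smult_right pint_smult e ss ..
  qed
  then show ?thesis using leg_expansion[OF cell_less[OF j] assms(1)] by simp
qed

lemma coord_expansion_fun:
  assumes "\<And>j. j \<in> {1..N} \<Longrightarrow> degree (v j) \<le> k" "j \<in> {1..N}"
  shows "v j = (\<Sum>b\<in>idx. smult (coord X v b) (basis_fun X b j))"
proof -
  have "(\<Sum>b\<in>idx. smult (coord X v b) (basis_fun X b j)) =
      (\<Sum>i\<in>{1..N}. \<Sum>m\<le>k. smult (coord X v (i, m)) (basis_fun X (i, m) j))"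
    by (simp add: sum.cartesian_product case_prod_unfold)
  also have "\<dots> = (\<Sum>i\<in>{1..N}. if i = j then v j else 0)"
    using coord_expansion[where v = v and j = j, OF assms(1)[OF assms(2)] assms(2)]
    by (intro sum.cong refl) (auto simp: basis_fun_def)
  also have "\<dots> = v j" using assms(2) by simp
  finally show ?thesis by simp
qed

lemma flux_form_cong:
  assumes "\<And>j. j \<in> {1..N} \<Longrightarrow> v j = v' j" "j \<in> {1..N}"
  shows "flux_form B N X fl v j w = flux_form B N X fl v' j w"
proof -
  have "u_hat fl B N X 0 0 v i = u_hat fl B N X 0 0 v' i" if "i \<le> N" for i
    using assms(1)[of i] assms(1)[of N] assms(1)[of "Suc i"] assms(1)[of 1] N that
    by (cases fl; cases B) (auto simp: left_limit_def right_limit_def)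
  moreover have "j \<le> N" "j - 1 \<le> N" using assms(2) by auto
  ultimately show ?thesis unfolding flux_form_def using assms by simp
qed

text \<open>The \<open>D\<close> of the abstract flow: rows belong to test functions, columns to
  trial functions.\<close>

definition flux_mat :: "flux \<Rightarrow> nat \<times> nat \<Rightarrow> nat \<times> nat \<Rightarrow> real" where
  "flux_mat fl a b = flux_form B N X fl (basis_fun X b) (fst a) (cell_basis X a)"

lemma flux_mat_app:
  assumes "\<And>j. j \<in> {1..N} \<Longrightarrow> degree (v j) \<le> k" "a \<in> idx"
  shows "mat_app idx (flux_mat fl) (coord X v) a = flux_form B N X fl v (fst a) (cell_basis X a)"
proof -
  have "flux_form B N X fl v (fst a) (cell_basis X a) =
      flux_form B N X fl (\<lambda>j. \<Sum>b\<in>idx. smult (coord X v b) (basis_fun X b j)) (fst a) (cell_basis X a)"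
  proof (rule flux_form_cong)
    fix j assume "j \<in> {1..N}"
    then show "v j = (\<Sum>b\<in>idx. smult (coord X v b) (basis_fun X b j))"
      by (intro coord_expansion_fun[where v = v] assms(1))
  qed (use assms(2) in auto)
  then show ?thesis
    unfolding flux_form_sum_left mat_app_def flux_mat_def by (simp add: mult.commute)
qed

text \<open>Adjointness makes the form with the opposite flux the negative transpose. This gives the
  two equations of the scheme the structure of a gradient flow.\<close>

lemma flux_mat_transp_app:
  assumes v: "\<And>j. j \<in> {1..N} \<Longrightarrow> degree (v j) \<le> k" and a: "a \<in> idx"
  shows "mat_app idx (transp_mat (flux_mat fl)) (coord X v) a = - flux_form B N X (opp fl) v (fst a) (cell_basis X a)"
proof -
  have "mat_app idx (transp_mat (flux_mat fl)) (coord X v) a =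
      (\<Sum>j\<in>{1..N}. \<Sum>m\<le>k. coord X v (j, m) * flux_form B N X fl (basis_fun X a) j (cell_basis X (j, m)))"
    unfolding mat_app_def flux_mat_def
    by (simp add: sum.cartesian_product case_prod_unfold mult.commute)
  also have "\<dots> = (\<Sum>j\<in>{1..N}. flux_form B N X fl (basis_fun X a) j (v j))"
  proof (intro sum.cong refl)
    fix j assume j: "j \<in> {1..N}"
    show "(\<Sum>m\<le>k. coord X v (j, m) * flux_form B N X fl (basis_fun X a) j (cell_basis X (j, m))) =
        flux_form B N X fl (basis_fun X a) j (v j)"
      by (subst coord_expansion[where v = v and j = j, OF v[OF j] j]) (rule flux_form_sum_right[symmetric])
  qed
  also have "\<dots> = - (\<Sum>j\<in>{1..N}. flux_form B N X (opp fl) v j (basis_fun X a j))"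
    by (rule flux_form_adjoint)
  also have "(\<Sum>j\<in>{1..N}. flux_form B N X (opp fl) v j (basis_fun X a j)) =
      (\<Sum>j\<in>{1..N}. if j = fst a then flux_form B N X (opp fl) v (fst a) (cell_basis X a) else 0)"
    by (intro sum.cong refl) (simp add: basis_fun_def)
  also have "\<dots> = flux_form B N X (opp fl) v (fst a) (cell_basis X a)" using a by auto
  finally show ?thesis .
qed

end

section \<open>Scaling of the basis and the matrix with the mesh size\<close>

locale mesh_bounds = mesh_space +
  fixes c L h :: real
  assumes L: "1 \<le> L"
    and leg_bd: "\<And>a b m x. a < b \<Longrightarrow> m \<le> k \<Longrightarrow> x \<in> {a..b} \<Longrightarrow> \<bar>poly (leg a b m) x\<bar> \<le> L"
    and dleg_bd: "\<And>a b m x. a < b \<Longrightarrow> m \<le> k \<Longrightarrow> x \<in> {a..b} \<Longrightarrow> \<bar>poly (pderiv (leg a b m)) x\<bar> \<le> 2 * L / (b - a)"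
    and h: "0 < h" and c: "1 \<le> c"
    and cell_h: "\<And>j. j \<in> {1..N} \<Longrightarrow> X j - X (j - 1) \<le> h"
    and quasi: "\<And>j. j \<in> {1..N} \<Longrightarrow> h \<le> c * (X j - X (j - 1))"
begin

text \<open>Bounds the basis functions and their derivatives after scaling by the powers 1/2 and 3/2
  of the cell length; the factor 2 stems from \<open>dleg_bd\<close>.\<close>

definition "S = 2 * L * sqrt (2 * real k + 1)"

lemma S1: "1 \<le> S"
proof -
  have "1 * 1 \<le> 2 * L * sqrt (2 * real k + 1)" using L by (intro mult_mono) auto
  then show ?thesis by (simp add: S_def)
qed

text \<open>Lets a spare positive power of h be replaced by a constant.\<close>

lemma h_le: "h \<le> c * (2 * pi)"
proof -
  have "X 1 - X (1 - 1) \<le> 2 * pi" using X_in[of 1] N X0 by simp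
  then have "c * (X 1 - X (1 - 1)) \<le> c * (2 * pi)" using c by (intro mult_left_mono) auto
  then show ?thesis using quasi[of 1] N by simp
qed

lemma basis_bd:
  assumes a: "a \<in> idx" and x: "x \<in> {X (fst a - 1)..X (fst a)}"
  shows "\<bar>poly (cell_basis X a) x\<bar> \<le> S / sqrt (X (fst a) - X (fst a - 1))"
    and "\<bar>poly (pderiv (cell_basis X a)) x\<bar> \<le> S / ((X (fst a) - X (fst a - 1)) * sqrt (X (fst a) - X (fst a - 1)))"
proof -
  let ?h = "X (fst a) - X (fst a - 1)"
  have j: "fst a \<in> {1..N}" and m: "snd a \<le> k" using a by auto
  have h: "0 < ?h" using cell_less[OF j] by simp
  have s: "sqrt ((2 * real (snd a) + 1) / ?h) \<le> sqrt (2 * real k + 1) / sqrt ?h"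
    unfolding real_sqrt_divide using m h by (intro divide_right_mono) auto
  have "\<bar>poly (cell_basis X a) x\<bar> \<le> (sqrt (2 * real k + 1) / sqrt ?h) * L"
    unfolding cell_basis_def poly_smult abs_mult
    using leg_bd[OF cell_less[OF j] m x] s h by (intro mult_mono) auto
  also have "\<dots> = sqrt (2 * real k + 1) * L / sqrt ?h" by simp
  also have "\<dots> \<le> S / sqrt ?h" unfolding S_def using h L by (intro divide_right_mono) auto
  finally show "\<bar>poly (cell_basis X a) x\<bar> \<le> S / sqrt ?h" .
  have "\<bar>poly (pderiv (cell_basis X a)) x\<bar> \<le> (sqrt (2 * real k + 1) / sqrt ?h) * (2 * L / ?h)"
    unfolding cell_basis_def poly_smult pderiv_smult abs_mult
    using dleg_bd[OF cell_less[OF j] m x] s h by (intro mult_mono) auto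
  also have "\<dots> = S / (?h * sqrt ?h)" unfolding S_def by (simp add: mult_ac)
  finally show "\<bar>poly (pderiv (cell_basis X a)) x\<bar> \<le> S / (?h * sqrt ?h)" .
qed

lemma pint_bound:
  assumes "a \<le> b" "\<And>x. x \<in> {a..b} \<Longrightarrow> \<bar>poly p x\<bar> \<le> A" "\<And>x. x \<in> {a..b} \<Longrightarrow> \<bar>poly q x\<bar> \<le> A'"
  shows "\<bar>pint a b (p * q)\<bar> \<le> A * A' * (b - a)"
proof -
  have "norm (integral {a..b} (poly (p * q))) \<le> A * A' * (b - a)"
  proof (rule integral_bound[OF assms(1)])
    show "continuous_on {a..b} (poly (p * q))" by (intro continuous_on_poly continuous_on_id)
    fix x assume x: "x \<in> {a..b}"
    have "\<bar>poly p x\<bar> * \<bar>poly q x\<bar> \<le> A * A'"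
      using assms(2,3)[OF x] by (intro mult_mono) auto
    then show "norm (poly (p * q) x) \<le> A * A'" by (simp add: abs_mult)
  qed
  then show ?thesis by (simp add: pint_def)
qed

lemma sqrt_quasi: "j \<in> {1..N} \<Longrightarrow> 1 / sqrt (X j - X (j - 1)) \<le> sqrt (c / h)"
proof -
  assume j: "j \<in> {1..N}"
  let ?h = "X j - X (j - 1)"
  have hj: "0 < ?h" using cell_less[OF j] by simp
  have "1 / ?h \<le> c / h" using quasi[OF j] hj h by (simp add: field_simps)
  then have "sqrt (1 / ?h) \<le> sqrt (c / h)" by (rule real_sqrt_le_mono)
  then show ?thesis by (simp add: real_sqrt_divide)
qed

text \<open>Basis functions are of size h^(-1/2). A product of two boundary values gives 1 / h, and
  so does the volume term, being h^(-1/2) times h^(-3/2) times the cell length.\<close>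

lemma flux_mat_bd:
  assumes a: "a \<in> idx" and b: "b \<in> idx"
  shows "\<bar>flux_mat fl a b\<bar> \<le> 3 * S\<^sup>2 * (c / h)"
proof -
  let ?j = "fst a"
  let ?h = "X ?j - X (?j - 1)"
  let ?R = "S * sqrt (c / h)"
  have j: "?j \<in> {1..N}" using a by auto
  have hj: "0 < ?h" using cell_less[OF j] by simp
  have S0: "0 \<le> S" using S1 by simp
  have bd: "\<bar>poly (cell_basis X a') x\<bar> \<le> ?R" if "a' \<in> idx" "x \<in> {X (fst a' - 1)..X (fst a')}" for a' x
  proof -
    have "S * (1 / sqrt (X (fst a') - X (fst a' - 1))) \<le> ?R"
      using sqrt_quasi[of "fst a'"] that(1) S0 by (intro mult_left_mono) auto
    then show ?thesis using basis_bd(1)[OF that] by simp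
  qed
  have R0: "0 \<le> ?R" using S0 c h by (intro mult_nonneg_nonneg) auto
  have RR: "?R * ?R = S\<^sup>2 * (c / h)" 
  proof -
    have q: "sqrt (c / h) * sqrt (c / h) = c / h" using c h by simp
    have e: "(S * r) * (S * r) = S\<^sup>2 * (r * r)" for r by (simp add: power2_eq_square)
    show ?thesis unfolding e q ..
  qed
  have hat: "\<bar>u_hat fl B N X 0 0 (basis_fun X b) i\<bar> \<le> ?R" if "i \<le> N" for i
    using bd[OF b] R0 by (intro u_hat_bound[OF _ that]) (auto simp: basis_fun_def)
  have end_bd: "\<bar>poly (cell_basis X a) (X ?j)\<bar> \<le> ?R" "\<bar>poly (cell_basis X a) (X (?j - 1))\<bar> \<le> ?R"
    using bd[OF a] hj by auto
  have t1: "\<bar>pint (X (?j - 1)) (X ?j) (basis_fun X b ?j * pderiv (cell_basis X a))\<bar> \<le> S\<^sup>2 * (c / h)"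
  proof (cases "?j = fst b")
    case True
    have "\<bar>pint (X (?j - 1)) (X ?j) (basis_fun X b ?j * pderiv (cell_basis X a))\<bar>
        \<le> (S / sqrt ?h) * (S / (?h * sqrt ?h)) * ?h"
      using basis_bd(1)[OF b] basis_bd(2)[OF a] hj True by (intro pint_bound) (auto simp: basis_fun_def)
    also have "\<dots> = S\<^sup>2 * (1 / ?h)" using hj by (simp add: power2_eq_square)
    also have "\<dots> \<le> S\<^sup>2 * (c / h)"
      using quasi[OF j] hj h by (intro mult_left_mono) (auto simp: field_simps)
    finally show ?thesis .
  next
    case False
    then show ?thesis using c h by (simp add: basis_fun_def)
  qed
  have jN: "?j \<le> N" "?j - 1 \<le> N" using j by auto
  have t2: "\<bar>u_hat fl B N X 0 0 (basis_fun X b) ?j * poly (cell_basis X a) (X ?j)\<bar> \<le> S\<^sup>2 * (c / h)"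
    unfolding abs_mult RR[symmetric] using hat[OF jN(1)] end_bd(1) R0 by (intro mult_mono) auto
  have t3: "\<bar>u_hat fl B N X 0 0 (basis_fun X b) (?j - 1) * poly (cell_basis X a) (X (?j - 1))\<bar> \<le> S\<^sup>2 * (c / h)"
    unfolding abs_mult RR[symmetric] using hat[OF jN(2)] end_bd(2) R0 by (intro mult_mono) auto
  have "\<bar>flux_mat fl a b\<bar> \<le> S\<^sup>2 * (c / h) + S\<^sup>2 * (c / h) + S\<^sup>2 * (c / h)"
  proof -
    have "\<bar>p\<bar> \<le> d \<Longrightarrow> \<bar>q\<bar> \<le> d \<Longrightarrow> \<bar>r\<bar> \<le> d \<Longrightarrow> \<bar>- p + q - r\<bar> \<le> d + d + d" for p q r d :: real by linarith
    from this[OF t1 t2 t3] show ?thesis unfolding flux_mat_def flux_form_def .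
  qed
  then show ?thesis by (simp add: mult_ac)
qed

lemma N_h: "real N * h \<le> c * (2 * pi)"
proof -
  have "real N * h = (\<Sum>j\<in>{1..N}. h)" by simp
  also have "\<dots> \<le> (\<Sum>j\<in>{1..N}. c * (X j - X (j - 1)))" by (intro sum_mono quasi)
  also have "\<dots> = c * (2 * pi)" unfolding sum_distrib_left[symmetric] sum_cells ..
  finally show ?thesis .
qed

text \<open>The entry bound 3 S^2 c / h times the number N (k + 1) of indices, with N at most 2 pi c
  / h, gives the first summand over h^2. The second summand ensures that K1 / h^2 is at least
  1.\<close>

definition "K1 = 6 * pi * real (k + 1) * c\<^sup>2 * S\<^sup>2 + (c * (2 * pi))\<^sup>2"

lemma K_ge1: "1 \<le> K1 / h\<^sup>2"
proof -
  have "h\<^sup>2 \<le> (c * (2 * pi))\<^sup>2" using h h_le by (intro power_mono) auto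
  also have "\<dots> \<le> K1" unfolding K1_def by simp
  finally show ?thesis using h by simp
qed

lemma flux_mat_frobenius: "(\<Sum>a\<in>idx. \<Sum>b\<in>idx. (flux_mat fl a b)\<^sup>2) \<le> (K1 / h\<^sup>2)\<^sup>2"
proof -
  let ?R = "3 * S\<^sup>2 * (c / h)"
  have "(\<Sum>a\<in>idx. \<Sum>b\<in>idx. (flux_mat fl a b)\<^sup>2) \<le> (\<Sum>a\<in>idx. \<Sum>b\<in>idx. ?R\<^sup>2)"
  proof (intro sum_mono)
    fix a b assume "a \<in> idx" "b \<in> idx"
    from flux_mat_bd[OF this] have "\<bar>flux_mat fl a b\<bar>\<^sup>2 \<le> ?R\<^sup>2" by (intro power_mono) auto
    then show "(flux_mat fl a b)\<^sup>2 \<le> ?R\<^sup>2" by simp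
  qed
  also have "\<dots> = real (card idx) * (real (card idx) * ?R\<^sup>2)" by (simp only: sum_constant)
  also have "real (card idx) = real N * real (k + 1)" by (simp add: card_cartesian_product algebra_simps)
  also have "real N * real (k + 1) * (real N * real (k + 1) * ?R\<^sup>2) = (real N * real (k + 1) * ?R)\<^sup>2"
    by (simp only: power2_eq_square mult_ac)
  also have "\<dots> \<le> (K1 / h\<^sup>2)\<^sup>2"
  proof (intro power_mono)
    have "real N * real (k + 1) * ?R = (real N * h) * (real (k + 1) * (3 * S\<^sup>2 * c)) / h\<^sup>2"
      using h by (simp add: power2_eq_square)
    also have "\<dots> \<le> (c * (2 * pi)) * (real (k + 1) * (3 * S\<^sup>2 * c)) / h\<^sup>2"
      using N_h c by (intro divide_right_mono mult_right_mono) auto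
    also have "\<dots> \<le> K1 / h\<^sup>2"
      unfolding K1_def by (intro divide_right_mono) (auto simp: power2_eq_square)
    finally show "real N * real (k + 1) * ?R \<le> K1 / h\<^sup>2" .
    show "0 \<le> real N * real (k + 1) * ?R" using c h by (intro mult_nonneg_nonneg) auto
  qed
  finally show ?thesis .
qed

definition "S2 = S * sqrt (2 * pi * real (k + 1))"

text \<open>A coordinate is at most R S times the square root of the cell length, and the squares
  sum up to the length of the domain.\<close>

lemma coord_norm_le:
  assumes "\<And>j x. j \<in> {1..N} \<Longrightarrow> x \<in> {X (j - 1)..X j} \<Longrightarrow> \<bar>poly (v j) x\<bar> \<le> R"
  shows "L2_set (coord X v) idx \<le> S2 * R"
proof -
  have R: "0 \<le> R" using assms[of 1 "X 1"] N cell_less[of 1] by force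
  have S0: "0 \<le> S" using S1 by simp
  have sq: "(coord X v (j, m))\<^sup>2 \<le> (R * S)\<^sup>2 * (X j - X (j - 1))" if "(j, m) \<in> idx" for j m
  proof -
    let ?h = "X j - X (j - 1)"
    have j: "j \<in> {1..N}" using that by auto
    have hj: "0 < ?h" using cell_less[OF j] by simp
    have "\<bar>coord X v (j, m)\<bar> \<le> R * (S / sqrt ?h) * ?h"
      unfolding coord_def fst_conv using assms[OF j] basis_bd(1)[OF that] hj by (intro pint_bound) auto
    also have "\<dots> = R * S * (?h / sqrt ?h)" by simp
    also have "?h / sqrt ?h = sqrt ?h" using hj by (intro real_div_sqrt) simp
    finally have "\<bar>coord X v (j, m)\<bar>\<^sup>2 \<le> (R * S * sqrt ?h)\<^sup>2" by (intro power_mono) auto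
    then show ?thesis using hj by (simp add: power_mult_distrib)
  qed
  have "(\<Sum>a\<in>idx. (coord X v a)\<^sup>2) \<le> (\<Sum>a\<in>idx. (R * S)\<^sup>2 * (X (fst a) - X (fst a - 1)))"
  proof (intro sum_mono)
    fix a assume "a \<in> idx"
    then have "(fst a, snd a) \<in> idx" by simp
    from sq[OF this] show "(coord X v a)\<^sup>2 \<le> (R * S)\<^sup>2 * (X (fst a) - X (fst a - 1))" by simp
  qed
  also have "\<dots> = (\<Sum>j\<in>{1..N}. \<Sum>m\<le>k. (R * S)\<^sup>2 * (X j - X (j - 1)))"
    unfolding sum.cartesian_product by (simp only: case_prod_unfold)
  also have "\<dots> = real (k + 1) * (R * S)\<^sup>2 * (2 * pi)"
    unfolding sum_cells[symmetric] by (simp add: sum_distrib_left mult_ac)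
  also have "\<dots> = (S2 * R)\<^sup>2" unfolding S2_def by (simp add: power_mult_distrib)
  finally show ?thesis unfolding L2_set_def using S0 R by (intro real_le_lsqrt) (auto simp: S2_def intro: sum_nonneg)
qed

text \<open>An inverse estimate: each coordinate is at most the norm, and differentiated basis
  functions are of size h^(-3/2).\<close>

lemma pderiv_bound_coord:
  assumes "degree (v j) \<le> k" and j: "j \<in> {1..N}" and x: "x \<in> {X (j - 1)..X j}"
  shows "\<bar>poly (pderiv (v j)) x\<bar> \<le> real (k + 1) * S * ((c / h) * sqrt (c / h)) * L2_set (coord X v) idx"
proof -
  let ?h = "X j - X (j - 1)"
  have hj: "0 < ?h" using cell_less[OF j] by simp
  have S0: "0 \<le> S" using S1 by simp
  have t: "S / (?h * sqrt ?h) \<le> S * ((c / h) * sqrt (c / h))"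
  proof -
    have "(1 / ?h) * (1 / sqrt ?h) \<le> (c / h) * sqrt (c / h)"
      using sqrt_quasi[OF j] quasi[OF j] hj h c by (intro mult_mono) (auto simp: field_simps)
    then have "S * ((1 / ?h) * (1 / sqrt ?h)) \<le> S * ((c / h) * sqrt (c / h))" using S0 by (intro mult_left_mono) auto
    then show ?thesis by simp
  qed
  have "pderiv (v j) = (\<Sum>m\<le>k. smult (coord X v (j, m)) (pderiv (cell_basis X (j, m))))"
    using arg_cong[OF coord_expansion[where v = v, OF assms(1) j], of pderiv] by (simp add: pderiv_sum pderiv_smult)
  then have "\<bar>poly (pderiv (v j)) x\<bar> \<le> (\<Sum>m\<le>k. \<bar>coord X v (j, m)\<bar> * \<bar>poly (pderiv (cell_basis X (j, m))) x\<bar>)"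
    by (simp add: poly_sum) (rule order_trans[OF sum_abs], simp add: abs_mult)
  also have "\<dots> \<le> (\<Sum>m\<le>k. L2_set (coord X v) idx * (S * ((c / h) * sqrt (c / h))))"
  proof (intro sum_mono mult_mono)
    fix m assume m: "m \<in> {..k}"
    have a: "(j, m) \<in> idx" using j m by auto
    have "\<bar>coord X v (j, m)\<bar> = L2_set (coord X v) {(j, m)}" by simp
    also have "\<dots> \<le> L2_set (coord X v) idx" using a
      by (simp only: L2_set_def) (intro real_sqrt_le_mono sum_mono2, auto)
    finally show "\<bar>coord X v (j, m)\<bar> \<le> L2_set (coord X v) idx" .
    show "\<bar>poly (pderiv (cell_basis X (j, m))) x\<bar> \<le> S * ((c / h) * sqrt (c / h))"
      using basis_bd(2)[OF a, of x] x t by simp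
  qed (auto simp: L2_set_nonneg)
  also have "\<dots> = real (k + 1) * S * ((c / h) * sqrt (c / h)) * L2_set (coord X v) idx" by simp
  finally show ?thesis .
qed

end

section \<open>The error equations\<close>

lemma has_real_derivative_transform:
  assumes "t \<in> A" "\<And>s. s \<in> A \<Longrightarrow> g s = f s" "(f has_real_derivative D) (at t within A)"
  shows "(g has_real_derivative D) (at t within A)"
  using has_derivative_transform[where f = f and g = g, OF assms(1,2)] assms(3)
  unfolding has_field_derivative_def by blast

lemma coord_diff: "coord X (\<lambda>j. v j - w j) a = coord X v a - coord X w a"
  by (simp add: coord_def left_diff_distrib pint_diff)

lemma mat_app_cong: "(\<And>b. b \<in> I \<Longrightarrow> v b = w b) \<Longrightarrow> mat_app I A v a = mat_app I A w a"
  unfolding mat_app_def by (intro sum.cong) auto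

text \<open>Written outside the error locale, with the locale constants applied to their parameters,
  so that independence of mesh and solution is visible. The summands belong to the projection, the
  two corrections and the discrete error.\<close>

definition total_const :: "nat \<Rightarrow> real \<Rightarrow> real \<Rightarrow> real \<Rightarrow> real \<Rightarrow> real \<Rightarrow> real" where
  "total_const k c L T CC CF = CC + CC * CF + 2 * pi * c * (CC * CF) +
     real (k + 1) * mesh_bounds.S k L * (c * sqrt c) *
     (perturbed_flow.growth T * (mesh_bounds.S2 k L * (CF * (CC * (4 + 2 * sqrt T)))) * mesh_bounds.K1 k c L powr (1 / 4))"

text \<open>\<open>xi\<close> and \<open>xq\<close> are the errors against the corrected interpolants of \<open>u\<close> and \<open>u\<^sub>x\<close>. The
  correction \<open>W1 + Wb\<close> of the first is \<open>W\<^sub>2\<^sup>2\<close>; the second is corrected by \<open>Z1\<close> only, so that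
  the second equation of the scheme holds exactly for the errors.\<close>

locale ldg_error = mesh_bounds N X k B c L h + smooth_heat U "k + 3" M T
  for N X k B c L h U M T +
  fixes fl :: flux and uh qh :: "real \<Rightarrow> nat \<Rightarrow> real poly" and g0 g1 :: "real \<Rightarrow> real" and CC CF :: real
  assumes sol: "ldg_solution k T fl B g0 g1 N X uh qh"
    and periodic: "\<And>t. B = Periodic \<Longrightarrow> t \<in> {0..T} \<Longrightarrow> U 0 0 t = U 0 (2 * pi) t \<and> U 1 0 t = U 1 (2 * pi) t"
    and mixed_I: "\<And>t. B = Mixed \<Longrightarrow> fl = FluxI \<Longrightarrow> t \<in> {0..T} \<Longrightarrow> g0 t = U 0 0 t \<and> g1 t = U 1 (2 * pi) t"
    and mixed_II: "\<And>t. B = Mixed \<Longrightarrow> fl = FluxII \<Longrightarrow> t \<in> {0..T} \<Longrightarrow> g0 t = U 1 0 t \<and> g1 t = U 0 (2 * pi) t"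
    and CC: "1 \<le> CC" and CF: "1 \<le> CF"
    and coef_approx: "\<And>a b f L fl. a < b \<Longrightarrow>
      (\<And>i x. i < k \<Longrightarrow> x \<in> {a..b} \<Longrightarrow> (f i has_real_derivative f (Suc i) x) (at x within {a..b})) \<Longrightarrow>
      (\<And>x. x \<in> {a..b} \<Longrightarrow> \<bar>f k x - f k a\<bar> \<le> L) \<Longrightarrow>
      \<bar>radau_coef k fl a b (f 0)\<bar> \<le> CC * (L * (b - a) ^ k)"
    and super_approx: "\<And>a b f L fl x. a < b \<Longrightarrow>
      (\<And>i x. i < k + 1 \<Longrightarrow> x \<in> {a..b} \<Longrightarrow> (f i has_real_derivative f (Suc i) x) (at x within {a..b})) \<Longrightarrow>
      (\<And>x. x \<in> {a..b} \<Longrightarrow> \<bar>f (k + 1) x - f (k + 1) a\<bar> \<le> L) \<Longrightarrow> radau_zero k fl a b x \<Longrightarrow>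
      \<bar>f 1 x - poly (pderiv (radau_proj k fl a b (f 0))) x\<bar> \<le> CC * (L * (b - a) ^ k)"
    and F_bd: "\<And>a b fl x. a < b \<Longrightarrow> x \<in> {a..b} \<Longrightarrow>
      \<bar>poly (radau_F k fl a b) x\<bar> \<le> CF \<and> \<bar>poly (radau_Fbar k fl a b) x\<bar> \<le> CF"
    and dF_bd: "\<And>a b fl x. a < b \<Longrightarrow> x \<in> {a..b} \<Longrightarrow>
      \<bar>poly (pderiv (radau_F k fl a b)) x\<bar> \<le> CF / (b - a) \<and> \<bar>poly (pderiv (radau_Fbar k fl a b)) x\<bar> \<le> CF / (b - a)"
    and initial: "\<And>j. j \<in> {1..N} \<Longrightarrow> uh 0 j = radau_proj k fl (X (j - 1)) (X j) (\<lambda>x. U 0 x 0)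
      - smult ((X j - X (j - 1)) / 2 * radau_coef k (opp fl) (X (j - 1)) (X j) (\<lambda>x. U 1 x 0)) (radau_F k fl (X (j - 1)) (X j))
      - smult (((X j - X (j - 1)) / 2)\<^sup>2 * radau_coef k fl (X (j - 1)) (X j) (\<lambda>x. U 2 x 0)) (radau_Fbar k fl (X (j - 1)) (X j))"
begin

section \<open>Corrected interpolants and the equations for the errors\<close>

definition hj :: "nat \<Rightarrow> real" where "hj j = (X j - X (j - 1)) / 2"

definition RC :: "flux \<Rightarrow> nat \<Rightarrow> real \<Rightarrow> nat \<Rightarrow> real" where
  "RC f i t j = radau_coef k f (X (j - 1)) (X j) (\<lambda>x. U i x t)"

definition "Pu t j = radau_proj k fl (X (j - 1)) (X j) (\<lambda>x. U 0 x t)"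
definition "Pq t j = radau_proj k (opp fl) (X (j - 1)) (X j) (\<lambda>x. U 1 x t)"
definition "W1 t j = smult (hj j * RC (opp fl) 1 t j) (radau_F k fl (X (j - 1)) (X j))"
definition "Wb t j = smult ((hj j)\<^sup>2 * RC fl 2 t j) (radau_Fbar k fl (X (j - 1)) (X j))"
definition "Z1 t j = smult (hj j * RC fl 2 t j) (radau_F k (opp fl) (X (j - 1)) (X j))"
text \<open>Not part of an interpolant: its flux form represents the time derivative of
  \<open>W1\<close>, so it enters the abstract flow as the datum \<open>z\<close>.\<close>

definition "Zb t j = smult ((hj j)\<^sup>2 * RC (opp fl) 3 t j) (radau_Fbar k (opp fl) (X (j - 1)) (X j))"
definition "xi t j = Pu t j - W1 t j - Wb t j - uh t j"
definition "xq t j = Pq t j - Z1 t j - qh t j"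

lemma hj_pos: "j \<in> {1..N} \<Longrightarrow> 0 < hj j"
  using cell_less[of j] by (simp add: hj_def)

lemma cont_cell: "j \<in> {1..N} \<Longrightarrow> i \<le> k + 3 \<Longrightarrow> t \<in> {0..T} \<Longrightarrow> continuous_on {X (j - 1)..X j} (\<lambda>x. U i x t)"
  by (intro continuous_x cell_in)

lemma degrees:
  assumes "j \<in> {1..N}"
  shows "degree (Pu t j) \<le> k" "degree (Pq t j) \<le> k" "degree (W1 t j) \<le> k" "degree (Wb t j) \<le> k"
    "degree (Z1 t j) \<le> k" "degree (Zb t j) \<le> k"
  unfolding Pu_def Pq_def W1_def Wb_def Z1_def Zb_def
  using cell_less[OF assms] k
  by (auto intro!: degree_radau_proj order_trans[OF degree_smult_le] radau_F_props(1) radau_Fbar_props(1))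

lemma degree_uh: "t \<in> {0..T} \<Longrightarrow> j \<in> {1..N} \<Longrightarrow> degree (uh t j) \<le> k"
  and degree_qh: "t \<in> {0..T} \<Longrightarrow> j \<in> {1..N} \<Longrightarrow> degree (qh t j) \<le> k"
  using sol unfolding ldg_solution_def Vh_def by auto

lemma degree_xi: "t \<in> {0..T} \<Longrightarrow> j \<in> {1..N} \<Longrightarrow> degree (xi t j) \<le> k"
  and degree_xq: "t \<in> {0..T} \<Longrightarrow> j \<in> {1..N} \<Longrightarrow> degree (xq t j) \<le> k"
  unfolding xi_def xq_def using degrees[of j t] degree_uh degree_qh
  by (auto intro!: degree_diff_le)

lemma sol1:
  assumes "t \<in> {0..T}" "j \<in> {1..N}" "degree w \<le> k"
  shows "integral {X (j - 1)..X j} (\<lambda>x. t_deriv T (\<lambda>s. poly (uh s j) x) t * poly w x) =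
    - pint (X (j - 1)) (X j) (qh t j * pderiv w)
    + u_hat (opp fl) B N X (g0 t) (g1 t) (qh t) j * poly w (X j)
    - u_hat (opp fl) B N X (g0 t) (g1 t) (qh t) (j - 1) * poly w (X (j - 1))"
proof -
  have v: "(\<lambda>_. w) \<in> Vh k N" using assms by (simp add: Vh_def)
  note eqs = sol[unfolded ldg_solution_def, THEN conjunct2, THEN conjunct2]
  show ?thesis
    using eqs[THEN bspec, OF assms(1), THEN bspec, OF v, THEN bspec, OF v, THEN bspec, OF assms(2), THEN conjunct1]
    unfolding cell_def q_hat_eq pint_eq poly_mult .
qed

lemma sol2:
  assumes "t \<in> {0..T}" "j \<in> {1..N}" "degree w \<le> k"
  shows "pint (X (j - 1)) (X j) (qh t j * w) =
    - pint (X (j - 1)) (X j) (uh t j * pderiv w)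
    + u_hat fl B N X (g0 t) (g1 t) (uh t) j * poly w (X j)
    - u_hat fl B N X (g0 t) (g1 t) (uh t) (j - 1) * poly w (X (j - 1))"
proof -
  have v: "(\<lambda>_. w) \<in> Vh k N" using assms by (simp add: Vh_def)
  note eqs = sol[unfolded ldg_solution_def, THEN conjunct2, THEN conjunct2]
  show ?thesis
    using eqs[THEN bspec, OF assms(1), THEN bspec, OF v, THEN bspec, OF v, THEN bspec, OF assms(2), THEN conjunct2]
    unfolding cell_def q_hat_eq pint_eq poly_mult .
qed

text \<open>The successor is passed as \<open>i'\<close> so that it can be instantiated with
  numerals.\<close>

lemma exact_by_parts:
  assumes j: "j \<in> {1..N}" and t: "t \<in> {0..T}" and i: "i < k + 3" "i' = Suc i"
  shows "integral {X (j - 1)..X j} (\<lambda>x. U i' x t * poly w x) =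
    - integral {X (j - 1)..X j} (\<lambda>x. U i x t * poly (pderiv w) x)
    + U i (X j) t * poly w (X j) - U i (X (j - 1)) t * poly w (X (j - 1))"
proof -
  let ?a = "X (j - 1)" and ?b = "X j"
  have "((\<lambda>x. U i x t * poly (pderiv w) x + U i' x t * poly w x) has_integral
      U i ?b t * poly w ?b - U i ?a t * poly w ?a) {?a..?b}"
  proof (rule fundamental_theorem_of_calculus)
    fix x assume x: "x \<in> {?a..?b}"
    have "((\<lambda>y. U i y t) has_real_derivative U i' x t) (at x within {?a..?b})"
      unfolding i(2) using x cell_in[OF j] by (intro has_field_derivative_subset[OF dx[OF i(1) _ t]]) auto
    from DERIV_mult[OF this has_field_derivative_at_within[OF poly_DERIV[of w x]]]
    show "((\<lambda>x. U i x t * poly w x) has_vector_derivative U i x t * poly (pderiv w) x + U i' x t * poly w x) (at x within {?a..?b})"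
      by (simp add: has_real_derivative_iff_has_vector_derivative add.commute mult.commute)
  qed (use cell_less[OF j] in simp)
  then have "U i ?b t * poly w ?b - U i ?a t * poly w ?a =
      integral {?a..?b} (\<lambda>x. U i x t * poly (pderiv w) x + U i' x t * poly w x)" by (simp add: integral_unique)
  also have "\<dots> = integral {?a..?b} (\<lambda>x. U i x t * poly (pderiv w) x) + integral {?a..?b} (\<lambda>x. U i' x t * poly w x)"
    using i by (intro integral_add integrable_mult_poly cont_cell[OF j _ t]) auto
  finally show ?thesis by simp
qed

lemma proj_identity:
  assumes j: "j \<in> {1..N}" and t: "t \<in> {0..T}" and w: "degree w \<le> k"
  shows "integral {X (j - 1)..X j} (\<lambda>x. U 0 x t * poly w x) =
      pint (X (j - 1)) (X j) (Pu t j * w) + RC fl 0 t j * pint (X (j - 1)) (X j) (leg (X (j - 1)) (X j) k * w)"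
    and "integral {X (j - 1)..X j} (\<lambda>x. U 1 x t * poly w x) =
      pint (X (j - 1)) (X j) (Pq t j * w) + RC (opp fl) 1 t j * pint (X (j - 1)) (X j) (leg (X (j - 1)) (X j) k * w)"
    and "integral {X (j - 1)..X j} (\<lambda>x. U 0 x t * poly (pderiv w) x) = pint (X (j - 1)) (X j) (Pu t j * pderiv w)"
    and "integral {X (j - 1)..X j} (\<lambda>x. U 1 x t * poly (pderiv w) x) = pint (X (j - 1)) (X j) (Pq t j * pderiv w)"
proof -
  note ab = cell_less[OF j]
  have dw: "degree (pderiv w) < k" using w k by (simp add: degree_pderiv)
  show "integral {X (j - 1)..X j} (\<lambda>x. U 0 x t * poly w x) =
      pint (X (j - 1)) (X j) (Pu t j * w) + RC fl 0 t j * pint (X (j - 1)) (X j) (leg (X (j - 1)) (X j) k * w)"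
    unfolding Pu_def RC_def by (rule integral_radau_proj[OF ab cont_cell[OF j _ t] w]) simp
  show "integral {X (j - 1)..X j} (\<lambda>x. U 1 x t * poly w x) =
      pint (X (j - 1)) (X j) (Pq t j * w) + RC (opp fl) 1 t j * pint (X (j - 1)) (X j) (leg (X (j - 1)) (X j) k * w)"
    unfolding Pq_def RC_def by (rule integral_radau_proj[OF ab cont_cell[OF j _ t] w]) simp
  show "integral {X (j - 1)..X j} (\<lambda>x. U 0 x t * poly (pderiv w) x) = pint (X (j - 1)) (X j) (Pu t j * pderiv w)"
    using integral_radau_proj[OF ab cont_cell[OF j _ t] less_imp_le[OF dw], of 0 fl] leg_orthogonal[OF ab dw]
    unfolding Pu_def by simp
  show "integral {X (j - 1)..X j} (\<lambda>x. U 1 x t * poly (pderiv w) x) = pint (X (j - 1)) (X j) (Pq t j * pderiv w)"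
    using integral_radau_proj[OF ab cont_cell[OF j _ t] less_imp_le[OF dw], of 1 "opp fl"] leg_orthogonal[OF ab dw]
    unfolding Pq_def by simp
qed

text \<open>The factor 1 / hj from each primitive meets the powers of \<open>hj\<close> in the
  corrections. \<open>W1\<close> and \<open>Z1\<close> cancel the residuals of \<open>Pq\<close> and
  of the time derivative of \<open>Pu\<close>; \<open>Wb\<close> cancels \<open>Z1\<close> in the
  equation for q, and \<open>Zb\<close> accounts for the time derivative of
  \<open>W1\<close>.\<close>

lemma correction_identity:
  assumes j: "j \<in> {1..N}" and w: "degree w \<le> k"
  shows "pint (X (j - 1)) (X j) (W1 t j * pderiv w) = - RC (opp fl) 1 t j * pint (X (j - 1)) (X j) (leg (X (j - 1)) (X j) k * w)"
    and "pint (X (j - 1)) (X j) (Wb t j * pderiv w) = - pint (X (j - 1)) (X j) (Z1 t j * w)"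
    and "pint (X (j - 1)) (X j) (Z1 t j * pderiv w) = - RC fl 2 t j * pint (X (j - 1)) (X j) (leg (X (j - 1)) (X j) k * w)"
    and "pint (X (j - 1)) (X j) (Zb t j * pderiv w) =
      - (hj j * RC (opp fl) 3 t j) * pint (X (j - 1)) (X j) (radau_F k fl (X (j - 1)) (X j) * w)"
proof -
  note ab = cell_less[OF j]
  have H: "2 / (X j - X (j - 1)) = 1 / hj j" by (simp add: hj_def)
  have h0: "hj j \<noteq> 0" using hj_pos[OF j] by simp
  have c: "hj j * r * (- (1 / hj j) * p) = - r * p" "(hj j)\<^sup>2 * r * (- (1 / hj j) * p) = - (hj j * r) * p" for r p
    using h0 by (simp_all add: power2_eq_square)
  show "pint (X (j - 1)) (X j) (W1 t j * pderiv w) = - RC (opp fl) 1 t j * pint (X (j - 1)) (X j) (leg (X (j - 1)) (X j) k * w)"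
    unfolding W1_def mult_smult_left pint_smult radau_F_props(3)[OF ab k w] H by (rule c)
  show "pint (X (j - 1)) (X j) (Wb t j * pderiv w) = - pint (X (j - 1)) (X j) (Z1 t j * w)"
    unfolding Wb_def Z1_def mult_smult_left pint_smult radau_Fbar_props(3)[OF ab k w] H using c(2) by simp
  show "pint (X (j - 1)) (X j) (Z1 t j * pderiv w) = - RC fl 2 t j * pint (X (j - 1)) (X j) (leg (X (j - 1)) (X j) k * w)"
    unfolding Z1_def mult_smult_left pint_smult radau_F_props(3)[OF ab k w] H by (rule c)
  show "pint (X (j - 1)) (X j) (Zb t j * pderiv w) =
      - (hj j * RC (opp fl) 3 t j) * pint (X (j - 1)) (X j) (radau_F k fl (X (j - 1)) (X j) * w)"
    unfolding Zb_def mult_smult_left pint_smult radau_Fbar_props(3)[OF ab k w] H opp_opp by (rule c)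
qed

text \<open>The corrections vanish at the collocation end, hence the interpolant has the exact trace
  at every node, and the boundary data cancel in the difference.\<close>

lemma trace_xi:
  assumes t: "t \<in> {0..T}" and i: "i \<le> N"
  shows "u_hat fl B N X 0 0 (xi t) i = U 0 (X i) t - u_hat fl B N X (g0 t) (g1 t) (uh t) i"
proof -
  let ?uI = "\<lambda>j. Pu t j - W1 t j - Wb t j"
  have "u_hat fl B N X (g0 t) (g1 t) ?uI i = U 0 (X i) t"
  proof (rule u_hat_exact[where f = "\<lambda>x. U 0 x t"])
    fix j assume j: "j \<in> {1..N}"
    show "poly (?uI j) (end_pt fl (X (j - 1)) (X j)) = U 0 (end_pt fl (X (j - 1)) (X j)) t"
      using radau_proj_end_pt[OF cell_less[OF j], of k fl "\<lambda>x. U 0 x t"]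
        radau_F_props(2)[OF cell_less[OF j] k, of fl] radau_Fbar_props(2)[OF cell_less[OF j] k, of fl]
      unfolding Pu_def W1_def Wb_def by simp
  qed (use periodic mixed_I mixed_II t i in auto)
  then show ?thesis
    using u_hat_diff[of fl B N X "g0 t" "g0 t" "g1 t" "g1 t" ?uI "uh t" i] by (simp add: xi_def[abs_def])
qed

lemma trace_xq:
  assumes t: "t \<in> {0..T}" and i: "i \<le> N"
  shows "u_hat (opp fl) B N X 0 0 (xq t) i = U 1 (X i) t - u_hat (opp fl) B N X (g0 t) (g1 t) (qh t) i"
proof -
  let ?qI = "\<lambda>j. Pq t j - Z1 t j"
  have "u_hat (opp fl) B N X (g0 t) (g1 t) ?qI i = U 1 (X i) t"
  proof (rule u_hat_exact[where f = "\<lambda>x. U 1 x t"])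
    fix j assume j: "j \<in> {1..N}"
    show "poly (?qI j) (end_pt (opp fl) (X (j - 1)) (X j)) = U 1 (end_pt (opp fl) (X (j - 1)) (X j)) t"
      using radau_proj_end_pt[OF cell_less[OF j], of k "opp fl" "\<lambda>x. U 1 x t"]
        radau_F_props(2)[OF cell_less[OF j] k, of "opp fl"]
      unfolding Pq_def Z1_def by simp
  next
    show "B = Mixed \<Longrightarrow> opp fl = FluxI \<Longrightarrow> g0 t = U 1 0 t" using mixed_II[OF _ _ t] by (cases fl) auto
    show "B = Mixed \<Longrightarrow> opp fl = FluxII \<Longrightarrow> g1 t = U 1 (2 * pi) t" using mixed_I[OF _ _ t] by (cases fl) auto
  qed (use periodic t i in auto)
  then show ?thesis
    using u_hat_diff[of "opp fl" B N X "g0 t" "g0 t" "g1 t" "g1 t" ?qI "qh t" i] by (simp add: xq_def[abs_def])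
qed

lemma trace_Zb: "i \<le> N \<Longrightarrow> u_hat (opp fl) B N X 0 0 (Zb t) i = 0"
  using radau_Fbar_props(2)[OF cell_less k, of _ "opp fl"]
  by (intro u_hat_exact[where f = "\<lambda>_. 0"]) (auto simp: Zb_def)

lemma error_eq_q:
  assumes t: "t \<in> {0..T}" and j: "j \<in> {1..N}" and w: "degree w \<le> k"
  shows "pint (X (j - 1)) (X j) (xq t j * w) = flux_form B N X fl (xi t) j w"
proof -
  have jN: "j \<le> N" "j - 1 \<le> N" using j by auto
  have i1: "(1::nat) = Suc 0" by simp
  show ?thesis
    using exact_by_parts[OF j t _ i1, of w] proj_identity(2,3)[OF j t w] correction_identity(1,2)[OF j w, of t]
      sol2[OF t j w] trace_xi[OF t jN(1)] trace_xi[OF t jN(2)]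
    unfolding flux_form_def
    by (simp add: xi_def xq_def left_diff_distrib pint_diff)
qed

text \<open>The scheme provides differentiable coefficients only; expanding in monomials up to
  degree \<open>k\<close> passes the derivative through \<open>poly\<close> and the
  integral.\<close>

lemma uh_time_derivative:
  assumes t: "t \<in> {0..T}" and j: "j \<in> {1..N}" and w: "degree w \<le> k"
  shows "((\<lambda>s. pint (X (j - 1)) (X j) (uh s j * w)) has_real_derivative
    integral {X (j - 1)..X j} (\<lambda>x. t_deriv T (\<lambda>s. poly (uh s j) x) t * poly w x)) (at t within {0..T})"
proof -
  define D where "D i = vector_derivative (\<lambda>s. coeff (uh s j) i) (at t within {0..T})" for i
  have D: "((\<lambda>s. coeff (uh s j) i) has_real_derivative D i) (at t within {0..T})" for i
  proof -
    have "(\<lambda>s. coeff (uh s j) i) differentiable (at t within {0..T})"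
      using sol j t unfolding ldg_solution_def differentiable_on_def by blast
    then show ?thesis
      unfolding D_def has_real_derivative_iff_has_vector_derivative by (simp add: vector_derivative_works)
  qed
  have rep: "uh s j = (\<Sum>i\<le>k. smult (coeff (uh s j) i) (monom 1 i))" if "s \<in> {0..T}" for s
    using poly_as_sum_of_monoms'[OF degree_uh[OF that j]] by (simp add: smult_monom)
  define ud where "ud = (\<Sum>i\<le>k. smult (D i) (monom 1 i))"
  have "t_deriv T (\<lambda>s. poly (uh s j) x) t = poly ud x" for x
  proof -
    have "((\<lambda>s. \<Sum>i\<le>k. coeff (uh s j) i * x ^ i) has_real_derivative (\<Sum>i\<le>k. D i * x ^ i)) (at t within {0..T})"
      by (intro DERIV_sum DERIV_cmult_right D)
    then have "((\<lambda>s. poly (uh s j) x) has_real_derivative (\<Sum>i\<le>k. D i * x ^ i)) (at t within {0..T})"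
    proof (rule has_real_derivative_transform[OF t, rotated])
      fix s assume "s \<in> {0..T}"
      from arg_cong[OF rep[OF this], of "\<lambda>p. poly p x"]
      show "poly (uh s j) x = (\<Sum>i\<le>k. coeff (uh s j) i * x ^ i)" by (simp add: poly_sum poly_monom)
    qed
    then have "t_deriv T (\<lambda>s. poly (uh s j) x) t = (\<Sum>i\<le>k. D i * x ^ i)"
      unfolding t_deriv_def has_real_derivative_iff_has_vector_derivative
      using vector_derivative_within_cbox[of 0 T t] T t by simp
    then show ?thesis by (simp add: ud_def poly_sum poly_monom)
  qed
  then have i: "integral {X (j - 1)..X j} (\<lambda>x. t_deriv T (\<lambda>s. poly (uh s j) x) t * poly w x) = pint (X (j - 1)) (X j) (ud * w)"
    by (simp add: pint_eq)
  have "((\<lambda>s. \<Sum>i\<le>k. coeff (uh s j) i * pint (X (j - 1)) (X j) (monom 1 i * w)) has_real_derivative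
      (\<Sum>i\<le>k. D i * pint (X (j - 1)) (X j) (monom 1 i * w))) (at t within {0..T})"
    by (intro DERIV_sum DERIV_cmult_right D)
  moreover have "(\<Sum>i\<le>k. D i * pint (X (j - 1)) (X j) (monom 1 i * w)) = pint (X (j - 1)) (X j) (ud * w)"
    by (simp add: ud_def sum_distrib_right pint_sum pint_smult)
  ultimately have d: "((\<lambda>s. \<Sum>i\<le>k. coeff (uh s j) i * pint (X (j - 1)) (X j) (monom 1 i * w)) has_real_derivative
      pint (X (j - 1)) (X j) (ud * w)) (at t within {0..T})" by simp
  show ?thesis
    unfolding i
  proof (rule has_real_derivative_transform[OF t _ d])
    fix s assume "s \<in> {0..T}"
    from arg_cong[OF rep[OF this], of "\<lambda>p. pint (X (j - 1)) (X j) (p * w)"]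
    show "pint (X (j - 1)) (X j) (uh s j * w) = (\<Sum>i\<le>k. coeff (uh s j) i * pint (X (j - 1)) (X j) (monom 1 i * w))"
      by (simp add: sum_distrib_right pint_sum pint_smult)
  qed
qed

text \<open>Adding \<open>Wb\<close> back removes the second correction, so only \<open>Pu\<close>,
  \<open>W1\<close> and \<open>uh\<close> are differentiated. The derivative of \<open>Wb\<close>
  would involve \<open>U 4\<close>, beyond the range of \<open>RC_bound\<close>.\<close>

lemma error_eq_u:
  assumes t: "t \<in> {0..T}" and j: "j \<in> {1..N}" and w: "degree w \<le> k"
  shows "((\<lambda>s. pint (X (j - 1)) (X j) ((xi s j + Wb s j) * w)) has_real_derivative
    flux_form B N X (opp fl) (xq t) j w - flux_form B N X (opp fl) (Zb t) j w) (at t within {0..T})"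
proof -
  let ?P = "pint (X (j - 1)) (X j)" and ?L = "leg (X (j - 1)) (X j) k" and ?F = "radau_F k fl (X (j - 1)) (X j)"
  let ?I = "\<lambda>f. integral {X (j - 1)..X j} f"
  have jN: "j \<le> N" "j - 1 \<le> N" using j by auto
  have i2: "(2::nat) = Suc 1" and n: "0 + 2 = (2::nat)" "1 + 2 = (3::nat)" by simp_all
  have dc: "((\<lambda>s. RC f i s j) has_real_derivative RC f (i + 2) t j) (at t within {0..T})" if "i \<le> 1" for f i
    unfolding RC_def using that k by (intro dt_radau_coef cell_less cell_in j t) auto
  have "((\<lambda>s. ?I (\<lambda>x. U 0 x s * poly w x) - RC fl 0 s j * ?P (?L * w) - hj j * RC (opp fl) 1 s j * ?P (?F * w) - ?P (uh s j * w))
      has_real_derivative ?I (\<lambda>x. U (0 + 2) x t * poly w x) - RC fl (0 + 2) t j * ?P (?L * w)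
        - hj j * RC (opp fl) (1 + 2) t j * ?P (?F * w)
        - ?I (\<lambda>x. t_deriv T (\<lambda>s. poly (uh s j) x) t * poly w x)) (at t within {0..T})"
    using k by (intro DERIV_diff DERIV_cmult DERIV_cmult_right dc dt_integral uh_time_derivative cell_in t j w) auto
  moreover have "?I (\<lambda>x. U (0 + 2) x t * poly w x) - RC fl (0 + 2) t j * ?P (?L * w)
        - hj j * RC (opp fl) (1 + 2) t j * ?P (?F * w)
        - ?I (\<lambda>x. t_deriv T (\<lambda>s. poly (uh s j) x) t * poly w x) =
      flux_form B N X (opp fl) (xq t) j w - flux_form B N X (opp fl) (Zb t) j w"
    using exact_by_parts[OF j t _ i2, of w] proj_identity(4)[OF j t w] correction_identity(3,4)[OF j w, of t]
      sol1[OF t j w] trace_xq[OF t jN(1)] trace_xq[OF t jN(2)] trace_Zb[OF jN(1), of t] trace_Zb[OF jN(2), of t]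
    unfolding flux_form_def n
    by (simp add: xq_def left_diff_distrib pint_diff)
  ultimately have d: "((\<lambda>s. ?I (\<lambda>x. U 0 x s * poly w x) - RC fl 0 s j * ?P (?L * w) - hj j * RC (opp fl) 1 s j * ?P (?F * w) - ?P (uh s j * w))
      has_real_derivative flux_form B N X (opp fl) (xq t) j w - flux_form B N X (opp fl) (Zb t) j w) (at t within {0..T})"
    by (simp only:)
  show ?thesis
  proof (rule has_real_derivative_transform[OF t _ d])
    fix s assume s: "s \<in> {0..T}"
    have e: "xi s j + Wb s j = Pu s j - W1 s j - uh s j" by (simp add: xi_def)
    show "?P ((xi s j + Wb s j) * w) = ?I (\<lambda>x. U 0 x s * poly w x) - RC fl 0 s j * ?P (?L * w)
        - hj j * RC (opp fl) 1 s j * ?P (?F * w) - ?P (uh s j * w)"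
      unfolding e proj_identity(1)[OF j s w] by (simp add: left_diff_distrib pint_diff W1_def pint_smult)
  qed
qed

section \<open>Size of the corrections and the discrete errors\<close>

lemma deriv_cell:
  assumes "j \<in> {1..N}" "i < k + 3" "x \<in> {X (j - 1)..X j}" "t \<in> {0..T}"
  shows "((\<lambda>y. U i y t) has_real_derivative U (Suc i) x t) (at x within {X (j - 1)..X j})"
  using assms cell_in[OF assms(1)] by (intro has_field_derivative_subset[OF dx]) auto

lemma cell_pow: "j \<in> {1..N} \<Longrightarrow> A * (X j - X (j - 1)) * (X j - X (j - 1)) ^ k \<le> A * h ^ (k + 1)" if "0 \<le> A"
proof -
  assume j: "j \<in> {1..N}"
  have "(X j - X (j - 1)) ^ (k + 1) \<le> h ^ (k + 1)" using cell_h[OF j] cell_less[OF j] by (intro power_mono) auto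
  then show ?thesis using mult_left_mono[OF _ that] by (simp add: mult.assoc)
qed

text \<open>The case \<open>i = 3\<close> uses the Lipschitz bound of the top derivative
  \<open>U (k + 3)\<close>.\<close>

lemma RC_bound:
  assumes j: "j \<in> {1..N}" and t: "t \<in> {0..T}" and i: "i \<le> 3"
  shows "\<bar>RC f i t j\<bar> \<le> CC * (M * h ^ (k + 1))"
proof -
  let ?h = "X j - X (j - 1)"
  have "\<bar>RC f (i + 0) t j\<bar> \<le> CC * (M * ?h * ?h ^ k)"
    unfolding RC_def
  proof (rule coef_approx[where f = "\<lambda>i' x. U (i + i') x t"])
    show "((\<lambda>x. U (i + i') x t) has_real_derivative U (i + Suc i') x t) (at x within {X (j - 1)..X j})"
      if "i' < k" "x \<in> {X (j - 1)..X j}" for i' x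
      using deriv_cell[OF j _ that(2) t, of "i + i'"] that(1) i by simp
    show "\<bar>U (i + k) x t - U (i + k) (X (j - 1)) t\<bar> \<le> M * ?h" if x: "x \<in> {X (j - 1)..X j}" for x
    proof -
      have "\<bar>U (i + k) x t - U (i + k) (X (j - 1)) t\<bar> \<le> M * \<bar>x - X (j - 1)\<bar>"
        using x cell_in[OF j] cell_less[OF j] i t by (intro lip_x) auto
      also have "\<dots> \<le> M * ?h" using x M_nonneg by (intro mult_left_mono) auto
      finally show ?thesis .
    qed
  qed (rule cell_less[OF j])
  also have "\<dots> \<le> CC * (M * h ^ (k + 1))" using CC cell_pow[OF M_nonneg j] by (intro mult_left_mono) auto
  finally show ?thesis by simp
qed

text \<open>The coefficient estimate is applied to the increment in time. Its derivative of order
  \<open>k\<close> oscillates over the cell by at most the cell length times the increment of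
  \<open>U (k + 3)\<close>, which is Hoelder continuous in time.\<close>

lemma RC_holder:
  assumes j: "j \<in> {1..N}" and t: "t \<in> {0..T}" and s: "s \<in> {0..T}"
  shows "\<bar>RC f 2 t j - RC f 2 s j\<bar> \<le> CC * ((4 + 2 * sqrt T) * M * sqrt \<bar>t - s\<bar> * h ^ (k + 1))"
proof -
  let ?h = "X j - X (j - 1)" and ?H = "(4 + 2 * sqrt T) * M * sqrt \<bar>t - s\<bar>"
  have H0: "0 \<le> ?H" using M_nonneg T by (intro mult_nonneg_nonneg add_nonneg_nonneg) auto
  have d: "((\<lambda>x. U i x t - U i x s) has_real_derivative U (Suc i) x t - U (Suc i) x s) (at x within {X (j - 1)..X j})"
    if "i < k + 3" "x \<in> {X (j - 1)..X j}" for i x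
    using deriv_cell[OF j that t] deriv_cell[OF j that s] by (rule DERIV_diff)
  have "RC f 2 t j - RC f 2 s j = radau_coef k f (X (j - 1)) (X j) (\<lambda>x. U (2 + 0) x t - U (2 + 0) x s)"
    unfolding RC_def using cont_cell[OF j _ t] cont_cell[OF j _ s] by (simp add: radau_coef_diff)
  also have "\<bar>\<dots>\<bar> \<le> CC * (?H * ?h * ?h ^ k)"
  proof (rule coef_approx[where f = "\<lambda>i x. U (2 + i) x t - U (2 + i) x s"])
    show "((\<lambda>x. U (2 + i) x t - U (2 + i) x s) has_real_derivative U (2 + Suc i) x t - U (2 + Suc i) x s) (at x within {X (j - 1)..X j})"
      if "i < k" "x \<in> {X (j - 1)..X j}" for i x
      using d[of "2 + i" x] that by simp
    show "\<bar>(U (2 + k) x t - U (2 + k) x s) - (U (2 + k) (X (j - 1)) t - U (2 + k) (X (j - 1)) s)\<bar> \<le> ?H * ?h"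
      if x: "x \<in> {X (j - 1)..X j}" for x
    proof (cases "x = X (j - 1)")
      case True
      then show ?thesis using H0 cell_less[OF j] by simp
    next
      case False
      obtain \<xi> where \<xi>: "\<xi> \<in> {X (j - 1)..X j}" "\<bar>\<xi> - X (j - 1)\<bar> \<le> \<bar>x - X (j - 1)\<bar>"
        "(U (2 + k) x t - U (2 + k) x s) - (U (2 + k) (X (j - 1)) t - U (2 + k) (X (j - 1)) s)
          = (x - X (j - 1)) * (U (Suc (2 + k)) \<xi> t - U (Suc (2 + k)) \<xi> s)"
        by (rule mvt_two_points[of "X (j - 1)" "X j" "\<lambda>x. U (2 + k) x t - U (2 + k) x s"
              "\<lambda>x. U (Suc (2 + k)) x t - U (Suc (2 + k)) x s" "X (j - 1)" x])
           (use d[of "2 + k"] x False cell_less[OF j] in auto)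
      have e: "Suc (2 + k) = k + 3" by simp
      have "\<bar>U (k + 3) \<xi> t - U (k + 3) \<xi> s\<bar> \<le> ?H" using \<xi>(1) cell_in[OF j] s t by (intro holder_t) auto
      then have "\<bar>U (Suc (2 + k)) \<xi> t - U (Suc (2 + k)) \<xi> s\<bar> \<le> ?H" unfolding e .
      then have "\<bar>(x - X (j - 1)) * (U (Suc (2 + k)) \<xi> t - U (Suc (2 + k)) \<xi> s)\<bar> \<le> ?h * ?H"
        unfolding abs_mult using x by (intro mult_mono) auto
      then show ?thesis unfolding \<xi>(3) by (simp add: mult.commute)
    qed
  qed (rule cell_less[OF j])
  also have "\<dots> \<le> CC * (?H * h ^ (k + 1))" using CC cell_pow[OF H0 j] by (intro mult_left_mono) auto
  finally show ?thesis .
qed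

text \<open>The common size of the data \<open>Zb\<close> and \<open>Wb\<close>; the factor 4 + 2
  sqrt T is the Hoelder constant of \<open>holder_t\<close>.\<close>

definition "E = S2 * (CF * (CC * (4 + 2 * sqrt T)) * (M * h ^ (k + 3)))"

lemma hj_sq: "j \<in> {1..N} \<Longrightarrow> (hj j)\<^sup>2 \<le> h\<^sup>2"
  using hj_pos[of j] cell_h[of j] h by (intro power_mono) (auto simp: hj_def)

lemma correction_value:
  assumes j: "j \<in> {1..N}" and x: "x \<in> {X (j - 1)..X j}" and r: "\<bar>r\<bar> \<le> R * h ^ (k + 1)"
  shows "\<bar>poly (smult ((hj j)\<^sup>2 * r) (radau_Fbar k f (X (j - 1)) (X j))) x\<bar> \<le> CF * R * h ^ (k + 3)"
proof -
  have "\<bar>(hj j)\<^sup>2 * r\<bar> \<le> h\<^sup>2 * (R * h ^ (k + 1))"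
    unfolding abs_mult using r hj_sq[OF j] by (intro mult_mono) auto
  moreover have "\<bar>poly (radau_Fbar k f (X (j - 1)) (X j)) x\<bar> \<le> CF" using F_bd[OF cell_less[OF j] x] by blast
  ultimately have "\<bar>(hj j)\<^sup>2 * r\<bar> * \<bar>poly (radau_Fbar k f (X (j - 1)) (X j)) x\<bar> \<le> (h\<^sup>2 * (R * h ^ (k + 1))) * CF"
    by (intro mult_mono) (auto intro: order_trans[OF abs_ge_zero])
  also have "\<dots> = CF * R * h ^ (k + 3)" by (simp add: power_add power2_eq_square power3_eq_cube)
  finally show ?thesis by (simp add: abs_mult)
qed

text \<open>The coordinates of \<open>xi\<close> are the unknown, since the choice of the initial
  value means that \<open>xi 0\<close> vanishes on every cell. By \<open>error_eq_q\<close> the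
  matrix maps them to the coordinates of \<open>xq\<close>, and its transpose gives the form in the
  equation for u.\<close>

lemma flow: "perturbed_flow idx (flux_mat fl) (\<lambda>s. coord X (xi s)) (\<lambda>s. coord X (\<lambda>j. xi s j + Wb s j))
    (\<lambda>s. coord X (Wb s)) (\<lambda>s. coord X (Zb s)) T E (K1 / h\<^sup>2)"
proof
  have pos: "0 \<le> 4 + 2 * sqrt T" "1 \<le> 4 + 2 * sqrt T" using T by auto
  show "finite idx" by simp
  show "0 < T" by (rule T)
  show "0 \<le> E" unfolding E_def S2_def
    using S1 CF CC M_nonneg h pos by (intro mult_nonneg_nonneg) auto
  show "1 \<le> K1 / h\<^sup>2" by (rule K_ge1)
  show "(\<Sum>a\<in>idx. \<Sum>b\<in>idx. (flux_mat fl a b)\<^sup>2) \<le> (K1 / h\<^sup>2)\<^sup>2" by (rule flux_mat_frobenius)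
  show "coord X (\<lambda>j. xi s j + Wb s j) a = coord X (xi s) a + coord X (Wb s) a" for s a
    by (simp add: coord_def distrib_right pint_add)
  show "coord X (xi 0) a = 0" if "a \<in> idx" for a
  proof -
    have "fst a \<in> {1..N}" using that by auto
    then have "xi 0 (fst a) = 0"
      using initial[of "fst a"] unfolding xi_def Pu_def W1_def Wb_def hj_def RC_def by simp
    then show ?thesis by (simp add: coord_def)
  qed
  show "L2_set (coord X (Zb s)) idx \<le> E" if s: "s \<in> {0..T}" for s
    unfolding E_def
  proof (rule coord_norm_le)
    fix j x assume j: "j \<in> {1..N}" and x: "x \<in> {X (j - 1)..X j}"
    have "\<bar>RC (opp fl) 3 s j\<bar> \<le> CC * M * h ^ (k + 1)" using RC_bound[OF j s, of 3 "opp fl"] by (simp add: mult.assoc)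
    then have "\<bar>poly (Zb s j) x\<bar> \<le> CF * (CC * M) * h ^ (k + 3)" unfolding Zb_def by (rule correction_value[OF j x])
    also have "\<dots> = CF * (CC * 1) * (M * h ^ (k + 3))" by simp
    also have "\<dots> \<le> CF * (CC * (4 + 2 * sqrt T)) * (M * h ^ (k + 3))"
      using CF CC M_nonneg h pos by (intro mult_right_mono mult_left_mono mult_nonneg_nonneg) auto
    finally show "\<bar>poly (Zb s j) x\<bar> \<le> CF * (CC * (4 + 2 * sqrt T)) * (M * h ^ (k + 3))" .
  qed
  show "L2_set (\<lambda>a. coord X (Wb s) a - coord X (Wb s') a) idx \<le> E * sqrt \<bar>s - s'\<bar>"
    if s: "s \<in> {0..T}" and s': "s' \<in> {0..T}" for s s'
  proof -
    have "L2_set (coord X (\<lambda>j. Wb s j - Wb s' j)) idx \<le> S2 * (CF * (CC * ((4 + 2 * sqrt T) * M * sqrt \<bar>s - s'\<bar>)) * h ^ (k + 3))"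
    proof (rule coord_norm_le)
      fix j x assume j: "j \<in> {1..N}" and x: "x \<in> {X (j - 1)..X j}"
      have "Wb s j - Wb s' j = smult ((hj j)\<^sup>2 * (RC fl 2 s j - RC fl 2 s' j)) (radau_Fbar k fl (X (j - 1)) (X j))"
        unfolding Wb_def by (simp add: right_diff_distrib smult_diff_left)
      moreover have "\<bar>RC fl 2 s j - RC fl 2 s' j\<bar> \<le> CC * ((4 + 2 * sqrt T) * M * sqrt \<bar>s - s'\<bar>) * h ^ (k + 1)"
        using RC_holder[OF j s s', of fl] by (simp add: mult.assoc)
      ultimately show "\<bar>poly (Wb s j - Wb s' j) x\<bar> \<le> CF * (CC * ((4 + 2 * sqrt T) * M * sqrt \<bar>s - s'\<bar>)) * h ^ (k + 3)"
        using correction_value[OF j x] by simp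
    qed
    also have "\<dots> = E * sqrt \<bar>s - s'\<bar>" unfolding E_def by (simp add: mult_ac)
    finally show ?thesis by (simp add: coord_diff[abs_def])
  qed
  show "((\<lambda>s. coord X (\<lambda>j. xi s j + Wb s j) a) has_real_derivative
      mat_app idx (transp_mat (flux_mat fl)) (\<lambda>b. coord X (Zb s) b - mat_app idx (flux_mat fl) (coord X (xi s)) b) a) (at s within {0..T})"
    if s: "s \<in> {0..T}" and a: "a \<in> idx" for s a
  proof -
    have ja: "fst a \<in> {1..N}" using a by auto
    have q: "mat_app idx (flux_mat fl) (coord X (xi s)) b = coord X (xq s) b" if b: "b \<in> idx" for b
    proof -
      have jb: "fst b \<in> {1..N}" using b by auto
      show ?thesis
        unfolding coord_def[of X "xq s"] error_eq_q[OF s jb degree_cell_basis[OF b]]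
        by (rule flux_mat_app[OF degree_xi[OF s] b])
    qed
    have "mat_app idx (transp_mat (flux_mat fl)) (\<lambda>b. coord X (Zb s) b - mat_app idx (flux_mat fl) (coord X (xi s)) b) a
        = mat_app idx (transp_mat (flux_mat fl)) (coord X (\<lambda>j. Zb s j - xq s j)) a"
      by (rule mat_app_cong) (simp only: coord_diff q)
    also have "\<dots> = - flux_form B N X (opp fl) (\<lambda>j. Zb s j - xq s j) (fst a) (cell_basis X a)"
      using degrees(6) degree_xq[OF s] by (intro flux_mat_transp_app a degree_diff_le) auto
    also have "\<dots> = flux_form B N X (opp fl) (xq s) (fst a) (cell_basis X a) - flux_form B N X (opp fl) (Zb s) (fst a) (cell_basis X a)"
      by (simp add: flux_form_diff)
    finally show ?thesis
      using error_eq_u[OF s ja degree_cell_basis[OF a]] unfolding coord_def by (simp only:)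
  qed
qed

text \<open>Through this identity \<open>Dx_bound\<close> controls the error of q.\<close>

lemma xq_coord: "t \<in> {0..T} \<Longrightarrow> L2_set (coord X (xq t)) idx = L2_set (mat_app idx (flux_mat fl) (coord X (xi t))) idx"
proof (rule L2_set_cong[OF refl])
  fix b assume t: "t \<in> {0..T}" and b: "b \<in> idx"
  have jb: "fst b \<in> {1..N}" using b by auto
  show "coord X (xq t) b = mat_app idx (flux_mat fl) (coord X (xi t)) b"
    unfolding coord_def[of X "xq t"] error_eq_q[OF t jb degree_cell_basis[OF b]]
    by (rule flux_mat_app[OF degree_xi[OF t] b, symmetric])
qed

definition "Cx = real (k + 1) * S * (c * sqrt c) *
  (perturbed_flow.growth T * (S2 * (CF * (CC * (4 + 2 * sqrt T)))) * K1 powr (1 / 4))"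

lemma discrete_error_bound:
  assumes t: "t \<in> {0..T}" and j: "j \<in> {1..N}" and x: "x \<in> {X (j - 1)..X j}"
  shows "\<bar>poly (pderiv (xi t j)) x\<bar> \<le> Cx * (M * h ^ (k + 1))"
    and "\<bar>poly (pderiv (xq t j)) x\<bar> \<le> Cx * (M * h ^ (k + 1))"
proof -
  interpret F: perturbed_flow idx "flux_mat fl" "\<lambda>s. coord X (xi s)" "\<lambda>s. coord X (\<lambda>j. xi s j + Wb s j)"
    "\<lambda>s. coord X (Wb s)" "\<lambda>s. coord X (Zb s)" T E "K1 / h\<^sup>2" by (rule flow)
  have "0 < K1 / h\<^sup>2" using K_ge1 by linarith
  then have K1: "0 < K1" using h by (simp add: zero_less_divide_iff)
  have g0: "0 \<le> F.growth * E"
    using order_trans[OF L2_set_nonneg F.x_bound[of 0]] T by simp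
  have Kq: "(K1 / h\<^sup>2) powr (1 / 4) = K1 powr (1 / 4) / sqrt h"
  proof -
    have "h\<^sup>2 = h powr 2" using h by simp
    then have "h\<^sup>2 powr (1 / 4) = h powr (2 * (1 / 4))" by (simp only: powr_powr)
    also have "\<dots> = sqrt h" using h by (simp add: powr_half_sqrt)
    finally show ?thesis using K1 h by (simp add: powr_divide)
  qed
  have K4: "1 \<le> (K1 / h\<^sup>2) powr (1 / 4)" using K_ge1 by (intro ge_one_powr_ge_zero) auto
  have bound: "\<bar>poly (pderiv (v j)) x\<bar> \<le> Cx * (M * h ^ (k + 1))"
    if v: "degree (v j) \<le> k" "L2_set (coord X v) idx \<le> F.growth * E * (K1 / h\<^sup>2) powr (1 / 4)" for v
  proof -
    let ?A = "real (k + 1) * S * ((c / h) * sqrt (c / h))"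
    have A: "0 \<le> ?A" using S1 c h by (intro mult_nonneg_nonneg) auto
    have "\<bar>poly (pderiv (v j)) x\<bar> \<le> ?A * L2_set (coord X v) idx" by (rule pderiv_bound_coord[where v = v, OF v(1) j x])
    also have "\<dots> \<le> ?A * (F.growth * E * (K1 / h\<^sup>2) powr (1 / 4))" using v(2) A by (intro mult_left_mono) auto
    \<comment> \<open>h^(k+3) from \<open>E\<close>, h^(-3/2) from the inverse estimate and h^(-1/2)
      from \<open>Kq\<close> leave h^(k+1).\<close>
    also have "\<dots> = Cx * (M * h ^ (k + 1))"
    proof -
      have hh: "h ^ (k + 3) / (h * (sqrt h * sqrt h)) = h ^ (k + 1)"
        using h by (simp add: power_add power3_eq_cube)
      have "?A * (F.growth * E * (K1 / h\<^sup>2) powr (1 / 4)) = Cx * (M * (h ^ (k + 3) / (h * (sqrt h * sqrt h))))"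
        unfolding Kq E_def Cx_def real_sqrt_divide using h by (simp add: field_simps)
      then show ?thesis unfolding hh .
    qed
    finally show ?thesis .
  qed
  have "L2_set (coord X (xi t)) idx \<le> F.growth * E" using F.x_bound[of t] t by simp
  \<comment> \<open>Weakened so that one constant serves both errors.\<close>
  also have "\<dots> \<le> F.growth * E * (K1 / h\<^sup>2) powr (1 / 4)" using mult_left_mono[OF K4 g0] by simp
  finally show "\<bar>poly (pderiv (xi t j)) x\<bar> \<le> Cx * (M * h ^ (k + 1))"
    by (intro bound degree_xi t j)
  show "\<bar>poly (pderiv (xq t j)) x\<bar> \<le> Cx * (M * h ^ (k + 1))"
    using F.Dx_bound[of t] t xq_coord[OF t] by (intro bound degree_xq t j) auto
qed

section \<open>Errors at the Radau points\<close>

lemma correction_deriv: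
  assumes j: "j \<in> {1..N}" and x: "x \<in> {X (j - 1)..X j}" and r: "\<bar>r\<bar> \<le> CC * (M * h ^ (k + 1))"
  shows "\<bar>poly (pderiv (smult (hj j * r) (radau_F k f (X (j - 1)) (X j)))) x\<bar> \<le> CC * CF * (M * h ^ (k + 1))"
    and "\<bar>poly (pderiv (smult ((hj j)\<^sup>2 * r) (radau_Fbar k f (X (j - 1)) (X j)))) x\<bar> \<le> 2 * pi * c * (CC * CF) * (M * h ^ (k + 1))"
proof -
  let ?R = "CC * (M * h ^ (k + 1))"
  have hj: "0 < hj j" by (rule hj_pos[OF j])
  have R: "0 \<le> ?R" using r by linarith
  have h2: "X j - X (j - 1) = 2 * hj j" by (simp add: hj_def)
  have d: "\<bar>poly (pderiv (radau_F k f (X (j - 1)) (X j))) x\<bar> \<le> CF / (2 * hj j)"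
    "\<bar>poly (pderiv (radau_Fbar k f (X (j - 1)) (X j))) x\<bar> \<le> CF / (2 * hj j)"
    using dF_bd[OF cell_less[OF j] x, of f] unfolding h2 by simp_all
  have "hj j * \<bar>r\<bar> * \<bar>poly (pderiv (radau_F k f (X (j - 1)) (X j))) x\<bar> \<le> hj j * ?R * (CF / (2 * hj j))"
    using r d(1) hj R by (intro mult_mono) auto
  also have "\<dots> = ?R * CF / 2" using hj by simp
  also have "\<dots> \<le> ?R * CF" using mult_nonneg_nonneg[OF R, of CF] CF by linarith
  finally show "\<bar>poly (pderiv (smult (hj j * r) (radau_F k f (X (j - 1)) (X j)))) x\<bar> \<le> CC * CF * (M * h ^ (k + 1))"
    using hj by (simp add: pderiv_smult abs_mult mult_ac)
  have "(hj j)\<^sup>2 * \<bar>r\<bar> * \<bar>poly (pderiv (radau_Fbar k f (X (j - 1)) (X j))) x\<bar> \<le> (hj j)\<^sup>2 * ?R * (CF / (2 * hj j))"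
    using r d(2) hj R by (intro mult_mono) auto
  also have "\<dots> = (hj j / 2) * (?R * CF)" using hj by (simp add: power2_eq_square)
  \<comment> \<open>The second correction is one order smaller; its spare factor h is bounded
    through \<open>h_le\<close>.\<close>
  also have "\<dots> \<le> (2 * pi * c) * (?R * CF)"
  proof (rule mult_right_mono)
    have "hj j / 2 \<le> h" using cell_h[OF j] cell_less[OF j] by (simp add: hj_def)
    then show "hj j / 2 \<le> 2 * pi * c" using h_le by (simp add: mult_ac)
    show "0 \<le> ?R * CF" using mult_nonneg_nonneg[OF R, of CF] CF by linarith
  qed
  finally show "\<bar>poly (pderiv (smult ((hj j)\<^sup>2 * r) (radau_Fbar k f (X (j - 1)) (X j)))) x\<bar> \<le> 2 * pi * c * (CC * CF) * (M * h ^ (k + 1))"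
    using hj by (simp add: pderiv_smult abs_mult mult_ac)
qed

lemma projection_superconvergence:
  assumes j: "j \<in> {1..N}" and t: "t \<in> {0..T}" and z: "radau_zero k f (X (j - 1)) (X j) x" and i: "i \<le> 1"
  shows "\<bar>U (Suc i) x t - poly (pderiv (radau_proj k f (X (j - 1)) (X j) (\<lambda>x. U i x t))) x\<bar> \<le> CC * (M * h ^ (k + 1))"
proof -
  let ?h = "X j - X (j - 1)"
  have "\<bar>U (i + 1) x t - poly (pderiv (radau_proj k f (X (j - 1)) (X j) (\<lambda>x. U (i + 0) x t))) x\<bar> \<le> CC * (M * ?h * ?h ^ k)"
  proof (rule super_approx[where f = "\<lambda>i' x. U (i + i') x t"])
    show "((\<lambda>x. U (i + i') x t) has_real_derivative U (i + Suc i') x t) (at x within {X (j - 1)..X j})"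
      if "i' < k + 1" "x \<in> {X (j - 1)..X j}" for i' x
      using deriv_cell[OF j _ that(2) t, of "i + i'"] that(1) i by simp
    show "\<bar>U (i + (k + 1)) x t - U (i + (k + 1)) (X (j - 1)) t\<bar> \<le> M * ?h" if x: "x \<in> {X (j - 1)..X j}" for x
    proof -
      have "\<bar>U (i + (k + 1)) x t - U (i + (k + 1)) (X (j - 1)) t\<bar> \<le> M * \<bar>x - X (j - 1)\<bar>"
        using x cell_in[OF j] cell_less[OF j] i t by (intro lip_x) auto
      also have "\<dots> \<le> M * ?h" using x M_nonneg by (intro mult_left_mono) auto
      finally show ?thesis .
    qed
  qed (rule cell_less[OF j], rule z)
  also have "\<dots> \<le> CC * (M * h ^ (k + 1))" using CC cell_pow[OF M_nonneg j] by (intro mult_left_mono) auto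
  finally show ?thesis by simp
qed

lemma total_const_eq: "total_const k c L T CC CF = CC + CC * CF + 2 * pi * c * (CC * CF) + Cx"
  by (simp add: total_const_def Cx_def)

lemma u_error:
  assumes j: "j \<in> {1..N}" and t: "t \<in> {0..T}" and z: "radau_zero k fl (X (j - 1)) (X j) x"
  shows "\<bar>U 1 x t - poly (pderiv (uh t j)) x\<bar> \<le> total_const k c L T CC CF * (M * h ^ (k + 1))"
proof -
  have x: "x \<in> {X (j - 1)..X j}" by (rule radau_zero_in_interval[OF cell_less[OF j] z])
  have "uh t j = Pu t j - W1 t j - Wb t j - xi t j" by (simp add: xi_def)
  then have e: "poly (pderiv (uh t j)) x = poly (pderiv (Pu t j)) x - poly (pderiv (W1 t j)) x
      - poly (pderiv (Wb t j)) x - poly (pderiv (xi t j)) x" by (simp add: pderiv_diff)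
  have "\<bar>U 1 x t - poly (pderiv (Pu t j)) x\<bar> \<le> CC * (M * h ^ (k + 1))"
    using projection_superconvergence[OF j t z, of 0] unfolding Pu_def by simp
  moreover have "\<bar>poly (pderiv (W1 t j)) x\<bar> \<le> CC * CF * (M * h ^ (k + 1))"
    unfolding W1_def by (rule correction_deriv(1)[OF j x RC_bound[OF j t]]) simp
  moreover have "\<bar>poly (pderiv (Wb t j)) x\<bar> \<le> 2 * pi * c * (CC * CF) * (M * h ^ (k + 1))"
    unfolding Wb_def by (rule correction_deriv(2)[OF j x RC_bound[OF j t]]) simp
  moreover note discrete_error_bound(1)[OF t j x]
  ultimately show ?thesis unfolding total_const_eq e distrib_right by linarith
qed

lemma q_error:
  assumes j: "j \<in> {1..N}" and t: "t \<in> {0..T}" and z: "radau_zero k (opp fl) (X (j - 1)) (X j) x"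
  shows "\<bar>U 2 x t - poly (pderiv (qh t j)) x\<bar> \<le> total_const k c L T CC CF * (M * h ^ (k + 1))"
proof -
  have x: "x \<in> {X (j - 1)..X j}" by (rule radau_zero_in_interval[OF cell_less[OF j] z])
  have "qh t j = Pq t j - Z1 t j - xq t j" by (simp add: xq_def)
  then have e: "poly (pderiv (qh t j)) x = poly (pderiv (Pq t j)) x - poly (pderiv (Z1 t j)) x
      - poly (pderiv (xq t j)) x" by (simp add: pderiv_diff)
  have "\<bar>U 2 x t - poly (pderiv (Pq t j)) x\<bar> \<le> CC * (M * h ^ (k + 1))"
    using projection_superconvergence[OF j t z, of 1] unfolding Pq_def by (simp add: numeral_2_eq_2)
  moreover have "\<bar>poly (pderiv (Z1 t j)) x\<bar> \<le> CC * CF * (M * h ^ (k + 1))"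
    unfolding Z1_def by (rule correction_deriv(1)[OF j x RC_bound[OF j t]]) simp
  \<comment> \<open>The interpolant of q has no second correction; this pads the sum to the common
    constant.\<close>
  moreover have "0 \<le> 2 * pi * c * (CC * CF) * (M * h ^ (k + 1))"
    using c CC CF M_nonneg h by (intro mult_nonneg_nonneg) auto
  moreover note discrete_error_bound(2)[OF t j x]
  ultimately show ?thesis unfolding total_const_eq e distrib_right by linarith
qed

end

section \<open>The classical solution\<close>

lemma vector_derivative_on_interval:
  fixes f :: "real \<Rightarrow> real"
  assumes "a < b" "x \<in> {a..b}" "(f has_real_derivative D) (at x within {a..b})"
  shows "vector_derivative f (at x within {a..b}) = D"
  using vector_derivative_within_cbox[of a b x f D] assms
  by (simp add: has_real_derivative_iff_has_vector_derivative)

text \<open>Classical representatives are chosen separately for each time. This suffices because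
  time regularity is asked of \<open>U 0\<close> alone, which equals \<open>u\<close>.\<close>

lemma classical_heat_solution:
  assumes T: "0 < T" and u: "heat_solution T u0 u" and W: "in_W_inf_unif (k + 4) T u"
  obtains U where "smooth_heat U (k + 3) (W_inf_norm_unif (k + 4) T u) T"
    "\<And>x t. x \<in> Omega \<Longrightarrow> t \<in> {0..T} \<Longrightarrow> U 0 x t = u x t"
    "\<And>x t. x \<in> Omega \<Longrightarrow> t \<in> {0..T} \<Longrightarrow> x_deriv u x t = U 1 x t"
    "\<And>x t. x \<in> Omega \<Longrightarrow> t \<in> {0..T} \<Longrightarrow> x_deriv (x_deriv u) x t = U 2 x t"
proof -
  let ?M = "W_inf_norm_unif (k + 4) T u"
  have cont: "continuous_on (Omega \<times> {0..T}) (\<lambda>(x, t). u x t)" using u by (simp add: heat_solution_def)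
  have contx: "continuous_on Omega (\<lambda>x. u x t)" if "t \<in> {0..T}" for t
  proof -
    have "continuous_on Omega (\<lambda>x. (x, t))" by (intro continuous_intros)
    from continuous_on_compose2[OF cont this] show ?thesis using that by fastforce
  qed
  have contt: "continuous_on {0..T} (u x)" if "x \<in> Omega" for x
  proof -
    have "continuous_on {0..T} (\<lambda>t. (x, t))" by (intro continuous_intros)
    from continuous_on_compose2[OF cont this] show ?thesis using that by fastforce
  qed
  have k4: "Suc (k + 3) = k + 4" by simp
  define P where "P t g \<longleftrightarrow> (\<forall>x\<in>Omega. g 0 x = u x t) \<and>
      (\<forall>i x. i < k + 3 \<longrightarrow> x \<in> Omega \<longrightarrow> (g i has_real_derivative g (Suc i) x) (at x within Omega)) \<and>
      (\<forall>i x. i \<le> k + 3 \<longrightarrow> x \<in> Omega \<longrightarrow> \<bar>g i x\<bar> \<le> ?M) \<and>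
      (\<forall>x y. x \<in> Omega \<longrightarrow> y \<in> Omega \<longrightarrow> \<bar>g (k + 3) x - g (k + 3) y\<bar> \<le> ?M * \<bar>x - y\<bar>)"
    for t and g :: "nat \<Rightarrow> real \<Rightarrow> real"
  have ex: "\<exists>g. P t g"
    if t: "t \<in> {0..T}" for t
  proof -
    have Wt: "in_W_inf (Suc (k + 3)) (\<lambda>x. u x t)" and bdd: "bdd_above ((\<lambda>t. W_inf_norm (k + 4) (\<lambda>x. u x t)) ` {0..T})"
      using W t unfolding in_W_inf_unif_def k4 by auto
    have M: "W_inf_norm (Suc (k + 3)) (\<lambda>x. u x t) \<le> ?M"
      unfolding W_inf_norm_unif_def k4 by (rule cSUP_upper[OF t bdd])
    obtain g where g: "\<And>x. x \<in> Omega \<Longrightarrow> g 0 x = u x t"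
      "\<And>i x. i < k + 3 \<Longrightarrow> x \<in> Omega \<Longrightarrow> (g i has_real_derivative g (Suc i) x) (at x within Omega)"
      "\<And>i x. i \<le> k + 3 \<Longrightarrow> x \<in> Omega \<Longrightarrow> \<bar>g i x\<bar> \<le> W_inf_norm (Suc (k + 3)) (\<lambda>x. u x t)"
      "\<And>x y. x \<in> Omega \<Longrightarrow> y \<in> Omega \<Longrightarrow>
        \<bar>g (k + 3) x - g (k + 3) y\<bar> \<le> W_inf_norm (Suc (k + 3)) (\<lambda>x. u x t) * \<bar>x - y\<bar>"
      by (rule sobolev_classical[OF Wt contx[OF t]]) blast
    show ?thesis
      unfolding P_def
    proof (rule exI[of _ g], intro conjI allI impI ballI)
      show "\<bar>g (k + 3) x - g (k + 3) y\<bar> \<le> ?M * \<bar>x - y\<bar>" if "x \<in> Omega" "y \<in> Omega" for x y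
        by (rule order_trans[OF g(4)[OF that] mult_right_mono[OF M]]) simp
      show "\<bar>g i x\<bar> \<le> ?M" if "i \<le> k + 3" "x \<in> Omega" for i x
        by (rule order_trans[OF g(3)[OF that] M])
    qed (fact g(1) g(2))+
  qed
  define G where "G t = (SOME g. P t g)" for t
  have "P t (G t)" if "t \<in> {0..T}" for t
    unfolding G_def by (rule someI_ex[OF ex[OF that]])
  note PG = this[unfolded P_def]
  have G: "\<And>t x. t \<in> {0..T} \<Longrightarrow> x \<in> Omega \<Longrightarrow> G t 0 x = u x t"
    "\<And>t i x. t \<in> {0..T} \<Longrightarrow> i < k + 3 \<Longrightarrow> x \<in> Omega \<Longrightarrow> (G t i has_real_derivative G t (Suc i) x) (at x within Omega)"
    "\<And>t i x. t \<in> {0..T} \<Longrightarrow> i \<le> k + 3 \<Longrightarrow> x \<in> Omega \<Longrightarrow> \<bar>G t i x\<bar> \<le> ?M"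
    "\<And>t x y. t \<in> {0..T} \<Longrightarrow> x \<in> Omega \<Longrightarrow> y \<in> Omega \<Longrightarrow> \<bar>G t (k + 3) x - G t (k + 3) y\<bar> \<le> ?M * \<bar>x - y\<bar>"
    using PG by blast+
  define U where "U i x t = G t i x" for i x t
  have U0: "U 0 x t = u x t" if "x \<in> Omega" "t \<in> {0..T}" for x t
    using G(1)[OF that(2,1)] by (simp add: U_def)
  have dU: "((\<lambda>y. U i y t) has_real_derivative U (Suc i) x t) (at x within Omega)"
    if "i < k + 3" "x \<in> Omega" "t \<in> {0..T}" for i x t
    using G(2)[OF that(3,1,2)] by (simp add: U_def)
  have U1: "x_deriv u x t = U 1 x t" if x: "x \<in> Omega" and t: "t \<in> {0..T}" for x t
    unfolding x_deriv_def
  proof (rule vector_derivative_on_interval[OF _ x])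
    show "((\<lambda>y. u y t) has_real_derivative U 1 x t) (at x within Omega)"
    proof (rule has_real_derivative_transform[OF x])
      show "u y t = U 0 y t" if "y \<in> Omega" for y using U0[OF that t] by simp
      show "((\<lambda>y. U 0 y t) has_real_derivative U 1 x t) (at x within Omega)" using dU[of 0, OF _ x t] by simp
    qed
  qed simp
  have U2: "x_deriv (x_deriv u) x t = U 2 x t" if x: "x \<in> Omega" and t: "t \<in> {0..T}" for x t
    unfolding x_deriv_def[of "x_deriv u"]
  proof (rule vector_derivative_on_interval[OF _ x])
    show "((\<lambda>y. x_deriv u y t) has_real_derivative U 2 x t) (at x within Omega)"
    proof (rule has_real_derivative_transform[OF x U1[OF _ t]])
      show "((\<lambda>y. U 1 y t) has_real_derivative U 2 x t) (at x within Omega)"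
        using dU[of 1, OF _ x t] by (simp add: numeral_2_eq_2)
    qed
  qed simp
  have "smooth_heat U (k + 3) ?M T"
  proof
    show "(U 0 x has_real_derivative U 2 x t) (at t within {0..T})" if x: "x \<in> Omega" and t: "t \<in> {0<..T}" for x t
    proof -
      have t': "t \<in> {0..T}" using t by auto
      have "u x differentiable (at t within {0..T})" "t_deriv T (u x) t = U 2 x t"
        using u x t U2[OF x t'] unfolding heat_solution_def by auto
      then have d: "(u x has_real_derivative U 2 x t) (at t within {0..T})"
        unfolding has_real_derivative_iff_has_vector_derivative t_deriv_def by (metis vector_derivative_works)
      show ?thesis by (rule has_real_derivative_transform[OF t' U0[OF x] d])
    qed
    show "continuous_on {0..T} (U 0 x)" if x: "x \<in> Omega" for x
      using contt[OF x] U0[OF x] by (subst continuous_on_cong[OF refl, of _ _ "u x"]) auto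
  qed (use T dU G(3,4) in \<open>auto simp: U_def\<close>)
  then show ?thesis using U0 U1 U2 by (rule that)
qed

text \<open>The equation turns the time derivative of a coefficient of \<open>u\<close> into the
  coefficient of \<open>U 2\<close>. With it the initial value has an explicit form free of
  \<open>THE\<close> and \<open>t_deriv\<close>.\<close>

lemma (in smooth_heat) u_interp_eq:
  assumes X: "X (j - 1) < X j" "{X (j - 1)..X j} \<subseteq> Omega" and k: "2 \<le> k"
    and U0: "\<And>x t. x \<in> Omega \<Longrightarrow> t \<in> {0..T} \<Longrightarrow> U 0 x t = u x t"
    and U1: "\<And>x t. x \<in> Omega \<Longrightarrow> t \<in> {0..T} \<Longrightarrow> x_deriv u x t = U 1 x t"
    and t: "t \<in> {0..T}"
  shows "u_interp fl k T X u t j = radau_proj k fl (X (j - 1)) (X j) (\<lambda>x. U 0 x t)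
      - smult ((X j - X (j - 1)) / 2 * radau_coef k (opp fl) (X (j - 1)) (X j) (\<lambda>x. U 1 x t)) (radau_F k fl (X (j - 1)) (X j))
      - smult (((X j - X (j - 1)) / 2)\<^sup>2 * radau_coef k fl (X (j - 1)) (X j) (\<lambda>x. U 2 x t)) (radau_Fbar k fl (X (j - 1)) (X j))"
proof -
  let ?I = "{X (j - 1)..X j}"
  have cU: "continuous_on ?I (\<lambda>x. U i x t)" if "i \<le> 1" "t \<in> {0..T}" for i t
    using that n X(2) by (intro continuous_x) auto
  have c0: "continuous_on ?I (\<lambda>x. u x t)" if "t \<in> {0..T}" for t
    using cU[of 0, OF _ that] U0[OF _ that] X(2) by (subst continuous_on_cong[OF refl, of _ _ "\<lambda>x. U 0 x t"]) auto
  have c1: "continuous_on ?I (\<lambda>x. x_deriv u x t)"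
    using cU[of 1, OF _ t] U1[OF _ t] X(2) by (subst continuous_on_cong[OF refl, of _ _ "\<lambda>x. U 1 x t"]) auto
  have r0: "radau_coef k f (X (j - 1)) (X j) (\<lambda>x. u x t) = radau_coef k f (X (j - 1)) (X j) (\<lambda>x. U 0 x t)"
    if "t \<in> {0..T}" for t f
    using U0[OF _ that] X by (intro radau_coef_cong) auto
  have r1: "radau_coef k f (X (j - 1)) (X j) (\<lambda>x. x_deriv u x t) = radau_coef k f (X (j - 1)) (X j) (\<lambda>x. U 1 x t)" for f
    using U1[OF _ t] X by (intro radau_coef_cong) auto
  have p: "radau_proj k f (X (j - 1)) (X j) (\<lambda>x. u x t) = radau_proj k f (X (j - 1)) (X j) (\<lambda>x. U 0 x t)" for f
    using U0[OF _ t] X by (intro radau_proj_cong) auto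
  have two: "0 + 2 = (2::nat)" by simp
  have d: "((\<lambda>s. radau_coef k f (X (j - 1)) (X j) (\<lambda>x. U 0 x s)) has_real_derivative
      radau_coef k f (X (j - 1)) (X j) (\<lambda>x. U 2 x t)) (at t within {0..T})" for f
    using dt_radau_coef[of 0 "X (j - 1)" "X j" t k f] n X t unfolding two by simp
  have db: "t_deriv T (\<lambda>s. coeff_bar k X j (\<lambda>x. u x s)) t = radau_coef k FluxI (X (j - 1)) (X j) (\<lambda>x. U 2 x t)"
    unfolding t_deriv_def
    by (rule vector_derivative_on_interval[OF T t has_real_derivative_transform[OF t _ d]])
      (simp only: coeff_bar_eq[OF X(1) c0] r0)
  have dt: "t_deriv T (\<lambda>s. coeff_tilde k X j (\<lambda>x. u x s)) t = radau_coef k FluxII (X (j - 1)) (X j) (\<lambda>x. U 2 x t)"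
    unfolding t_deriv_def
    by (rule vector_derivative_on_interval[OF T t has_real_derivative_transform[OF t _ d]])
      (simp only: coeff_tilde_eq[OF X(1) c0] r0)
  have k1: "1 \<le> k" using k by simp
  show ?thesis
    by (cases fl)
      (simp_all only: u_interp.simps W2.simps opp.simps half_len_def cell_len_def F_defs_eq[OF X(1) k] db dt
        coeff_bar_eq[OF X(1) c1] coeff_tilde_eq[OF X(1) c1] proj_minus_eq[OF X(1) k1 c0[OF t]]
        proj_plus_eq[OF X(1) k1 c0[OF t]] r1 p diff_diff_eq add.commute)
qed

text \<open>\<open>Max\<close> is meaningful here since the set of errors is finite and, by
  \<open>radau_zero_exists\<close>, nonempty.\<close>

lemma max_error_at_le:
  assumes N: "1 \<le> N" and k: "1 \<le> k" and X: "\<And>j. j \<in> {1..N} \<Longrightarrow> X (j - 1) < X j"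
    and b: "\<And>j x. j \<in> {1..N} \<Longrightarrow> radau_zero k fl (X (j - 1)) (X j) x \<Longrightarrow> \<bar>f x - poly (v j) x\<bar> \<le> K"
  shows "max_error_at N (\<lambda>j. {x. radau_zero k fl (X (j - 1)) (X j) x}) f v \<le> K"
proof -
  let ?R = "\<lambda>j. {x. radau_zero k fl (X (j - 1)) (X j) x}"
  let ?A = "(\<Union>j\<in>{1..N}. (\<lambda>x. \<bar>f x - poly (v j) x\<bar>) ` ?R j)"
  have A: "{\<bar>f x - poly (v j) x\<bar> |j x. j \<in> {1..N} \<and> x \<in> ?R j} = ?A" by blast
  obtain x where "radau_zero k fl (X (1 - 1)) (X 1) x"
    using radau_zero_exists[OF X[of 1] k] N by auto
  then have "?A \<noteq> {}" using N by fastforce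
  moreover have "finite ?A" using finite_radau_zeros[OF X] by blast
  ultimately show ?thesis unfolding max_error_at_def A using b by (subst Max_le_iff) auto
qed

section \<open>The superconvergence theorem\<close>

theorem theorem4p7:
  fixes k :: nat and c T :: real
  assumes "2 \<le> k" and "0 < T"
  shows "\<exists>C>0. \<forall>(B :: bc) (fl :: flux) (g0 :: real \<Rightarrow> real) (g1 :: real \<Rightarrow> real)
      (u0 :: real \<Rightarrow> real) (u :: real \<Rightarrow> real \<Rightarrow> real) (N :: nat) (X :: nat \<Rightarrow> real)
      (uh :: real \<Rightarrow> nat \<Rightarrow> real poly) (qh :: real \<Rightarrow> nat \<Rightarrow> real poly) (q :: real \<Rightarrow> real \<Rightarrow> real).
    heat_solution T u0 u \<longrightarrow>
    boundary_condition B fl T g0 g1 u \<longrightarrow>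
    in_W_inf_unif (k + 4) T u \<longrightarrow>
    q = x_deriv u \<longrightarrow>
    mesh N X \<longrightarrow>
    quasi_uniform c N X \<longrightarrow>
    ldg_solution k T fl B g0 g1 N X uh qh \<longrightarrow>
    (\<forall>j\<in>{1..N}. uh 0 j = u_interp fl k T X u 0 j) \<longrightarrow>
    (\<forall>t\<in>{0..T}.
      let h = mesh_size N X;
          M = W_inf_norm_unif (k + 4) T u;
          e_ux_l = max_error_at N (left_radau_points k X) (\<lambda>x. x_deriv u x t) (\<lambda>j. pderiv (uh t j));
          e_ux_r = max_error_at N (right_radau_points k X) (\<lambda>x. x_deriv u x t) (\<lambda>j. pderiv (uh t j));
          e_qx_l = max_error_at N (left_radau_points k X) (\<lambda>x. x_deriv q x t) (\<lambda>j. pderiv (qh t j));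
          e_qx_r = max_error_at N (right_radau_points k X) (\<lambda>x. x_deriv q x t) (\<lambda>j. pderiv (qh t j))
      in (fl = FluxI \<longrightarrow>
            e_ux_l \<le> C * ((1 + t * sqrt h) * h ^ (k + 1) * M) \<and>
            e_qx_r \<le> C * ((1 + sqrt (t * h)) * h ^ (k + 1) * M)) \<and>
         (fl = FluxII \<longrightarrow>
            e_ux_r \<le> C * ((1 + t * sqrt h) * h ^ (k + 1) * M) \<and>
            e_qx_l \<le> C * ((1 + sqrt (t * h)) * h ^ (k + 1) * M)))"
proof -
  have k: "2 \<le> k" and T: "0 < T" and k1: "1 \<le> k" using assms by auto
  obtain L where L: "L \<ge> 1"
    "\<And>a b m x. a < b \<Longrightarrow> m \<le> k \<Longrightarrow> x \<in> {a..b} \<Longrightarrow> \<bar>poly (leg a b m) x\<bar> \<le> L"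
    "\<And>a b m x. a < b \<Longrightarrow> m \<le> k \<Longrightarrow> x \<in> {a..b} \<Longrightarrow> \<bar>poly (pderiv (leg a b m)) x\<bar> \<le> 2 * L / (b - a)"
    by (rule leg_bounded[of k]) blast
  obtain CC where CC: "CC \<ge> 1"
    "\<And>a b f L fl. a < b \<Longrightarrow>
      (\<And>i x. i < k \<Longrightarrow> x \<in> {a..b} \<Longrightarrow> (f i has_real_derivative f (Suc i) x) (at x within {a..b})) \<Longrightarrow>
      (\<And>x. x \<in> {a..b} \<Longrightarrow> \<bar>f k x - f k a\<bar> \<le> L) \<Longrightarrow>
      \<bar>radau_coef k fl a b (f 0)\<bar> \<le> CC * (L * (b - a) ^ k)"
    "\<And>a b f L fl x. a < b \<Longrightarrow>
      (\<And>i x. i < k + 1 \<Longrightarrow> x \<in> {a..b} \<Longrightarrow> (f i has_real_derivative f (Suc i) x) (at x within {a..b})) \<Longrightarrow>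
      (\<And>x. x \<in> {a..b} \<Longrightarrow> \<bar>f (k + 1) x - f (k + 1) a\<bar> \<le> L) \<Longrightarrow> radau_zero k fl a b x \<Longrightarrow>
      \<bar>f 1 x - poly (pderiv (radau_proj k fl a b (f 0))) x\<bar> \<le> CC * (L * (b - a) ^ k)"
    using radau_approximation[OF k1] by metis
  obtain CF where CF: "CF \<ge> 1"
    "\<And>a b fl x. a < b \<Longrightarrow> x \<in> {a..b} \<Longrightarrow> \<bar>poly (radau_F k fl a b) x\<bar> \<le> CF \<and> \<bar>poly (radau_Fbar k fl a b) x\<bar> \<le> CF"
    "\<And>a b fl x. a < b \<Longrightarrow> x \<in> {a..b} \<Longrightarrow>
      \<bar>poly (pderiv (radau_F k fl a b)) x\<bar> \<le> CF / (b - a) \<and> \<bar>poly (pderiv (radau_Fbar k fl a b)) x\<bar> \<le> CF / (b - a)"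
    by (rule radau_F_bounded[of k]) blast
  \<comment> \<open>\<open>c\<close> is arbitrary, while the estimates use a ratio of at least 1; a
    mesh that is quasi-uniform for \<open>c\<close> is so for the larger constant.\<close>
  let ?c = "max c 1"
  \<comment> \<open>Fixed before any mesh or solution; the absolute value and the summand 1 give
    positivity.\<close>
  define C where "C = \<bar>total_const k ?c L T CC CF\<bar> + 1"
  have C: "0 < C" "total_const k ?c L T CC CF \<le> C" unfolding C_def by linarith+
  have main_u: "max_error_at N (\<lambda>j. {x. radau_zero k fl (X (j - 1)) (X j) x}) (\<lambda>x. x_deriv u x t) (\<lambda>j. pderiv (uh t j))
        \<le> C * ((1 + t * sqrt (mesh_size N X)) * mesh_size N X ^ (k + 1) * W_inf_norm_unif (k + 4) T u)" (is ?eu)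
    and main_q: "max_error_at N (\<lambda>j. {x. radau_zero k (opp fl) (X (j - 1)) (X j) x}) (\<lambda>x. x_deriv (x_deriv u) x t) (\<lambda>j. pderiv (qh t j))
        \<le> C * ((1 + sqrt (t * mesh_size N X)) * mesh_size N X ^ (k + 1) * W_inf_norm_unif (k + 4) T u)" (is ?eq)
    if u: "heat_solution T u0 u" and bc: "boundary_condition B fl T g0 g1 u" and W: "in_W_inf_unif (k + 4) T u"
      and m: "mesh N X" and qu: "quasi_uniform c N X" and sol: "ldg_solution k T fl B g0 g1 N X uh qh"
      and ini: "\<forall>j\<in>{1..N}. uh 0 j = u_interp fl k T X u 0 j" and t: "t \<in> {0..T}"
    for B fl g0 g1 u0 u N X uh qh t
  proof -
    let ?h = "mesh_size N X" and ?M = "W_inf_norm_unif (k + 4) T u"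
    obtain U where H: "smooth_heat U (k + 3) ?M T"
      and U0: "\<And>x t. x \<in> Omega \<Longrightarrow> t \<in> {0..T} \<Longrightarrow> U 0 x t = u x t"
      and U1: "\<And>x t. x \<in> Omega \<Longrightarrow> t \<in> {0..T} \<Longrightarrow> x_deriv u x t = U 1 x t"
      and U2: "\<And>x t. x \<in> Omega \<Longrightarrow> t \<in> {0..T} \<Longrightarrow> x_deriv (x_deriv u) x t = U 2 x t"
      by (rule classical_heat_solution[OF T u W]) blast
    interpret H: smooth_heat U "k + 3" ?M T by (rule H)
    interpret S: mesh_space N X k B using m k by unfold_locales
    have ends: "0 \<in> Omega" "2 * pi \<in> Omega" by auto
    have cell_h: "X j - X (j - 1) \<le> ?h" if "j \<in> {1..N}" for j
      unfolding mesh_size_def cell_len_def using that by (intro Max_ge) auto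
    have h: "0 < ?h" using cell_h[of 1] S.cell_less[of 1] S.N by auto
    have qu': "?h \<le> ?c * (X j - X (j - 1))" if j: "j \<in> {1..N}" for j
    proof -
      have "?h \<le> c * (X j - X (j - 1))" using qu j unfolding quasi_uniform_def cell_len_def by blast
      also have "\<dots> \<le> ?c * (X j - X (j - 1))" using S.cell_less[OF j] by (intro mult_right_mono) auto
      finally show ?thesis .
    qed
    have c1: "1 \<le> ?c" by simp
    have per: "U 0 0 t = U 0 (2 * pi) t \<and> U 1 0 t = U 1 (2 * pi) t" if "B = Periodic" "t \<in> {0..T}" for t
      using bc that U0[OF ends(1)] U0[OF ends(2)] U1[OF ends(1)] U1[OF ends(2)] by simp
    have mixed_I: "g0 t = U 0 0 t \<and> g1 t = U 1 (2 * pi) t" if "B = Mixed" "fl = FluxI" "t \<in> {0..T}" for t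
      using bc that U0[OF ends(1)] U1[OF ends(2)] by simp
    have mixed_II: "g0 t = U 1 0 t \<and> g1 t = U 0 (2 * pi) t" if "B = Mixed" "fl = FluxII" "t \<in> {0..T}" for t
      using bc that U1[OF ends(1)] U0[OF ends(2)] by simp
    have T0: "0 \<in> {0..T}" using T by simp
    have ini': "uh 0 j = radau_proj k fl (X (j - 1)) (X j) (\<lambda>x. U 0 x 0)
        - smult ((X j - X (j - 1)) / 2 * radau_coef k (opp fl) (X (j - 1)) (X j) (\<lambda>x. U 1 x 0)) (radau_F k fl (X (j - 1)) (X j))
        - smult (((X j - X (j - 1)) / 2)\<^sup>2 * radau_coef k fl (X (j - 1)) (X j) (\<lambda>x. U 2 x 0)) (radau_Fbar k fl (X (j - 1)) (X j))"
      if j: "j \<in> {1..N}" for j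
      using bspec[OF ini j] H.u_interp_eq[OF S.cell_less[OF j] S.cell_in[OF j] k U0 U1 T0, of fl] by (rule trans)
    interpret E: ldg_error N X k B ?c L ?h U ?M T fl uh qh g0 g1 CC CF
      by unfold_locales (fact L CC CF h c1 cell_h qu' sol per mixed_I mixed_II ini')+
    have K0: "0 \<le> ?h ^ (k + 1) * ?M" using h H.M_nonneg by simp
    \<comment> \<open>\<open>r\<close> stands for one of the two growth factors in time, both at
      least 1.\<close>
    have fin: "K \<le> C * (r * ?h ^ (k + 1) * ?M)" if "K \<le> total_const k ?c L T CC CF * (?M * ?h ^ (k + 1))" "1 \<le> r" for K r
    proof -
      have "K \<le> C * (?h ^ (k + 1) * ?M)"
        using that(1) mult_right_mono[OF C(2) K0] by (simp add: mult.commute)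
      also have "\<dots> \<le> C * (r * (?h ^ (k + 1) * ?M))"
        using C(1) mult_right_mono[OF that(2) K0] by (intro mult_left_mono) auto
      finally show ?thesis by (simp only: mult.assoc)
    qed
    show ?eu
    proof (rule max_error_at_le[where X = X, OF S.N k1 S.cell_less])
      fix j x assume j: "j \<in> {1..N}" and z: "radau_zero k fl (X (j - 1)) (X j) x"
      have "x \<in> Omega" using radau_zero_in_interval[OF S.cell_less[OF j] z] S.cell_in[OF j] by blast
      then show "\<bar>x_deriv u x t - poly (pderiv (uh t j)) x\<bar> \<le> C * ((1 + t * sqrt ?h) * ?h ^ (k + 1) * ?M)"
        using E.u_error[OF j t z] U1 t h by (intro fin) auto
    qed
    show ?eq
    proof (rule max_error_at_le[where X = X, OF S.N k1 S.cell_less])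
      fix j x assume j: "j \<in> {1..N}" and z: "radau_zero k (opp fl) (X (j - 1)) (X j) x"
      have "x \<in> Omega" using radau_zero_in_interval[OF S.cell_less[OF j] z] S.cell_in[OF j] by blast
      then show "\<bar>x_deriv (x_deriv u) x t - poly (pderiv (qh t j)) x\<bar> \<le> C * ((1 + sqrt (t * ?h)) * ?h ^ (k + 1) * ?M)"
        using E.q_error[OF j t z] U2 t h by (intro fin) auto
    qed
  qed
  have pts: "left_radau_points k X = (\<lambda>j. {x. radau_zero k FluxI (X (j - 1)) (X j) x})"
    "right_radau_points k X = (\<lambda>j. {x. radau_zero k FluxII (X (j - 1)) (X j) x})" for X
    by (intro ext radau_points_eq)+
  show ?thesis
    unfolding Let_def pts
  \<comment> \<open>In each goal fact 4 is the equation for \<open>q\<close> and fact 10 fixes the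
    flux. The Radau family in \<open>main_q\<close> is that of the opposite flux, which
    \<open>opp.simps\<close> evaluates.\<close>
  proof (intro exI[of _ C] conjI allI impI ballI, rule C(1), goal_cases)
    case 1
    show ?case using main_u[OF 1(1-3,5-9)] unfolding 1(10) .
  next
    case 2
    show ?case using main_q[OF 2(1-3,5-9)] unfolding 2(4,10) opp.simps .
  next
    case 3
    show ?case using main_u[OF 3(1-3,5-9)] unfolding 3(10) .
  next
    case 4
    show ?case using main_q[OF 4(1-3,5-9)] unfolding 4(4,10) opp.simps .
  qed
qed

end
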